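(* Let $l>n>1$ be integers. Then the image of the Hurewicz homomorphism $\pi_l(\mathcal{H}_n)\to H_l(\mathcal{H}_n)$ is a cotorsion group. In particular, $H_{n+1}(\mathcal{H}_n)$ is cotorsion for every $n>1$.
   Context: $\mathcal{H}_n$ is the $n$-dimensional Hawaiian earring (Barratt–Milnor space): the one-point union in $\mathbb{R}^{n+1}$ of a sequence of $n$-dimensional spheres whose radii decrease to zero; the common point is the base point. Equivalently, it is the one-point compactification of a countably infinite disjoint union of open $n$-balls. $H_l$ denotes singular homology with integer coefficients. An abelian group $G$ is cotorsion if it is a direct summand of every (abelian) extension by a torsion-free group, i.e. $\operatorname{Ext}(A,G)=0$ for all torsion-free abelian groups $A$. *)

theory Defs
  imports "HOL-Homology.Homology"
begin

definition torsion_free_group :: "('a, 'm) monoid_scheme \<Rightarrow> bool" where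
  "torsion_free_group A \<longleftrightarrow>
     (\<forall>x \<in> carrier A. \<forall>k::nat. k > 0 \<and> x [^]\<^bsub>A\<^esub> k = \<one>\<^bsub>A\<^esub> \<longrightarrow> x = \<one>\<^bsub>A\<^esub>)"

definition direct_summand :: "'a set \<Rightarrow> ('a, 'm) monoid_scheme \<Rightarrow> bool" where
  "direct_summand H E \<longleftrightarrow>
     subgroup H E \<and> (\<exists>K. subgroup K E \<and> H \<inter> K = {\<one>\<^bsub>E\<^esub>} \<and> H <#>\<^bsub>E\<^esub> K = carrier E)"

text \<open>
  \<open>G\<close> is cotorsion if every short exact sequence \<open>0 \<rightarrow> G \<rightarrow> E \<rightarrow> A \<rightarrow> 0\<close> of abelian groups
  with \<open>A\<close> torsion-free splits. HOL cannot quantify over types inside a definition, so the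
  types of the elements of \<open>E\<close> and \<open>A\<close> are parameters; a theorem about
  \<open>cotorsion_group TYPE('e) TYPE('q) G\<close> that is polymorphic in \<open>'e\<close> and \<open>'q\<close> speaks
  about all \<open>E\<close> and \<open>A\<close>.
\<close>

definition cotorsion_group ::
    "'e itself \<Rightarrow> 'q itself \<Rightarrow> ('a, 'm) monoid_scheme \<Rightarrow> bool" where
  "cotorsion_group _ _ G \<longleftrightarrow>
     comm_group G \<and>
     (\<forall>(E :: 'e monoid) (A :: 'q monoid) i p.
        comm_group E \<and> comm_group A \<and> torsion_free_group A \<and>
        i \<in> mon G E \<and> p \<in> epi E A \<and> kernel E A p = i ` carrier G
        \<longrightarrow> direct_summand (i ` carrier G) E)"

definition cube :: "nat \<Rightarrow> (nat \<Rightarrow> real) topology" where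
  "cube l = subtopology (Euclidean_space l) {x. \<forall>i<l. 0 \<le> x i \<and> x i \<le> 1}"

definition cube_boundary :: "nat \<Rightarrow> (nat \<Rightarrow> real) set" where
  "cube_boundary l = {x \<in> topspace (cube l). \<exists>i<l. x i = 0 \<or> x i = 1}"

definition spheroids :: "nat \<Rightarrow> 'a topology \<Rightarrow> 'a \<Rightarrow> ((nat \<Rightarrow> real) \<Rightarrow> 'a) set" where
  "spheroids l X x0 = {f. continuous_map (cube l) X f \<and> f ` cube_boundary l \<subseteq> {x0}}"

definition spheroid_class ::
    "nat \<Rightarrow> 'a topology \<Rightarrow> 'a \<Rightarrow> ((nat \<Rightarrow> real) \<Rightarrow> 'a) \<Rightarrow> ((nat \<Rightarrow> real) \<Rightarrow> 'a) set" where
  "spheroid_class l X x0 f =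
     {g. homotopic_with (\<lambda>h. h ` cube_boundary l \<subseteq> {x0}) (cube l) X f g}"

definition spheroid_concat ::
    "((nat \<Rightarrow> real) \<Rightarrow> 'a) \<Rightarrow> ((nat \<Rightarrow> real) \<Rightarrow> 'a) \<Rightarrow> (nat \<Rightarrow> real) \<Rightarrow> 'a" where
  "spheroid_concat f g =
     (\<lambda>x. if x 0 \<le> 1 / 2 then f (x(0 := 2 * x 0)) else g (x(0 := 2 * x 0 - 1)))"

text \<open>
  \<open>\<pi>\<^sub>l(X, x\<^sub>0)\<close>, meaningful for \<open>l \<ge> 1\<close> and \<open>x0 \<in> topspace X\<close>. The union in the product of
  two classes is a union of equal classes.
\<close>

definition homotopy_group ::
    "nat \<Rightarrow> 'a topology \<Rightarrow> 'a \<Rightarrow> ((nat \<Rightarrow> real) \<Rightarrow> 'a) set monoid" where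
  "homotopy_group l X x0 =
     \<lparr>carrier = spheroid_class l X x0 ` spheroids l X x0,
      mult = (\<lambda>a b. \<Union>f\<in>a. \<Union>g\<in>b. spheroid_class l X x0 (spheroid_concat f g)),
      one = spheroid_class l X x0 (\<lambda>_. x0)\<rparr>"

text \<open>
  A fixed generator of the infinite cyclic group \<open>H\<^sub>l([0,1]\<^sup>l, \<partial>[0,1]\<^sup>l)\<close>. The other
  choice changes the sign of the Hurewicz homomorphism and hence not its image.
\<close>

definition cube_class :: "nat \<Rightarrow> (nat \<Rightarrow> real) chain set" where
  "cube_class l =
     (let H = relative_homology_group (int l) (cube l) (cube_boundary l)
      in SOME u. u \<in> carrier H \<and> generate H {u} = carrier H)"

text \<open>
  \<open>[f] \<mapsto> f\<^sub>*(u)\<close> for a map of pairs \<open>f : ([0,1]\<^sup>l, \<partial>[0,1]\<^sup>l) \<rightarrow> (X, {x\<^sub>0})\<close>, read in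
  \<open>H\<^sub>l(X)\<close> through the isomorphism \<open>H\<^sub>l(X) \<rightarrow> H\<^sub>l(X, {x\<^sub>0})\<close> for \<open>l \<ge> 1\<close>. The value does not
  depend on the representative \<open>f\<close>.
\<close>

definition hurewicz ::
    "nat \<Rightarrow> 'a topology \<Rightarrow> 'a \<Rightarrow> ((nat \<Rightarrow> real) \<Rightarrow> 'a) set \<Rightarrow> 'a chain set" where
  "hurewicz l X x0 a =
     inv_into (carrier (homology_group (int l) X))
       (hom_induced (int l) X {} X {x0} id)
       (hom_induced (int l) (cube l) (cube_boundary l) X {x0} (SOME f. f \<in> a) (cube_class l))"

text \<open>
  The \<open>n\<close>-spheres in \<open>\<real>\<^sup>n\<^sup>+\<^sup>1\<close> (coordinates \<open>0, \<dots>, n\<close>) with radius \<open>r = 1/(k+1)\<close> and centre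
  \<open>(r, 0, \<dots>, 0)\<close>; any two of them meet exactly in the origin, the base point.
\<close>

definition earring_sphere :: "nat \<Rightarrow> real \<Rightarrow> (nat \<Rightarrow> real) set" where
  "earring_sphere n r = {x. (x 0 - r)\<^sup>2 + (\<Sum>i = 1..n. (x i)\<^sup>2) = r\<^sup>2}"

definition hawaiian_earring :: "nat \<Rightarrow> (nat \<Rightarrow> real) topology" where
  "hawaiian_earring n =
     subtopology (Euclidean_space (Suc n)) (\<Union>k::nat. earring_sphere n (1 / (real k + 1)))"

definition earring_base :: "nat \<Rightarrow> real" where
  "earring_base = (\<lambda>_. 0)"

end

(*
By a theorem on abelian groups, G is cotorsion as soon as every tower of equations
x_k = g_k + m_k x_(k+1) with m_k > 0 is solvable in G: extend partial retractions onto G one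
element of rank one at a time and use Zorn's lemma.

For l > n, removing finitely many spheres from the earring does not change its l-th homology
modulo the rest, so the class of a spheroid may be represented by spheroids in arbitrarily small
tails of the earring. Shrinking representatives of the g_k can therefore be concatenated
infinitely often, each x_k being the class of g_k followed by m_k copies of x_(k+1); hence
the group of spheroid classes solves all towers.

For l = n + 1 every homology class is the class of a spheroid. A cycle is first perturbed,
naturally in faces and on all spheres simultaneously, so that Bernstein approximations of its
coordinates miss the antipode of the base point on the codimension-two skeleton, which is then
pushed into the base point. The faces of the resulting cycle are spheroids of dimension n;
tagging them with the spheres of a finite bouquet makes them cancel in the homotopy group of
a subspace A with H_(n+1)(A) = 0, and the homotopy addition theorem assembles the simplices
into one spheroid of dimension n + 1.
*)

theory Submission
  imports Defs "HOL-Analysis.Analysis"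
begin

section \<open>Cotorsion groups and towers of equations\<close>

text \<open>A torsion-free group of rank one is a union of cyclic groups with generators e_k = m_k
  e_(k+1), and its Ext with values in G is the cokernel of (x_k) |-> (x_k - m_k x_(k+1)) on
  sequences in G. Solvability of towers says that all these cokernels vanish.

  The tagging answers a loss of information: homotopy addition slides boundaries inside a subspace A
  and determines a class only in the homology relative to A. If A were the union of the faces in the
  earring itself, its homology in degree n + 1 would be unknown; over a finite bouquet it vanishes
  and nothing is lost.

  The tower argument applies to the values of spheroids on any class of the cube relative to its
  boundary. The statement on H_(n+1) can therefore use a class transported from the simplex.\<close>

definition solves_towers :: "('a, 'm) monoid_scheme \<Rightarrow> bool" where
  "solves_towers G \<longleftrightarrow>
     (\<forall>m::nat \<Rightarrow> nat. \<forall>g. (\<forall>k. m k > 0 \<and> g k \<in> carrier G) \<longrightarrow>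
        (\<exists>x. \<forall>k. x k \<in> carrier G \<and> x k = g k \<otimes>\<^bsub>G\<^esub> x (Suc k) [^]\<^bsub>G\<^esub> m k))"

text \<open>For a subgroup this says that the quotient is torsion-free, which implies purity in the
  usual sense of divisibility.\<close>

definition pure_subset :: "'a set \<Rightarrow> ('a, 'm) monoid_scheme \<Rightarrow> bool" where
  "pure_subset H G \<longleftrightarrow> (\<forall>x \<in> carrier G. \<forall>k::nat. k > 0 \<and> x [^]\<^bsub>G\<^esub> k \<in> H \<longrightarrow> x \<in> H)"

section \<open>Extending homomorphisms by steps of rank one\<close>

context comm_group begin

lemma pure_subsetD_int:
  assumes "pure_subset H G" "subgroup H G" "x \<in> carrier G" "x [^] (a::int) \<in> H" "a \<noteq> 0"
  shows "x \<in> H"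
proof -
  have "x [^] (nat \<bar>a\<bar>) \<in> H"
  proof (cases "a > 0")
    case True
    then have "x [^] (nat \<bar>a\<bar>) = x [^] a"
      by (metis abs_of_pos int_pow_int nat_0_le less_imp_le)
    then show ?thesis using assms by simp
  next
    case False
    then have "x [^] (nat \<bar>a\<bar>) = x [^] (- a)"
      using int_pow_int[of G x "nat \<bar>a\<bar>"] by auto
    also have "\<dots> = inv (x [^] a)"
      using assms by (simp add: int_pow_neg)
    finally show ?thesis
      using assms subgroup.m_inv_closed by metis
  qed
  moreover have "nat \<bar>a\<bar> > 0" using assms by simp
  ultimately show ?thesis
    using assms unfolding pure_subset_def by blast
qed

text \<open>Homomorphisms to \<open>N\<close> that are the identity on \<open>N\<close>, kept as
  graphs so that extension is inclusion and the union of a chain is again such a graph. Purity of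
  the domain makes what each further step adds to it torsion-free of rank one.\<close>

definition partial_retraction :: "'a set \<Rightarrow> ('a \<times> 'a) set \<Rightarrow> bool" where
  "partial_retraction N R \<longleftrightarrow>
     R \<subseteq> carrier G \<times> N \<and> Id_on N \<subseteq> R \<and>
     (\<forall>x y x' y'. (x, y) \<in> R \<and> (x', y') \<in> R \<longrightarrow> (x \<otimes> x', y \<otimes> y') \<in> R) \<and>
     (\<forall>x y. (x, y) \<in> R \<longrightarrow> (inv x, inv y) \<in> R) \<and>
     single_valued R \<and> pure_subset (Domain R) G"

lemma partial_retraction_chain:
  assumes "C \<in> chains {R. partial_retraction N R}" "C \<noteq> {}"
  shows "partial_retraction N (\<Union>C)"
proof -
  have C: "\<And>R. R \<in> C \<Longrightarrow> partial_retraction N R"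
    using assms by (auto simp: chains_def)
  have lin: "\<And>R S. R \<in> C \<Longrightarrow> S \<in> C \<Longrightarrow> R \<subseteq> S \<or> S \<subseteq> R"
    using assms by (auto simp: chains_def chain_subset_def)
  have two: "\<exists>R\<in>C. p \<in> R \<and> q \<in> R" if "p \<in> \<Union>C" "q \<in> \<Union>C" for p q
    using that lin by blast
  show ?thesis
    unfolding partial_retraction_def
  proof (intro conjI allI impI)
    show "\<Union>C \<subseteq> carrier G \<times> N" using C unfolding partial_retraction_def by blast
    show "Id_on N \<subseteq> \<Union>C" using C assms(2) unfolding partial_retraction_def by blast
    show "(x \<otimes> x', y \<otimes> y') \<in> \<Union>C" if "(x, y) \<in> \<Union>C \<and> (x', y') \<in> \<Union>C" for x y x' y'
      using two[of "(x,y)" "(x',y')"] that C unfolding partial_retraction_def by blast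
    show "(inv x, inv y) \<in> \<Union>C" if "(x, y) \<in> \<Union>C" for x y
      using that C unfolding partial_retraction_def by blast
    show "single_valued (\<Union>C)"
      unfolding single_valued_def
    proof (intro allI impI)
      fix x y z assume "(x, y) \<in> \<Union>C" "(x, z) \<in> \<Union>C"
      then obtain R where "R \<in> C" "(x,y) \<in> R" "(x,z) \<in> R" using two by blast
      then show "y = z" using C unfolding partial_retraction_def single_valued_def by blast
    qed
    show "pure_subset (Domain (\<Union>C)) G"
      unfolding pure_subset_def
    proof (intro ballI allI impI)
      fix x and k :: nat assume x: "x \<in> carrier G" and k: "0 < k \<and> x [^] k \<in> Domain (\<Union>C)"
      then obtain R where R: "R \<in> C" "x [^] k \<in> Domain R" by blast
      then have "pure_subset (Domain R) G" using C unfolding partial_retraction_def by metis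
      then have "x \<in> Domain R" using x k R unfolding pure_subset_def by metis
      then show "x \<in> Domain (\<Union>C)" using R by blast
    qed
  qed
qed

text \<open>
  One step of the extension argument. The pure closure of \<open>H\<close> and \<open>e\<close> is the increasing union
  of groups generated by \<open>H\<close> and a single element \<open>e\<^sub>k\<close> with
  \<open>e\<^sub>k = h\<^sub>k e\<^sub>k\<^sub>+\<^sub>1\<^bsup>m\<^sub>k\<^esup>\<close>, so extending a homomorphism amounts to solving a tower of equations.
\<close>

lemma partial_retraction_extend:
  assumes N: "subgroup N G" "solves_towers (G\<lparr>carrier := N\<rparr>)"
    and R: "partial_retraction N R" and e: "e \<in> carrier G" "e \<notin> Domain R"
  shows "\<exists>R'. partial_retraction N R' \<and> R \<subset> R'"
proof -
  define H where "H = Domain R"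
  have Rc: "x \<in> carrier G" "y \<in> N" if "(x, y) \<in> R" for x y
    using that R unfolding partial_retraction_def by auto
  have Rid: "(x, x) \<in> R" if "x \<in> N" for x
    using that R unfolding partial_retraction_def by auto
  have Rm: "(x \<otimes> x', y \<otimes> y') \<in> R" if "(x, y) \<in> R" "(x', y') \<in> R" for x y x' y'
    using that R unfolding partial_retraction_def by auto
  have Ri: "(inv x, inv y) \<in> R" if "(x, y) \<in> R" for x y
    using that R unfolding partial_retraction_def by auto
  have Rs: "y = y'" if "(x, y) \<in> R" "(x, y') \<in> R" for x y y'
    using that R unfolding partial_retraction_def single_valued_def by auto
  have pure: "pure_subset H G"
    using R unfolding partial_retraction_def H_def by auto
  have Nc: "\<And>x. x \<in> N \<Longrightarrow> x \<in> carrier G" using N subgroup.mem_carrier by metis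
  have R1: "(\<one>, \<one>) \<in> R" using Rid N subgroup.one_closed by metis
  have Rp: "(x [^] k, y [^] k) \<in> R" if "(x, y) \<in> R" for x y and k :: nat
    using that by (induction k) (auto simp: R1 Rm)
  have Rip: "(x [^] a, y [^] a) \<in> R" if "(x, y) \<in> R" for x y and a :: int
    using Rp[OF that, of "nat a"] Ri[OF Rp[OF that, of "nat (- a)"]] unfolding int_pow_def2
    by presburger
  have H: "subgroup H G"
  proof
    show "H \<subseteq> carrier G" using Rc by (auto simp: H_def)
    show "x \<otimes> y \<in> H" if "x \<in> H" "y \<in> H" for x y using Rm that unfolding H_def by blast
    show "\<one> \<in> H" using R1 by (auto simp: H_def)
    show "inv x \<in> H" if "x \<in> H" for x using Ri that by (auto simp: H_def)
  qed
  have Hc: "\<And>x. x \<in> H \<Longrightarrow> x \<in> carrier G" using H subgroup.mem_carrier by metis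
  have Hm: "\<And>x y. x \<in> H \<Longrightarrow> y \<in> H \<Longrightarrow> x \<otimes> y \<in> H" using H subgroup.m_closed by metis
  have Hi: "\<And>x. x \<in> H \<Longrightarrow> inv x \<in> H" using H subgroup.m_inv_closed by metis
  have Hp: "\<And>x a. x \<in> H \<Longrightarrow> x [^] (a::int) \<in> H" using H subgroup_int_pow_closed by metis
  have e0: "e \<notin> H" using e H_def by simp
  have epow: "a = 0" if "e [^] (a::int) \<in> H" for a
    using pure_subsetD_int[OF pure H e(1) that] e0 by blast
  \<comment> \<open>\<open>C k a\<close> collects the elements whose coordinate with respect to
    \<open>e\<close> modulo \<open>H\<close> is the fraction a / k!. Factorials make the levels
    nested and let every denominator occur.\<close>
  define C where "C k a = {y \<in> carrier G. \<exists>h\<in>H. y [^] (int (fact k)) = h \<otimes> e [^] (a::int)}" for k :: nat and a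
  have Cc: "y \<in> carrier G" if "y \<in> C k a" for y k a using that by (auto simp: C_def)
  have Cm: "y \<otimes> y' \<in> C k (a + a')" if "y \<in> C k a" "y' \<in> C k a'" for y y' k a a'
  proof -
    from that obtain h h' where h: "h \<in> H" "h' \<in> H" "y [^] (int (fact k)) = h \<otimes> e [^] a"
      "y' [^] (int (fact k)) = h' \<otimes> e [^] a'" and y: "y \<in> carrier G" "y' \<in> carrier G"
      by (auto simp: C_def)
    have "(y \<otimes> y') [^] (int (fact k)) = (h \<otimes> e [^] a) \<otimes> (h' \<otimes> e [^] a')"
      using h y by (simp add: int_pow_distrib)
    also have "\<dots> = (h \<otimes> h') \<otimes> e [^] (a + a')"
      using h(1,2) e Hc by (simp add: int_pow_mult m_ac)
    finally show ?thesis using h y Hm by (auto simp: C_def)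
  qed
  have Ci: "inv y \<in> C k (- a)" if "y \<in> C k a" for y k a
  proof -
    from that obtain h where h: "h \<in> H" "y [^] (int (fact k)) = h \<otimes> e [^] a" and y: "y \<in> carrier G"
      by (auto simp: C_def)
    have "(inv y) [^] (int (fact k)) = inv (h \<otimes> e [^] a)"
      using h y by (simp add: int_pow_inv)
    also have "\<dots> = inv h \<otimes> e [^] (- a)"
      using h(1) e Hc by (simp add: inv_mult int_pow_neg)
    finally show ?thesis using h y Hi by (auto simp: C_def)
  qed
  have Cp: "y [^] (b::int) \<in> C k (b * a)" if "y \<in> C k a" for y k a b
  proof -
    from that obtain h where h: "h \<in> H" "y [^] (int (fact k)) = h \<otimes> e [^] a" and y: "y \<in> carrier G"
      by (auto simp: C_def)
    have "(y [^] b) [^] (int (fact k)) = (y [^] (int (fact k))) [^] b"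
      using y by (simp add: int_pow_pow mult.commute)
    also have "\<dots> = (h \<otimes> e [^] a) [^] b" using h by simp
    also have "\<dots> = h [^] b \<otimes> e [^] (b * a)"
      using h(1) e Hc by (simp add: int_pow_distrib int_pow_pow mult.commute)
    finally show ?thesis using h y Hp by (auto simp: C_def)
  qed
  have C0: "y \<in> H" if "y \<in> C k 0" for y k
  proof -
    from that have "y [^] (int (fact k)) \<in> H" "y \<in> carrier G"
      using Hc by (auto simp: C_def)
    then show ?thesis using pure_subsetD_int[OF pure H, of y "int (fact k)"] by simp
  qed
  have CH: "y \<in> C k 0" if "y \<in> H" for y k
    using that Hp Hc by (auto simp: C_def)
  have CS: "y \<in> C (Suc k) (int (Suc k) * a)" if "y \<in> C k a" for y k a
  proof -
    from that obtain h where h: "h \<in> H" "y [^] (int (fact k)) = h \<otimes> e [^] a" and y: "y \<in> carrier G"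
      by (auto simp: C_def)
    have "y [^] (int (fact (Suc k))) = (y [^] (int (fact k))) [^] (int (Suc k))"
      using y by (simp add: int_pow_pow algebra_simps)
    also have "\<dots> = (h \<otimes> e [^] a) [^] (int (Suc k))" using h by simp
    also have "\<dots> = h [^] (int (Suc k)) \<otimes> e [^] (int (Suc k) * a)"
      using h(1) e Hc by (simp add: int_pow_distrib int_pow_pow mult.commute)
    finally show ?thesis using h y Hp[of h "int (Suc k)"] by (auto simp: C_def)
  qed
  have Ce: "e \<in> C k (int (fact k))" for k
    using e H by (auto simp: C_def subgroup.one_closed intro!: bexI[of _ \<one>])
  have Cu: "a = a'" if "y \<in> C k a" "y \<in> C k a'" for y k a a'
  proof -
    have "y \<otimes> inv y \<in> C k (a + - a')" using Cm[OF that(1) Ci[OF that(2)]] .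
    then have "\<one> \<in> C k (a - a')" using Cc[OF that(1)] by simp
    then obtain h where h: "h \<in> H" "\<one> [^] (int (fact k)) = h \<otimes> e [^] (a - a')"
      unfolding C_def by blast
    have "e [^] (a - a') \<otimes> h = \<one>"
      using h(2) Hc[OF h(1)] e(1) by (metis int_pow_closed int_pow_one m_comm)
    then have "inv h = e [^] (a - a')"
      using Hc[OF h(1)] e(1) inv_equality int_pow_closed by metis
    then have "e [^] (a - a') \<in> H" using Hi[OF h(1)] by simp
    then show ?thesis using epow by force
  qed
  \<comment> \<open>The numerators occurring at level \<open>k\<close> form an infinite cyclic
    group. \<open>d k\<close> is its positive generator and \<open>ee k\<close> an element attaining
    it, so \<open>H\<close> and \<open>ee k\<close> generate the whole level.\<close>
  define d where "d k = (LEAST d. d > 0 \<and> C k (int d) \<noteq> {})" for k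
  have d: "d k > 0 \<and> C k (int (d k)) \<noteq> {}" for k
    unfolding d_def by (rule LeastI[of _ "fact k"]) (use Ce[of k] in auto)
  have dmin: "d k \<le> j" if "j > 0" "C k (int j) \<noteq> {}" for j k
    unfolding d_def by (rule Least_le) (use that in auto)
  define ee where "ee k = (SOME y. y \<in> C k (int (d k)))" for k
  have ee: "ee k \<in> C k (int (d k))" for k
    unfolding ee_def using d[of k] by (simp add: some_in_eq)
  have eec: "ee k \<in> carrier G" for k using ee Cc by blast
  have ddvd: "int (d k) dvd a" if "y \<in> C k a" for y k a
  proof -
    have "y \<otimes> (ee k) [^] (- (a div int (d k))) \<in> C k (a + (- (a div int (d k))) * int (d k))"
      using Cm Cp ee that by blast
    then have "C k (a mod int (d k)) \<noteq> {}"
    proof -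
      have "a + (- (a div int (d k))) * int (d k) = a mod int (d k)"
        using minus_div_mult_eq_mod[of a "int (d k)"] by linarith
      then show ?thesis
        using \<open>y \<otimes> (ee k) [^] (- (a div int (d k))) \<in> C k (a + (- (a div int (d k))) * int (d k))\<close> by auto
    qed
    then have "\<not> a mod int (d k) > 0"
    proof -
      assume ne: "C k (a mod int (d k)) \<noteq> {}"
      have "a mod int (d k) < int (d k)" using d[of k] by simp
      then have "\<not> d k \<le> nat (a mod int (d k))" using d[of k] by linarith
      then show ?thesis using dmin[of "nat (a mod int (d k))" k] ne by auto
    qed
    moreover have "a mod int (d k) \<ge> 0" using d[of k] by simp
    ultimately have "a mod int (d k) = 0" by linarith
    then show ?thesis by presburger
  qed
  have decomp: "\<exists>h\<in>H. \<exists>b. y = h \<otimes> ee k [^] (b::int) \<and> a = b * int (d k)" if yC: "y \<in> C k a" for y k a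
  proof -
    obtain b where b: "a = int (d k) * b" using ddvd[OF yC] by blast
    have "y \<otimes> ee k [^] (- b) \<in> C k (a + (- b) * int (d k))"
      using Cm Cp ee yC by blast
    then have "y \<otimes> ee k [^] (- b) \<in> H" using C0 b by (simp add: mult.commute)
    moreover have "y = (y \<otimes> ee k [^] (- b)) \<otimes> ee k [^] b"
      using Cc[OF yC] eec by (simp add: m_assoc flip: int_pow_mult)
    ultimately show ?thesis using b by (auto simp: mult.commute)
  qed
  have "\<exists>h m. h \<in> H \<and> m > 0 \<and> ee k = h \<otimes> ee (Suc k) [^] (m::nat)" for k
  proof -
    obtain h b where hb: "h \<in> H" "ee k = h \<otimes> ee (Suc k) [^] (b::int)"
        "int (Suc k) * int (d k) = b * int (d (Suc k))"
      using decomp[OF CS[OF ee[of k]]] by blast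
    have "int (Suc k) * int (d k) > 0" using d[of k] by simp
    then have "b * int (d (Suc k)) > 0" using hb(3) by linarith
    then have "b > 0" by (simp add: zero_less_mult_iff)
    then have "ee k = h \<otimes> ee (Suc k) [^] (nat b)"
      using hb(2) by (metis int_pow_int nat_0_le less_imp_le)
    then show ?thesis using hb \<open>b > 0\<close> by (intro exI[of _ h] exI[of _ "nat b"]) auto
  qed
  then obtain h m where hm: "\<And>k. h k \<in> H" "\<And>k. m k > (0::nat)" "\<And>k. ee k = h k \<otimes> ee (Suc k) [^] m k"
    by metis
  have "\<forall>k. \<exists>v. (h k, v) \<in> R" using hm(1) unfolding H_def by blast
  then obtain g where g: "\<And>k. (h k, g k) \<in> R" by metis
  obtain x where x: "\<And>k. x k \<in> N" "\<And>k. x k = g k \<otimes> x (Suc k) [^] m k"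
  proof -
    have "\<forall>k. m k > 0 \<and> g k \<in> carrier (G\<lparr>carrier := N\<rparr>)" using hm(2) Rc(2)[OF g] by simp
    then have "\<exists>x. \<forall>k. x k \<in> carrier (G\<lparr>carrier := N\<rparr>) \<and>
        x k = g k \<otimes>\<^bsub>G\<lparr>carrier := N\<rparr>\<^esub> x (Suc k) [^]\<^bsub>G\<lparr>carrier := N\<rparr>\<^esub> m k"
      using N(2)[unfolded solves_towers_def, rule_format] by meson
    then have "\<exists>x. \<forall>k. x k \<in> N \<and> x k = g k \<otimes> x (Suc k) [^] m k"
      by (simp add: nat_pow_def)
    then show ?thesis using that by meson
  qed
  have xc: "x k \<in> carrier G" for k using x Nc by blast
  \<comment> \<open>\<open>Q k\<close> is the graph of the extension that sends \<open>ee k\<close>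
    to \<open>x k\<close>, on the group generated by \<open>H\<close> and \<open>ee k\<close>. The
    tower equation is what makes \<open>Q k\<close> a part of \<open>Q (Suc k)\<close>.\<close>
  define Q where "Q k = {(u \<otimes> ee k [^] (b::int), v \<otimes> x k [^] b) | u v b. (u, v) \<in> R}" for k
  have QS: "Q k \<subseteq> Q (Suc k)" for k
  proof
    fix p assume "p \<in> Q k"
    then obtain u v b where p: "p = (u \<otimes> ee k [^] (b::int), v \<otimes> x k [^] b)" "(u, v) \<in> R"
      by (auto simp: Q_def)
    have uv: "u \<in> carrier G" "v \<in> carrier G" using Rc[OF p(2)] Nc by auto
    have hg: "h k \<in> carrier G" "g k \<in> carrier G" using Rc[OF g[of k]] Nc by auto
    have "u \<otimes> ee k [^] b = u \<otimes> (h k \<otimes> ee (Suc k) [^] int (m k)) [^] b"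
      using hm(3)[of k] by (simp add: int_pow_int)
    also have "\<dots> = (u \<otimes> h k [^] b) \<otimes> ee (Suc k) [^] (int (m k) * b)"
      using uv hg eec by (simp add: int_pow_distrib int_pow_pow m_assoc)
    finally have 1: "u \<otimes> ee k [^] b = (u \<otimes> h k [^] b) \<otimes> ee (Suc k) [^] (int (m k) * b)" .
    have "v \<otimes> x k [^] b = v \<otimes> (g k \<otimes> x (Suc k) [^] int (m k)) [^] b"
      using x(2)[of k] by (simp add: int_pow_int)
    also have "\<dots> = (v \<otimes> g k [^] b) \<otimes> x (Suc k) [^] (int (m k) * b)"
      using uv hg xc by (simp add: int_pow_distrib int_pow_pow m_assoc)
    finally have 2: "v \<otimes> x k [^] b = (v \<otimes> g k [^] b) \<otimes> x (Suc k) [^] (int (m k) * b)" .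
    have "(u \<otimes> h k [^] b, v \<otimes> g k [^] b) \<in> R" using p g Rm Rip by blast
    then show "p \<in> Q (Suc k)" unfolding p Q_def 1 2 by blast
  qed
  have Qmono: "Q k \<subseteq> Q l" if "k \<le> l" for k l
    using QS that by (rule lift_Suc_mono_le)
  have eeinH: "b = 0" if "ee k [^] (b::int) \<in> H" for b k
  proof (rule ccontr)
    assume "b \<noteq> 0"
    then have "ee k \<in> H" using pure_subsetD_int[OF pure H eec that] by blast
    then have "ee k \<in> C k 0" using CH by blast
    then have "int (d k) = 0" using Cu ee by blast
    then show False using d[of k] by simp
  qed
  have Qsv: "v = v'" if "(u, v) \<in> Q k" "(u, v') \<in> Q k" for u v v' k
  proof -
    obtain s t b where 1: "u = s \<otimes> ee k [^] (b::int)" "v = t \<otimes> x k [^] b" "(s, t) \<in> R"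
      using \<open>(u, v) \<in> Q k\<close> by (auto simp: Q_def)
    obtain s' t' b' where 2: "u = s' \<otimes> ee k [^] (b'::int)" "v' = t' \<otimes> x k [^] b'" "(s', t') \<in> R"
      using \<open>(u, v') \<in> Q k\<close> by (auto simp: Q_def)
    have sc: "s \<in> carrier G" "s' \<in> carrier G" "s \<in> H" "s' \<in> H"
      using 1 2 Rc by (auto simp: H_def)
    have "ee k [^] (b - b') = inv s \<otimes> (s \<otimes> ee k [^] b) \<otimes> ee k [^] (- b')"
      using sc eec by (simp add: m_assoc[symmetric] int_pow_mult[symmetric] flip: diff_conv_add_uminus)
    also have "\<dots> = inv s \<otimes> (s' \<otimes> ee k [^] b') \<otimes> ee k [^] (- b')"
      using 1 2 by simp
    also have "\<dots> = inv s \<otimes> s'"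
      using sc eec by (simp add: m_assoc int_pow_neg)
    finally have "ee k [^] (b - b') \<in> H" using sc Hm Hi by simp
    then have "b = b'" using eeinH by force
    then have "s = s'" using 1 2 sc eec by simp
    then show ?thesis using 1 2 \<open>b = b'\<close> Rs by blast
  qed
  define R' where "R' = (\<Union>k. Q k)"
  have two: "\<exists>k. p \<in> Q k \<and> q \<in> Q k" if "p \<in> R'" "q \<in> R'" for p q
  proof -
    from that obtain k l where "p \<in> Q k" "q \<in> Q l" by (auto simp: R'_def)
    then show ?thesis using Qmono[of k "max k l"] Qmono[of l "max k l"] by auto
  qed
  have RQ: "R \<subseteq> Q k" for k
  proof
    fix p assume "p \<in> R"
    then obtain u v where "p = (u, v)" "(u, v) \<in> R" by (cases p) auto
    moreover have "(u \<otimes> ee k [^] (0::int), v \<otimes> x k [^] (0::int)) \<in> Q k"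
      using \<open>(u, v) \<in> R\<close> unfolding Q_def by blast
    ultimately show "p \<in> Q k" using Rc Nc by force
  qed
  have CQ: "y \<in> Domain R'" if yC: "y \<in> C k a" for y k a
  proof -
    obtain u b where "u \<in> H" "y = u \<otimes> ee k [^] (b::int)" using decomp[OF yC] by blast
    moreover then obtain v where "(u, v) \<in> R" by (auto simp: H_def)
    ultimately show ?thesis unfolding R'_def Q_def by blast
  qed
  have QC: "\<exists>a. y \<in> C k a" if yQ: "(y, s) \<in> Q k" for y s k
  proof -
    obtain u v b where "y = u \<otimes> ee k [^] (b::int)" "(u, v) \<in> R"
      using yQ by (auto simp: Q_def)
    moreover have "u \<in> C k 0" using CH calculation by (auto simp: H_def)
    ultimately show ?thesis using Cm Cp ee by blast
  qed
  have "partial_retraction N R'"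
    unfolding partial_retraction_def
  proof (intro conjI allI impI)
    show "R' \<subseteq> carrier G \<times> N"
    proof
      fix p assume "p \<in> R'"
      then obtain k u v b where "p = (u \<otimes> ee k [^] (b::int), v \<otimes> x k [^] b)" "(u, v) \<in> R"
        by (auto simp: R'_def Q_def)
      then show "p \<in> carrier G \<times> N"
        using Rc eec x(1) subgroup_int_pow_closed[OF N(1)] subgroup.m_closed[OF N(1)] by auto
    qed
    show "Id_on N \<subseteq> R'" using RQ Rid by (fastforce simp: R'_def)
    show "(y \<otimes> y', z \<otimes> z') \<in> R'" if yz: "(y, z) \<in> R' \<and> (y', z') \<in> R'" for y z y' z'
    proof -
      obtain k where k: "(y, z) \<in> Q k" "(y', z') \<in> Q k" using two yz by blast
      obtain s t b where 1: "y = s \<otimes> ee k [^] (b::int)" "z = t \<otimes> x k [^] b" "(s, t) \<in> R"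
        using k by (auto simp: Q_def)
      obtain s' t' b' where 2: "y' = s' \<otimes> ee k [^] (b'::int)" "z' = t' \<otimes> x k [^] b'" "(s', t') \<in> R"
        using k by (auto simp: Q_def)
      have sc: "s \<in> carrier G" "s' \<in> carrier G" "t \<in> carrier G" "t' \<in> carrier G"
        using 1 2 Rc Nc by blast+
      have "y \<otimes> y' = (s \<otimes> s') \<otimes> ee k [^] (b + b')"
        unfolding 1 2 using sc eec by (simp add: int_pow_mult m_ac)
      moreover have "z \<otimes> z' = (t \<otimes> t') \<otimes> x k [^] (b + b')"
        unfolding 1 2 using sc xc by (simp add: int_pow_mult m_ac)
      ultimately show ?thesis
        using Rm[OF 1(3) 2(3)] unfolding R'_def Q_def by blast
    qed
    show "(inv y, inv z) \<in> R'" if yz: "(y, z) \<in> R'" for y z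
    proof -
      obtain k s t b where 1: "y = s \<otimes> ee k [^] (b::int)" "z = t \<otimes> x k [^] b" "(s, t) \<in> R"
        using yz by (auto simp: R'_def Q_def)
      have sc: "s \<in> carrier G" "t \<in> carrier G"
        using 1 Rc Nc by blast+
      have "inv y = inv s \<otimes> ee k [^] (- b)"
        unfolding 1 using sc eec by (simp add: int_pow_neg inv_mult)
      moreover have "inv z = inv t \<otimes> x k [^] (- b)"
        unfolding 1 using sc xc by (simp add: int_pow_neg inv_mult)
      ultimately show ?thesis
        using Ri[OF 1(3)] unfolding R'_def Q_def by blast
    qed
    show "single_valued R'"
      unfolding single_valued_def using two Qsv by blast
    show "pure_subset (Domain R') G"
      unfolding pure_subset_def
    proof (intro ballI allI impI)
      fix y and k :: nat assume y: "y \<in> carrier G" and "0 < k \<and> y [^] k \<in> Domain R'"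
      then obtain l a where k: "k > 0" and "y [^] k \<in> C l a" using QC unfolding R'_def by blast
      then obtain u where u: "u \<in> H" "(y [^] k) [^] (int (fact l)) = u \<otimes> e [^] a"
        by (auto simp: C_def)
      \<comment> \<open>If the power with exponent \<open>k\<close> has a coordinate of denominator
        l!, the element itself has one of denominator k times l!, and this number divides its own
        factorial.\<close>
      define M :: nat where "M = k * fact l"
      have "M > 0" using k by (simp add: M_def)
      then obtain q where q: "fact M = M * q" using dvd_fact[of M M] by (metis dvdE order_refl Suc_leI One_nat_def)
      have "y [^] (int (fact M)) = ((y [^] k) [^] (int (fact l))) [^] (int q)"
      proof -
        have "int (fact M) = int k * int (fact l) * int q"
          using q M_def by (metis of_nat_mult)
        then show ?thesis using y by (simp only: int_pow_int[symmetric] int_pow_pow int_pow_closed)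
      qed
      also have "\<dots> = u [^] (int q) \<otimes> e [^] (a * int q)"
        using u Hc e by (simp add: int_pow_distrib int_pow_pow)
      finally have "y \<in> C M (a * int q)" using y Hp u by (auto simp: C_def)
      then show "y \<in> Domain R'" using CQ by blast
    qed
  qed
  moreover have "R \<subseteq> R'" using RQ by (auto simp: R'_def)
  moreover have "e \<in> Domain R'" using CQ Ce by blast
  ultimately show ?thesis using e(2) by blast
qed

text \<open>A maximal partial retraction is total, because a missing element would allow one more
  extension. Its kernel is the complement.\<close>

lemma direct_summand_if_solves_towers:
  assumes N: "subgroup N G" "solves_towers (G\<lparr>carrier := N\<rparr>)" "pure_subset N G"
  shows "direct_summand N G"
proof -
  have Nc: "\<And>x. x \<in> N \<Longrightarrow> x \<in> carrier G" using N subgroup.mem_carrier by metis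
  have id: "partial_retraction N (Id_on N)"
    using N Nc unfolding partial_retraction_def
    by (auto simp: subgroup.m_closed subgroup.m_inv_closed single_valued_Id_on)
  have "\<exists>M\<in>{R. partial_retraction N R}. \<forall>X\<in>{R. partial_retraction N R}. M \<subseteq> X \<longrightarrow> X = M"
    by (rule Zorn_Lemma2) (use id partial_retraction_chain in \<open>metis Union_upper mem_Collect_eq empty_iff\<close>)
  then obtain R where R: "partial_retraction N R" and max: "\<And>X. partial_retraction N X \<Longrightarrow> R \<subseteq> X \<Longrightarrow> X = R"
    by auto
  have dom: "x \<in> Domain R" if "x \<in> carrier G" for x
    using partial_retraction_extend[OF N(1,2) R that] max by blast
  have Rc: "x \<in> carrier G" "y \<in> N" if "(x, y) \<in> R" for x y
    using that R unfolding partial_retraction_def by auto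
  have Rid: "(x, x) \<in> R" if "x \<in> N" for x
    using that R unfolding partial_retraction_def by auto
  have Rm: "(x \<otimes> x', y \<otimes> y') \<in> R" if "(x, y) \<in> R" "(x', y') \<in> R" for x y x' y'
    using that R unfolding partial_retraction_def by auto
  have Ri: "(inv x, inv y) \<in> R" if "(x, y) \<in> R" for x y
    using that R unfolding partial_retraction_def by auto
  have Rs: "y = y'" if "(x, y) \<in> R" "(x, y') \<in> R" for x y y'
    using that R unfolding partial_retraction_def single_valued_def by auto
  have R1: "(\<one>, \<one>) \<in> R" using Rid N subgroup.one_closed by metis
  define K where "K = {x. (x, \<one>) \<in> R}"
  have K: "subgroup K G"
  proof
    show "K \<subseteq> carrier G" using Rc by (auto simp: K_def)
    show "x \<otimes> y \<in> K" if "x \<in> K" "y \<in> K" for x y using Rm that by (force simp: K_def)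
    show "\<one> \<in> K" using R1 by (auto simp: K_def)
    show "inv x \<in> K" if "x \<in> K" for x using Ri that by (force simp: K_def)
  qed
  have "N \<inter> K = {\<one>}"
  proof
    show "N \<inter> K \<subseteq> {\<one>}" using Rs Rid unfolding K_def by blast
    show "{\<one>} \<subseteq> N \<inter> K" using R1 subgroup.one_closed[OF N(1)] unfolding K_def by blast
  qed
  moreover have "N <#> K = carrier G"
  proof
    show "N <#> K \<subseteq> carrier G"
      using Nc subgroup.mem_carrier[OF K] by (auto simp: set_mult_def)
    show "carrier G \<subseteq> N <#> K"
    proof
      fix x assume x: "x \<in> carrier G"
      obtain y where y: "(x, y) \<in> R" using dom[OF x] by blast
      have yc: "y \<in> N" "y \<in> carrier G" using Rc y Nc by blast+
      have "(inv y \<otimes> x, inv y \<otimes> y) \<in> R" using Rm Ri Rid y yc by blast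
      then have "inv y \<otimes> x \<in> K" using yc by (simp add: K_def)
      moreover have "x = y \<otimes> (inv y \<otimes> x)" using x yc by (simp add: m_assoc[symmetric])
      ultimately show "x \<in> N <#> K" using yc unfolding set_mult_def by blast
    qed
  qed
  ultimately show ?thesis using K N unfolding direct_summand_def by blast
qed

end

section \<open>Towers and the splitting of extensions\<close>

lemma solves_towers_image:
  assumes G: "group G" and E: "group E" and i: "i \<in> hom G E" and s: "solves_towers G"
  shows "solves_towers (E\<lparr>carrier := i ` carrier G\<rparr>)"
  unfolding solves_towers_def
proof (intro allI impI)
  interpret G: group G by fact
  interpret E: group E by fact
  interpret group_hom G E i by (simp add: group_hom_def group_hom_axioms_def G E i)
  fix m :: "nat \<Rightarrow> nat" and g
  assume "\<forall>k. 0 < m k \<and> g k \<in> carrier (E\<lparr>carrier := i ` carrier G\<rparr>)"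
  then have m: "\<And>k. m k > 0" and "\<forall>k. \<exists>c\<in>carrier G. g k = i c" by auto
  then obtain c where c: "\<And>k. c k \<in> carrier G" "\<And>k. g k = i (c k)" by metis
  obtain x where x: "\<And>k. x k \<in> carrier G" "\<And>k. x k = c k \<otimes>\<^bsub>G\<^esub> x (Suc k) [^]\<^bsub>G\<^esub> m k"
  proof -
    have "\<forall>k. m k > 0 \<and> c k \<in> carrier G" using m c(1) by simp
    then have "\<exists>x. \<forall>k. x k \<in> carrier G \<and> x k = c k \<otimes>\<^bsub>G\<^esub> x (Suc k) [^]\<^bsub>G\<^esub> m k"
      using s[unfolded solves_towers_def, rule_format] by meson
    then show ?thesis using that by meson
  qed
  have "i (x k) = g k \<otimes>\<^bsub>E\<^esub> (i (x (Suc k))) [^]\<^bsub>E\<^esub> m k" for k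
  proof -
    have "i (x k) = i (c k \<otimes>\<^bsub>G\<^esub> x (Suc k) [^]\<^bsub>G\<^esub> m k)" using x(2)[of k] by simp
    also have "\<dots> = i (c k) \<otimes>\<^bsub>E\<^esub> i (x (Suc k) [^]\<^bsub>G\<^esub> m k)" by (rule hom_mult) (simp_all add: c x(1))
    finally show ?thesis using x(1) c by (simp add: hom_nat_pow)
  qed
  note step = this
  have "i (x k) = g k \<otimes>\<^bsub>E\<lparr>carrier := i ` carrier G\<rparr>\<^esub>
      i (x (Suc k)) [^]\<^bsub>E\<lparr>carrier := i ` carrier G\<rparr>\<^esub> m k" for k
    by (subst step) (simp add: nat_pow_def)
  moreover have "i (x k) \<in> carrier (E\<lparr>carrier := i ` carrier G\<rparr>)" for k
    using x(1) by simp
  ultimately show "\<exists>x. \<forall>k. x k \<in> carrier (E\<lparr>carrier := i ` carrier G\<rparr>) \<and>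
               x k = g k \<otimes>\<^bsub>E\<lparr>carrier := i ` carrier G\<rparr>\<^esub> x (Suc k) [^]\<^bsub>E\<lparr>carrier := i ` carrier G\<rparr>\<^esub> m k"
    by (intro exI[where x = "\<lambda>k. i (x k)"]) (intro allI conjI, assumption+)
qed

text \<open>The image of \<open>G\<close> in an extension is pure because the quotient is the
  torsion-free group \<open>A\<close>, and towers are solvable in the image because they are
  solvable in \<open>G\<close>.\<close>

theorem cotorsion_group_if_solves_towers:
  assumes G: "comm_group G" and s: "solves_towers G"
  shows "cotorsion_group TYPE('e) TYPE('q) G"
  unfolding cotorsion_group_def
proof (intro conjI allI impI G)
  fix E :: "'e monoid" and A :: "'q monoid" and i p
  assume *: "comm_group E \<and> comm_group A \<and> torsion_free_group A \<and>
        i \<in> mon G E \<and> p \<in> epi E A \<and> kernel E A p = i ` carrier G"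
  then interpret G: comm_group G + E: comm_group E + A: comm_group A using G by auto
  have i: "i \<in> hom G E" and p: "p \<in> hom E A" using * by (auto simp: mon_def epi_def)
  interpret i: group_hom G E i by (simp add: group_hom_def group_hom_axioms_def i)
  interpret p: group_hom E A p by (simp add: group_hom_def group_hom_axioms_def p)
  have "pure_subset (i ` carrier G) E"
    unfolding pure_subset_def
  proof (intro ballI allI impI)
    fix x and k :: nat assume x: "x \<in> carrier E" and k: "0 < k \<and> x [^]\<^bsub>E\<^esub> k \<in> i ` carrier G"
    then have "x [^]\<^bsub>E\<^esub> k \<in> kernel E A p" using * by simp
    then have "p x [^]\<^bsub>A\<^esub> k = \<one>\<^bsub>A\<^esub>" using x by (simp add: kernel_def p.hom_nat_pow)
    then have "p x = \<one>\<^bsub>A\<^esub>" using * k x unfolding torsion_free_group_def by auto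
    then show "x \<in> i ` carrier G" using * x by (auto simp: kernel_def)
  qed
  moreover have "subgroup (i ` carrier G) E" using i.img_is_subgroup .
  ultimately show "direct_summand (i ` carrier G) E"
    using E.direct_summand_if_solves_towers solves_towers_image[OF G.is_group E.is_group i s] by blast
qed

section \<open>Relative homology classes of maps of cubes\<close>

text \<open>Points are sequences that vanish from index \<open>l\<close> on. Thus
  \<open>unit_cube n\<close> literally is the face \<open>x n = 0\<close> of
  \<open>unit_cube (Suc n)\<close>, which later serves as the bottom of a filling.\<close>

definition unit_cube :: "nat \<Rightarrow> (nat \<Rightarrow> real) set" where
  "unit_cube l = {x. (\<forall>i<l. 0 \<le> x i \<and> x i \<le> 1) \<and> (\<forall>i\<ge>l. x i = 0)}"

lemma cube_eq: "cube l = top_of_set (unit_cube l)"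
proof -
  have "{x. \<forall>i\<ge>l. x i = 0} \<inter> {x. \<forall>i<l. 0 \<le> x i \<and> x i \<le> 1} = unit_cube l"
    by (auto simp: unit_cube_def)
  then show ?thesis
    by (simp add: cube_def Euclidean_space_def subtopology_subtopology euclidean_product_topology)
qed

lemma unit_cubeD: "x \<in> unit_cube l \<Longrightarrow> 0 \<le> x i" "x \<in> unit_cube l \<Longrightarrow> x i \<le> 1"
  by (cases "i < l"; auto simp: unit_cube_def)+

lemma topspace_cube [simp]: "topspace (cube l) = unit_cube l"
  by (simp add: cube_eq)

lemma cube_boundary_eq: "cube_boundary l = {x \<in> unit_cube l. \<exists>i<l. x i = 0 \<or> x i = 1}"
  by (simp add: cube_boundary_def)

lemma cube_boundary_subset: "cube_boundary l \<subseteq> unit_cube l"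
  by (auto simp: cube_boundary_eq)

lemma continuous_on_coordinate:
  fixes f :: "'a::topological_space \<Rightarrow> 'i \<Rightarrow> 'b::topological_space"
  assumes "continuous_on S f"
  shows "continuous_on S (\<lambda>x. f x i)"
  using assms by (rule continuous_on_product_then_coordinatewise)

lemma continuous_on_fun_upd [continuous_intros]:
  fixes f :: "'a::topological_space \<Rightarrow> 'i \<Rightarrow> 'b::topological_space"
  assumes "continuous_on S f" "continuous_on S g"
  shows "continuous_on S (\<lambda>x. (f x)(i := g x))"
proof (rule continuous_on_coordinatewise_then_product)
  show "continuous_on S (\<lambda>x. ((f x)(i := g x)) j)" for j
    using assms by (cases "j = i") (auto intro: continuous_on_coordinate)
qed

lemma hom_induced_homotopic_on:
  fixes h :: "real \<Rightarrow> 'a::topological_space \<Rightarrow> 'b::topological_space"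
  assumes "continuous_on ({0..1} \<times> S) (\<lambda>z. h (fst z) (snd z))"
    and "\<And>t x. t \<in> {0..1} \<Longrightarrow> x \<in> S \<Longrightarrow> h t x \<in> T"
    and "\<And>t x. t \<in> {0..1} \<Longrightarrow> x \<in> S \<Longrightarrow> x \<in> A \<Longrightarrow> h t x \<in> B"
    and "\<And>x. x \<in> S \<Longrightarrow> f x = h 0 x" "\<And>x. x \<in> S \<Longrightarrow> g x = h 1 x"
  shows "hom_induced p (top_of_set S) A (top_of_set T) B f = hom_induced p (top_of_set S) A (top_of_set T) B g"
proof -
  have "continuous_map (prod_topology (top_of_set {0..1}) (top_of_set S)) (top_of_set T) (\<lambda>z. h (fst z) (snd z))"
    using assms(1,2) by (auto simp: continuous_map_in_subtopology simp flip: subtopology_Times)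
  then have "homotopic_with (\<lambda>k. k \<in> S \<inter> A \<rightarrow> T \<inter> B) (top_of_set S) (top_of_set T) (h 0) (h 1)"
    using assms(2,3) unfolding homotopic_with_def by (intro exI[of _ "\<lambda>z. h (fst z) (snd z)"]) auto
  then have "hom_induced p (top_of_set S) (S \<inter> A) (top_of_set T) (T \<inter> B) (h 0)
           = hom_induced p (top_of_set S) (S \<inter> A) (top_of_set T) (T \<inter> B) (h 1)"
    by (rule homology_homotopy_axiom)
  then have "hom_induced p (top_of_set S) A (top_of_set T) B (h 0)
           = hom_induced p (top_of_set S) A (top_of_set T) B (h 1)"
    using hom_induced_restrict[of p "top_of_set S" A "top_of_set T" B] by simp
  moreover have "hom_induced p (top_of_set S) A (top_of_set T) B f = hom_induced p (top_of_set S) A (top_of_set T) B (h 0)"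
    by (rule hom_induced_eq) (simp add: assms)
  moreover have "hom_induced p (top_of_set S) A (top_of_set T) B g = hom_induced p (top_of_set S) A (top_of_set T) B (h 1)"
    by (rule hom_induced_eq) (simp add: assms)
  ultimately show ?thesis by simp
qed

lemma hom_induced_into_subset:
  assumes "continuous_map X Y f" "f ` topspace X \<subseteq> T"
  shows "hom_induced (int p) X S Y T f c = \<one>\<^bsub>relative_homology_group (int p) Y T\<^esub>"
proof (cases "c \<in> carrier (relative_homology_group (int p) X S)")
  case True
  then obtain d where d: "c = homologous_rel_set p X S d" "singular_relcycle p X S d"
    by (auto simp: carrier_relative_homology_group)
  have "singular_chain p X d" using d(2) by (simp add: singular_relcycle_def)
  moreover have "continuous_map X (subtopology Y T) f"
    using assms by (auto simp: continuous_map_in_subtopology)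
  ultimately have "singular_chain p (subtopology Y T) (chain_map p f d)"
    by (rule singular_chain_chain_map)
  then have "singular_relboundary p Y T (chain_map p f d)"
    by (rule singular_chain_imp_relboundary)
  then have "homologous_rel_set p Y T (chain_map p f d) = singular_relboundary_set p Y T"
    by (simp add: homologous_rel_set_eq_relboundary)
  moreover have "hom_induced (int p) X S Y T f (homologous_rel_set p X S d) = homologous_rel_set p Y T (chain_map p f d)"
    using assms d by (intro hom_induced_chain_map_gen) auto
  ultimately show ?thesis using d(1) by simp
\<comment> \<open>Outside the carrier \<open>hom_induced\<close> has the value one by convention, so
  the conclusion holds for every \<open>c\<close>.\<close>
qed (simp add: hom_induced_default)

lemma mult_homologous_rel_set:
  assumes "singular_relcycle p X S a" "singular_relcycle p X S b"
  shows "homologous_rel_set p X S a \<otimes>\<^bsub>relative_homology_group (int p) X S\<^esub> homologous_rel_set p X S b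
       = homologous_rel_set p X S (a + b)"
proof -
  have "homologous_rel_set p X S = (\<lambda>a. singular_relboundary_set p X S #>\<^bsub>relcycle_group p X S\<^esub> a)"
    by (simp add: right_coset_singular_relboundary)
  moreover have "(\<lambda>a. singular_relboundary_set p X S #>\<^bsub>relcycle_group p X S\<^esub> a)
      \<in> hom (relcycle_group p X S) (relative_homology_group (int p) X S)"
    unfolding nontrivial_relative_homology_group
    by (rule normal.r_coset_hom_Mod[OF normal_subgroup_singular_relboundary_relcycle])
  ultimately have "homologous_rel_set p X S \<in> hom (relcycle_group p X S) (relative_homology_group (int p) X S)"
    by metis
  from hom_mult[OF this, of a b] assms show ?thesis by simp
qed

text \<open>Subdividing a relative cycle of the cube into simplices on either side of the wall
  \<open>x\<^sub>i = 1/2\<close>: the cut chains are cycles relative to the boundary and the strip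
  \<open>1/3 < x\<^sub>i < 2/3\<close>.\<close>

lemma cube_split_cycle:
  assumes c: "singular_relcycle p (cube l) (cube_boundary l) c" and i: "i < l"
  defines "B \<equiv> cube_boundary l \<union> {x. 1/3 < x i \<and> x i < 2/3}"
  obtains c1 c2 where
    "homologous_rel p (cube l) (cube_boundary l) c (c1 + c2)"
    "singular_relcycle p (subtopology (cube l) {x. x i < 2/3}) B c1"
    "singular_relcycle p (subtopology (cube l) {x. x i > 1/3}) B c2"
proof -
  define V1 where "V1 = {x \<in> unit_cube l. x i < (2/3::real)}"
  define V2 where "V2 = {x \<in> unit_cube l. x i > (1/3::real)}"
  have cont: "continuous_map (cube l) euclideanreal (\<lambda>x. x i)"
    unfolding cube_eq by simp (rule continuous_on_coordinate[OF continuous_on_id])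
  have o1: "openin (cube l) V1" and o2: "openin (cube l) V2"
    using openin_continuous_map_preimage[OF cont, of "{..<2/3}"]
          openin_continuous_map_preimage[OF cont, of "{1/3<..}"]
    by (auto simp: V1_def V2_def)
  obtain c' where c': "singular_relcycle p (cube l) (cube_boundary l) c'"
      "homologous_rel p (cube l) (cube_boundary l) c c'"
      "\<And>f. f \<in> Poly_Mapping.keys c' \<Longrightarrow> \<exists>V \<in> {V1, V2}. f \<in> (standard_simplex p) \<rightarrow> V"
    by (rule small_homologous_rel_relcycle_exists[of "{V1, V2}" "cube l", OF _ _ c])
       (use o1 o2 in \<open>auto simp: V1_def V2_def\<close>)
  define K where "K = {f. f \<in> standard_simplex p \<rightarrow> V1}"
  define c1 where "c1 = frag_extend (\<lambda>f. if f \<in> K then frag_of f else 0) c'"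
  define c2 where "c2 = frag_extend (\<lambda>f. if f \<in> K then 0 else frag_of f) c'"
  have sum: "c1 + c2 = c'"
  proof -
    have "c1 + c2 = frag_extend frag_of c'"
      unfolding c1_def c2_def frag_extend_def sum.distrib[symmetric]
      by (intro sum.cong) (auto simp: frag_cmul_distrib2 simp flip: )
    then show ?thesis by (simp add: frag_expansion[symmetric] comp_def)
  qed
  have sc: "singular_chain p (cube l) c'" using c'(1) by (simp add: singular_relcycle_def)
  have s1: "singular_chain p (subtopology (cube l) V1) c1"
    unfolding c1_def
  proof (rule singular_chain_extend)
    fix f assume "f \<in> Poly_Mapping.keys c'"
    then have "singular_simplex p (cube l) f" using sc by (auto simp: singular_chain_def)
    then show "singular_chain p (subtopology (cube l) V1) (if f \<in> K then frag_of f else 0)"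
      by (auto simp: singular_chain_of singular_simplex_subtopology K_def)
  qed
  have s2: "singular_chain p (subtopology (cube l) V2) c2"
    unfolding c2_def
  proof (rule singular_chain_extend)
    fix f assume f: "f \<in> Poly_Mapping.keys c'"
    then have "singular_simplex p (cube l) f" using sc by (auto simp: singular_chain_def)
    moreover have "f \<in> K \<or> f \<in> standard_simplex p \<rightarrow> V2" using c'(3)[OF f] by (auto simp: K_def)
    ultimately show "singular_chain p (subtopology (cube l) V2) (if f \<in> K then 0 else frag_of f)"
      by (auto simp: singular_chain_of singular_simplex_subtopology K_def)
  qed
  have b: "singular_chain (p - 1) (subtopology (cube l) (cube_boundary l)) (chain_boundary p c1 + chain_boundary p c2)"
    using c'(1) unfolding sum[symmetric] by (simp add: singular_relcycle_def mod_subset_def chain_boundary_add)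
  have b1: "singular_chain (p - 1) (subtopology (cube l) V1) (chain_boundary p c1)"
    using singular_chain_boundary[OF s1] by simp
  have b2: "singular_chain (p - 1) (subtopology (cube l) V2) (chain_boundary p c2)"
    using singular_chain_boundary[OF s2] by simp
  have V12: "V1 \<inter> V2 \<subseteq> B" by (auto simp: V1_def V2_def B_def)
  \<comment> \<open>A simplex in the boundary of one half either cancels against the other half, and
    then lies in both open sets and hence in the strip, or it survives in the boundary of
    \<open>c'\<close>, and then lies in the boundary of the cube.\<close>
  have in_B: "f ` standard_simplex (p-1) \<subseteq> B"
    if f: "f \<in> Poly_Mapping.keys d" and de: "singular_chain (p - 1) (subtopology (cube l) (cube_boundary l)) (d + e)"
      and d: "singular_chain (p - 1) (subtopology (cube l) W) d" and e: "singular_chain (p - 1) (subtopology (cube l) W') e"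
      and W: "W \<inter> W' \<subseteq> B" for f d e W W'
  proof (cases "f \<in> Poly_Mapping.keys e")
    case True
    then have "f ` standard_simplex (p-1) \<subseteq> W'" "f ` standard_simplex (p-1) \<subseteq> W"
      using f d e by (auto simp: singular_chain_subtopology)
    then show ?thesis using W by blast
  next
    case False
    then have "f \<in> Poly_Mapping.keys (d + e)"
      using f by (simp add: in_keys_iff lookup_add)
    then show ?thesis using de by (auto simp: singular_chain_subtopology B_def)
  qed
  have sub: "subtopology (subtopology (cube l) W) B = subtopology (subtopology (cube l) B) W" for W
    by (simp add: subtopology_subtopology Int_commute)
  have r1: "singular_relcycle p (subtopology (cube l) V1) B c1"
    unfolding singular_relcycle_def mod_subset_def
    using s1 b1 in_B[OF _ b b1 b2 V12] by (auto simp: singular_chain_subtopology sub)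
  have r2: "singular_relcycle p (subtopology (cube l) V2) B c2"
    unfolding singular_relcycle_def mod_subset_def
    using s2 b2 in_B[OF _ _ b2 b1, of _] b V12 by (auto simp: singular_chain_subtopology sub add.commute Int_commute)
  have e1: "subtopology (cube l) V1 = subtopology (cube l) {x. x i < 2/3}"
    and e2: "subtopology (cube l) V2 = subtopology (cube l) {x. x i > 1/3}"
    using subtopology_restrict[of "cube l" "{x. x i < 2/3}"] subtopology_restrict[of "cube l" "{x. x i > 1/3}"]
    by (simp_all add: V1_def V2_def Collect_conj_eq)
  show ?thesis
    by (rule that[of c1 c2]) (use c'(2) r1 r2 in \<open>simp_all only: sum e1 e2\<close>)
qed

section \<open>Reparametrizing one coordinate of the cube\<close>

definition squeeze :: "nat \<Rightarrow> (real \<Rightarrow> real) \<Rightarrow> (nat \<Rightarrow> real) \<Rightarrow> nat \<Rightarrow> real" where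
  "squeeze i g x = x(i := g (x i))"

lemma squeeze_in_cube:
  assumes "i < l" "x \<in> unit_cube l" "0 \<le> g (x i)" "g (x i) \<le> 1"
  shows "squeeze i g x \<in> unit_cube l"
  using assms by (auto simp: squeeze_def unit_cube_def)

lemma squeeze_in_boundary:
  assumes "i < l" "x \<in> cube_boundary l" "0 \<le> g (x i)" "g (x i) \<le> 1"
    "x i = 0 \<or> x i = 1 \<Longrightarrow> g (x i) = 0 \<or> g (x i) = 1"
  shows "squeeze i g x \<in> cube_boundary l"
proof -
  obtain j where "j < l" "x j = 0 \<or> x j = 1" using assms(2) by (auto simp: cube_boundary_eq)
  then have "\<exists>j<l. squeeze i g x j = 0 \<or> squeeze i g x j = 1"
    using assms by (intro exI[of _ j]) (auto simp: squeeze_def)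
  moreover have "x \<in> unit_cube l" using assms(2) by (auto simp: cube_boundary_eq)
  ultimately show ?thesis using squeeze_in_cube[of i l x g] assms by (auto simp: cube_boundary_eq)
qed

lemma continuous_on_squeeze_param:
  assumes "continuous_on S f" "continuous_on S (\<lambda>z. g z (f z i))"
  shows "continuous_on S (\<lambda>z. squeeze i (g z) (f z))"
  unfolding squeeze_def by (rule continuous_on_fun_upd[OF assms])

lemma continuous_on_squeeze:
  assumes "continuous_on UNIV g"
  shows "continuous_on S (squeeze i g)"
proof -
  have "continuous_on S (\<lambda>x. x i)" by (rule continuous_on_coordinate[OF continuous_on_id])
  then have "continuous_on S (\<lambda>x. g (x i))" by (rule continuous_on_compose2[OF assms]) auto
  then show ?thesis by (rule continuous_on_squeeze_param[OF continuous_on_id])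
qed

text \<open>Linear interpolation between \<open>g\<close> and \<open>g'\<close> stays in the unit
  interval and is constant at its two ends, where the common values are 0 or 1. So the boundary
  stays in the boundary at all times.\<close>

lemma hom_induced_squeeze_homotopic:
  assumes i: "i < l" and A: "A \<subseteq> unit_cube l"
    and g: "continuous_on UNIV g" "continuous_on UNIV g'"
    and g01: "\<And>t. 0 \<le> t \<Longrightarrow> t \<le> 1 \<Longrightarrow> 0 \<le> g t \<and> g t \<le> 1 \<and> 0 \<le> g' t \<and> g' t \<le> 1"
    and ends: "g 0 = g' 0" "g 1 = g' 1" "g 0 \<in> {0,1}" "g 1 \<in> {0,1}"
  shows "hom_induced p (cube l) (cube_boundary l) (cube l) (cube_boundary l) (squeeze i g)
       = hom_induced p (cube l) (cube_boundary l) (cube l) (cube_boundary l) (squeeze i g')"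
  unfolding cube_eq
proof (rule hom_induced_homotopic_on[where h = "\<lambda>t. squeeze i (\<lambda>u. (1 - t) * g u + t * g' u)"])
  show "continuous_on ({0..1} \<times> unit_cube l)
     (\<lambda>z. squeeze i (\<lambda>u. (1 - fst z) * g u + fst z * g' u) (snd z))"
    by (intro continuous_on_squeeze_param continuous_on_add continuous_on_mult continuous_on_diff
        continuous_on_const continuous_on_fst continuous_on_snd continuous_on_id
        continuous_on_compose2[OF g(1)] continuous_on_compose2[OF g(2)] continuous_on_coordinate) auto
  have cv: "0 \<le> (1 - t) * g u + t * g' u \<and> (1 - t) * g u + t * g' u \<le> 1"
    if "t \<in> {0..1}" "0 \<le> u" "u \<le> 1" for t u
    using g01[OF that(2,3)] that(1) convex_bound_le[of "g u" 1 "g' u" "1 - t" t] by auto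
  show "squeeze i (\<lambda>u. (1 - t) * g u + t * g' u) x \<in> unit_cube l" if "t \<in> {0..1}" "x \<in> unit_cube l" for t x
    using that i cv[OF that(1), of "x i"] by (intro squeeze_in_cube) (auto simp: unit_cube_def)
  show "squeeze i (\<lambda>u. (1 - t) * g u + t * g' u) x \<in> cube_boundary l"
    if "t \<in> {0..1}" "x \<in> unit_cube l" "x \<in> cube_boundary l" for t x
  proof (rule squeeze_in_boundary[OF i that(3)])
    have "0 \<le> x i" "x i \<le> 1" using that(2) by (simp_all only: unit_cubeD)
    then show "0 \<le> (1 - t) * g (x i) + t * g' (x i)" "(1 - t) * g (x i) + t * g' (x i) \<le> 1"
      using cv[OF that(1)] by blast+
    have "(1 - t) * g u + t * g' u = g u" if "g u = g' u" for u
      using that by (simp add: algebra_simps)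
    then show "(1 - t) * g (x i) + t * g' (x i) = 0 \<or> (1 - t) * g (x i) + t * g' (x i) = 1"
      if "x i = 0 \<or> x i = 1" using that ends by auto
  qed
qed auto

lemma squeeze_ident: "squeeze i (\<lambda>u. u) = id"
  by (auto simp: squeeze_def)

lemma continuous_map_squeeze:
  assumes "i < l" "continuous_on UNIV g" "\<And>t. 0 \<le> t \<Longrightarrow> t \<le> 1 \<Longrightarrow> 0 \<le> g t \<and> g t \<le> 1"
  shows "continuous_map (cube l) (cube l) (squeeze i g)"
  unfolding cube_eq using assms continuous_on_squeeze[OF assms(2), of "unit_cube l" i]
  by (auto intro!: squeeze_in_cube simp: unit_cubeD)

lemma squeeze_boundary:
  assumes "i < l" "\<And>t. 0 \<le> t \<Longrightarrow> t \<le> 1 \<Longrightarrow> 0 \<le> g t \<and> g t \<le> 1" "g 0 = 0 \<or> g 0 = 1" "g 1 = 0 \<or> g 1 = 1"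
  shows "squeeze i g \<in> cube_boundary l \<rightarrow> cube_boundary l"
proof
  fix x assume x: "x \<in> cube_boundary l"
  then have "x \<in> unit_cube l" by (simp add: cube_boundary_eq)
  then have "0 \<le> x i" "x i \<le> 1" by (simp_all only: unit_cubeD)
  then have g: "0 \<le> g (x i)" "g (x i) \<le> 1" using assms(2) by blast+
  show "squeeze i g x \<in> cube_boundary l"
    by (rule squeeze_in_boundary[where g = g, OF assms(1) x g]) (use assms(3,4) in auto)
qed

lemma squeeze_comp: "squeeze i g \<circ> squeeze i h = squeeze i (g \<circ> h)"
  by (auto simp: squeeze_def)

text \<open>On the strip between 1/3 and 2/3 \<open>lo_map\<close> is constantly 1 and
  \<open>hi_map\<close> constantly 0. They carry the strip into the boundary and so turn the two cut
  chains into cycles relative to the boundary of the cube.\<close>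

definition lo_map :: "real \<Rightarrow> real" where "lo_map u = min 1 (3 * u)"
definition hi_map :: "real \<Rightarrow> real" where "hi_map u = max 0 (3 * u - 2)"

lemma lo_hi_map:
  "continuous_on UNIV lo_map" "continuous_on UNIV hi_map"
  "0 \<le> t \<Longrightarrow> t \<le> 1 \<Longrightarrow> 0 \<le> lo_map t \<and> lo_map t \<le> 1"
  "0 \<le> t \<Longrightarrow> t \<le> 1 \<Longrightarrow> 0 \<le> hi_map t \<and> hi_map t \<le> 1"
  unfolding lo_map_def[abs_def] hi_map_def[abs_def] by (auto intro!: continuous_intros)

lemma singular_relcycle_lo_map:
  assumes c1: "singular_relcycle p (subtopology (cube l) {x. x i < 2/3})
                 (cube_boundary l \<union> {x. 1/3 < x i \<and> x i < 2/3}) c1" and i: "i < l"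
  shows "singular_relcycle p (cube l) (cube_boundary l) (chain_map p (squeeze i lo_map) c1)"
proof (rule singular_relcycle_chain_map[where S = "{x \<in> unit_cube l. x i < 2/3} \<inter> (cube_boundary l \<union> {x. 1/3 < x i \<and> x i < 2/3})"])
  let ?X = "subtopology (cube l) {x. x i < 2/3}"
  have "topspace ?X \<inter> (cube_boundary l \<union> {x. 1/3 < x i \<and> x i < 2/3})
      = {x \<in> unit_cube l. x i < 2/3} \<inter> (cube_boundary l \<union> {x. 1/3 < x i \<and> x i < 2/3})"
    by (auto)
  then show "singular_relcycle p ?X ({x \<in> unit_cube l. x i < 2/3} \<inter> (cube_boundary l \<union> {x. 1/3 < x i \<and> x i < 2/3})) c1"
    using c1 singular_relcycle_restrict[of p ?X "cube_boundary l \<union> {x. 1/3 < x i \<and> x i < 2/3}"] by simp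
  show "continuous_map ?X (cube l) (squeeze i lo_map)"
    using continuous_map_squeeze[OF i lo_hi_map(1,3)] by (rule continuous_map_from_subtopology)
  show "squeeze i lo_map \<in> {x \<in> unit_cube l. x i < 2/3} \<inter> (cube_boundary l \<union> {x. 1/3 < x i \<and> x i < 2/3}) \<rightarrow> cube_boundary l"
  proof
    fix x assume x: "x \<in> {x \<in> unit_cube l. x i < 2/3} \<inter> (cube_boundary l \<union> {x. 1/3 < x i \<and> x i < 2/3})"
    show "squeeze i lo_map x \<in> cube_boundary l"
    proof (cases "x \<in> cube_boundary l")
      case True
      then show ?thesis using squeeze_boundary[of i l lo_map] i lo_hi_map(3) by (auto simp: lo_map_def)
    next
      case False
      then have "squeeze i lo_map x i = 1" using x by (auto simp: squeeze_def lo_map_def)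
      moreover have "squeeze i lo_map x \<in> unit_cube l"
        using x i lo_hi_map(3)[of "x i"] by (intro squeeze_in_cube) (auto simp: unit_cube_def)
      ultimately show ?thesis using i by (auto simp: cube_boundary_eq)
    qed
  qed
qed

lemma singular_relcycle_hi_map:
  assumes c2: "singular_relcycle p (subtopology (cube l) {x. x i > 1/3})
                 (cube_boundary l \<union> {x. 1/3 < x i \<and> x i < 2/3}) c2" and i: "i < l"
  shows "singular_relcycle p (cube l) (cube_boundary l) (chain_map p (squeeze i hi_map) c2)"
proof (rule singular_relcycle_chain_map[where S = "{x \<in> unit_cube l. x i > 1/3} \<inter> (cube_boundary l \<union> {x. 1/3 < x i \<and> x i < 2/3})"])
  let ?X = "subtopology (cube l) {x. x i > 1/3}"
  have "topspace ?X \<inter> (cube_boundary l \<union> {x. 1/3 < x i \<and> x i < 2/3})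
      = {x \<in> unit_cube l. x i > 1/3} \<inter> (cube_boundary l \<union> {x. 1/3 < x i \<and> x i < 2/3})"
    by (auto)
  then show "singular_relcycle p ?X ({x \<in> unit_cube l. x i > 1/3} \<inter> (cube_boundary l \<union> {x. 1/3 < x i \<and> x i < 2/3})) c2"
    using c2 singular_relcycle_restrict[of p ?X "cube_boundary l \<union> {x. 1/3 < x i \<and> x i < 2/3}"] by simp
  show "continuous_map ?X (cube l) (squeeze i hi_map)"
    using continuous_map_squeeze[OF i lo_hi_map(2,4)] by (rule continuous_map_from_subtopology)
  show "squeeze i hi_map \<in> {x \<in> unit_cube l. x i > 1/3} \<inter> (cube_boundary l \<union> {x. 1/3 < x i \<and> x i < 2/3}) \<rightarrow> cube_boundary l"
  proof
    fix x assume x: "x \<in> {x \<in> unit_cube l. x i > 1/3} \<inter> (cube_boundary l \<union> {x. 1/3 < x i \<and> x i < 2/3})"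
    show "squeeze i hi_map x \<in> cube_boundary l"
    proof (cases "x \<in> cube_boundary l")
      case True
      then show ?thesis using squeeze_boundary[of i l hi_map] i lo_hi_map(4) by (auto simp: hi_map_def)
    next
      case False
      then have "squeeze i hi_map x i = 0" using x by (auto simp: squeeze_def hi_map_def)
      moreover have "squeeze i hi_map x \<in> unit_cube l"
        using x i lo_hi_map(4)[of "x i"] by (intro squeeze_in_cube) (auto simp: unit_cube_def)
      ultimately show ?thesis using i by (auto simp: cube_boundary_eq)
    qed
  qed
qed

lemma hom_induced_cube_split:
  assumes c: "singular_relcycle p (cube l) (cube_boundary l) c" and i: "i < l"
    and hc: "homologous_rel p (cube l) (cube_boundary l) c (c1 + c2)"
    and c1: "singular_relcycle p (subtopology (cube l) {x. x i < 2/3})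
               (cube_boundary l \<union> {x. 1/3 < x i \<and> x i < 2/3}) c1"
    and c2: "singular_relcycle p (subtopology (cube l) {x. x i > 1/3})
               (cube_boundary l \<union> {x. 1/3 < x i \<and> x i < 2/3}) c2"
    and f: "continuous_map (cube l) Y f"
    and fA: "f ` (cube_boundary l \<union> {x \<in> unit_cube l. x i = 1/2}) \<subseteq> A"
  defines "a \<equiv> homologous_rel_set p (cube l) (cube_boundary l) (chain_map p (squeeze i lo_map) c1)"
    and "b \<equiv> homologous_rel_set p (cube l) (cube_boundary l) (chain_map p (squeeze i hi_map) c2)"
  shows "hom_induced (int p) (cube l) (cube_boundary l) Y A f (homologous_rel_set p (cube l) (cube_boundary l) c) =
       hom_induced (int p) (cube l) (cube_boundary l) Y A (f \<circ> squeeze i (\<lambda>u. u / 2)) a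
       \<otimes>\<^bsub>relative_homology_group (int p) Y A\<^esub>
       hom_induced (int p) (cube l) (cube_boundary l) Y A (f \<circ> squeeze i (\<lambda>u. (1 + u) / 2)) b"
proof -
  \<comment> \<open>\<open>g\<close> climbs to 1/2 on the first third, rests at 1/2 on the strip and
    climbs to 1 on the last third. It is homotopic to the identity, equals half of
    \<open>lo_map\<close> where \<open>c1\<close> lives and (1 + \<open>hi_map\<close>) / 2 where
    \<open>c2\<close> lives.\<close>
  define g where "g u = (lo_map u + hi_map u) / 2" for u
  have g: "continuous_on UNIV g" "\<And>t. 0 \<le> t \<Longrightarrow> t \<le> 1 \<Longrightarrow> 0 \<le> g t \<and> g t \<le> 1" "g 0 = 0" "g 1 = 1"
    using lo_hi_map(3,4) unfolding g_def
    by (force intro!: continuous_intros lo_hi_map(1,2) simp: lo_map_def hi_map_def)+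
  have gc: "continuous_map (cube l) (cube l) (squeeze i g)" using continuous_map_squeeze[OF i g(1,2)] .
  have gb: "squeeze i g \<in> cube_boundary l \<rightarrow> cube_boundary l"
    using squeeze_boundary[OF i g(2)] g by simp
  have fb: "f \<in> cube_boundary l \<rightarrow> A" using fA by auto
  let ?H = "hom_induced (int p) (cube l) (cube_boundary l) Y A"
  have "hom_induced (int p) (cube l) (cube_boundary l) (cube l) (cube_boundary l) (squeeze i g)
      = hom_induced (int p) (cube l) (cube_boundary l) (cube l) (cube_boundary l) (squeeze i (\<lambda>u. u))"
    by (rule hom_induced_squeeze_homotopic[OF i cube_boundary_subset g(1)]) (auto simp: g)
  then have "?H (f \<circ> squeeze i g) = ?H (f \<circ> squeeze i (\<lambda>u. u))"
    using hom_induced_compose[OF gc gb f fb] hom_induced_compose[of "cube l" "cube l" id "cube_boundary l" "cube_boundary l" Y f A] f fb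
    by (simp add: squeeze_ident)
  then have "?H f (homologous_rel_set p (cube l) (cube_boundary l) c)
      = ?H (f \<circ> squeeze i g) (homologous_rel_set p (cube l) (cube_boundary l) (c1 + c2))"
    using hc homologous_rel_set_eq[of p "cube l" "cube_boundary l" c "c1 + c2"] by (simp add: squeeze_ident)
  also have "\<dots> = homologous_rel_set p Y A (chain_map p (f \<circ> squeeze i g) (c1 + c2))"
  proof (rule hom_induced_chain_map)
    show "continuous_map (cube l) Y (f \<circ> squeeze i g)" using gc f by (rule continuous_map_compose)
    show "f \<circ> squeeze i g \<in> cube_boundary l \<rightarrow> A" using fb gb by auto
    show "singular_relcycle p (cube l) (cube_boundary l) (c1 + c2)"
      using hc c homologous_rel_singular_relcycle by blast
  qed
  also have "chain_map p (f \<circ> squeeze i g) (c1 + c2)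
      = chain_map p (f \<circ> squeeze i g) c1 + chain_map p (f \<circ> squeeze i g) c2"
    by (rule chain_map_add)
  also have "chain_map p (f \<circ> squeeze i g) c1 = chain_map p (f \<circ> squeeze i (\<lambda>u. u / 2)) (chain_map p (squeeze i lo_map) c1)"
  proof -
    have "chain_map p (f \<circ> squeeze i g) c1 = chain_map p ((f \<circ> squeeze i (\<lambda>u. u / 2)) \<circ> squeeze i lo_map) c1"
      using c1 by (intro chain_map_eq[of p "subtopology (cube l) {x. x i < 2/3}"])
        (auto simp: singular_relcycle_def squeeze_def g_def hi_map_def)
    then show ?thesis by (simp add: chain_map_compose)
  qed
  also have "chain_map p (f \<circ> squeeze i g) c2 = chain_map p (f \<circ> squeeze i (\<lambda>u. (1 + u) / 2)) (chain_map p (squeeze i hi_map) c2)"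
  proof -
    have "chain_map p (f \<circ> squeeze i g) c2 = chain_map p ((f \<circ> squeeze i (\<lambda>u. (1 + u) / 2)) \<circ> squeeze i hi_map) c2"
      using c2 by (intro chain_map_eq[of p "subtopology (cube l) {x. x i > 1/3}"])
        (auto simp: singular_relcycle_def squeeze_def g_def lo_map_def)
    then show ?thesis by (simp add: chain_map_compose)
  qed
  finally have 1: "?H f (homologous_rel_set p (cube l) (cube_boundary l) c) =
      homologous_rel_set p Y A (chain_map p (f \<circ> squeeze i (\<lambda>u. u / 2)) (chain_map p (squeeze i lo_map) c1)
      + chain_map p (f \<circ> squeeze i (\<lambda>u. (1 + u) / 2)) (chain_map p (squeeze i hi_map) c2))" .
  have half: "squeeze i h \<in> cube_boundary l \<rightarrow> cube_boundary l \<union> {x \<in> unit_cube l. x i = 1/2}"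
    if h: "\<And>t. 0 \<le> t \<Longrightarrow> t \<le> 1 \<Longrightarrow> 0 \<le> h t \<and> h t \<le> 1" "h 0 \<in> {0,1/2,1}" "h 1 \<in> {0,1/2,1}" for h
  proof
    fix x assume x: "x \<in> cube_boundary l"
    have xi: "0 \<le> x i" "x i \<le> 1" using x i by (auto simp: cube_boundary_eq unit_cube_def)
    have u: "squeeze i h x \<in> unit_cube l"
      using x i h(1)[OF xi] by (intro squeeze_in_cube) (auto simp: cube_boundary_eq)
    obtain j where j: "j < l" "x j = 0 \<or> x j = 1" using x by (auto simp: cube_boundary_eq)
    show "squeeze i h x \<in> cube_boundary l \<union> {x \<in> unit_cube l. x i = 1/2}"
      using u j h(2,3) i by (cases "j = i") (auto simp: squeeze_def cube_boundary_eq)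
  qed
  have cont: "continuous_map (cube l) Y (f \<circ> squeeze i (\<lambda>u. u / 2))"
     "continuous_map (cube l) Y (f \<circ> squeeze i (\<lambda>u. (1 + u) / 2))"
    by (intro continuous_map_compose[OF _ f] continuous_map_squeeze[OF i]; auto intro!: continuous_intros)+
  have bd: "f \<circ> squeeze i (\<lambda>u. u / 2) \<in> cube_boundary l \<rightarrow> A" "f \<circ> squeeze i (\<lambda>u. (1 + u) / 2) \<in> cube_boundary l \<rightarrow> A"
    using half[of "\<lambda>u. u / 2"] half[of "\<lambda>u. (1 + u) / 2"] fA by (auto simp: Pi_iff image_subset_iff)
  note r1 = singular_relcycle_lo_map[OF c1 i] and r2 = singular_relcycle_hi_map[OF c2 i]
  show ?thesis
    unfolding 1 a_def b_def hom_induced_chain_map[OF cont(1) bd(1) r1] hom_induced_chain_map[OF cont(2) bd(2) r2]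
    by (rule mult_homologous_rel_set[symmetric]) (intro singular_relcycle_chain_map[OF r1] singular_relcycle_chain_map[OF r2] cont bd)+
qed

text \<open>The classes \<open>a\<close> and \<open>b\<close> of the two cut halves both equal
  \<open>v\<close>. To see this, the splitting is applied to self-maps of the cube that are
  homotopic to the identity and collapse one half into the boundary: \<open>m1\<close> the upper
  half to 1, \<open>m2\<close> the lower half to 0. One factor is then trivial and the other is the
  class in question.\<close>

lemma hom_induced_cube_wall:
  assumes v: "v \<in> carrier (relative_homology_group (int p) (cube l) (cube_boundary l))" and i: "i < l"
    and f: "continuous_map (cube l) Y f"
    and fA: "f ` (cube_boundary l \<union> {x \<in> unit_cube l. x i = 1/2}) \<subseteq> A"
  shows "hom_induced (int p) (cube l) (cube_boundary l) Y A f v =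
       hom_induced (int p) (cube l) (cube_boundary l) Y A (f \<circ> squeeze i (\<lambda>u. u / 2)) v
       \<otimes>\<^bsub>relative_homology_group (int p) Y A\<^esub>
       hom_induced (int p) (cube l) (cube_boundary l) Y A (f \<circ> squeeze i (\<lambda>u. (1 + u) / 2)) v"
proof -
  obtain c where c: "v = homologous_rel_set p (cube l) (cube_boundary l) c"
      "singular_relcycle p (cube l) (cube_boundary l) c"
    using v by (auto simp: carrier_relative_homology_group)
  obtain c1 c2 where hc: "homologous_rel p (cube l) (cube_boundary l) c (c1 + c2)"
    and c1: "singular_relcycle p (subtopology (cube l) {x. x i < 2/3}) (cube_boundary l \<union> {x. 1/3 < x i \<and> x i < 2/3}) c1"
    and c2: "singular_relcycle p (subtopology (cube l) {x. x i > 1/3}) (cube_boundary l \<union> {x. 1/3 < x i \<and> x i < 2/3}) c2"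
    using cube_split_cycle[OF c(2) i] by blast
  define a where "a = homologous_rel_set p (cube l) (cube_boundary l) (chain_map p (squeeze i lo_map) c1)"
  define b where "b = homologous_rel_set p (cube l) (cube_boundary l) (chain_map p (squeeze i hi_map) c2)"
  have ac: "a \<in> carrier (relative_homology_group (int p) (cube l) (cube_boundary l))"
    and bc: "b \<in> carrier (relative_homology_group (int p) (cube l) (cube_boundary l))"
    unfolding a_def b_def carrier_relative_homology_group
    using singular_relcycle_lo_map[OF c1 i] singular_relcycle_hi_map[OF c2 i] by auto
  note split = hom_induced_cube_split[OF c(2) i hc c1 c2, folded a_def b_def c(1)]
  let ?G = "relative_homology_group (int p) (cube l) (cube_boundary l)"
  let ?E = "hom_induced (int p) (cube l) (cube_boundary l) (cube l) (cube_boundary l)"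
  interpret G: group ?G by simp
  define m1 where "m1 u = min 1 (2 * u)" for u :: real
  define m2 where "m2 u = max 0 (2 * u - 1)" for u :: real
  have m: "continuous_on UNIV m1" "continuous_on UNIV m2" unfolding m1_def m2_def by (intro continuous_intros)+
  have m01: "0 \<le> m1 t \<and> m1 t \<le> 1" "0 \<le> m2 t \<and> m2 t \<le> 1" if "0 \<le> t" "t \<le> 1" for t
    using that by (auto simp: m1_def m2_def)
  have mc: "continuous_map (cube l) (cube l) (squeeze i m1)" "continuous_map (cube l) (cube l) (squeeze i m2)"
    using continuous_map_squeeze[OF i m(1) m01(1)] continuous_map_squeeze[OF i m(2) m01(2)] by auto
  have idm: "?E (squeeze i g) v = v" if "continuous_on UNIV g" "\<And>t. 0 \<le> t \<Longrightarrow> t \<le> 1 \<Longrightarrow> 0 \<le> g t \<and> g t \<le> 1" "g 0 = 0" "g 1 = 1" for g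
  proof -
    have "?E (squeeze i g) = ?E (squeeze i (\<lambda>u. u))"
      using that by (intro hom_induced_squeeze_homotopic[OF i cube_boundary_subset that(1)]) auto
    then show ?thesis using v by (simp add: squeeze_ident hom_induced_id)
  qed
  have wall: "squeeze i g ` (cube_boundary l \<union> {x \<in> unit_cube l. x i = 1/2}) \<subseteq> cube_boundary l"
    if g: "\<And>t. 0 \<le> t \<Longrightarrow> t \<le> 1 \<Longrightarrow> 0 \<le> g t \<and> g t \<le> 1" "g 0 \<in> {0,1}" "g 1 \<in> {0,1}" "g (1/2) \<in> {0,1}" for g
  proof -
    have "squeeze i g x \<in> cube_boundary l" if "x \<in> unit_cube l" "x i = 1/2" for x
    proof -
      have "squeeze i g x \<in> unit_cube l" using that g(1)[of "x i"] by (intro squeeze_in_cube i) auto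
      moreover have "squeeze i g x i = 0 \<or> squeeze i g x i = 1" using g(4) unfolding squeeze_def that(2) by auto
      ultimately show ?thesis using i by (auto simp: cube_boundary_eq)
    qed
    moreover have "squeeze i g \<in> cube_boundary l \<rightarrow> cube_boundary l"
      using g by (intro squeeze_boundary i) auto
    ultimately show ?thesis by auto
  qed
  have const: "?E (squeeze i g) w = \<one>\<^bsub>?G\<^esub>"
    if g: "continuous_on UNIV g" "\<And>t. 0 \<le> t \<Longrightarrow> t \<le> 1 \<Longrightarrow> g t = k" and k: "k \<in> {0,1}" for g w k
  proof (rule hom_induced_into_subset)
    show "continuous_map (cube l) (cube l) (squeeze i g)"
      using g k by (intro continuous_map_squeeze i) auto
    show "squeeze i g ` topspace (cube l) \<subseteq> cube_boundary l"
    proof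
      fix y assume "y \<in> squeeze i g ` topspace (cube l)"
      then obtain x where x: "x \<in> unit_cube l" "y = squeeze i g x" by auto
      have gx: "g (x i) = k" using x g(2)[of "x i"] i by (auto simp: unit_cube_def)
      then have "y \<in> unit_cube l" using x k i by (auto intro!: squeeze_in_cube)
      moreover have "y i = k" using x gx by (simp add: squeeze_def)
      ultimately show "y \<in> cube_boundary l" using i k by (auto simp: cube_boundary_eq)
    qed
  qed
  have cong: "?E (squeeze i g) w = ?E (squeeze i h) w" if "\<And>t. 0 \<le> t \<Longrightarrow> t \<le> 1 \<Longrightarrow> g t = h t" for g h w
    using hom_induced_eq[of "cube l" "squeeze i g" "squeeze i h" "int p"] that i
    by (auto simp: squeeze_def unit_cube_def)
  have "v = ?E (squeeze i m1) v"
    using idm[of m1] m m01 by (simp add: m1_def)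
  also have "\<dots> = ?E (squeeze i m1 \<circ> squeeze i (\<lambda>u. u / 2)) a \<otimes>\<^bsub>?G\<^esub> ?E (squeeze i m1 \<circ> squeeze i (\<lambda>u. (1 + u) / 2)) b"
    by (rule split[OF mc(1)]) (rule wall, use m01 in \<open>auto simp: m1_def\<close>)
  also have "?E (squeeze i m1 \<circ> squeeze i (\<lambda>u. u / 2)) a = a"
    unfolding squeeze_comp using cong[of "m1 \<circ> (\<lambda>u. u / 2)" "\<lambda>u. u" a] ac
    by (simp add: m1_def squeeze_ident hom_induced_id)
  also have "?E (squeeze i m1 \<circ> squeeze i (\<lambda>u. (1 + u) / 2)) b = \<one>\<^bsub>?G\<^esub>"
    unfolding squeeze_comp by (rule const[of _ 1]) (auto simp: m1_def comp_def intro!: continuous_intros)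
  finally have va: "v = a" using G.r_one[OF ac] by simp
  have "v = ?E (squeeze i m2) v"
    using idm[of m2] m m01 by (simp add: m2_def)
  also have "\<dots> = ?E (squeeze i m2 \<circ> squeeze i (\<lambda>u. u / 2)) a \<otimes>\<^bsub>?G\<^esub> ?E (squeeze i m2 \<circ> squeeze i (\<lambda>u. (1 + u) / 2)) b"
    by (rule split[OF mc(2)]) (rule wall, use m01 in \<open>auto simp: m2_def\<close>)
  also have "?E (squeeze i m2 \<circ> squeeze i (\<lambda>u. (1 + u) / 2)) b = b"
    unfolding squeeze_comp using cong[of "m2 \<circ> (\<lambda>u. (1 + u) / 2)" "\<lambda>u. u" b] bc
    by (simp add: m2_def squeeze_ident hom_induced_id add_divide_distrib)
  also have "?E (squeeze i m2 \<circ> squeeze i (\<lambda>u. u / 2)) a = \<one>\<^bsub>?G\<^esub>"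
    unfolding squeeze_comp by (rule const[of _ 0]) (auto simp: m2_def comp_def intro!: continuous_intros)
  finally have vb: "v = b" using G.l_one[OF bc] by simp
  show ?thesis using split[OF f fA] va vb by simp
qed

section \<open>Gluing and reversing maps of cubes\<close>

definition concat_at :: "nat \<Rightarrow> ((nat \<Rightarrow> real) \<Rightarrow> 'a) \<Rightarrow> ((nat \<Rightarrow> real) \<Rightarrow> 'a) \<Rightarrow> (nat \<Rightarrow> real) \<Rightarrow> 'a" where
  "concat_at i f g = (\<lambda>x. if x i \<le> 1 / 2 then f (squeeze i (\<lambda>u. 2 * u) x) else g (squeeze i (\<lambda>u. 2 * u - 1) x))"

lemma spheroid_concat_eq: "spheroid_concat = concat_at 0"
  by (intro ext) (simp add: spheroid_concat_def concat_at_def squeeze_def)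

lemma continuous_map_concat_at:
  assumes f: "continuous_map (cube l) Y f" and g: "continuous_map (cube l) Y g" and i: "i < l"
    and agree: "\<And>x. x \<in> unit_cube l \<Longrightarrow> x i = 1 \<Longrightarrow> f x = g (x(i := 0))"
  shows "continuous_map (cube l) Y (concat_at i f g)"
  unfolding concat_at_def
proof (rule continuous_map_cases_le)
  show p: "continuous_map (cube l) euclideanreal (\<lambda>x. x i)"
    unfolding cube_eq by simp (rule continuous_on_coordinate[OF continuous_on_id])
  show "continuous_map (cube l) euclideanreal (\<lambda>x. 1 / 2)" by simp
  show "continuous_map (subtopology (cube l) {x \<in> topspace (cube l). x i \<le> 1 / 2}) Y (\<lambda>x. f (squeeze i (\<lambda>u. 2 * u) x))"
  proof (rule continuous_map_compose[OF _ f, unfolded comp_def])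
    have "continuous_on S (squeeze i (\<lambda>u. 2 * u))" for S
      by (rule continuous_on_squeeze) (intro continuous_intros)
    then show "continuous_map (subtopology (cube l) {x \<in> topspace (cube l). x i \<le> 1 / 2}) (cube l) (squeeze i (\<lambda>u. 2 * u))"
      using i unit_cubeD unfolding cube_eq by (auto simp: subtopology_subtopology intro!: squeeze_in_cube)
  qed
  show "continuous_map (subtopology (cube l) {x \<in> topspace (cube l). 1 / 2 \<le> x i}) Y (\<lambda>x. g (squeeze i (\<lambda>u. 2 * u - 1) x))"
  proof (rule continuous_map_compose[OF _ g, unfolded comp_def])
    have "continuous_on S (squeeze i (\<lambda>u. 2 * u - 1))" for S
      by (rule continuous_on_squeeze) (intro continuous_intros)
    then show "continuous_map (subtopology (cube l) {x \<in> topspace (cube l). 1 / 2 \<le> x i}) (cube l) (squeeze i (\<lambda>u. 2 * u - 1))"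
      using i unit_cubeD unfolding cube_eq by (auto simp: subtopology_subtopology intro!: squeeze_in_cube)
  qed
  show "f (squeeze i (\<lambda>u. 2 * u) x) = g (squeeze i (\<lambda>u. 2 * u - 1) x)"
    if "x \<in> topspace (cube l)" "x i = 1 / 2" for x
  proof -
    have "squeeze i (\<lambda>u. 2 * u) x \<in> unit_cube l" using that i by (intro squeeze_in_cube) auto
    moreover have "squeeze i (\<lambda>u. 2 * u) x = x(i := 1)" "squeeze i (\<lambda>u. 2 * u - 1) x = x(i := 0)"
      by (simp_all add: squeeze_def that(2))
    ultimately show ?thesis using agree[of "x(i := 1)"] by simp
  qed
qed

lemma boundaryI: "x \<in> unit_cube l \<Longrightarrow> i < l \<Longrightarrow> x i = 0 \<or> x i = 1 \<Longrightarrow> x \<in> cube_boundary l"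
  by (auto simp: cube_boundary_eq)

lemma concat_at_boundary:
  assumes "\<And>x. x \<in> cube_boundary l \<Longrightarrow> f x \<in> A" "\<And>x. x \<in> cube_boundary l \<Longrightarrow> g x \<in> A"
    "i < l" "x \<in> cube_boundary l"
  shows "concat_at i f g x \<in> A"
proof -
  have xc: "x \<in> unit_cube l" using assms(4) by (auto simp: cube_boundary_eq)
  then have xi: "0 \<le> x i" "x i \<le> 1" by (simp_all only: unit_cubeD)
  obtain j where j: "j < l" "x j = 0 \<or> x j = 1" using assms(4) by (auto simp: cube_boundary_eq)
  show ?thesis
  proof (cases "x i \<le> 1/2")
    case True
    have "squeeze i (\<lambda>u. 2 * u) x \<in> unit_cube l" using xi True assms xc by (intro squeeze_in_cube) auto
    moreover have "squeeze i (\<lambda>u. 2 * u) x j = 0 \<or> squeeze i (\<lambda>u. 2 * u) x j = 1"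
      using True j by (cases "j = i") (auto simp: squeeze_def)
    ultimately show ?thesis using True assms(1) j boundaryI by (auto simp: concat_at_def)
  next
    case False
    have "squeeze i (\<lambda>u. 2 * u - 1) x \<in> unit_cube l" using xi False assms xc by (intro squeeze_in_cube) auto
    moreover have "squeeze i (\<lambda>u. 2 * u - 1) x j = 0 \<or> squeeze i (\<lambda>u. 2 * u - 1) x j = 1"
      using False j by (cases "j = i") (auto simp: squeeze_def)
    ultimately show ?thesis using False assms(2) j boundaryI by (auto simp: concat_at_def)
  qed
qed

text \<open>The glued map sends the middle wall to values of \<open>f\<close> on the boundary, hence
  into \<open>A\<close>, so the wall formula applies. Agreement is asked for only along the glued
  faces, because the fillings of the homotopy addition argument are not constant on the boundary of
  the cube.\<close>

lemma hom_induced_concat_at: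
  assumes v: "v \<in> carrier (relative_homology_group (int p) (cube l) (cube_boundary l))"
    and f: "continuous_map (cube l) Y f" and g: "continuous_map (cube l) Y g" and i: "i < l"
    and agree: "\<And>x. x \<in> unit_cube l \<Longrightarrow> x i = 1 \<Longrightarrow> f x = g (x(i := 0))"
    and fA: "f ` cube_boundary l \<subseteq> A" and gA: "g ` cube_boundary l \<subseteq> A"
  shows "hom_induced (int p) (cube l) (cube_boundary l) Y A (concat_at i f g) v =
       hom_induced (int p) (cube l) (cube_boundary l) Y A f v
       \<otimes>\<^bsub>relative_homology_group (int p) Y A\<^esub>
       hom_induced (int p) (cube l) (cube_boundary l) Y A g v"
proof -
  have c: "continuous_map (cube l) Y (concat_at i f g)"
    by (rule continuous_map_concat_at[OF f g i agree])
  have b: "concat_at i f g ` (cube_boundary l \<union> {x \<in> unit_cube l. x i = 1/2}) \<subseteq> A"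
  proof (intro image_subsetI)
    fix x assume x: "x \<in> cube_boundary l \<union> {x \<in> unit_cube l. x i = 1/2}"
    show "concat_at i f g x \<in> A"
    proof (cases "x \<in> cube_boundary l")
      case True
      then show ?thesis using fA gA by (intro concat_at_boundary[OF _ _ i]) auto
    next
      case False
      then have xi: "x \<in> unit_cube l" "x i = 1/2" using x by auto
      have "squeeze i (\<lambda>u. 2 * u) x = x(i := 1)" by (simp add: squeeze_def xi(2))
      moreover have "x(i := 1) \<in> cube_boundary l" using xi(1) i by (intro boundaryI[of _ _ i]) (auto simp: unit_cube_def)
      ultimately show ?thesis using fA xi(2) by (auto simp: concat_at_def)
    qed
  qed
  have 1: "hom_induced (int p) (cube l) (cube_boundary l) Y A (concat_at i f g \<circ> squeeze i (\<lambda>u. u / 2))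
      = hom_induced (int p) (cube l) (cube_boundary l) Y A f"
  proof (rule hom_induced_eq)
    fix x assume "x \<in> topspace (cube l)"
    then have "x i \<le> 1" using unit_cubeD by auto
    then show "(concat_at i f g \<circ> squeeze i (\<lambda>u. u / 2)) x = f x"
      by (simp add: concat_at_def squeeze_def)
  qed
  have 2: "hom_induced (int p) (cube l) (cube_boundary l) Y A (concat_at i f g \<circ> squeeze i (\<lambda>u. (1 + u) / 2))
      = hom_induced (int p) (cube l) (cube_boundary l) Y A g"
  proof (rule hom_induced_eq)
    fix x assume x: "x \<in> topspace (cube l)"
    then have xi: "0 \<le> x i" "x i \<le> 1" using unit_cubeD by auto
    show "(concat_at i f g \<circ> squeeze i (\<lambda>u. (1 + u) / 2)) x = g x"
    proof (cases "x i = 0")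
      case True
      have "x(i := 1) \<in> unit_cube l" using x i by (auto simp: unit_cube_def)
      from agree[OF this] have "f (x(i := 1)) = g x" using True by (simp add: fun_upd_idem)
      then show ?thesis using True by (simp add: concat_at_def squeeze_def)
    next
      case False
      then show ?thesis using xi by (simp add: concat_at_def squeeze_def add_divide_distrib)
    qed
  qed
  show ?thesis
    using hom_induced_cube_wall[OF v i c b] unfolding 1 2 .
qed

definition flip :: "nat \<Rightarrow> (nat \<Rightarrow> real) \<Rightarrow> nat \<Rightarrow> real" where
  "flip i = squeeze i (\<lambda>u. 1 - u)"

lemma continuous_map_flip: "i < l \<Longrightarrow> continuous_map (cube l) (cube l) (flip i)"
  unfolding flip_def by (intro continuous_map_squeeze) (auto intro!: continuous_intros)

lemma flip_boundary: "i < l \<Longrightarrow> flip i \<in> cube_boundary l \<rightarrow> cube_boundary l"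
  unfolding flip_def by (intro squeeze_boundary) auto

text \<open>The map \<open>f\<close> followed by its reverse is \<open>f\<close> read along a tent
  function. The tent has the value 0 at both ends and flattens to the constant 0, so the product of
  the two values is one.\<close>

lemma hom_induced_flip:
  assumes v: "v \<in> carrier (relative_homology_group (int p) (cube l) (cube_boundary l))"
    and f: "continuous_map (cube l) Y f" and i: "i < l"
    and fA: "f ` cube_boundary l \<subseteq> A"
  shows "hom_induced (int p) (cube l) (cube_boundary l) Y A (f \<circ> flip i) v =
     inv\<^bsub>relative_homology_group (int p) Y A\<^esub> hom_induced (int p) (cube l) (cube_boundary l) Y A f v"
proof -
  let ?G = "relative_homology_group (int p) Y A"
  let ?H = "hom_induced (int p) (cube l) (cube_boundary l) Y A"
  let ?E = "hom_induced (int p) (cube l) (cube_boundary l) (cube l) (cube_boundary l)"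
  interpret G: comm_group ?G by simp
  have fb: "f \<in> cube_boundary l \<rightarrow> A" using fA by auto
  define tent where "tent u = min (2 * u) (2 - 2 * u)" for u :: real
  have tc: "continuous_on UNIV tent" unfolding tent_def by (intro continuous_intros)
  have t01: "0 \<le> tent t \<and> tent t \<le> 1" if "0 \<le> t" "t \<le> 1" for t using that by (auto simp: tent_def)
  have z: "continuous_map (cube l) (cube l) (squeeze i (\<lambda>u. 0))" "squeeze i (\<lambda>u. 0) \<in> cube_boundary l \<rightarrow> cube_boundary l"
    "squeeze i (\<lambda>u. 0) ` topspace (cube l) \<subseteq> cube_boundary l"
    using i by (auto intro!: continuous_map_squeeze squeeze_boundary) (auto simp: cube_boundary_eq unit_cube_def squeeze_def)
  have "?E (squeeze i tent) = ?E (squeeze i (\<lambda>u. 0))"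
    using t01 by (intro hom_induced_squeeze_homotopic[OF i cube_boundary_subset tc]) (auto simp: tent_def)
  moreover have "squeeze i tent \<in> cube_boundary l \<rightarrow> cube_boundary l"
    using t01 by (intro squeeze_boundary i) (auto simp: tent_def)
  moreover have tcm: "continuous_map (cube l) (cube l) (squeeze i tent)"
    using t01 by (intro continuous_map_squeeze i tc) auto
  ultimately have "?H (f \<circ> squeeze i tent) = ?H (f \<circ> squeeze i (\<lambda>u. 0))"
    using hom_induced_compose[OF tcm _ f fb, of "cube_boundary l"] hom_induced_compose[OF z(1,2) f fb] by simp
  moreover have "?H (f \<circ> squeeze i (\<lambda>u. 0)) v = \<one>\<^bsub>?G\<^esub>"
    using z fA by (intro hom_induced_into_subset continuous_map_compose[OF _ f]) auto
  moreover have "?H (f \<circ> squeeze i tent) = ?H (concat_at i f (f \<circ> flip i))"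
  proof (rule hom_induced_eq)
    show "(f \<circ> squeeze i tent) x = concat_at i f (f \<circ> flip i) x" if "x \<in> topspace (cube l)" for x
      by (auto simp: concat_at_def squeeze_def flip_def tent_def min_def intro!: arg_cong[of _ _ f])
  qed
  moreover have "?H (concat_at i f (f \<circ> flip i)) v = ?H f v \<otimes>\<^bsub>?G\<^esub> ?H (f \<circ> flip i) v"
  proof (rule hom_induced_concat_at[OF v f continuous_map_compose[OF continuous_map_flip[OF i] f] i])
    show "f x = (f \<circ> flip i) (x(i := 0))" if "x i = 1" for x
      using that by (simp add: flip_def squeeze_def fun_upd_idem)
    show "(f \<circ> flip i) ` cube_boundary l \<subseteq> A" using flip_boundary[OF i] fb by fastforce
  qed (rule fA)
  ultimately have "?H f v \<otimes>\<^bsub>?G\<^esub> ?H (f \<circ> flip i) v = \<one>\<^bsub>?G\<^esub>" by simp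
  then show ?thesis
    using G.inv_equality[of "?H (f \<circ> flip i) v" "?H f v"] hom_induced_carrier G.m_comm by metis
qed

section \<open>Values of spheroids in homology\<close>

text \<open>The class \<open>v\<close> is a parameter because two classes occur:
  \<open>cube_class\<close> in the Hurewicz homomorphism and \<open>transferred_class\<close>, which
  comes from the simplex, in the representation of homology classes.\<close>

definition spheroid_value :: "nat \<Rightarrow> 'a topology \<Rightarrow> 'a \<Rightarrow> (nat \<Rightarrow> real) chain set \<Rightarrow> ((nat \<Rightarrow> real) \<Rightarrow> 'a) \<Rightarrow> 'a chain set" where
  "spheroid_value l X x0 v f = hom_induced (int l) (cube l) (cube_boundary l) X {x0} f v"

lemma spheroids_iff:
  "f \<in> spheroids l X x0 \<longleftrightarrow> continuous_map (cube l) X f \<and> (\<forall>x\<in>cube_boundary l. f x = x0)"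
  by (auto simp: spheroids_def)

lemma spheroid_agree:
  assumes "f \<in> spheroids l X x0" "g \<in> spheroids l X x0" "i < l" "x \<in> unit_cube l" "x i = 1"
  shows "f x = g (x(i := 0))"
proof -
  have "x(i := 0) \<in> cube_boundary l" using assms by (intro boundaryI[of _ _ i]) (auto simp: unit_cube_def)
  moreover have "x \<in> cube_boundary l" using assms by (intro boundaryI[of _ _ i]) auto
  ultimately show ?thesis using assms by (simp add: spheroids_iff)
qed

lemma concat_at_spheroids:
  assumes "f \<in> spheroids l X x0" "g \<in> spheroids l X x0" "i < l"
  shows "concat_at i f g \<in> spheroids l X x0"
  unfolding spheroids_iff
proof
  show "continuous_map (cube l) X (concat_at i f g)"
    using assms spheroid_agree[OF assms(1,2,3)] by (intro continuous_map_concat_at) (auto simp: spheroids_iff)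
  show "\<forall>x\<in>cube_boundary l. concat_at i f g x = x0"
    using concat_at_boundary[of l f "{x0}" g i] assms by (auto simp: spheroids_iff)
qed

lemma spheroid_value_concat_at:
  assumes "v \<in> carrier (relative_homology_group (int l) (cube l) (cube_boundary l))"
    and "f \<in> spheroids l X x0" "g \<in> spheroids l X x0" "i < l"
  shows "spheroid_value l X x0 v (concat_at i f g) =
     spheroid_value l X x0 v f \<otimes>\<^bsub>relative_homology_group (int l) X {x0}\<^esub> spheroid_value l X x0 v g"
  unfolding spheroid_value_def using assms spheroid_agree[OF assms(2,3,4)]
  by (intro hom_induced_concat_at) (auto simp: spheroids_iff)

lemma flip_spheroids:
  assumes "f \<in> spheroids l X x0" "i < l"
  shows "f \<circ> flip i \<in> spheroids l X x0"
  using assms flip_boundary[OF assms(2)] continuous_map_compose[OF continuous_map_flip[OF assms(2)]]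
  by (fastforce simp: spheroids_iff)

lemma const_spheroids: "x0 \<in> topspace X \<Longrightarrow> (\<lambda>_. x0) \<in> spheroids l X x0"
  by (simp add: spheroids_iff)

lemma spheroid_value_const:
  "x0 \<in> topspace X \<Longrightarrow> spheroid_value l X x0 v (\<lambda>_. x0) = \<one>\<^bsub>relative_homology_group (int l) X {x0}\<^esub>"
  unfolding spheroid_value_def by (rule hom_induced_into_subset) auto

lemma subgroup_spheroid_values:
  assumes v: "v \<in> carrier (relative_homology_group (int l) (cube l) (cube_boundary l))"
    and "l > 0" "x0 \<in> topspace X"
  shows "subgroup (spheroid_value l X x0 v ` spheroids l X x0) (relative_homology_group (int l) X {x0})"
    (is "subgroup ?S ?G")
proof
  show "?S \<subseteq> carrier ?G" by (auto simp: spheroid_value_def hom_induced_carrier)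
  show "a \<otimes>\<^bsub>?G\<^esub> b \<in> ?S" if "a \<in> ?S" "b \<in> ?S" for a b
  proof -
    from that obtain f g where fg: "f \<in> spheroids l X x0" "g \<in> spheroids l X x0"
      "a = spheroid_value l X x0 v f" "b = spheroid_value l X x0 v g" by auto
    then have "a \<otimes>\<^bsub>?G\<^esub> b = spheroid_value l X x0 v (concat_at 0 f g)"
      using spheroid_value_concat_at[OF v fg(1,2)] assms by simp
    then show ?thesis using concat_at_spheroids[OF fg(1,2)] assms by blast
  qed
  show "\<one>\<^bsub>?G\<^esub> \<in> ?S"
    using spheroid_value_const[OF assms(3), symmetric] const_spheroids[OF assms(3)] by (metis imageI)
  show "inv\<^bsub>?G\<^esub> a \<in> ?S" if "a \<in> ?S" for a
  proof -
    from that obtain f where f: "f \<in> spheroids l X x0" "a = spheroid_value l X x0 v f" by auto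
    then have "inv\<^bsub>?G\<^esub> a = spheroid_value l X x0 v (f \<circ> flip 0)"
      using hom_induced_flip[OF v, of X f 0 "{x0}"] assms by (auto simp: spheroid_value_def spheroids_iff)
    then show ?thesis using flip_spheroids[OF f(1)] assms by blast
  qed
qed

lemma spheroid_value_homotopic:
  assumes "homotopic_with (\<lambda>h. h ` cube_boundary l \<subseteq> {x0}) (cube l) X f g"
  shows "spheroid_value l X x0 v f = spheroid_value l X x0 v g"
proof -
  have "homotopic_with (\<lambda>h. h \<in> cube_boundary l \<rightarrow> {x0}) (cube l) X f g"
    using assms by (simp add: image_subset_iff_funcset)
  then show ?thesis unfolding spheroid_value_def by (metis homology_homotopy_axiom)
qed

lemma iso_homology_relative_point:
  assumes "x0 \<in> topspace X" "p \<noteq> 0"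
  shows "hom_induced p X {} X {x0} id \<in> iso (homology_group p X) (relative_homology_group p X {x0})"
proof -
  have "contractible_space (subtopology X {x0})" by (simp add: assms contractible_space_subtopology_singleton)
  then have "hom_induced p X {} X {x0} id \<in> iso (reduced_homology_group p X) (relative_homology_group p X {x0})"
    using assms by (intro iso_reduced_homology_by_contractible) auto
  then show ?thesis using assms by (simp add: un_reduced_homology_group)
qed

text \<open>The representative chosen inside \<open>hurewicz\<close> is homotopic to the given
  spheroid relative to the boundary and therefore has the same value.\<close>

lemma hurewicz_image:
  assumes "x0 \<in> topspace X"
  shows "hurewicz l X x0 ` carrier (homotopy_group l X x0) =
     inv_into (carrier (homology_group (int l) X)) (hom_induced (int l) X {} X {x0} id) `
       spheroid_value l X x0 (cube_class l) ` spheroids l X x0"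
proof -
  have "hurewicz l X x0 (spheroid_class l X x0 f) =
    inv_into (carrier (homology_group (int l) X)) (hom_induced (int l) X {} X {x0} id) (spheroid_value l X x0 (cube_class l) f)"
    if f: "f \<in> spheroids l X x0" for f
  proof -
    have "f \<in> spheroid_class l X x0 f"
      using f by (auto simp: spheroid_class_def spheroids_def homotopic_with_refl)
    then have "(SOME g. g \<in> spheroid_class l X x0 f) \<in> spheroid_class l X x0 f" by (rule someI[of "\<lambda>g. g \<in> spheroid_class l X x0 f"])
    then have "spheroid_value l X x0 (cube_class l) (SOME g. g \<in> spheroid_class l X x0 f) = spheroid_value l X x0 (cube_class l) f"
      using spheroid_value_homotopic by (fastforce simp: spheroid_class_def)
    then show ?thesis by (simp add: hurewicz_def spheroid_value_def)
  qed
  then show ?thesis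
    unfolding homotopy_group_def by (simp add: image_image)
qed

lemma continuous_on_coordinates [continuous_intros]:
  "continuous_on S (\<lambda>x::'i \<Rightarrow> 'b::topological_space. x i)"
  "continuous_on T (\<lambda>z::('i \<Rightarrow> 'b) \<times> 'c::topological_space. fst z i)"
  "continuous_on U (\<lambda>z::'c::topological_space \<times> ('i \<Rightarrow> 'b). snd z i)"
  by (rule continuous_on_coordinate; intro continuous_intros)+

section \<open>Bouquets of spheres\<close>

definition sqnorm :: "nat \<Rightarrow> (nat \<Rightarrow> real) \<Rightarrow> real" where
  "sqnorm n x = (\<Sum>i\<le>n. (x i)\<^sup>2)"

text \<open>The sphere of radius 1/(k + 1) through the origin, written so that off the origin it is
  the level set k + 1 of the ratio of \<open>2 * x 0\<close> to the squared norm. Disjointness of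
  the spheres and openness of the punctured ones become statements about this ratio.\<close>

definition esphere :: "nat \<Rightarrow> nat \<Rightarrow> (nat \<Rightarrow> real) set" where
  "esphere n k = {x. (\<forall>i>n. x i = 0) \<and> (real k + 1) * sqnorm n x = 2 * x 0}"

text \<open>The base point is inserted by hand so that the bouquet over the empty set is a
  point.\<close>

definition bouquet :: "nat \<Rightarrow> nat set \<Rightarrow> (nat \<Rightarrow> real) set" where
  "bouquet n J = insert earring_base (\<Union>k\<in>J. esphere n k)"

lemma sqnorm_split: "sqnorm n x = (x 0)\<^sup>2 + (\<Sum>i = 1..n. (x i)\<^sup>2)"
proof -
  have "{..n} = insert 0 {1..n}" by auto
  then show ?thesis by (simp add: sqnorm_def)
qed

lemma sqnorm_nonneg: "0 \<le> sqnorm n x"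
  by (simp add: sqnorm_def sum_nonneg)

lemma sqnorm_eq_0: "sqnorm n x = 0 \<Longrightarrow> i \<le> n \<Longrightarrow> x i = 0"
  by (simp add: sqnorm_def sum_nonneg_eq_0_iff)

lemma continuous_on_sqnorm [continuous_intros]: "continuous_on S (sqnorm n)"
  unfolding sqnorm_def[abs_def] by (intro continuous_intros)

lemma earring_sphere_eq:
  "{x. \<forall>i\<ge>Suc n. x i = 0} \<inter> earring_sphere n (1 / (real k + 1)) = esphere n k"
proof -
  have "(x 0 - 1 / (real k + 1))\<^sup>2 + (\<Sum>i = 1..n. (x i)\<^sup>2) = (1 / (real k + 1))\<^sup>2
     \<longleftrightarrow> (real k + 1) * sqnorm n x = 2 * x 0" for x :: "nat \<Rightarrow> real"
  proof -
    have "(x 0 - 1 / (real k + 1))\<^sup>2 + (\<Sum>i = 1..n. (x i)\<^sup>2) - (1 / (real k + 1))\<^sup>2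
        = sqnorm n x - 2 * x 0 / (real k + 1)"
      by (simp add: sqnorm_split power2_diff)
    moreover have "sqnorm n x - 2 * x 0 / (real k + 1) = ((real k + 1) * sqnorm n x - 2 * x 0) / (real k + 1)"
      by (simp add: field_simps)
    ultimately show ?thesis by (auto simp: divide_eq_0_iff)
  qed
  then show ?thesis by (auto simp: earring_sphere_def esphere_def Suc_le_eq)
qed

lemma base_in_esphere: "earring_base \<in> esphere n k"
  by (simp add: earring_base_def esphere_def sqnorm_def)

lemma base_in_bouquet [simp]: "earring_base \<in> bouquet n J"
  by (simp add: bouquet_def)

lemma hawaiian_earring_eq: "hawaiian_earring n = top_of_set (bouquet n UNIV)"
proof -
  have "{x. \<forall>i\<ge>Suc n. x i = 0} \<inter> (\<Union>k::nat. earring_sphere n (1 / (real k + 1))) = bouquet n UNIV"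
    using base_in_esphere earring_sphere_eq unfolding bouquet_def by fastforce
  then show ?thesis
    unfolding hawaiian_earring_def Euclidean_space_def
    by (simp add: subtopology_subtopology euclidean_product_topology)
qed

lemma esphere_nonneg: "x \<in> esphere n k \<Longrightarrow> 0 \<le> x 0"
  using sqnorm_nonneg[of n x] mult_nonneg_nonneg[of "real k + 1" "sqnorm n x"] by (auto simp: esphere_def)

lemma esphere_eq_base:
  assumes "x \<in> esphere n k" "x 0 = 0" shows "x = earring_base"
proof -
  have "sqnorm n x = 0" using assms by (auto simp: esphere_def add_eq_0_iff)
  then have "x i = 0" for i using sqnorm_eq_0[of n x i] assms(1) by (cases "i \<le> n") (auto simp: esphere_def)
  then show ?thesis by (auto simp: earring_base_def)
qed

lemma esphere_pos: "x \<in> esphere n k \<Longrightarrow> x \<noteq> earring_base \<Longrightarrow> 0 < x 0"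
  using esphere_nonneg esphere_eq_base by fastforce

lemma esphere_sqnorm_pos:
  assumes "x \<in> esphere n k" "x \<noteq> earring_base" shows "0 < sqnorm n x"
proof -
  have "sqnorm n x \<noteq> 0" using esphere_pos[OF assms] assms(1) by (auto simp: esphere_def)
  then show ?thesis using sqnorm_nonneg[of n x] by simp
qed

lemma esphere_disjoint:
  assumes "x \<in> esphere n k" "x \<in> esphere n j" "k \<noteq> j" shows "x = earring_base"
proof (rule ccontr)
  assume "x \<noteq> earring_base"
  then have "sqnorm n x > 0" using esphere_sqnorm_pos assms by blast
  moreover have "(real k + 1) * sqnorm n x = (real j + 1) * sqnorm n x" using assms by (auto simp: esphere_def)
  ultimately show False using assms(3) by simp
qed

section \<open>Subbouquets and retractions onto them\<close>

lemma closed_esphere: "closed (esphere n k)"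
proof -
  have "esphere n k = (\<Inter>i\<in>{n<..}. {x. x i = 0}) \<inter> {x. (real k + 1) * sqnorm n x = 2 * x 0}"
    by (auto simp: esphere_def)
  moreover have "closed {x::nat \<Rightarrow> real. x i = 0}" for i
    by (rule closed_Collect_eq) (intro continuous_intros)+
  moreover have "closed {x. (real k + 1) * sqnorm n x = 2 * x 0}"
    by (rule closed_Collect_eq) (intro continuous_intros)+
  ultimately show ?thesis by (auto intro!: closed_Int closed_INT)
qed

lemma bouquet_mono: "J \<subseteq> K \<Longrightarrow> bouquet n J \<subseteq> bouquet n K"
  by (auto simp: bouquet_def)

lemma bouquet_Un: "bouquet n (J \<union> K) = bouquet n J \<union> bouquet n K"
  by (auto simp: bouquet_def)

lemma in_bouquet_esphere:
  assumes "x \<in> bouquet n J" "x \<in> esphere n k" "k \<notin> J" shows "x = earring_base"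
  using assms esphere_disjoint by (auto simp: bouquet_def)

text \<open>On the earring, the punctured spheres are cut out by the open conditions
  \<open>(k + 1/2) |x|\<^sup>2 < 2 x\<^sub>0 < (k + 3/2) |x|\<^sup>2\<close>.\<close>

lemma openin_punctured_esphere:
  assumes "k \<in> K"
  shows "openin (top_of_set (bouquet n K)) (esphere n k - {earring_base})"
proof -
  let ?U = "{x. (real k + 1/2) * sqnorm n x < 2 * x 0} \<inter> {x. 2 * x 0 < (real k + 3/2) * sqnorm n x}"
  have "open ?U"
    by (intro open_Int open_Collect_less continuous_intros)
  moreover have "esphere n k - {earring_base} = bouquet n K \<inter> ?U"
  proof (intro equalityI subsetI)
    fix x assume x: "x \<in> esphere n k - {earring_base}"
    then have "0 < sqnorm n x" using esphere_sqnorm_pos by blast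
    then have "(real k + 1/2) * sqnorm n x < (real k + 1) * sqnorm n x"
      "(real k + 1) * sqnorm n x < (real k + 3/2) * sqnorm n x" by simp_all
    then show "x \<in> bouquet n K \<inter> ?U" using x assms by (auto simp: bouquet_def esphere_def)
  next
    fix x assume x: "x \<in> bouquet n K \<inter> ?U"
    then have nb: "x \<noteq> earring_base" by (auto simp: earring_base_def sqnorm_def)
    then obtain j where j: "x \<in> esphere n j" using x by (auto simp: bouquet_def)
    then have pos: "0 < sqnorm n x" using esphere_sqnorm_pos nb by blast
    have "(real k + 1/2) * sqnorm n x < (real j + 1) * sqnorm n x"
      "(real j + 1) * sqnorm n x < (real k + 3/2) * sqnorm n x"
      using x j by (auto simp: esphere_def)
    then have "real k + 1/2 < real j + 1" "real j + 1 < real k + 3/2" using pos by simp_all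
    then have "j = k" by linarith
    then show "x \<in> esphere n k - {earring_base}" using j nb by simp
  qed
  ultimately show ?thesis by (auto simp: openin_open)
qed

text \<open>The complement is a union of punctured spheres, each of which is open in the whole
  bouquet.\<close>

lemma closedin_bouquet:
  assumes "J \<subseteq> K" shows "closedin (top_of_set (bouquet n K)) (bouquet n J)"
proof -
  have "bouquet n K - bouquet n J = (\<Union>k\<in>K-J. esphere n k - {earring_base})"
  proof (intro equalityI subsetI)
    fix x assume "x \<in> bouquet n K - bouquet n J"
    then show "x \<in> (\<Union>k\<in>K-J. esphere n k - {earring_base})" by (auto simp: bouquet_def)
  next
    fix x assume "x \<in> (\<Union>k\<in>K-J. esphere n k - {earring_base})"
    then show "x \<in> bouquet n K - bouquet n J" using in_bouquet_esphere by (fastforce simp: bouquet_def)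
  qed
  moreover have "openin (top_of_set (bouquet n K)) (\<Union>k\<in>K-J. esphere n k - {earring_base})"
    by (intro openin_clauses(3)) (auto intro: openin_punctured_esphere)
  ultimately show ?thesis
    using bouquet_mono[OF assms] by (simp add: closedin_def)
qed

definition bouquet_retract :: "nat \<Rightarrow> nat set \<Rightarrow> (nat \<Rightarrow> real) \<Rightarrow> nat \<Rightarrow> real" where
  "bouquet_retract n J x = (if x \<in> bouquet n J then x else earring_base)"

text \<open>The spheres with index in \<open>J\<close> and those with index outside \<open>J\<close>
  form two closed subbouquets that meet in the base point. The identity on the one and the constant
  map on the other are pasted together.\<close>

lemma continuous_on_bouquet_retract: "continuous_on (bouquet n K) (bouquet_retract n J)"
proof -
  have K: "bouquet n (K \<inter> J) \<union> bouquet n (K - J) = bouquet n K"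
    by (simp add: bouquet_Un[symmetric] Int_Diff_Un)
  have "continuous_on (bouquet n (K \<inter> J) \<union> bouquet n (K - J)) (\<lambda>x. if x \<in> bouquet n J then x else earring_base)"
  proof (rule continuous_on_cases_local)
    show "closedin (top_of_set (bouquet n (K \<inter> J) \<union> bouquet n (K - J))) (bouquet n (K \<inter> J))"
      "closedin (top_of_set (bouquet n (K \<inter> J) \<union> bouquet n (K - J))) (bouquet n (K - J))"
      unfolding K by (auto intro!: closedin_bouquet)
    show "x = earring_base" if "x \<in> bouquet n (K \<inter> J) \<and> x \<notin> bouquet n J \<or> x \<in> bouquet n (K - J) \<and> x \<in> bouquet n J" for x
      using that bouquet_mono[of "K \<inter> J" J n] in_bouquet_esphere[of x n J] by (auto simp: bouquet_def)
  qed (auto intro!: continuous_intros)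
  then show ?thesis unfolding K bouquet_retract_def[abs_def] .
qed

subsection \<open>Attaching a sphere does not change homology above its dimension\<close>

lemma esphere_homeomorphic_nsphere: "top_of_set (esphere n k) homeomorphic_space nsphere n"
proof -
  define r where "r = 1 / (real k + 1)"
  have r: "r > 0" "(real k + 1) * r = 1" by (auto simp: r_def)
  define f where "f x i = (if i = 0 then (x 0 - r) / r else x i / r)" for x :: "nat \<Rightarrow> real" and i :: nat
  define g where "g x i = (if i = 0 then r + r * x 0 else r * x i)" for x :: "nat \<Rightarrow> real" and i :: nat
  have ns: "nsphere n = top_of_set {x. (\<Sum>i\<le>n. x i ^ 2) = 1 \<and> (\<forall>i>n. x i = 0)}"
    by (simp add: nsphere euclidean_product_topology)
  have sq: "(\<Sum>i\<le>n. x i ^ 2) = (x 0)\<^sup>2 + (\<Sum>i = 1..n. (x i)\<^sup>2)" for x :: "nat \<Rightarrow> real"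
    using sqnorm_split[of n x] by (simp add: sqnorm_def)
  have "homeomorphic_maps (top_of_set (esphere n k)) (nsphere n) f g"
    unfolding homeomorphic_maps_def ns
  proof (intro conjI ballI)
    have "continuous_on (esphere n k) f" unfolding f_def[abs_def]
    proof (rule continuous_on_coordinatewise_then_product)
      show "continuous_on (esphere n k) (\<lambda>x. if i = 0 then (x 0 - r) / r else x i / r)" for i
        using r(1) by (cases "i = 0") (auto intro!: continuous_intros)
    qed
    moreover have "f x \<in> {x. (\<Sum>i\<le>n. x i ^ 2) = 1 \<and> (\<forall>i>n. x i = 0)}" if x: "x \<in> esphere n k" for x
    proof -
      have "x \<in> earring_sphere n r" using x earring_sphere_eq[of n k] by (auto simp: r_def)
      then have "(x 0 - r)\<^sup>2 + (\<Sum>i = 1..n. (x i)\<^sup>2) = r\<^sup>2" by (simp add: earring_sphere_def)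
      moreover have "(\<Sum>i\<le>n. f x i ^ 2) = ((x 0 - r)\<^sup>2 + (\<Sum>i = 1..n. (x i)\<^sup>2)) / r\<^sup>2"
        unfolding sq by (simp add: f_def power_divide sum_divide_distrib add_divide_distrib)
      ultimately show ?thesis using x r by (auto simp: f_def esphere_def)
    qed
    ultimately show "continuous_map (top_of_set (esphere n k)) (top_of_set {x. (\<Sum>i\<le>n. x i ^ 2) = 1 \<and> (\<forall>i>n. x i = 0)}) f"
      by auto
    have "continuous_on S g" for S unfolding g_def[abs_def]
    proof (rule continuous_on_coordinatewise_then_product)
      show "continuous_on S (\<lambda>x. if i = 0 then r + r * x 0 else r * x i)" for i
        by (cases "i = 0") (auto intro!: continuous_intros)
    qed
    moreover have "g x \<in> esphere n k" if x: "x \<in> {x. (\<Sum>i\<le>n. x i ^ 2) = 1 \<and> (\<forall>i>n. x i = 0)}" for x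
    proof -
      have 1: "(x 0)\<^sup>2 + (\<Sum>i = 1..n. (x i)\<^sup>2) = 1" using x sq by simp
      have "(g x 0 - r)\<^sup>2 + (\<Sum>i = 1..n. (g x i)\<^sup>2) = r\<^sup>2 * ((x 0)\<^sup>2 + (\<Sum>i = 1..n. (x i)\<^sup>2))"
        by (simp add: g_def power_mult_distrib sum_distrib_left algebra_simps)
      then have "g x \<in> earring_sphere n r" using 1 by (simp add: earring_sphere_def)
      moreover have "\<forall>i\<ge>Suc n. g x i = 0" using x by (auto simp: g_def)
      ultimately show ?thesis using earring_sphere_eq[of n k] by (auto simp: r_def)
    qed
    ultimately show "continuous_map (top_of_set {x. (\<Sum>i\<le>n. x i ^ 2) = 1 \<and> (\<forall>i>n. x i = 0)}) (top_of_set (esphere n k)) g"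
      by auto
  qed (use r in \<open>auto simp: f_def g_def\<close>)
  then show ?thesis by (auto simp: homeomorphic_space_def)
qed

text \<open>The open hemisphere centred at the base point.\<close>

definition ecap :: "nat \<Rightarrow> nat \<Rightarrow> (nat \<Rightarrow> real) set" where
  "ecap n k = {x \<in> esphere n k. (real k + 1) * x 0 < 1}"

text \<open>Scales the tangential coordinates by \<open>1 - t\<close> and solves the equation of the sphere for the height.\<close>

definition shrink_cap :: "nat \<Rightarrow> real \<Rightarrow> (nat \<Rightarrow> real) \<Rightarrow> nat \<Rightarrow> real" where
  "shrink_cap k t x i =
     (if i = 0 then (1 - sqrt (1 - (1 - t)\<^sup>2 * (real k + 1) * x 0 * (2 - (real k + 1) * x 0))) / (real k + 1)
      else (1 - t) * x i)"

text \<open>With s = k + 1 and u = s x_0 the equation of the sphere says that the tangential part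
  has square norm u (2 - u) / s^2. After scaling this by (1 - t)^2 the height is the smaller root of
  a quadratic equation; the smaller root is the one that stays below the equator.\<close>

lemma shrink_cap:
  assumes x: "x \<in> ecap n k" and t: "0 \<le> t" "t \<le> 1"
  shows "shrink_cap k t x \<in> ecap n k" "shrink_cap k 0 x = x" "shrink_cap k 1 x = earring_base"
    "shrink_cap k t earring_base = earring_base"
proof -
  define s where "s = real k + 1"
  have s: "s > 0" by (simp add: s_def)
  define u where "u = s * x 0"
  have u: "0 \<le> u" "u < 1" using x esphere_nonneg s by (auto simp: u_def ecap_def s_def)
  have xs: "x \<in> esphere n k" using x by (simp add: ecap_def)
  have sum: "s\<^sup>2 * (\<Sum>i = 1..n. (x i)\<^sup>2) = u * (2 - u)"
  proof -
    have "s * (x 0)\<^sup>2 + s * (\<Sum>i = 1..n. (x i)\<^sup>2) = 2 * x 0"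
      using xs by (simp add: esphere_def sqnorm_split s_def distrib_left)
    then have "s * (s * (x 0)\<^sup>2 + s * (\<Sum>i = 1..n. (x i)\<^sup>2)) = s * (2 * x 0)" by simp
    then show ?thesis by (simp add: u_def power2_eq_square algebra_simps)
  qed
  define q where "q = (1 - t)\<^sup>2 * (u * (2 - u))"
  have "u * (2 - u) = 1 - (1 - u)\<^sup>2" by (simp add: power2_eq_square algebra_simps)
  moreover have "0 < (1 - u)\<^sup>2" "(1-u)\<^sup>2 \<le> 1" using u by (auto simp: power_le_one)
  ultimately have uu: "0 \<le> u * (2 - u)" "u * (2 - u) < 1" by auto
  have t2: "0 \<le> (1-t)\<^sup>2" "(1-t)\<^sup>2 \<le> 1" using t by (auto simp: power_le_one)
  have q: "0 \<le> q" "q < 1" using uu t2 mult_left_le_one_le[of "u * (2 - u)" "(1 - t)\<^sup>2"] by (auto simp: q_def)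
  have sc0: "shrink_cap k t x 0 = (1 - sqrt (1 - q)) / s"
    by (simp add: shrink_cap_def q_def u_def s_def algebra_simps)
  have "(\<Sum>i = 1..n. (shrink_cap k t x i)\<^sup>2) = (1 - t)\<^sup>2 * (\<Sum>i = 1..n. (x i)\<^sup>2)"
    by (simp add: shrink_cap_def power_mult_distrib sum_distrib_left)
  then have "s\<^sup>2 * (\<Sum>i = 1..n. (shrink_cap k t x i)\<^sup>2) = q"
  proof -
    assume a: "(\<Sum>i = 1..n. (shrink_cap k t x i)\<^sup>2) = (1 - t)\<^sup>2 * (\<Sum>i = 1..n. (x i)\<^sup>2)"
    have "s\<^sup>2 * ((1 - t)\<^sup>2 * (\<Sum>i = 1..n. (x i)\<^sup>2)) = (1 - t)\<^sup>2 * (s\<^sup>2 * (\<Sum>i = 1..n. (x i)\<^sup>2))"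
      by (rule mult.left_commute)
    then show ?thesis unfolding a sum q_def .
  qed
  then have "s\<^sup>2 * sqnorm n (shrink_cap k t x) = (1 - sqrt (1 - q))\<^sup>2 + q"
    using s by (simp add: sqnorm_split distrib_left sc0 power_divide)
  also have "\<dots> = 2 * (1 - sqrt (1 - q))" using q by (simp add: power2_diff)
  also have "\<dots> = 2 * (s * shrink_cap k t x 0)" using s by (simp add: sc0)
  finally have "s * (s * sqnorm n (shrink_cap k t x)) = s * (2 * shrink_cap k t x 0)"
    by (simp add: power2_eq_square)
  then have "s * sqnorm n (shrink_cap k t x) = 2 * shrink_cap k t x 0" using s by simp
  moreover have "\<forall>i>n. shrink_cap k t x i = 0" using xs by (auto simp: shrink_cap_def esphere_def)
  moreover have "s * shrink_cap k t x 0 < 1" using s q by (simp add: sc0)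
  ultimately show "shrink_cap k t x \<in> ecap n k" by (simp add: ecap_def esphere_def s_def)
  have "1 - (real k + 1) * x 0 * (2 - (real k + 1) * x 0) = (1 - u)\<^sup>2"
    by (simp add: u_def s_def power2_eq_square algebra_simps)
  then have "sqrt (1 - (real k + 1) * x 0 * (2 - (real k + 1) * x 0)) = 1 - u" using u by simp
  then show "shrink_cap k 0 x = x" using s by (auto simp: shrink_cap_def u_def s_def)
  show "shrink_cap k 1 x = earring_base" "shrink_cap k t earring_base = earring_base"
    by (auto simp: shrink_cap_def earring_base_def)
qed

lemma continuous_on_shrink_cap:
  "continuous_on S (\<lambda>z. shrink_cap k (fst z) (snd z))"
proof (rule continuous_on_coordinatewise_then_product)
  show "continuous_on S (\<lambda>z. shrink_cap k (fst z) (snd z) i)" for i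
    unfolding shrink_cap_def by (cases "i = 0") (auto intro!: continuous_intros)
qed

lemma trivial_relative_homology_triple:
  assumes "T \<subseteq> S" "trivial_group (relative_homology_group p (subtopology X S) T)"
    "trivial_group (relative_homology_group p X S)"
  shows "trivial_group (relative_homology_group p X T)"
proof -
  let ?i = "hom_induced p (subtopology X S) T X T id"
  let ?j = "hom_induced p X T X S id"
  have ker: "?i ` carrier (relative_homology_group p (subtopology X S) T)
    = kernel (relative_homology_group p X T) (relative_homology_group p X S) ?j"
    using homology_exactness_triple_3[OF assms(1), of p X] by simp
  interpret i: group_hom "relative_homology_group p (subtopology X S) T" "relative_homology_group p X T" ?i
    by (simp add: group_hom_def group_hom_axioms_def hom_induced_hom)
  have "?i ` carrier (relative_homology_group p (subtopology X S) T) = {\<one>\<^bsub>relative_homology_group p X T\<^esub>}"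
    using assms(2) i.hom_one by (auto simp: trivial_group_def)
  moreover have "?j c = \<one>\<^bsub>relative_homology_group p X S\<^esub>" for c
    using assms(3) hom_induced_carrier[of p X T X S id c] by (auto simp: trivial_group_def)
  ultimately have "carrier (relative_homology_group p X T) = {\<one>\<^bsub>relative_homology_group p X T\<^esub>}"
    using ker by (auto simp: kernel_def)
  then show ?thesis by (simp add: trivial_group_def)
qed

text \<open>Between \<open>T\<close> and the whole bouquet lies \<open>T \<union> C\<close>, where
  \<open>C\<close> is the open hemisphere at the base point. It deforms into \<open>T\<close>.
  Relative to it, excision of \<open>T\<close> without the base point leaves the sphere relative to
  a contractible set, which has homology only in degree \<open>n\<close>.\<close>

lemma trivial_homology_attach_esphere:
  assumes k: "k \<notin> J" and p: "p \<noteq> int n"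
  shows "trivial_group (relative_homology_group p (top_of_set (bouquet n (insert k J))) (bouquet n J))"
proof -
  define Y where "Y = bouquet n (insert k J)"
  define T where "T = bouquet n J"
  define C where "C = ecap n k"
  have Y: "Y = T \<union> esphere n k" using base_in_esphere[of n k] by (auto simp: Y_def T_def bouquet_def)
  have TY: "T \<subseteq> Y" by (auto simp: Y)
  have CS: "C \<subseteq> esphere n k" by (auto simp: C_def ecap_def)
  have bC: "earring_base \<in> C" using base_in_esphere by (auto simp: C_def ecap_def earring_base_def)
  have bT: "earring_base \<in> T" by (simp add: T_def)
  have inter: "x = earring_base" if "x \<in> T" "x \<in> esphere n k" for x
    using in_bouquet_esphere[OF _ _ k] that by (simp add: T_def)
  have clT: "closedin (top_of_set Y) T" unfolding Y_def T_def by (rule closedin_bouquet) auto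
  have opU: "openin (top_of_set Y) (T \<union> C)"
  proof -
    have "Y - (T \<union> C) = Y \<inter> (esphere n k \<inter> {x. 1 \<le> (real k + 1) * x 0})"
    proof -
      have "x \<notin> T" if "x \<in> esphere n k" "1 \<le> (real k + 1) * x 0" for x
        using that inter[of x] by (auto simp: earring_base_def)
      then show ?thesis by (auto simp: Y C_def ecap_def)
    qed
    moreover have "closed (esphere n k \<inter> {x. 1 \<le> (real k + 1) * x 0})"
      by (intro closed_Int closed_esphere closed_Collect_le continuous_intros)
    ultimately have "closedin (top_of_set Y) (Y - (T \<union> C))" by (auto simp: closedin_closed)
    moreover have "Y - (Y - (T \<union> C)) = T \<union> C" using CS by (auto simp: Y)
    ultimately show ?thesis by (metis openin_diff openin_topspace topspace_euclidean_subtopology)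
  qed
  define H where "H z = (if snd z \<in> T then snd z else shrink_cap k (fst z) (snd z))" for z
  have Hcont: "continuous_on ({0..1} \<times> (T \<union> C)) H"
  proof -
    have eq: "{0..1} \<times> (T \<union> C) = ({0..1} \<times> T) \<union> ({0..1::real} \<times> C)" by auto
    have cT: "closedin (top_of_set (T \<union> C)) T"
      using clT CS by (rule_tac closedin_subset_trans[of Y]) (auto simp: Y)
    have cC: "closedin (top_of_set (T \<union> C)) C"
    proof -
      have "C = (T \<union> C) \<inter> esphere n k" using CS inter bC by auto
      then show ?thesis using closed_esphere by (metis closedin_closed_Int)
    qed
    show ?thesis unfolding eq H_def
    proof (rule continuous_on_cases_local)
      show "closedin (top_of_set ({0..1} \<times> T \<union> {0..1} \<times> C)) ({0..1::real} \<times> T)"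
        "closedin (top_of_set ({0..1} \<times> T \<union> {0..1} \<times> C)) ({0..1::real} \<times> C)"
        unfolding eq[symmetric] using cT cC by (auto intro!: closedin_Times)
      show "continuous_on ({0..1::real} \<times> T) (\<lambda>z. snd z)" by (intro continuous_intros)
      show "continuous_on ({0..1} \<times> C) (\<lambda>z. shrink_cap k (fst z) (snd z))" by (rule continuous_on_shrink_cap)
      show "snd z = shrink_cap k (fst z) (snd z)"
        if "z \<in> {0..1} \<times> T \<and> snd z \<notin> T \<or> z \<in> {0..1} \<times> C \<and> snd z \<in> T" for z
        using that CS inter shrink_cap(4)[of earring_base n k "fst z"] bC unfolding C_def by (cases z) fastforce
    qed
  qed
  have HC: "H (t, x) \<in> C" if "x \<in> C" "t \<in> {0..1}" for t x
    using that shrink_cap(1)[of x n k t] by (auto simp: H_def C_def)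
  have HT: "H (t, x) = x" if "x \<in> T" for t x using that by (simp add: H_def)
  have H0: "H (0, x) = x" if "x \<in> T \<union> C" for x
    using that shrink_cap(2)[of x n k 0] by (auto simp: H_def C_def)
  have H1: "H (1, x) = earring_base" if "x \<in> C" for x
    using that CS inter shrink_cap(3)[of x n k 0] by (auto simp: H_def C_def)
  have tr1: "trivial_group (relative_homology_group p (subtopology (top_of_set Y) (T \<union> C)) T)"
  proof -
    have YU: "subtopology (top_of_set Y) (T \<union> C) = top_of_set (T \<union> C)"
    proof -
      have "T \<union> C \<subseteq> Y" using CS by (auto simp: Y)
      then show ?thesis by (simp add: subtopology_subtopology Int_absorb1)
    qed
    define f where "f x = H (1, x)" for x
    have fT: "f x \<in> T" if "x \<in> T \<union> C" for x using that H1 HT bT by (auto simp: f_def)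
    have "trivial_group (relative_homology_group p (top_of_set (T \<union> C)) T)"
    proof (rule trivial_relative_homology_group_alt)
      have "continuous_on (T \<union> C) f" unfolding f_def
        by (rule continuous_on_compose2[OF Hcont]) (auto intro!: continuous_intros)
      then show "continuous_map (top_of_set (T \<union> C)) (subtopology (top_of_set (T \<union> C)) T) f"
        using fT by (auto simp: continuous_map_in_subtopology)
      have "homotopic_with (\<lambda>k. k ` T \<subseteq> T) (top_of_set (T \<union> C)) (top_of_set (T \<union> C)) id f"
        unfolding homotopic_with_def
      \<comment> \<open>\<open>homotopic_with\<close> prescribes the end maps at every point of the
        type, also off the space, which explains the second branch.\<close>
      proof (intro exI[of _ "\<lambda>z. if snd z \<in> T \<union> C then H z else (if fst z = 0 then snd z else f (snd z))"] conjI ballI allI)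
        have "continuous_on ({0..1} \<times> (T \<union> C)) (\<lambda>z. if snd z \<in> T \<union> C then H z else (if fst z = 0 then snd z else f (snd z)))"
          by (rule continuous_on_eq[OF Hcont]) auto
        then show "continuous_map (prod_topology (top_of_set {0..1}) (top_of_set (T \<union> C))) (top_of_set (T \<union> C))
            (\<lambda>z. if snd z \<in> T \<union> C then H z else (if fst z = 0 then snd z else f (snd z)))"
          by (auto simp: continuous_map_in_subtopology HC HT simp flip: subtopology_Times)
      qed (auto simp: H0 f_def HT)
      then show "homotopic_with (\<lambda>k. k ` T \<subseteq> T) (top_of_set (T \<union> C)) (top_of_set (T \<union> C)) f id"
        by (simp add: homotopic_with_sym)
    qed
    then show ?thesis unfolding YU .
  qed
  have tr2: "trivial_group (relative_homology_group p (top_of_set Y) (T \<union> C))"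
  proof -
    \<comment> \<open>The closure of \<open>V\<close> lies in the closed set \<open>T\<close>, and
      \<open>T\<close> lies in the open set \<open>T \<union> C\<close>, as excision
      demands.\<close>
    define V where "V = T - {earring_base}"
    have "top_of_set Y closure_of V \<subseteq> T"
      by (rule closure_of_minimal) (auto simp: V_def clT)
    also have "T \<subseteq> top_of_set Y interior_of (T \<union> C)" using opU by (simp add: interior_of_openin)
    finally have "hom_induced p (subtopology (top_of_set Y) (Y - V)) (T \<union> C - V) (subtopology (top_of_set Y) Y) (T \<union> C) id
      \<in> iso (relative_homology_group p (subtopology (top_of_set Y) (Y - V)) (T \<union> C - V))
          (relative_homology_group p (subtopology (top_of_set Y) Y) (T \<union> C))"
      using CS by (intro homology_excision_axiom) (auto simp: Y)
    moreover have "Y - V = esphere n k" "T \<union> C - V = C"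
      using inter base_in_esphere[of n k] CS bC by (auto simp: Y V_def)
    moreover have "subtopology (top_of_set Y) (esphere n k) = top_of_set (esphere n k)"
    proof -
      have "esphere n k \<subseteq> Y" by (auto simp: Y)
      then show ?thesis by (simp add: subtopology_subtopology Int_absorb1)
    qed
    ultimately have "relative_homology_group p (top_of_set (esphere n k)) C \<cong> relative_homology_group p (top_of_set Y) (T \<union> C)"
      by (simp add: is_isoI subtopology_subtopology)
    moreover have "trivial_group (relative_homology_group p (top_of_set (esphere n k)) C)"
    proof -
      have "contractible C"
        unfolding contractible_def
      proof (rule exI)
        show "homotopic_with_canon (\<lambda>x. True) C C id (\<lambda>x. earring_base)"
          unfolding homotopic_with_def
        proof (intro exI[of _ "\<lambda>z. if snd z \<in> C then H z else (if fst z = 0 then snd z else earring_base)"] conjI ballI allI)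
          have "continuous_on ({0..1} \<times> C) (\<lambda>z. if snd z \<in> C then H z else (if fst z = 0 then snd z else earring_base))"
            by (rule continuous_on_eq[OF continuous_on_subset[OF Hcont]]) auto
          then show "continuous_map (prod_topology (top_of_set {0..1}) (top_of_set C)) (top_of_set C)
            (\<lambda>z. if snd z \<in> C then H z else (if fst z = 0 then snd z else earring_base))"
            using HC by (auto simp: continuous_map_in_subtopology simp flip: subtopology_Times)
        qed (simp_all add: H0 H1)
      qed
      then have "relative_homology_group p (top_of_set (esphere n k)) C \<cong> reduced_homology_group p (top_of_set (esphere n k))"
        using CS bC by (intro isomorphic_relative_homology_by_contractible) (auto simp: subtopology_subtopology Int_absorb1)
      moreover have "reduced_homology_group p (top_of_set (esphere n k)) \<cong> reduced_homology_group p (nsphere n)"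
        by (intro homeomorphic_space_imp_isomorphic_reduced_homology_groups esphere_homeomorphic_nsphere)
      moreover have "trivial_group (reduced_homology_group p (nsphere n))" using p by (simp add: trivial_reduced_homology_group_nsphere)
      ultimately show ?thesis
        by (metis group_reduced_homology_group group_relative_homology_group isomorphic_group_triviality)
    qed
    ultimately show ?thesis
      by (metis group_relative_homology_group isomorphic_group_triviality)
  qed
  show ?thesis
    using trivial_relative_homology_triple[OF _ tr1 tr2] unfolding Y_def T_def by auto
qed

lemma trivial_homology_bouquet_finite:
  assumes "finite F" "F \<inter> J = {}" "p \<noteq> int n"
  shows "trivial_group (relative_homology_group p (top_of_set (bouquet n (F \<union> J))) (bouquet n J))"
  using assms
proof (induction F)
  case empty
  have "relative_homology_group p (top_of_set (bouquet n J)) (bouquet n J)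
      = relative_homology_group p (top_of_set (bouquet n J)) (topspace (top_of_set (bouquet n J)))" by simp
  then show ?case using trivial_relative_homology_group_topspace[of p "top_of_set (bouquet n J)"] by simp
next
  case (insert k F)
  have "subtopology (top_of_set (bouquet n (insert k F \<union> J))) (bouquet n (F \<union> J)) = top_of_set (bouquet n (F \<union> J))"
    using bouquet_mono[of "F \<union> J" "insert k F \<union> J" n] by (simp add: subtopology_subtopology Int_absorb1 subset_insertI)
  then show ?case
    using trivial_relative_homology_triple[of "bouquet n J" "bouquet n (F \<union> J)" p "top_of_set (bouquet n (insert k F \<union> J))"]
      insert trivial_homology_attach_esphere[of k "F \<union> J" p n] bouquet_mono[of J "F \<union> J" n]
    by auto
qed

text \<open>Above the dimension of the spheres, classes of the earring already live in every tail.\<close>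

lemma hom_induced_bouquet_retract:
  assumes "finite (- J)" "p \<noteq> int n"
    and c: "c \<in> carrier (relative_homology_group p (top_of_set (bouquet n UNIV)) {earring_base})"
  shows "hom_induced p (top_of_set (bouquet n UNIV)) {earring_base} (top_of_set (bouquet n UNIV)) {earring_base}
           (bouquet_retract n J) c = c"
proof -
  let ?X = "top_of_set (bouquet n UNIV)" and ?T = "top_of_set (bouquet n J)"
  let ?b = "{earring_base}"
  have sub: "subtopology ?X (bouquet n J) = ?T"
    using bouquet_mono[of J UNIV n] by (auto simp: subtopology_subtopology Int_absorb1)
  have "- J \<union> J = UNIV" by auto
  then have "trivial_group (relative_homology_group p ?X (bouquet n J))"
    using trivial_homology_bouquet_finite[of "- J" J p n] assms by (simp add: Int_commute)
  then have "hom_induced p ?X ?b ?X (bouquet n J) id c = \<one>\<^bsub>relative_homology_group p ?X (bouquet n J)\<^esub>"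
    using hom_induced_carrier[of p ?X ?b ?X "bouquet n J" id c] unfolding trivial_group_def by blast
  then have "c \<in> kernel (relative_homology_group p ?X ?b) (relative_homology_group p ?X (bouquet n J)) (hom_induced p ?X ?b ?X (bouquet n J) id)"
    using c by (simp add: kernel_def)
  moreover have "?b \<subseteq> bouquet n J" by simp
  ultimately obtain c' where c': "c' \<in> carrier (relative_homology_group p ?T ?b)" "c = hom_induced p ?T ?b ?X ?b id c'"
    using homology_exactness_triple_3[of ?b "bouquet n J" p ?X] by (auto simp: sub)
  have r: "continuous_map ?X ?X (bouquet_retract n J)"
    using continuous_on_bouquet_retract[of n UNIV J] bouquet_mono[of J UNIV n] by (auto simp: bouquet_retract_def)
  have i: "continuous_map ?T ?X id" using bouquet_mono[of J UNIV n] by auto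
  have "hom_induced p ?X ?b ?X ?b (bouquet_retract n J) c = hom_induced p ?T ?b ?X ?b (bouquet_retract n J \<circ> id) c'"
    unfolding c'(2) by (intro hom_induced_compose' i r) (auto simp: bouquet_retract_def)
  also have "\<dots> = hom_induced p ?T ?b ?X ?b id c'"
    by (rule fun_cong[OF hom_induced_eq]) (auto simp: bouquet_retract_def)
  finally show ?thesis using c' by simp
qed

section \<open>Powers of spheroids\<close>

primrec concat_power :: "'a \<Rightarrow> nat \<Rightarrow> ((nat \<Rightarrow> real) \<Rightarrow> 'a) \<Rightarrow> (nat \<Rightarrow> real) \<Rightarrow> 'a" where
  "concat_power b 0 f = (\<lambda>_. b)"
| "concat_power b (Suc m) f = concat_at 0 f (concat_power b m f)"

lemma concat_power_spheroids:
  assumes "f \<in> spheroids l X x0" "l > 0" "x0 \<in> topspace X"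
  shows "concat_power x0 m f \<in> spheroids l X x0"
  by (induction m) (use assms in \<open>auto intro: concat_at_spheroids const_spheroids\<close>)

lemma spheroid_value_concat_power:
  assumes v: "v \<in> carrier (relative_homology_group (int l) (cube l) (cube_boundary l))"
    and f: "f \<in> spheroids l X x0" and "l > 0" "x0 \<in> topspace X"
  shows "spheroid_value l X x0 v (concat_power x0 m f) =
    spheroid_value l X x0 v f [^]\<^bsub>relative_homology_group (int l) X {x0}\<^esub> m"
proof -
  interpret G: comm_group "relative_homology_group (int l) X {x0}" by simp
  have c: "spheroid_value l X x0 v f \<in> carrier (relative_homology_group (int l) X {x0})"
    by (simp add: spheroid_value_def hom_induced_carrier)
  show ?thesis
  proof (induction m)
    case 0
    show ?case using spheroid_value_const[OF assms(4)] by simp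
  next
    case (Suc m)
    have "spheroid_value l X x0 v (concat_power x0 (Suc m) f) =
      spheroid_value l X x0 v f \<otimes>\<^bsub>relative_homology_group (int l) X {x0}\<^esub> spheroid_value l X x0 v (concat_power x0 m f)"
      using spheroid_value_concat_at[OF v f concat_power_spheroids[OF assms(2-4)], of 0] assms by simp
    then show ?case using Suc c by (simp add: G.m_comm)
  qed
qed

section \<open>Infinite concatenation\<close>

text \<open>The point \<open>y\<close> is chosen before the maps and depends on \<open>x\<close>
  only. The same evaluation therefore serves all approximations to an infinite concatenation as well
  as their limit.\<close>

lemma concat_at_eval:
  assumes "i < l" "x \<in> unit_cube l"
  shows "(\<exists>y\<in>unit_cube l. \<forall>f g. concat_at i f g x = f y) \<or> (\<exists>y\<in>unit_cube l. \<forall>f g. concat_at i f g x = g y)"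
proof -
  have xi: "0 \<le> x i" "x i \<le> 1" using assms(2) by (simp_all only: unit_cubeD)
  show ?thesis
  proof (cases "x i \<le> 1/2")
    case True
    have "squeeze i (\<lambda>u. 2 * u) x \<in> unit_cube l" using True xi assms by (intro squeeze_in_cube) auto
    then show ?thesis using True unfolding concat_at_def by auto
  next
    case False
    have "squeeze i (\<lambda>u. 2 * u - 1) x \<in> unit_cube l" using False xi assms by (intro squeeze_in_cube) auto
    then show ?thesis using False unfolding concat_at_def by auto
  qed
qed

lemma concat_power_eval:
  assumes "0 < l" "x \<in> unit_cube l"
  shows "(\<forall>f. concat_power b m f x = b) \<or> (\<exists>y\<in>unit_cube l. \<forall>f. concat_power b m f x = f y)"
  using assms(2)
proof (induction m arbitrary: x)
  case (Suc m)
  show ?case using concat_at_eval[OF assms(1) Suc.prems]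
  proof
    assume "\<exists>y\<in>unit_cube l. \<forall>f g::(nat \<Rightarrow> real) \<Rightarrow> 'a. concat_at 0 f g x = f y"
    then show ?thesis by auto
  next
    assume "\<exists>y\<in>unit_cube l. \<forall>f g::(nat \<Rightarrow> real) \<Rightarrow> 'a. concat_at 0 f g x = g y"
    then obtain y where "y \<in> unit_cube l" "\<And>f g::(nat \<Rightarrow> real) \<Rightarrow> 'a. concat_at 0 f g x = g y" by auto
    then show ?thesis using Suc.IH[of y] by simp
  qed
qed simp

lemma bouquet_small:
  assumes "x \<in> bouquet n {K..}" shows "\<bar>x i\<bar> \<le> 2 / (real K + 1)"
proof -
  obtain k where k: "x \<in> esphere n k" "k \<ge> K"
    using assms base_in_esphere[of n K] by (auto simp: bouquet_def)
  define s where "s = real k + 1"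
  have s: "s > 0" "real K + 1 \<le> s" using k by (auto simp: s_def)
  have eq: "s * sqnorm n x = 2 * x 0" using k by (simp add: esphere_def s_def)
  have le: "(x i)\<^sup>2 \<le> sqnorm n x"
  proof (cases "i \<le> n")
    case True
    then show ?thesis unfolding sqnorm_def by (intro member_le_sum) auto
  next
    case False
    then show ?thesis using k sqnorm_nonneg by (auto simp: esphere_def)
  qed
  have "(x 0)\<^sup>2 \<le> sqnorm n x" by (simp add: sqnorm_split sum_nonneg)
  then have "s * (x 0)\<^sup>2 \<le> 2 * x 0" using eq s by (metis less_imp_le mult_left_mono)
  then have "x 0 * (2 - s * x 0) \<ge> 0" by (simp add: power2_eq_square algebra_simps)
  then have "s * x 0 \<le> 2" using esphere_nonneg[OF k(1)] s by (auto simp: zero_le_mult_iff)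
  then have "s * (s * sqnorm n x) \<le> 4" using eq by simp
  then have "(s * \<bar>x i\<bar>)\<^sup>2 \<le> 2\<^sup>2"
  proof -
    assume a: "s * (s * sqnorm n x) \<le> 4"
    have "s * (s * (x i)\<^sup>2) \<le> s * (s * sqnorm n x)" using le s by (intro mult_left_mono) auto
    moreover have "(s * \<bar>x i\<bar>)\<^sup>2 = s * (s * (x i)\<^sup>2)"
      by (simp add: power_mult_distrib power2_eq_square[of s] mult.assoc)
    ultimately show ?thesis using a by simp
  qed
  then have "s * \<bar>x i\<bar> \<le> 2" by (rule power2_le_imp_le) simp
  then have "\<bar>x i\<bar> \<le> 2 / s" using s by (simp add: field_simps)
  also have "\<dots> \<le> 2 / (real K + 1)" using s by (intro divide_left_mono) auto
  finally show ?thesis .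
qed

locale spheroid_tower =
  fixes n l :: nat and g :: "nat \<Rightarrow> (nat \<Rightarrow> real) \<Rightarrow> nat \<Rightarrow> real" and m :: "nat \<Rightarrow> nat"
  assumes l: "0 < l" and g: "\<And>k. g k \<in> spheroids l (hawaiian_earring n) earring_base"
    and tail: "\<And>k x. x \<in> unit_cube l \<Longrightarrow> g k x \<in> bouquet n {k..}"
begin

text \<open>The infinite expression that solves the tower from level \<open>k\<close> on, cut off
  after \<open>N\<close> levels by inserting the constant spheroid.\<close>

primrec tower_approx :: "nat \<Rightarrow> nat \<Rightarrow> (nat \<Rightarrow> real) \<Rightarrow> nat \<Rightarrow> real" where
  "tower_approx 0 k = (\<lambda>_. earring_base)"
| "tower_approx (Suc N) k = concat_at 0 (g k) (concat_power earring_base (m k) (tower_approx N (Suc k)))"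

lemma base_in_earring: "earring_base \<in> topspace (hawaiian_earring n)"
  by (simp add: hawaiian_earring_eq)

lemma tower_approx_spheroids: "tower_approx N k \<in> spheroids l (hawaiian_earring n) earring_base"
  by (induction N arbitrary: k)
    (auto intro!: const_spheroids base_in_earring concat_at_spheroids g l concat_power_spheroids)

lemma tower_eval:
  assumes "x \<in> unit_cube l"
  shows "(\<exists>y\<in>unit_cube l. \<forall>f. concat_at 0 (g k) (concat_power earring_base (m k) f) x = g k y) \<or>
         (\<forall>f. concat_at 0 (g k) (concat_power earring_base (m k) f) x = earring_base) \<or>
         (\<exists>y\<in>unit_cube l. \<forall>f. concat_at 0 (g k) (concat_power earring_base (m k) f) x = f y)"
  using concat_at_eval[OF l assms]
proof
  assume "\<exists>y\<in>unit_cube l. \<forall>f g::(nat \<Rightarrow> real) \<Rightarrow> nat \<Rightarrow> real. concat_at 0 f g x = g y"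
  then obtain y where y: "y \<in> unit_cube l" "\<And>f g::(nat \<Rightarrow> real) \<Rightarrow> nat \<Rightarrow> real. concat_at 0 f g x = g y" by auto
  then show ?thesis using concat_power_eval[OF l y(1), of earring_base "m k"] by simp
next
  assume "\<exists>y\<in>unit_cube l. \<forall>f g::(nat \<Rightarrow> real) \<Rightarrow> nat \<Rightarrow> real. concat_at 0 f g x = f y"
  then show ?thesis by auto
qed

text \<open>A point is handed down from level to level until it meets some \<open>g\<close> or a
  constant piece. Only a point still on its way after \<open>N\<close> levels notices the cut, where
  one more level replaces the base point by the base point or a value of
  \<open>g (k + N)\<close>.\<close>

lemma tower_approx_step:
  assumes "x \<in> unit_cube l"
  shows "tower_approx (Suc N) k x = tower_approx N k x \<or>
     (tower_approx N k x = earring_base \<and> tower_approx (Suc N) k x \<in> bouquet n {k + N..})"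
  using assms
proof (induction N arbitrary: k x)
  case 0
  have "tower_approx (Suc 0) k x = earring_base \<or> (\<exists>y\<in>unit_cube l. tower_approx (Suc 0) k x = g k y)"
    using tower_eval[OF 0, of k] by auto
  then show ?case using tail[of _ k] by auto
next
  case (Suc N)
  show ?case
    using tower_eval[OF Suc.prems, of k]
  proof (elim disjE bexE)
    fix y assume y: "y \<in> unit_cube l" "\<forall>f. concat_at 0 (g k) (concat_power earring_base (m k) f) x = f y"
    then have "tower_approx (Suc N) k x = tower_approx N (Suc k) y"
      "tower_approx (Suc (Suc N)) k x = tower_approx (Suc N) (Suc k) y"
      by (simp_all only: tower_approx.simps)
    then show ?thesis using Suc.IH[OF y(1), of "Suc k"] by simp
  next
    fix y assume "\<forall>f. concat_at 0 (g k) (concat_power earring_base (m k) f) x = g k y"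
    then show ?thesis by (simp only: tower_approx.simps) simp
  next
    assume "\<forall>f. concat_at 0 (g k) (concat_power earring_base (m k) f) x = earring_base"
    then show ?thesis by (simp only: tower_approx.simps) simp
  qed
qed

lemma tower_approx_diff:
  assumes "x \<in> unit_cube l"
  shows "tower_approx (N + M) k x = tower_approx N k x \<or>
     (tower_approx N k x = earring_base \<and> tower_approx (N + M) k x \<in> bouquet n {k + N..})"
proof (induction M)
  case (Suc M)
  have mono: "bouquet n {k + (N + M)..} \<subseteq> bouquet n {k + N..}" by (rule bouquet_mono) auto
  show ?case
    using Suc tower_approx_step[OF assms, of "N + M" k] mono by auto
qed simp

text \<open>At a given point the approximations leave the base point at most once and keep their
  value from then on, so every stage with a value other than the base point shows the limit.\<close>

definition tower_limit :: "nat \<Rightarrow> (nat \<Rightarrow> real) \<Rightarrow> nat \<Rightarrow> real" where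
  "tower_limit k x = (if \<exists>N. tower_approx N k x \<noteq> earring_base
     then tower_approx (SOME N. tower_approx N k x \<noteq> earring_base) k x else earring_base)"

lemma tower_limit_eventually:
  assumes "x \<in> unit_cube l"
  obtains N where "\<And>M. M \<ge> N \<Longrightarrow> tower_approx M k x = tower_limit k x"
proof (cases "\<exists>N. tower_approx N k x \<noteq> earring_base")
  case True
  define N where "N = (SOME N. tower_approx N k x \<noteq> earring_base)"
  have N: "tower_approx N k x \<noteq> earring_base" unfolding N_def by (rule someI_ex[OF True])
  have "tower_approx M k x = tower_limit k x" if "M \<ge> N" for M
    using tower_approx_diff[OF assms, of N "M - N" k] that N True by (simp add: tower_limit_def N_def[symmetric])
  then show ?thesis using that by blast
next
  case False
  then show ?thesis using that[of 0] by (simp add: tower_limit_def)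
qed

lemma tower_limit_close:
  assumes "x \<in> unit_cube l"
  shows "tower_limit k x = tower_approx N k x \<or>
     (tower_approx N k x = earring_base \<and> tower_limit k x \<in> bouquet n {k + N..})"
proof -
  obtain M where M: "\<And>M'. M' \<ge> M \<Longrightarrow> tower_approx M' k x = tower_limit k x"
    using tower_limit_eventually[OF assms] by blast
  then show ?thesis using tower_approx_diff[OF assms, of N M k] by simp
qed

text \<open>The limit differs from the \<open>N\<close>-th approximation only by points in the tail
  of spheres from index \<open>k + N\<close> on, which is small. The convergence is uniform in each
  coordinate.\<close>

lemma tower_limit_spheroids: "tower_limit k \<in> spheroids l (hawaiian_earring n) earring_base"
proof -
  have approx: "continuous_on (unit_cube l) (tower_approx N k)"
    "x \<in> cube_boundary l \<Longrightarrow> tower_approx N k x = earring_base" for N x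
    using tower_approx_spheroids[of N k] by (auto simp: spheroids_iff hawaiian_earring_eq cube_eq)
  have "continuous_on (unit_cube l) (tower_limit k)"
  proof (rule continuous_on_coordinatewise_then_product)
    fix i
    have bound: "\<bar>tower_limit k x i - tower_approx N k x i\<bar> \<le> 2 / (real N + 1)" if "x \<in> unit_cube l" for x N
      using tower_limit_close[OF that, of k N]
    proof
      assume *: "tower_approx N k x = earring_base \<and> tower_limit k x \<in> bouquet n {k + N..}"
      then have "\<bar>tower_limit k x i\<bar> \<le> 2 / (real (k + N) + 1)" using bouquet_small by blast
      also have "\<dots> \<le> 2 / (real N + 1)" by (intro divide_left_mono) auto
      finally show ?thesis using * by (simp add: earring_base_def)
    qed simp
    show "continuous_on (unit_cube l) (\<lambda>x. tower_limit k x i)"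
    proof (rule uniform_limit_theorem[where F = sequentially])
      show "\<forall>\<^sub>F N in sequentially. continuous_on (unit_cube l) (\<lambda>x. tower_approx N k x i)"
        using continuous_on_coordinate[OF approx(1)] by simp
      have lim: "(\<lambda>N. 2 / (real N + 1)) \<longlonglongrightarrow> 0"
        using tendsto_mult_right_zero[OF LIMSEQ_inverse_real_of_nat, of 2] by (simp add: divide_inverse add.commute)
      show "uniform_limit (unit_cube l) (\<lambda>N x. tower_approx N k x i) (\<lambda>x. tower_limit k x i) sequentially"
        unfolding uniform_limit_iff
      proof (intro allI impI)
        fix e :: real assume "e > 0"
        then have "\<forall>\<^sub>F N in sequentially. 2 / (real N + 1) < e" using order_tendstoD(2)[OF lim] by simp
        then show "\<forall>\<^sub>F N in sequentially. \<forall>x\<in>unit_cube l. dist (tower_approx N k x i) (tower_limit k x i) < e"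
        proof (rule eventually_mono, intro ballI)
          fix N x assume *: "2 / (real N + 1) < e" "x \<in> unit_cube l"
          show "dist (tower_approx N k x i) (tower_limit k x i) < e"
            using le_less_trans[OF bound[OF *(2), of N] *(1)] by (simp add: dist_real_def abs_minus_commute)
        qed
      qed
    qed simp
  qed
  moreover have "tower_limit k x \<in> bouquet n UNIV" if "x \<in> unit_cube l" for x
  proof -
    have "tower_limit k x = earring_base \<or> tower_limit k x \<in> bouquet n {k..}"
      using tower_limit_close[OF that, of k 0] by auto
    then show ?thesis using bouquet_mono[of "{k..}" UNIV n] by auto
  qed
  moreover have "tower_limit k x = earring_base" if "x \<in> cube_boundary l" for x
    using approx(2)[OF that] by (simp add: tower_limit_def)
  ultimately show ?thesis by (auto simp: spheroids_iff hawaiian_earring_eq cube_eq)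
qed

lemma tower_limit_eq:
  assumes "x \<in> unit_cube l"
  shows "tower_limit k x = concat_at 0 (g k) (concat_power earring_base (m k) (tower_limit (Suc k))) x"
proof -
  obtain N where N: "\<And>M. M \<ge> N \<Longrightarrow> tower_approx M k x = tower_limit k x"
    using tower_limit_eventually[OF assms] by blast
  show ?thesis
    using tower_eval[OF assms, of k]
  proof (elim disjE bexE)
    fix y assume y: "y \<in> unit_cube l" "\<forall>f. concat_at 0 (g k) (concat_power earring_base (m k) f) x = f y"
    obtain N' where N': "\<And>M. M \<ge> N' \<Longrightarrow> tower_approx M (Suc k) y = tower_limit (Suc k) y"
      using tower_limit_eventually[OF y(1)] by blast
    have "tower_limit k x = tower_approx (Suc (max N N')) k x" by (rule N[symmetric]) simp
    also have "\<dots> = tower_approx (max N N') (Suc k) y" using y(2) by simp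
    finally show ?thesis using N' y(2) by simp
  next
    fix y assume "\<forall>f. concat_at 0 (g k) (concat_power earring_base (m k) f) x = g k y"
    then show ?thesis using N[of "Suc N"] by simp
  next
    assume "\<forall>f. concat_at 0 (g k) (concat_power earring_base (m k) f) x = earring_base"
    then show ?thesis using N[of "Suc N"] by simp
  qed
qed

lemma spheroid_value_tower_limit:
  assumes v: "v \<in> carrier (relative_homology_group (int l) (cube l) (cube_boundary l))"
  defines "val \<equiv> spheroid_value l (hawaiian_earring n) earring_base v"
    and "G \<equiv> relative_homology_group (int l) (hawaiian_earring n) {earring_base}"
  shows "val (tower_limit k) = val (g k) \<otimes>\<^bsub>G\<^esub> val (tower_limit (Suc k)) [^]\<^bsub>G\<^esub> m k"
proof -
  have "val (tower_limit k) = val (concat_at 0 (g k) (concat_power earring_base (m k) (tower_limit (Suc k))))"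
    unfolding val_def spheroid_value_def by (rule fun_cong[OF hom_induced_eq]) (use tower_limit_eq in simp)
  also have "\<dots> = val (g k) \<otimes>\<^bsub>G\<^esub> val (concat_power earring_base (m k) (tower_limit (Suc k)))"
    unfolding val_def G_def
    by (rule spheroid_value_concat_at[OF v g concat_power_spheroids[OF tower_limit_spheroids l base_in_earring] l])
  also have "val (concat_power earring_base (m k) (tower_limit (Suc k))) = val (tower_limit (Suc k)) [^]\<^bsub>G\<^esub> m k"
    unfolding val_def G_def
    by (rule spheroid_value_concat_power[OF v tower_limit_spheroids l base_in_earring])
  finally show ?thesis .
qed

end

text \<open>Outside the carrier \<open>hom_induced\<close> returns one. This covers
  \<open>cube_class\<close>, which is introduced by a choice operator, without deciding whether it
  lies in the carrier.\<close>

lemma spheroid_value_default: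
  assumes "v \<notin> carrier (relative_homology_group (int l) (cube l) (cube_boundary l))"
  shows "spheroid_value l X x0 v f = spheroid_value l X x0 \<one>\<^bsub>relative_homology_group (int l) (cube l) (cube_boundary l)\<^esub> f"
proof -
  interpret group_hom "relative_homology_group (int l) (cube l) (cube_boundary l)" "relative_homology_group (int l) X {x0}"
    "hom_induced (int l) (cube l) (cube_boundary l) X {x0} f"
    by (simp add: group_hom_def group_hom_axioms_def hom_induced_hom)
  show ?thesis
    unfolding spheroid_value_def using hom_one assms by (simp add: hom_induced_default)
qed

text \<open>Because \<open>n < l\<close>, composing with the retraction onto the tail of spheres
  from index \<open>k\<close> on leaves the value unchanged. The given classes thus have
  representatives in shrinking tails, to which infinite concatenation applies.\<close>

lemma solves_towers_spheroid_values:
  assumes n: "n < l"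
    and v: "v \<in> carrier (relative_homology_group (int l) (cube l) (cube_boundary l))"
  defines "G \<equiv> relative_homology_group (int l) (hawaiian_earring n) {earring_base}"
    and "S \<equiv> spheroid_value l (hawaiian_earring n) earring_base v ` spheroids l (hawaiian_earring n) earring_base"
  shows "solves_towers (G\<lparr>carrier := S\<rparr>)"
  unfolding solves_towers_def
proof (intro allI impI)
  let ?X = "hawaiian_earring n" and ?val = "spheroid_value l (hawaiian_earring n) earring_base v"
  fix m :: "nat \<Rightarrow> nat" and g
  assume "\<forall>k. 0 < m k \<and> g k \<in> carrier (G\<lparr>carrier := S\<rparr>)"
  then have "\<forall>k. \<exists>f. f \<in> spheroids l ?X earring_base \<and> g k = ?val f" by (auto simp: S_def)
  then obtain f where f: "\<And>k. f k \<in> spheroids l ?X earring_base" "\<And>k. g k = ?val (f k)" by metis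
  define h where "h k = bouquet_retract n {k..} \<circ> f k" for k
  have r: "continuous_map ?X ?X (bouquet_retract n {k..})" for k
    using continuous_on_bouquet_retract[of n UNIV "{k..}"] bouquet_mono[of "{k..}" UNIV n]
    by (auto simp: bouquet_retract_def hawaiian_earring_eq)
  have rb: "bouquet_retract n J earring_base = earring_base" for J by (simp add: bouquet_retract_def)
  have hs: "h k \<in> spheroids l ?X earring_base" for k
    using f(1)[of k] continuous_map_compose[OF _ r[of k]] by (auto simp: h_def spheroids_iff rb)
  have gh: "g k = ?val (h k)" for k
  proof -
    have "?val (h k) = hom_induced (int l) ?X {earring_base} ?X {earring_base} (bouquet_retract n {k..}) (?val (f k))"
      unfolding spheroid_value_def h_def using f(1)[of k]
      by (intro hom_induced_compose'[symmetric] r) (auto simp: spheroids_iff rb)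
    also have "\<dots> = ?val (f k)"
      unfolding hawaiian_earring_eq
    proof (rule hom_induced_bouquet_retract)
      have "- {k..} = {..<k}" by auto
      then show "finite (- {k..})" by simp
    qed (use n in \<open>auto simp: spheroid_value_def hom_induced_carrier\<close>)
    finally show ?thesis by (simp add: f(2))
  qed
  interpret spheroid_tower n l h m
  proof
    show "0 < l" using n by simp
    show "h k \<in> spheroids l ?X earring_base" for k by (rule hs)
    show "h k x \<in> bouquet n {k..}" for k x by (simp add: h_def bouquet_retract_def)
  qed
  have step: "?val (tower_limit k) = g k \<otimes>\<^bsub>G\<^esub> ?val (tower_limit (Suc k)) [^]\<^bsub>G\<^esub> m k" for k
    using spheroid_value_tower_limit[OF v, of k] unfolding G_def gh .
  have "?val (tower_limit k) \<in> carrier (G\<lparr>carrier := S\<rparr>)" for k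
    using tower_limit_spheroids by (simp add: S_def)
  moreover have "?val (tower_limit k) = g k \<otimes>\<^bsub>G\<lparr>carrier := S\<rparr>\<^esub> ?val (tower_limit (Suc k)) [^]\<^bsub>G\<lparr>carrier := S\<rparr>\<^esub> m k" for k
    by (subst step) (simp add: nat_pow_def)
  ultimately show "\<exists>x. \<forall>k. x k \<in> carrier (G\<lparr>carrier := S\<rparr>) \<and>
      x k = g k \<otimes>\<^bsub>G\<lparr>carrier := S\<rparr>\<^esub> x (Suc k) [^]\<^bsub>G\<lparr>carrier := S\<rparr>\<^esub> m k"
    by (intro exI[of _ "\<lambda>k. ?val (tower_limit k)"] allI conjI) assumption+
qed

section \<open>Cotorsion of the groups of spheroid values\<close>

lemma (in comm_group) comm_group_subgroup:
  assumes "subgroup S G" shows "comm_group (G\<lparr>carrier := S\<rparr>)"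
  by (rule group.group_comm_groupI[OF subgroup_imp_group[OF assms]])
    (use subgroup.mem_carrier[OF assms] m_comm in auto)

lemma cotorsion_spheroid_values:
  assumes n: "n < l" "0 < n"
  defines "X \<equiv> hawaiian_earring n"
  shows "cotorsion_group TYPE('e) TYPE('q)
    ((homology_group (int l) X)\<lparr>carrier :=
       inv_into (carrier (homology_group (int l) X)) (hom_induced (int l) X {} X {earring_base} id) `
         spheroid_value l X earring_base v ` spheroids l X earring_base\<rparr>)"
proof -
  \<comment> \<open>\<open>v\<close> may lie outside the carrier; replacing it by the neutral class
    then changes no value.\<close>
  define v' where "v' = (if v \<in> carrier (relative_homology_group (int l) (cube l) (cube_boundary l)) then v
     else \<one>\<^bsub>relative_homology_group (int l) (cube l) (cube_boundary l)\<^esub>)"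
  interpret C: group "relative_homology_group (int l) (cube l) (cube_boundary l)" by simp
  have v': "v' \<in> carrier (relative_homology_group (int l) (cube l) (cube_boundary l))"
    using C.one_closed by (simp add: v'_def)
  have vv: "spheroid_value l X earring_base v = spheroid_value l X earring_base v'"
    unfolding v'_def using spheroid_value_default[of v l X earring_base] by (intro ext) presburger
  define G where "G = relative_homology_group (int l) X {earring_base}"
  define H where "H = homology_group (int l) X"
  define S where "S = spheroid_value l X earring_base v' ` spheroids l X earring_base"
  define j where "j = inv_into (carrier H) (hom_induced (int l) X {} X {earring_base} id)"
  interpret G: comm_group G by (simp add: G_def)
  interpret H: comm_group H by (simp add: H_def)
  have b: "earring_base \<in> topspace X" by (simp add: X_def hawaiian_earring_eq)
  have "hom_induced (int l) X {} X {earring_base} id \<in> iso H G"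
    unfolding H_def G_def using n by (intro iso_homology_relative_point b) auto
  then have "j \<in> iso G H" unfolding j_def by (rule H.iso_set_sym)
  then have jh: "j \<in> hom G H" by (simp add: iso_def)
  have S: "subgroup S G"
    unfolding S_def G_def using n by (intro subgroup_spheroid_values v' b) auto
  interpret GS: comm_group "G\<lparr>carrier := S\<rparr>" by (rule G.comm_group_subgroup[OF S])
  have jS: "j \<in> hom (G\<lparr>carrier := S\<rparr>) H"
    using jh subgroup.mem_carrier[OF S] by (auto simp: hom_def)
  then interpret group_hom "G\<lparr>carrier := S\<rparr>" H j
    by (simp add: group_hom_def group_hom_axioms_def)
  have "subgroup (j ` S) H" using img_is_subgroup by simp
  then have "comm_group (H\<lparr>carrier := j ` S\<rparr>)" by (rule H.comm_group_subgroup)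
  moreover have "solves_towers (H\<lparr>carrier := j ` S\<rparr>)"
    using solves_towers_image[OF GS.is_group H.is_group jS] solves_towers_spheroid_values[OF n(1) v']
    by (simp add: G_def S_def X_def)
  ultimately have "cotorsion_group TYPE('e) TYPE('q) (H\<lparr>carrier := j ` S\<rparr>)"
    by (rule cotorsion_group_if_solves_towers)
  then show ?thesis by (simp add: H_def j_def S_def vv)
qed

theorem hurewicz_image_cotorsion:
  assumes "1 < n" "n < l"
  shows "cotorsion_group TYPE('e) TYPE('q)
        ((homology_group (int l) (hawaiian_earring n))
          \<lparr>carrier := hurewicz l (hawaiian_earring n) earring_base `
             carrier (homotopy_group l (hawaiian_earring n) earring_base)\<rparr>)"
proof -
  have "earring_base \<in> topspace (hawaiian_earring n)" by (simp add: hawaiian_earring_eq)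
  then show ?thesis
    using hurewicz_image[of earring_base "hawaiian_earring n" l] cotorsion_spheroid_values[OF assms(2), where v = "cube_class l"] assms
    by simp
qed

section \<open>Homotopy groups\<close>

definition spheroid_homotopic :: "nat \<Rightarrow> 'a topology \<Rightarrow> 'a \<Rightarrow> ((nat \<Rightarrow> real) \<Rightarrow> 'a) \<Rightarrow> ((nat \<Rightarrow> real) \<Rightarrow> 'a) \<Rightarrow> bool" where
  "spheroid_homotopic n Y y0 f g \<longleftrightarrow> homotopic_with (\<lambda>h. h ` cube_boundary n \<subseteq> {y0}) (cube n) Y f g"

lemma spheroid_homotopic_iff:
  "spheroid_homotopic n Y y0 f g \<longleftrightarrow>
     (\<exists>h. continuous_map (prod_topology (top_of_set {0..1::real}) (cube n)) Y h \<and>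
        (\<forall>x\<in>unit_cube n. h (0, x) = f x \<and> h (1, x) = g x) \<and>
        (\<forall>t\<in>{0..1}. \<forall>x\<in>cube_boundary n. h (t, x) = y0))"
proof -
  have "homotopic_with (\<lambda>h. h ` cube_boundary n \<subseteq> {y0}) (cube n) Y f g \<longleftrightarrow>
     (\<exists>h. continuous_map (prod_topology (top_of_set {0..1::real}) (cube n)) Y h \<and>
        (\<forall>x\<in>topspace (cube n). h (0, x) = f x) \<and> (\<forall>x\<in>topspace (cube n). h (1, x) = g x) \<and>
        (\<forall>t\<in>{0..1}. (\<lambda>x. h (t, x)) ` cube_boundary n \<subseteq> {y0}))"
  proof (subst homotopic_with)
    fix h k :: "(nat \<Rightarrow> real) \<Rightarrow> 'a" assume "\<And>x. x \<in> topspace (cube n) \<Longrightarrow> h x = k x"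
    then have "\<And>x. x \<in> cube_boundary n \<Longrightarrow> h x = k x" using cube_boundary_subset by auto
    then show "(h ` cube_boundary n \<subseteq> {y0}) = (k ` cube_boundary n \<subseteq> {y0})" by (simp add: image_subset_iff)
  qed (rule refl)
  then show ?thesis
    unfolding spheroid_homotopic_def by (simp add: image_subset_iff ball_conj_distrib conj_assoc)
qed

lemma spheroid_homotopic_sym: "spheroid_homotopic n Y y0 f g \<Longrightarrow> spheroid_homotopic n Y y0 g f"
  unfolding spheroid_homotopic_def by (rule homotopic_with_symD)

lemma spheroid_homotopic_trans [trans]:
  "spheroid_homotopic n Y y0 f g \<Longrightarrow> spheroid_homotopic n Y y0 g h \<Longrightarrow> spheroid_homotopic n Y y0 f h"
  unfolding spheroid_homotopic_def by (rule homotopic_with_trans)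

lemma spheroid_homotopic_refl: "f \<in> spheroids n Y y0 \<Longrightarrow> spheroid_homotopic n Y y0 f f"
  by (auto simp: spheroid_homotopic_def spheroids_def homotopic_with_refl)

lemma spheroid_homotopicD:
  assumes "spheroid_homotopic n Y y0 f g"
  shows "f \<in> spheroids n Y y0" "g \<in> spheroids n Y y0"
  using homotopic_with_imp_continuous_maps[OF assms[unfolded spheroid_homotopic_def]]
    homotopic_with_imp_property[OF assms[unfolded spheroid_homotopic_def]]
  by (auto simp: spheroids_def)

lemma spheroid_class_eq_iff:
  assumes "f \<in> spheroids n Y y0"
  shows "spheroid_class n Y y0 f = spheroid_class n Y y0 g \<longleftrightarrow> spheroid_homotopic n Y y0 g f"
proof
  assume "spheroid_class n Y y0 f = spheroid_class n Y y0 g"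
  moreover have "f \<in> spheroid_class n Y y0 f"
    using spheroid_homotopic_refl[OF assms] by (simp add: spheroid_class_def spheroid_homotopic_def)
  ultimately show "spheroid_homotopic n Y y0 g f"
    by (simp add: spheroid_class_def spheroid_homotopic_def)
next
  assume "spheroid_homotopic n Y y0 g f"
  then show "spheroid_class n Y y0 f = spheroid_class n Y y0 g"
    unfolding spheroid_class_def using homotopic_with_trans homotopic_with_symD
    by (fastforce simp: spheroid_homotopic_def)
qed

lemma spheroid_homotopic_eqI:
  assumes "f \<in> spheroids n Y y0" "\<And>x. x \<in> unit_cube n \<Longrightarrow> f x = g x"
  shows "spheroid_homotopic n Y y0 f g"
  unfolding spheroid_homotopic_iff
proof (intro exI[of _ "\<lambda>z::real \<times> (nat \<Rightarrow> real). f (snd z)"] conjI ballI)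
  show "continuous_map (prod_topology (top_of_set {0..1}) (cube n)) Y (\<lambda>z::real \<times> (nat \<Rightarrow> real). f (snd z))"
    using continuous_map_compose[OF continuous_map_snd, of "cube n" Y f "top_of_set {0..1::real}"] assms(1)
    by (simp add: spheroids_iff comp_def)
qed (use assms in \<open>auto simp: spheroids_iff\<close>)

section \<open>Homotopies of spheroids by reparametrization\<close>

lemma spheroid_reparam:
  fixes m :: "real \<Rightarrow> (nat \<Rightarrow> real) \<Rightarrow> nat \<Rightarrow> real"
  assumes f: "f \<in> spheroids n Y y0"
    and m: "continuous_on ({0..1} \<times> unit_cube n) (\<lambda>z. m (fst z) (snd z))"
      "\<And>t x. t \<in> {0..1} \<Longrightarrow> x \<in> unit_cube n \<Longrightarrow> m t x \<in> unit_cube n"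
      "\<And>t x. t \<in> {0..1} \<Longrightarrow> x \<in> cube_boundary n \<Longrightarrow> m t x \<in> cube_boundary n"
    and ab: "\<And>x. x \<in> unit_cube n \<Longrightarrow> a x = f (m 0 x)" "\<And>x. x \<in> unit_cube n \<Longrightarrow> b x = f (m 1 x)"
  shows "spheroid_homotopic n Y y0 a b"
  unfolding spheroid_homotopic_iff
proof (intro exI[of _ "\<lambda>z. f (m (fst z) (snd z))"] conjI ballI)
  have "continuous_map (prod_topology (top_of_set {0..1}) (cube n)) (cube n) (\<lambda>z. m (fst z) (snd z))"
    using m(1,2) unfolding cube_eq by (auto simp: continuous_map_in_subtopology simp flip: subtopology_Times)
  then show "continuous_map (prod_topology (top_of_set {0..1}) (cube n)) Y (\<lambda>z. f (m (fst z) (snd z)))"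
    using f continuous_map_compose[of _ "cube n" "\<lambda>z. m (fst z) (snd z)" Y f] by (simp add: spheroids_iff comp_def)
qed (use ab m(3) f in \<open>auto simp: spheroids_iff\<close>)

lemma spheroid_squeeze_homotopic:
  fixes g :: "real \<Rightarrow> real \<Rightarrow> real"
  assumes f: "f \<in> spheroids n Y y0" and i: "i < n"
    and g: "continuous_on ({0..1} \<times> {0..1}) (\<lambda>z. g (fst z) (snd z))"
      "\<And>t u. t \<in> {0..1} \<Longrightarrow> u \<in> {0..1} \<Longrightarrow> g t u \<in> {0..1}"
      "\<And>t u. t \<in> {0..1} \<Longrightarrow> u \<in> {0,1} \<Longrightarrow> g t u \<in> {0,1}"
    and ab: "\<And>x. x \<in> unit_cube n \<Longrightarrow> a x = f (squeeze i (g 0) x)" "\<And>x. x \<in> unit_cube n \<Longrightarrow> b x = f (squeeze i (g 1) x)"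
  shows "spheroid_homotopic n Y y0 a b"
proof (rule spheroid_reparam[OF f, where m = "\<lambda>t. squeeze i (g t)"])
  show "continuous_on ({0..1} \<times> unit_cube n) (\<lambda>z. squeeze i (g (fst z)) (snd z))"
  proof (rule continuous_on_squeeze_param)
    have c: "continuous_on ({0..1} \<times> unit_cube n) (\<lambda>z. (fst z, snd z i))" by (intro continuous_intros)
    have "(\<lambda>z. (fst z, snd z i)) ` ({0..1} \<times> unit_cube n) \<subseteq> {0..1} \<times> {0..1}" by (auto simp: unit_cubeD)
    from continuous_on_compose2[OF g(1) c this]
    show "continuous_on ({0..1} \<times> unit_cube n) (\<lambda>z. g (fst z) (snd z i))" by simp
  qed (intro continuous_intros)
  show "squeeze i (g t) x \<in> unit_cube n" if "t \<in> {0..1}" "x \<in> unit_cube n" for t x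
    using g(2)[OF that(1), of "x i"] that unit_cubeD[OF that(2)] by (intro squeeze_in_cube i) auto
  show "squeeze i (g t) x \<in> cube_boundary n" if "t \<in> {0..1}" "x \<in> cube_boundary n" for t x
  proof -
    have "x \<in> unit_cube n" using that cube_boundary_subset by auto
    from unit_cubeD[OF this] show ?thesis
      using g(2)[OF that(1), of "x i"] g(3)[OF that(1), of "x i"] that by (intro squeeze_in_boundary i) auto
  qed
qed (use ab in auto)

lemma concat_at_homotopic:
  assumes "spheroid_homotopic n Y y0 f f'" "spheroid_homotopic n Y y0 g g'" "i < n"
  shows "spheroid_homotopic n Y y0 (concat_at i f g) (concat_at i f' g')"
proof -
  let ?P = "prod_topology (top_of_set {0..1::real}) (cube n)"
  obtain h where h: "continuous_map ?P Y h" "\<And>x. x\<in>unit_cube n \<Longrightarrow> h (0, x) = f x \<and> h (1, x) = f' x"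
     "\<And>t x. t\<in>{0..1} \<Longrightarrow> x\<in>cube_boundary n \<Longrightarrow> h (t, x) = y0"
    using assms(1) unfolding spheroid_homotopic_iff by blast
  obtain k where k: "continuous_map ?P Y k" "\<And>x. x\<in>unit_cube n \<Longrightarrow> k (0, x) = g x \<and> k (1, x) = g' x"
     "\<And>t x. t\<in>{0..1} \<Longrightarrow> x\<in>cube_boundary n \<Longrightarrow> k (t, x) = y0"
    using assms(2) unfolding spheroid_homotopic_iff by blast
  define H where "H z = concat_at i (\<lambda>x. h (fst z, x)) (\<lambda>x. k (fst z, x)) (snd z)" for z
  have top: "?P = top_of_set ({0..1} \<times> unit_cube n)" by (simp add: cube_eq subtopology_Times)
  have Hc: "continuous_map ?P Y H"
    unfolding H_def concat_at_def
  proof (rule continuous_map_cases_le)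
    show "continuous_map ?P euclideanreal (\<lambda>z. snd z i)" unfolding top by simp (intro continuous_intros)
    show "continuous_map (subtopology ?P {x \<in> topspace ?P. snd x i \<le> 1 / 2}) Y (\<lambda>z. h (fst z, squeeze i (\<lambda>u. 2 * u) (snd z)))"
    proof (rule continuous_map_compose[OF _ h(1), unfolded comp_def])
      have "continuous_on S (\<lambda>z::real \<times> (nat \<Rightarrow> real). (fst z, squeeze i (\<lambda>u. 2 * u) (snd z)))" for S
        by (intro continuous_intros continuous_on_squeeze_param)
      then show "continuous_map (subtopology ?P {x \<in> topspace ?P. snd x i \<le> 1 / 2}) ?P (\<lambda>z. (fst z, squeeze i (\<lambda>u. 2 * u) (snd z)))"
        using assms(3) unit_cubeD unfolding top by (auto simp: subtopology_subtopology intro!: squeeze_in_cube)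
    qed
    show "continuous_map (subtopology ?P {x \<in> topspace ?P. 1 / 2 \<le> snd x i}) Y (\<lambda>z. k (fst z, squeeze i (\<lambda>u. 2 * u - 1) (snd z)))"
    proof (rule continuous_map_compose[OF _ k(1), unfolded comp_def])
      have "continuous_on S (\<lambda>z::real \<times> (nat \<Rightarrow> real). (fst z, squeeze i (\<lambda>u. 2 * u - 1) (snd z)))" for S
        by (intro continuous_intros continuous_on_squeeze_param)
      then show "continuous_map (subtopology ?P {x \<in> topspace ?P. 1 / 2 \<le> snd x i}) ?P (\<lambda>z. (fst z, squeeze i (\<lambda>u. 2 * u - 1) (snd z)))"
        using assms(3) unit_cubeD unfolding top by (auto simp: subtopology_subtopology intro!: squeeze_in_cube)
    qed
    show "h (fst z, squeeze i (\<lambda>u. 2 * u) (snd z)) = k (fst z, squeeze i (\<lambda>u. 2 * u - 1) (snd z))"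
      if z: "z \<in> topspace ?P" "snd z i = 1 / 2" for z
    proof -
      have s: "squeeze i (\<lambda>u. 2 * u) (snd z) = (snd z)(i := 1)" "squeeze i (\<lambda>u. 2 * u - 1) (snd z) = (snd z)(i := 0)"
        by (simp_all add: squeeze_def z(2))
      have "snd z \<in> unit_cube n" "fst z \<in> {0..1}" using z(1) by auto
      moreover from this have "(snd z)(i := 1) \<in> cube_boundary n" "(snd z)(i := 0) \<in> cube_boundary n"
        using assms(3) by (auto intro!: boundaryI[of _ n i] simp: unit_cube_def)
      ultimately show ?thesis unfolding s using h(3) k(3) by simp
    qed
  qed simp
  have e: "concat_at i a b x = concat_at i a' b' x"
    if "x \<in> unit_cube n" "\<And>y. y \<in> unit_cube n \<Longrightarrow> a y = a' y" "\<And>y. y \<in> unit_cube n \<Longrightarrow> b y = b' y" for a b a' b' :: "(nat \<Rightarrow> real) \<Rightarrow> 'a" and x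
    using concat_at_eval[OF assms(3) that(1), where 'a = 'a and 'b = 'a] by (elim disjE bexE) (metis that(2), metis that(3))
  show ?thesis
    unfolding spheroid_homotopic_iff
  proof (intro exI[of _ H] conjI ballI Hc)
    show "H (0, x) = concat_at i f g x" if "x \<in> unit_cube n" for x
      unfolding H_def fst_conv snd_conv by (rule e[OF that]) (use h(2) k(2) in auto)
    show "H (1, x) = concat_at i f' g' x" if "x \<in> unit_cube n" for x
      unfolding H_def fst_conv snd_conv by (rule e[OF that]) (use h(2) k(2) in auto)
    show "H (t, x) = y0" if "t \<in> {0..1}" "x \<in> cube_boundary n" for t x
      using concat_at_boundary[of n "\<lambda>x. h (t, x)" "{y0}" "\<lambda>x. k (t, x)" i x] h(3) k(3) that assms(3)
      by (simp add: H_def)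
  qed
qed

lemma concat_at_const_right:
  assumes f: "f \<in> spheroids n Y y0" and i: "i < n"
  shows "spheroid_homotopic n Y y0 (concat_at i f (\<lambda>_. y0)) f"
\<comment> \<open>At t = 0 the coordinate is doubled and cut off at 1, at t = 1 it is unchanged, and
  the ends of the interval go to ends throughout.\<close>
proof (rule spheroid_squeeze_homotopic[OF f i, where g = "\<lambda>t u. min 1 ((2 - t) * u)"])
  show "continuous_on ({0..1} \<times> {0..1}) (\<lambda>z::real \<times> real. min 1 ((2 - fst z) * snd z))"
    by (intro continuous_intros)
  show "min 1 ((2 - t) * u) \<in> {0..1}" if "t \<in> {0..1}" "u \<in> {0..1}" for t u :: real using that by auto
  show "min 1 ((2 - t) * u) \<in> {0, 1}" if "t \<in> {0..1}" "u \<in> {0, 1}" for t u :: real using that by auto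
  show "concat_at i f (\<lambda>_. y0) x = f (squeeze i (\<lambda>u. min 1 ((2 - 0) * u)) x)" if x: "x \<in> unit_cube n" for x
  proof (cases "x i \<le> 1/2")
    case False
    have "squeeze i (\<lambda>u. min 1 ((2 - 0) * u)) x = x(i := 1)" using False by (auto simp: squeeze_def)
    moreover have "x(i := 1) \<in> cube_boundary n" using x i by (intro boundaryI[of _ _ i]) (auto simp: unit_cube_def)
    ultimately show ?thesis using f False by (simp add: spheroids_iff concat_at_def)
  qed (simp add: concat_at_def squeeze_def)
  show "f x = f (squeeze i (\<lambda>u. min 1 ((2 - 1) * u)) x)" if x: "x \<in> unit_cube n" for x
    using unit_cubeD[OF x, of i] by (simp add: squeeze_def fun_upd_idem)
qed

lemma concat_at_const_left:
  assumes f: "f \<in> spheroids n Y y0" and i: "i < n"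
  shows "spheroid_homotopic n Y y0 (concat_at i (\<lambda>_. y0) f) f"
proof (rule spheroid_squeeze_homotopic[OF f i, where g = "\<lambda>t u. max 0 ((2 - t) * u - (1 - t))"])
  show "continuous_on ({0..1} \<times> {0..1}) (\<lambda>z::real \<times> real. max 0 ((2 - fst z) * snd z - (1 - fst z)))"
    by (intro continuous_intros)
  show "max 0 ((2 - t) * u - (1 - t)) \<in> {0..1}" if "t \<in> {0..1}" "u \<in> {0..1}" for t u :: real
  proof -
    have "(2 - t) * u \<le> (2 - t) * 1" using that by (intro mult_left_mono) auto
    then have "(2 - t) * u \<le> 2 - t" by (simp only: mult_1_right)
    then have "(2 - t) * u - (1 - t) \<le> 1" by linarith
    then show ?thesis by simp
  qed
  show "max 0 ((2 - t) * u - (1 - t)) \<in> {0, 1}" if "t \<in> {0..1}" "u \<in> {0, 1}" for t u :: real using that by auto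
  show "concat_at i (\<lambda>_. y0) f x = f (squeeze i (\<lambda>u. max 0 ((2 - 0) * u - (1 - 0))) x)" if x: "x \<in> unit_cube n" for x
  proof (cases "x i \<le> 1/2")
    case True
    have "squeeze i (\<lambda>u. max 0 ((2 - 0) * u - (1 - 0))) x = x(i := 0)" using True by (auto simp: squeeze_def)
    moreover have "x(i := 0) \<in> cube_boundary n" using x i by (intro boundaryI[of _ _ i]) (auto simp: unit_cube_def)
    ultimately show ?thesis using f True by (simp add: spheroids_iff concat_at_def)
  qed (simp add: concat_at_def squeeze_def)
  show "f x = f (squeeze i (\<lambda>u. max 0 ((2 - 1) * u - (1 - 1))) x)" if x: "x \<in> unit_cube n" for x
    using unit_cubeD[OF x, of i] by (simp add: squeeze_def fun_upd_idem)
qed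

text \<open>The concatenation is \<open>f\<close> read along a tent; scaling the tent by 1 - t
  flattens it onto the face where the coordinate is 0 and \<open>f\<close> is constant.\<close>

lemma concat_at_flip:
  assumes f: "f \<in> spheroids n Y y0" and i: "i < n"
  shows "spheroid_homotopic n Y y0 (concat_at i f (f \<circ> flip i)) (\<lambda>_. y0)"
proof (rule spheroid_squeeze_homotopic[OF f i, where g = "\<lambda>t u. (1 - t) * min (2 * u) (2 - 2 * u)"])
  show "continuous_on ({0..1} \<times> {0..1}) (\<lambda>z::real \<times> real. (1 - fst z) * min (2 * snd z) (2 - 2 * snd z))"
    by (intro continuous_intros)
  show "(1 - t) * min (2 * u) (2 - 2 * u) \<in> {0..1}" if "t \<in> {0..1}" "u \<in> {0..1}" for t u :: real
    using that mult_le_one[of "1 - t" "min (2 * u) (2 - 2 * u)"] by auto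
  show "(1 - t) * min (2 * u) (2 - 2 * u) \<in> {0, 1}" if "t \<in> {0..1}" "u \<in> {0, 1}" for t u :: real using that by auto
  show "concat_at i f (f \<circ> flip i) x = f (squeeze i (\<lambda>u. (1 - 0) * min (2 * u) (2 - 2 * u)) x)" if x: "x \<in> unit_cube n" for x
    by (auto simp: concat_at_def squeeze_def flip_def min_def intro!: arg_cong[of _ _ f])
  show "y0 = f (squeeze i (\<lambda>u. (1 - 1) * min (2 * u) (2 - 2 * u)) x)" if x: "x \<in> unit_cube n" for x
  proof -
    have "x(i := 0) \<in> cube_boundary n" using x i by (intro boundaryI[of _ _ i]) (auto simp: unit_cube_def)
    then show ?thesis using f by (simp add: spheroids_iff squeeze_def)
  qed
qed

text \<open>Both sides cut the cube into the same four quarters, so this is an equality of maps and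
  not only a homotopy.\<close>

lemma concat_at_interchange:
  assumes "i \<noteq> j"
  shows "concat_at i (concat_at j a b) (concat_at j c d) = concat_at j (concat_at i a c) (concat_at i b d)"
  using assms by (intro ext) (auto simp: concat_at_def squeeze_def fun_upd_twist)

text \<open>The Eckmann--Hilton argument.\<close>

lemma concat_at_direction:
  assumes "f \<in> spheroids n Y y0" "g \<in> spheroids n Y y0" "i < n" "j < n" "i \<noteq> j"
  shows "spheroid_homotopic n Y y0 (concat_at i f g) (concat_at j f g)"
    "spheroid_homotopic n Y y0 (concat_at i f g) (concat_at j g f)"
proof -
  let ?e = "\<lambda>_::nat \<Rightarrow> real. y0"
  note R = concat_at_const_right and L = concat_at_const_left
  have "spheroid_homotopic n Y y0 (concat_at i f g) (concat_at i (concat_at j f ?e) (concat_at j ?e g))"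
    using assms by (intro concat_at_homotopic spheroid_homotopic_sym[OF R] spheroid_homotopic_sym[OF L])
  also have "concat_at i (concat_at j f ?e) (concat_at j ?e g) = concat_at j (concat_at i f ?e) (concat_at i ?e g)"
    using assms by (intro concat_at_interchange)
  also have "spheroid_homotopic n Y y0 \<dots> (concat_at j f g)"
    using assms by (intro concat_at_homotopic R L)
  finally show "spheroid_homotopic n Y y0 (concat_at i f g) (concat_at j f g)" .
  have "spheroid_homotopic n Y y0 (concat_at i f g) (concat_at i (concat_at j ?e f) (concat_at j g ?e))"
    using assms by (intro concat_at_homotopic spheroid_homotopic_sym[OF R] spheroid_homotopic_sym[OF L])
  also have "concat_at i (concat_at j ?e f) (concat_at j g ?e) = concat_at j (concat_at i ?e g) (concat_at i f ?e)"
    using assms by (intro concat_at_interchange)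
  also have "spheroid_homotopic n Y y0 \<dots> (concat_at j g f)"
    using assms by (intro concat_at_homotopic R L)
  finally show "spheroid_homotopic n Y y0 (concat_at i f g) (concat_at j g f)" .
qed

lemma concat_at_0_eq:
  assumes "f \<in> spheroids n Y y0" "g \<in> spheroids n Y y0" "i < n"
  shows "spheroid_homotopic n Y y0 (concat_at i f g) (concat_at 0 f g)"
  using concat_at_direction(1)[OF assms(1,2,3), of 0] spheroid_homotopic_refl[OF concat_at_spheroids[OF assms]]
    assms(3) by (cases "i = 0") auto

lemma concat_at_commute:
  assumes "f \<in> spheroids n Y y0" "g \<in> spheroids n Y y0" "2 \<le> n"
  shows "spheroid_homotopic n Y y0 (concat_at 0 f g) (concat_at 0 g f)"
  using concat_at_direction(2)[OF assms(1,2), of 0 1] concat_at_direction(1)[OF assms(2,1), of 1 0] assms(3)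
  by (auto intro: spheroid_homotopic_trans)

text \<open>Associativity also follows from the interchange law, with a constant inserted next to
  \<open>f\<close> and \<open>h\<close>; the second direction exists because \<open>n\<close> is at
  least 2.\<close>

lemma concat_at_assoc:
  assumes f: "f \<in> spheroids n Y y0" and g: "g \<in> spheroids n Y y0" and h: "h \<in> spheroids n Y y0" and n: "2 \<le> n"
  shows "spheroid_homotopic n Y y0 (concat_at 0 (concat_at 0 f g) h) (concat_at 0 f (concat_at 0 g h))"
proof -
  let ?e = "\<lambda>_::nat \<Rightarrow> real. y0"
  note R = concat_at_const_right and L = concat_at_const_left and cs = concat_at_spheroids
  note refl = spheroid_homotopic_refl
  have 01: "0 < n" "1 < n" "(0::nat) \<noteq> 1" using n by auto
  have "spheroid_homotopic n Y y0 (concat_at 0 (concat_at 0 f g) h) (concat_at 1 (concat_at 0 f g) h)"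
    using 01 by (intro concat_at_direction(1) cs f g h)
  also have "spheroid_homotopic n Y y0 \<dots> (concat_at 1 (concat_at 0 f g) (concat_at 0 ?e h))"
    using 01 by (intro concat_at_homotopic refl cs f g spheroid_homotopic_sym[OF L] h)
  also have "concat_at 1 (concat_at 0 f g) (concat_at 0 ?e h) = concat_at 0 (concat_at 1 f ?e) (concat_at 1 g h)"
    by (intro concat_at_interchange) simp
  also have "spheroid_homotopic n Y y0 \<dots> (concat_at 0 f (concat_at 0 g h))"
    using 01 by (intro concat_at_homotopic R concat_at_direction(1) f g h) auto
  finally show ?thesis .
qed

lemma concat_at_flip_left:
  assumes f: "f \<in> spheroids n Y y0" and n: "2 \<le> n"
  shows "spheroid_homotopic n Y y0 (concat_at 0 (f \<circ> flip 0) f) (\<lambda>_. y0)"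
  using concat_at_commute[OF flip_spheroids[OF f] f n, of 0] concat_at_flip[OF f, of 0] n
  by (auto intro: spheroid_homotopic_trans)

section \<open>The group structure on classes of spheroids\<close>

lemma mult_homotopy_group:
  assumes "f \<in> spheroids n Y y0" "g \<in> spheroids n Y y0" "0 < n"
  shows "spheroid_class n Y y0 f \<otimes>\<^bsub>homotopy_group n Y y0\<^esub> spheroid_class n Y y0 g = spheroid_class n Y y0 (concat_at 0 f g)"
proof -
  have in_class: "a \<in> spheroid_class n Y y0 b \<longleftrightarrow> spheroid_homotopic n Y y0 b a" for a b
    by (simp add: spheroid_class_def spheroid_homotopic_def)
  have "spheroid_class n Y y0 (concat_at 0 a b) = spheroid_class n Y y0 (concat_at 0 f g)"
    if "a \<in> spheroid_class n Y y0 f" "b \<in> spheroid_class n Y y0 g" for a b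
    using that assms unfolding in_class
    by (subst spheroid_class_eq_iff) (auto intro: concat_at_homotopic concat_at_spheroids spheroid_homotopicD)
  then have "(\<Union>a\<in>spheroid_class n Y y0 f. \<Union>b\<in>spheroid_class n Y y0 g. spheroid_class n Y y0 (concat_at 0 a b))
    = (\<Union>a\<in>spheroid_class n Y y0 f. \<Union>b\<in>spheroid_class n Y y0 g. spheroid_class n Y y0 (concat_at 0 f g))"
    by (intro SUP_cong refl)
  moreover have "f \<in> spheroid_class n Y y0 f" "g \<in> spheroid_class n Y y0 g"
    using assms spheroid_homotopic_refl by (auto simp: in_class)
  then have "(\<Union>a\<in>spheroid_class n Y y0 f. \<Union>b\<in>spheroid_class n Y y0 g. C) = C" for C :: "((nat \<Rightarrow> real) \<Rightarrow> 'a) set"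
    by blast
  ultimately show ?thesis
    unfolding homotopy_group_def by (simp add: spheroid_concat_eq)
qed

lemma carrier_homotopy_group: "carrier (homotopy_group n Y y0) = spheroid_class n Y y0 ` spheroids n Y y0"
  by (simp add: homotopy_group_def)

lemma one_homotopy_group: "\<one>\<^bsub>homotopy_group n Y y0\<^esub> = spheroid_class n Y y0 (\<lambda>_. y0)"
  by (simp add: homotopy_group_def)

lemma comm_group_homotopy_group:
  assumes n: "2 \<le> n" and y0: "y0 \<in> topspace Y"
  shows "comm_group (homotopy_group n Y y0)"
proof -
  let ?G = "homotopy_group n Y y0" and ?c = "spheroid_class n Y y0"
  have n0: "0 < n" using n by simp
  note cs = concat_at_spheroids[OF _ _ n0] and m = mult_homotopy_group[OF _ _ n0] and k = const_spheroids[OF y0, of n]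
  have eq: "?c f = ?c g" if "spheroid_homotopic n Y y0 f g" for f g
    using that spheroid_homotopicD[OF that] by (metis spheroid_class_eq_iff)
  show ?thesis
  proof (rule comm_groupI)
    show "x \<otimes>\<^bsub>?G\<^esub> y \<in> carrier ?G" if "x \<in> carrier ?G" "y \<in> carrier ?G" for x y
      using that by (auto simp: carrier_homotopy_group m intro!: imageI cs)
    show "\<one>\<^bsub>?G\<^esub> \<in> carrier ?G" using k by (simp add: carrier_homotopy_group one_homotopy_group)
    show "x \<otimes>\<^bsub>?G\<^esub> y \<otimes>\<^bsub>?G\<^esub> z = x \<otimes>\<^bsub>?G\<^esub> (y \<otimes>\<^bsub>?G\<^esub> z)"
      if "x \<in> carrier ?G" "y \<in> carrier ?G" "z \<in> carrier ?G" for x y z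
    proof -
      from that obtain f g h where "f \<in> spheroids n Y y0" "g \<in> spheroids n Y y0" "h \<in> spheroids n Y y0"
        "x = ?c f" "y = ?c g" "z = ?c h" by (auto simp: carrier_homotopy_group)
      then show ?thesis using eq[OF concat_at_assoc[OF _ _ _ n]] by (simp add: m cs)
    qed
    show "x \<otimes>\<^bsub>?G\<^esub> y = y \<otimes>\<^bsub>?G\<^esub> x" if "x \<in> carrier ?G" "y \<in> carrier ?G" for x y
    proof -
      from that obtain f g where "f \<in> spheroids n Y y0" "g \<in> spheroids n Y y0" "x = ?c f" "y = ?c g"
        by (auto simp: carrier_homotopy_group)
      then show ?thesis using eq[OF concat_at_commute[OF _ _ n]] by (simp add: m)
    qed
    show "\<one>\<^bsub>?G\<^esub> \<otimes>\<^bsub>?G\<^esub> x = x" if "x \<in> carrier ?G" for x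
    proof -
      from that obtain f where "f \<in> spheroids n Y y0" "x = ?c f" by (auto simp: carrier_homotopy_group)
      then show ?thesis using eq[OF concat_at_const_left[OF _ n0]] k by (simp add: m one_homotopy_group)
    qed
    show "\<exists>y\<in>carrier ?G. y \<otimes>\<^bsub>?G\<^esub> x = \<one>\<^bsub>?G\<^esub>" if x: "x \<in> carrier ?G" for x
    proof -
      obtain f where f: "f \<in> spheroids n Y y0" "x = ?c f" using x by (auto simp: carrier_homotopy_group)
      then show ?thesis
        using flip_spheroids[OF f(1) n0] eq[OF concat_at_flip_left[OF f(1) n]]
        by (intro bexI[of _ "?c (f \<circ> flip 0)"]) (simp_all add: carrier_homotopy_group m one_homotopy_group)
    qed
  qed
qed

lemma inv_homotopy_group:
  assumes "2 \<le> n" "f \<in> spheroids n Y y0" "y0 \<in> topspace Y"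
  shows "inv\<^bsub>homotopy_group n Y y0\<^esub> (spheroid_class n Y y0 f) = spheroid_class n Y y0 (f \<circ> flip 0)"
proof -
  interpret comm_group "homotopy_group n Y y0" by (rule comm_group_homotopy_group[OF assms(1,3)])
  have n0: "0 < n" using assms by simp
  note f' = flip_spheroids[OF assms(2) n0]
  have h: "spheroid_homotopic n Y y0 (concat_at 0 (f \<circ> flip 0) f) (\<lambda>_. y0)" by (rule concat_at_flip_left[OF assms(2,1)])
  have "spheroid_class n Y y0 (f \<circ> flip 0) \<otimes>\<^bsub>homotopy_group n Y y0\<^esub> spheroid_class n Y y0 f = \<one>\<^bsub>homotopy_group n Y y0\<^esub>"
    unfolding mult_homotopy_group[OF f' assms(2) n0] one_homotopy_group
    using spheroid_class_eq_iff[OF spheroid_homotopicD(2)[OF h]] h by metis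
  then show ?thesis
    by (intro inv_equality) (use assms f' in \<open>auto simp: carrier_homotopy_group\<close>)
qed

subsection \<open>Exchanging two coordinates is inversion\<close>

definition clamp01 :: "real \<Rightarrow> real" where "clamp01 u = max 0 (min 1 u)"

lemma clamp01: "0 \<le> clamp01 u" "clamp01 u \<le> 1" "u \<le> 0 \<Longrightarrow> clamp01 u = 0" "1 \<le> u \<Longrightarrow> clamp01 u = 1"
    "0 \<le> u \<Longrightarrow> u \<le> 1 \<Longrightarrow> clamp01 u = u"
  by (auto simp: clamp01_def)

lemma continuous_on_clamp01 [continuous_intros]:
  "continuous_on S f \<Longrightarrow> continuous_on S (\<lambda>x. clamp01 (f x))"
  unfolding clamp01_def by (intro continuous_intros)

definition plane_map :: "nat \<Rightarrow> nat \<Rightarrow> (real \<Rightarrow> real \<Rightarrow> real \<times> real) \<Rightarrow> (nat \<Rightarrow> real) \<Rightarrow> nat \<Rightarrow> real" where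
  "plane_map i j q x =
     x(i := clamp01 (1/2 + fst (q (x i - 1/2) (x j - 1/2))), j := clamp01 (1/2 + snd (q (x i - 1/2) (x j - 1/2))))"

text \<open>Coordinates are measured from the centre of the square, so its boundary and exterior are
  where one of them has modulus at least 1/2. If \<open>q\<close> keeps points there, clamping puts
  them on the boundary of the cube, where \<open>f\<close> is constant.\<close>

lemma spheroid_plane_homotopic:
  fixes q :: "real \<Rightarrow> real \<Rightarrow> real \<Rightarrow> real \<times> real"
  assumes f: "f \<in> spheroids n Y y0" and ij: "i < n" "j < n" "i \<noteq> j"
    and q: "continuous_on ({0..1} \<times> UNIV) (\<lambda>z. q (fst z) (fst (snd z)) (snd (snd z)))"
      "\<And>t a b. t \<in> {0..1} \<Longrightarrow> 1/2 \<le> \<bar>a\<bar> \<or> 1/2 \<le> \<bar>b\<bar> \<Longrightarrow> 1/2 \<le> \<bar>fst (q t a b)\<bar> \<or> 1/2 \<le> \<bar>snd (q t a b)\<bar>"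
  shows "spheroid_homotopic n Y y0 (f \<circ> plane_map i j (q 0)) (f \<circ> plane_map i j (q 1))"
proof (rule spheroid_reparam[OF f, where m = "\<lambda>t. plane_map i j (q t)"])
  have qc: "continuous_on ({0..1} \<times> unit_cube n) (\<lambda>z. q (fst z) (snd z i - 1/2) (snd z j - 1/2))"
  proof -
    have c: "continuous_on ({0..1} \<times> unit_cube n) (\<lambda>z. (fst z, snd z i - 1/2, snd z j - 1/2))" by (intro continuous_intros)
    have "(\<lambda>z. (fst z, snd z i - 1/2, snd z j - 1/2)) ` ({0..1} \<times> unit_cube n) \<subseteq> {0..1} \<times> UNIV" by auto
    from continuous_on_compose2[OF q(1) c this] show ?thesis by simp
  qed
  show "continuous_on ({0..1} \<times> unit_cube n) (\<lambda>z. plane_map i j (q (fst z)) (snd z))"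
    unfolding plane_map_def
    by (intro continuous_on_fun_upd continuous_on_clamp01 continuous_on_add continuous_on_const
        continuous_on_fst[OF qc] continuous_on_snd[OF qc] continuous_on_snd[OF continuous_on_id])
  show c: "plane_map i j (q t) x \<in> unit_cube n" if "x \<in> unit_cube n" for t x
    using that ij clamp01 by (auto simp: plane_map_def unit_cube_def)
  show "plane_map i j (q t) x \<in> cube_boundary n" if t: "t \<in> {0..1}" and x: "x \<in> cube_boundary n" for t x
  proof -
    have xc: "x \<in> unit_cube n" using x cube_boundary_subset by auto
    obtain k where k: "k < n" "x k = 0 \<or> x k = 1" using x by (auto simp: cube_boundary_eq)
    show ?thesis
    proof (cases "k = i \<or> k = j")
      case False
      then show ?thesis using k c[OF xc] by (intro boundaryI[of _ _ k]) (auto simp: plane_map_def)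
    next
      case True
      then have "1/2 \<le> \<bar>x i - 1/2\<bar> \<or> 1/2 \<le> \<bar>x j - 1/2\<bar>" using k by auto
      then have *: "1/2 \<le> \<bar>fst (q t (x i - 1/2) (x j - 1/2))\<bar> \<or> 1/2 \<le> \<bar>snd (q t (x i - 1/2) (x j - 1/2))\<bar>"
        by (rule q(2)[OF t])
      have cl: "clamp01 (1/2 + u) = 0 \<or> clamp01 (1/2 + u) = 1" if "1/2 \<le> \<bar>u\<bar>" for u
        using that by (auto simp: clamp01_def abs_if split: if_splits)
      show ?thesis
        using * boundaryI[OF c[OF xc], of i t] boundaryI[OF c[OF xc], of j t] cl ij by (auto simp: plane_map_def)
    qed
  qed
qed auto

text \<open>The exchange of two coordinates and the sign change of one are both orthogonal
  reflections of the plane. The segment joining them consists of reflections scaled by the square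
  root of (1 - t)^2 + t^2, which is at least 1/2. Stretching by 4 beforehand makes up for this
  shrinking and for the difference between the Euclidean and the maximum norm, so the boundary of
  the square never enters its interior.\<close>

lemma spheroid_swap:
  assumes f: "f \<in> spheroids n Y y0" and ij: "i < n" "j < n" "i \<noteq> j"
  shows "spheroid_homotopic n Y y0 (\<lambda>x. f (x(i := x j, j := x i))) (f \<circ> flip i)"
proof -
  define s where "s x = x(i := x j, j := x i)" for x :: "nat \<Rightarrow> real"
  have sc: "s x \<in> unit_cube n" if "x \<in> unit_cube n" for x using that ij by (auto simp: s_def unit_cube_def)
  have sb: "s x \<in> cube_boundary n" if x: "x \<in> cube_boundary n" for x
  proof -
    obtain k where "k < n" "x k = 0 \<or> x k = 1" using x by (auto simp: cube_boundary_eq)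
    then have "\<exists>k<n. s x k = 0 \<or> s x k = 1"
      using ij by (intro exI[of _ "if k = i then j else if k = j then i else k"]) (auto simp: s_def)
    then show ?thesis using sc[of x] x by (auto simp: cube_boundary_eq)
  qed
  have fs: "f \<circ> s \<in> spheroids n Y y0"
  proof -
    have "continuous_map (cube n) (cube n) s"
    proof -
      have "continuous_on (unit_cube n) s" unfolding s_def[abs_def]
        by (intro continuous_on_fun_upd continuous_on_id continuous_on_coordinates)
      then show ?thesis using sc by (auto simp: cube_eq)
    qed
    then show ?thesis using f sb continuous_map_compose[of "cube n" "cube n" s Y f] by (auto simp: spheroids_iff)
  qed
  have scale: "spheroid_homotopic n Y y0 g (g \<circ> plane_map i j (\<lambda>a b. (4 * a, 4 * b)))" if g: "g \<in> spheroids n Y y0" for g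
  proof -
    have "spheroid_homotopic n Y y0 (g \<circ> plane_map i j (\<lambda>a b. ((1 + 3 * 0) * a, (1 + 3 * 0) * b)))
        (g \<circ> plane_map i j (\<lambda>a b. ((1 + 3 * 1) * a, (1 + 3 * 1) * b)))"
    proof (rule spheroid_plane_homotopic[OF g ij, where q = "\<lambda>t a b. ((1 + 3 * t) * a, (1 + 3 * t) * b)"])
      fix t a b :: real assume t: "t \<in> {0..1}" and ab: "1/2 \<le> \<bar>a\<bar> \<or> 1/2 \<le> \<bar>b\<bar>"
      have "\<bar>u\<bar> \<le> \<bar>(1 + 3 * t) * u\<bar>" for u
        using t mult_right_mono[of 1 "1 + 3 * t" "\<bar>u\<bar>"] unfolding abs_mult by auto
      then show "1/2 \<le> \<bar>fst ((1 + 3 * t) * a, (1 + 3 * t) * b)\<bar> \<or> 1/2 \<le> \<bar>snd ((1 + 3 * t) * a, (1 + 3 * t) * b)\<bar>"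
        using ab by (metis fst_conv snd_conv order_trans)
    qed (intro continuous_intros)
    note stretch = this
    have "spheroid_homotopic n Y y0 g (g \<circ> plane_map i j (\<lambda>a b. ((1 + 3 * 0) * a, (1 + 3 * 0) * b)))"
    proof (rule spheroid_homotopic_eqI[OF g])
      fix x assume x: "x \<in> unit_cube n"
      have "plane_map i j (\<lambda>a b. ((1 + 3 * 0) * a, (1 + 3 * 0) * b)) x = x"
        using unit_cubeD[OF x] by (simp add: plane_map_def clamp01(5) fun_upd_idem)
      then show "g x = (g \<circ> plane_map i j (\<lambda>a b. ((1 + 3 * 0) * a, (1 + 3 * 0) * b))) x" by simp
    qed
    from spheroid_homotopic_trans[OF this stretch] show ?thesis by simp
  qed
  define q where "q t a b = (4 * ((1 - t) * b - t * a), 4 * ((1 - t) * a + t * b))" for t a b :: real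
  have rot: "spheroid_homotopic n Y y0 (f \<circ> plane_map i j (q 0)) (f \<circ> plane_map i j (q 1))"
  proof (rule spheroid_plane_homotopic[OF f ij])
    show "continuous_on ({0..1} \<times> UNIV) (\<lambda>z. q (fst z) (fst (snd z)) (snd (snd z)))"
      unfolding q_def by (intro continuous_intros)
    fix t a b :: real assume t: "t \<in> {0..1}" and ab: "1/2 \<le> \<bar>a\<bar> \<or> 1/2 \<le> \<bar>b\<bar>"
    define u where "u = (1 - t) * b - t * a"
    define v where "v = (1 - t) * a + t * b"
    have "u\<^sup>2 + v\<^sup>2 = ((1 - t)\<^sup>2 + t\<^sup>2) * (a\<^sup>2 + b\<^sup>2)"
      by (simp add: u_def v_def power2_eq_square algebra_simps)
    moreover have "(1 - t)\<^sup>2 + t\<^sup>2 \<ge> 1/2"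
      using sum_squares_bound[of "1 - t" t] by (simp add: power2_eq_square algebra_simps)
    moreover have "a\<^sup>2 + b\<^sup>2 \<ge> 1/4"
    proof -
      have "1/4 \<le> c\<^sup>2" if "1/2 \<le> \<bar>c\<bar>" for c :: real
        using power_mono[OF that, of 2] by (simp add: power_divide)
      then show ?thesis using ab by (smt (verit) zero_le_power2)
    qed
    ultimately have uv: "u\<^sup>2 + v\<^sup>2 \<ge> 1/8"
      using mult_mono[of "1/2" "(1 - t)\<^sup>2 + t\<^sup>2" "1/4" "a\<^sup>2 + b\<^sup>2"] by simp
    have "1/8 \<le> \<bar>u\<bar> \<or> 1/8 \<le> \<bar>v\<bar>"
    proof (rule ccontr)
      assume "\<not> ?thesis"
      then have "\<bar>u\<bar>\<^sup>2 \<le> (1/8)\<^sup>2" "\<bar>v\<bar>\<^sup>2 \<le> (1/8)\<^sup>2" by (intro power_mono; simp)+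
      then show False using uv by (simp add: power_divide)
    qed
    then show "1/2 \<le> \<bar>fst (q t a b)\<bar> \<or> 1/2 \<le> \<bar>snd (q t a b)\<bar>"
      by (auto simp: q_def u_def[symmetric] v_def[symmetric] abs_mult)
  qed
  have "spheroid_homotopic n Y y0 (f \<circ> s) (f \<circ> s \<circ> plane_map i j (\<lambda>a b. (4 * a, 4 * b)))"
    by (rule scale[OF fs])
  also have "f \<circ> s \<circ> plane_map i j (\<lambda>a b. (4 * a, 4 * b)) = f \<circ> plane_map i j (q 0)"
    using ij by (intro ext) (auto simp: s_def plane_map_def q_def fun_upd_twist intro!: arg_cong[of _ _ f])
  also note rot
  also have "f \<circ> plane_map i j (q 1) = f \<circ> flip i \<circ> plane_map i j (\<lambda>a b. (4 * a, 4 * b))"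
  proof -
    have "clamp01 (5/2 - 4 * u) = 1 - clamp01 (4 * u - 3/2)" for u by (auto simp: clamp01_def min_def max_def)
    then show ?thesis
      using ij by (intro ext) (auto simp: plane_map_def q_def flip_def squeeze_def fun_upd_twist intro!: arg_cong[of _ _ f])
  qed
  also have "spheroid_homotopic n Y y0 \<dots> (f \<circ> flip i)"
    by (rule spheroid_homotopic_sym[OF scale[OF flip_spheroids[OF f ij(1)]]])
  finally show ?thesis unfolding comp_def s_def .
qed

text \<open>Concatenation in direction \<open>i\<close> is homotopic to concatenation in direction
  0, so both reversals represent the inverse of the class of \<open>f\<close>.\<close>

lemma flip_homotopic:
  assumes f: "f \<in> spheroids n Y y0" and i: "i < n" and n: "2 \<le> n" and y0: "y0 \<in> topspace Y"
  shows "spheroid_homotopic n Y y0 (f \<circ> flip i) (f \<circ> flip 0)"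
proof -
  interpret comm_group "homotopy_group n Y y0" by (rule comm_group_homotopy_group[OF n y0])
  let ?c = "spheroid_class n Y y0"
  have n0: "0 < n" using n by simp
  note f' = flip_spheroids[OF f i]
  have "spheroid_homotopic n Y y0 (concat_at 0 f (f \<circ> flip i)) (\<lambda>_. y0)"
    using spheroid_homotopic_sym[OF concat_at_0_eq[OF f f' i]] concat_at_flip[OF f i] by (rule spheroid_homotopic_trans)
  then have "?c (concat_at 0 f (f \<circ> flip i)) = ?c (\<lambda>_. y0)"
    using spheroid_class_eq_iff[OF spheroid_homotopicD(1), THEN iffD2, OF _ spheroid_homotopic_sym] by metis
  then have "?c f \<otimes>\<^bsub>homotopy_group n Y y0\<^esub> ?c (f \<circ> flip i) = \<one>\<^bsub>homotopy_group n Y y0\<^esub>"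
    unfolding mult_homotopy_group[OF f f' n0] one_homotopy_group .
  then have "inv\<^bsub>homotopy_group n Y y0\<^esub> ?c f = ?c (f \<circ> flip i)"
    using f f' by (intro inv_equality) (auto simp: carrier_homotopy_group m_comm)
  then have "?c (f \<circ> flip 0) = ?c (f \<circ> flip i)" using inv_homotopy_group[OF n f y0] by simp
  then show ?thesis using spheroid_class_eq_iff[OF flip_spheroids[OF f n0], of "f \<circ> flip i"] by simp
qed

section \<open>Simplices and cubes\<close>

text \<open>\<open>theta\<close> is stick breaking: coordinate \<open>t\<^sub>j\<close> is the fraction of the remaining stick that is passed on.\<close>

definition theta :: "nat \<Rightarrow> (nat \<Rightarrow> real) \<Rightarrow> nat \<Rightarrow> real" where
  "theta p t j = (if j < p then (\<Prod>i<j. t i) * (1 - t j) else if j = p then (\<Prod>i<p. t i) else 0)"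

text \<open>Not an inverse of \<open>theta\<close>, only a map for which
  \<open>theta p \<circ> eta p\<close> respects every closed face of the simplex. A vanishing
  coordinate \<open>j < p\<close> yields the value 1. If the last coordinate vanishes, some other
  one is at least 1/p and yields the value 0; this is the origin of the factor
  \<open>real p\<close>.\<close>

definition eta :: "nat \<Rightarrow> (nat \<Rightarrow> real) \<Rightarrow> nat \<Rightarrow> real" where
  "eta p x j = (if j < p then clamp01 (1 - real p * (x j - x p)) else 0)"

definition simplex_boundary :: "nat \<Rightarrow> (nat \<Rightarrow> real) set" where
  "simplex_boundary p = {x \<in> standard_simplex p. \<exists>i\<le>p. x i = 0}"

lemma simplex_top: "subtopology (powertop_real UNIV) (standard_simplex p) = top_of_set (standard_simplex p)"
  by (simp add: euclidean_product_topology)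

lemma theta_telescope: "(\<Sum>j<p. (\<Prod>i<j. t i) * (1 - t j)) = 1 - (\<Prod>i<p. t i)" for t :: "nat \<Rightarrow> real"
  by (induction p) (auto simp: algebra_simps)

lemma theta_in_simplex:
  assumes "t \<in> unit_cube p"
  shows "theta p t \<in> standard_simplex p"
proof -
  have pr: "0 \<le> (\<Prod>i<j. t i)" "(\<Prod>i<j. t i) \<le> 1" for j
    using unit_cubeD[OF assms] by (auto intro!: prod_nonneg prod_le_1)
  have "0 \<le> theta p t j \<and> theta p t j \<le> 1" for j
    using pr unit_cubeD[OF assms, of j] by (auto simp: theta_def intro!: mult_le_one mult_nonneg_nonneg)
  moreover have "(\<Sum>j\<le>p. theta p t j) = 1"
  proof -
    have "(\<Sum>j\<le>p. theta p t j) = (\<Sum>j<p. theta p t j) + theta p t p"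
      by (simp add: lessThan_Suc_atMost[symmetric])
    also have "(\<Sum>j<p. theta p t j) = (\<Sum>j<p. (\<Prod>i<j. t i) * (1 - t j))" by (simp add: theta_def)
    finally show ?thesis by (simp add: theta_telescope) (simp add: theta_def)
  qed
  ultimately show ?thesis by (auto simp: standard_simplex_def theta_def)
qed

lemma continuous_on_theta: "continuous_on S (theta p)"
proof (rule continuous_on_coordinatewise_then_product)
  show "continuous_on S (\<lambda>t. theta p t j)" for j
    unfolding theta_def by (cases "j < p"; cases "j = p") (auto intro!: continuous_intros)
qed

lemma continuous_on_eta: "continuous_on S (eta p)"
proof (rule continuous_on_coordinatewise_then_product)
  show "continuous_on S (\<lambda>x. eta p x j)" for j
    unfolding eta_def by (cases "j < p") (auto intro!: continuous_intros)
qed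

lemma eta_in_cube: "eta p x \<in> unit_cube p"
  by (auto simp: eta_def unit_cube_def clamp01)

lemma theta_eq_0:
  "t j = 1 \<Longrightarrow> j < p \<Longrightarrow> theta p t j = 0"
  "t j = 0 \<Longrightarrow> j < i \<Longrightarrow> theta p t i = 0"
  by (auto simp: theta_def)

lemma theta_boundary:
  assumes "t \<in> cube_boundary p"
  shows "theta p t \<in> simplex_boundary p"
proof -
  obtain j where j: "j < p" "t j = 0 \<or> t j = 1" using assms by (auto simp: cube_boundary_eq)
  then have "theta p t j = 0 \<or> theta p t p = 0" using theta_eq_0 by metis
  then have "\<exists>i\<le>p. theta p t i = 0" using j(1) by (metis less_imp_le order_refl)
  moreover have "t \<in> unit_cube p" using assms cube_boundary_subset by auto
  ultimately show ?thesis using theta_in_simplex[of t p] by (simp add: simplex_boundary_def)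
qed

lemma simplex_nonneg: "x \<in> standard_simplex p \<Longrightarrow> 0 \<le> x i"
  by (simp add: standard_simplex_def)

lemma eta_eq_1: "x \<in> standard_simplex p \<Longrightarrow> x j = 0 \<Longrightarrow> j < p \<Longrightarrow> eta p x j = 1"
  using simplex_nonneg[of x p p] by (simp add: eta_def clamp01)

lemma eta_eq_0:
  assumes x: "x \<in> standard_simplex p" "x p = 0" "0 < p"
  obtains j where "j < p" "eta p x j = 0"
proof -
  have "\<exists>j<p. 1 / real p \<le> x j"
  proof (rule ccontr)
    assume "\<not> ?thesis"
    then have "\<And>j. j \<in> {..<p} \<Longrightarrow> x j < 1 / real p" by force
    moreover have "{..<p} \<noteq> {}" using x(3) by blast
    ultimately have "(\<Sum>j<p. x j) < (\<Sum>j<p. 1 / real p)" by (intro sum_strict_mono) auto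
    moreover have "(\<Sum>j\<le>p. x j) = 1" using x by (simp add: standard_simplex_def)
    ultimately show False using x by (simp add: lessThan_Suc_atMost[symmetric])
  qed
  then obtain j where j: "j < p" "1 / real p \<le> x j" by blast
  then have "1 \<le> real p * x j" using x(3) by (simp add: field_simps)
  then have "eta p x j = 0" using j x by (simp add: eta_def clamp01)
  then show ?thesis using that j by blast
qed

lemma theta_eta_zero:
  assumes "x \<in> standard_simplex p" "x i = 0" "i \<le> p"
  shows "theta p (eta p x) i = 0"
proof (cases "i < p")
  case True
  then show ?thesis using eta_eq_1[OF assms(1,2)] theta_eq_0(1) by blast
next
  case False
  then have i: "i = p" using assms by simp
  have "p \<noteq> 0"
  proof
    assume "p = 0"
    then have "x 0 = 1" using assms(1) by (simp add: standard_simplex_def)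
    then show False using assms(2) i \<open>p = 0\<close> by simp
  qed
  then show ?thesis using eta_eq_0[of x p] theta_eq_0(2) assms i by (metis neq0_conv)
qed

lemma eta_boundary:
  assumes "x \<in> simplex_boundary p" "0 < p"
  shows "eta p x \<in> cube_boundary p"
proof -
  obtain i where i: "i \<le> p" "x i = 0" "x \<in> standard_simplex p" using assms by (auto simp: simplex_boundary_def)
  then have "\<exists>j<p. eta p x j = 0 \<or> eta p x j = 1"
    using eta_eq_1[of x p i] eta_eq_0[of x p] assms(2) by (cases "i = p") (metis, metis le_neq_implies_less)
  then show ?thesis using eta_in_cube by (auto simp: cube_boundary_eq)
qed

text \<open>The fundamental relative class of the simplex and its transfer to the cube. Since \<open>theta \<circ> eta\<close>
  never leaves a closed face of the simplex, it is homotopic to the identity as a map of pairs.\<close>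

definition simplex_class :: "nat \<Rightarrow> (nat \<Rightarrow> real) chain set" where
  "simplex_class p = homologous_rel_set p (top_of_set (standard_simplex p)) (simplex_boundary p)
     (frag_of (restrict id (standard_simplex p)))"

definition transferred_class :: "nat \<Rightarrow> (nat \<Rightarrow> real) chain set" where
  "transferred_class p = hom_induced (int p) (top_of_set (standard_simplex p)) (simplex_boundary p)
     (cube p) (cube_boundary p) (eta p) (simplex_class p)"

lemma singular_relcycle_simplex:
  assumes f: "singular_simplex p X f" and A: "f ` simplex_boundary p \<subseteq> A" and p: "0 < p"
  shows "singular_relcycle p X A (frag_of f)"
  unfolding singular_relcycle_def mod_subset_def
proof (intro conjI)
  show "singular_chain p X (frag_of f)" using f by (simp add: singular_chain_of)
  have "singular_simplex (p - 1) (subtopology X A) (singular_face p k f)" if k: "k \<le> p" for k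
    unfolding singular_simplex_subtopology
  proof
    show "singular_simplex (p - 1) X (singular_face p k f)"
      using singular_simplex_singular_face[OF f _ k] p by simp
    show "singular_face p k f ` standard_simplex (p - 1) \<subseteq> A"
    proof (intro image_subsetI)
      fix x assume x: "x \<in> standard_simplex (p - 1)"
      then have "simplical_face k x \<in> standard_simplex p"
        using simplical_face_in_standard_simplex[of p k x] p k by simp
      moreover have "simplical_face k x k = 0" by (simp add: simplical_face_def)
      ultimately have "simplical_face k x \<in> simplex_boundary p" using k by (auto simp: simplex_boundary_def)
      then show "singular_face p k f x \<in> A" using A x by (auto simp: singular_face_def)
    qed
  qed
  then show "(chain_boundary p (frag_of f), 0) \<in> {(a, b). singular_chain (p - 1) (subtopology X A) (a - b)}"
    using p by (auto simp: chain_boundary_of intro!: singular_chain_sum singular_chain_cmul simp: singular_chain_of)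
qed

lemma simplex_class_carrier:
  "0 < p \<Longrightarrow> simplex_class p \<in> carrier (relative_homology_group (int p) (top_of_set (standard_simplex p)) (simplex_boundary p))"
  and singular_relcycle_ident: "0 < p \<Longrightarrow> singular_relcycle p (top_of_set (standard_simplex p)) (simplex_boundary p)
     (frag_of (restrict id (standard_simplex p)))"
proof -
  assume p: "0 < p"
  show r: "singular_relcycle p (top_of_set (standard_simplex p)) (simplex_boundary p) (frag_of (restrict id (standard_simplex p)))"
  proof (rule singular_relcycle_simplex[OF _ _ p])
    show "singular_simplex p (top_of_set (standard_simplex p)) (restrict id (standard_simplex p))"
      unfolding singular_simplex_def simplex_top by auto
  qed (auto simp: simplex_boundary_def)
  show "simplex_class p \<in> carrier (relative_homology_group (int p) (top_of_set (standard_simplex p)) (simplex_boundary p))"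
    unfolding simplex_class_def carrier_relative_homology_group using r by blast
qed

lemma transferred_class_carrier:
  "transferred_class p \<in> carrier (relative_homology_group (int p) (cube p) (cube_boundary p))"
  by (simp add: transferred_class_def hom_induced_carrier)

lemma convex_simplex:
  assumes "x \<in> standard_simplex p" "y \<in> standard_simplex p" "0 \<le> t" "t \<le> 1"
  shows "(\<lambda>i. (1 - t) * x i + t * y i) \<in> standard_simplex p"
  using convex_standard_simplex[OF assms] .

lemma hom_induced_theta_transferred:
  assumes p: "0 < p"
  shows "hom_induced (int p) (cube p) (cube_boundary p) (top_of_set (standard_simplex p)) (simplex_boundary p)
     (theta p) (transferred_class p) = simplex_class p"
proof -
  let ?S = "top_of_set (standard_simplex p)" and ?B = "simplex_boundary p"
  have th: "continuous_map (cube p) ?S (theta p)" "theta p \<in> cube_boundary p \<rightarrow> ?B"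
    using continuous_on_theta theta_in_simplex theta_boundary by (auto simp: cube_eq)
  have et: "continuous_map ?S (cube p) (eta p)" "eta p \<in> ?B \<rightarrow> cube_boundary p"
    using continuous_on_eta eta_in_cube eta_boundary[OF _ p] by (auto simp: cube_eq)
  have "hom_induced (int p) (cube p) (cube_boundary p) ?S ?B (theta p) (transferred_class p)
      = hom_induced (int p) ?S ?B ?S ?B (theta p \<circ> eta p) (simplex_class p)"
    unfolding transferred_class_def by (rule hom_induced_compose'[OF et th])
  also have "hom_induced (int p) ?S ?B ?S ?B (theta p \<circ> eta p) = hom_induced (int p) ?S ?B ?S ?B id"
  proof (rule hom_induced_homotopic_on[where h = "\<lambda>t x i. (1 - t) * theta p (eta p x) i + t * x i"])
    show "continuous_on ({0..1} \<times> standard_simplex p) (\<lambda>z i. (1 - fst z) * theta p (eta p (snd z)) i + fst z * snd z i)"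
    proof (rule continuous_on_coordinatewise_then_product)
      fix i
      have "continuous_on ({0..1} \<times> standard_simplex p) (\<lambda>z. theta p (eta p (snd z)) i)"
        by (rule continuous_on_coordinate, rule continuous_on_compose2[OF continuous_on_theta[of UNIV]],
            rule continuous_on_compose2[OF continuous_on_eta[of UNIV]]) (auto intro!: continuous_intros)
      then show "continuous_on ({0..1} \<times> standard_simplex p) (\<lambda>z. (1 - fst z) * theta p (eta p (snd z)) i + fst z * snd z i)"
        by (intro continuous_intros)
    qed
    show c: "(\<lambda>i. (1 - t) * theta p (eta p x) i + t * x i) \<in> standard_simplex p"
      if "t \<in> {0..1}" "x \<in> standard_simplex p" for t x
      using that by (intro convex_simplex theta_in_simplex eta_in_cube) auto
    show "(\<lambda>i. (1 - t) * theta p (eta p x) i + t * x i) \<in> ?B"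
      if tx: "t \<in> {0..1}" "x \<in> standard_simplex p" "x \<in> ?B" for t x
    proof -
      obtain i where "i \<le> p" "x i = 0" using tx(3) by (auto simp: simplex_boundary_def)
      then show ?thesis using c[OF tx(1,2)] theta_eta_zero[OF tx(2)] by (auto simp: simplex_boundary_def)
    qed
  qed auto
  also have "hom_induced (int p) ?S ?B ?S ?B id (simplex_class p) = simplex_class p"
    by (rule hom_induced_id[OF simplex_class_carrier[OF p]])
  finally show ?thesis .
qed

text \<open>A relative class given by a singular simplex becomes the value of a map of the cube on
  one fixed class, so the gluing formulas for cubes apply to it.\<close>

lemma hom_induced_transferred:
  assumes f: "singular_simplex p X f" and A: "f ` simplex_boundary p \<subseteq> A" and p: "0 < p"
  shows "hom_induced (int p) (cube p) (cube_boundary p) X A (f \<circ> theta p) (transferred_class p)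
    = homologous_rel_set p X A (frag_of f)"
proof -
  let ?S = "top_of_set (standard_simplex p)" and ?B = "simplex_boundary p"
  have th: "continuous_map (cube p) ?S (theta p)" "theta p \<in> cube_boundary p \<rightarrow> ?B"
    using continuous_on_theta theta_in_simplex theta_boundary by (auto simp: cube_eq)
  have fc: "continuous_map ?S X f" "f \<in> ?B \<rightarrow> A" using f A by (auto simp: singular_simplex_def simplex_top)
  have "hom_induced (int p) (cube p) (cube_boundary p) X A (f \<circ> theta p) (transferred_class p)
     = hom_induced (int p) ?S ?B X A f (simplex_class p)"
    using hom_induced_compose'[OF th fc, of "int p" "transferred_class p"] hom_induced_theta_transferred[OF p] by simp
  also have "\<dots> = homologous_rel_set p X A (chain_map p f (frag_of (restrict id (standard_simplex p))))"
    unfolding simplex_class_def by (rule hom_induced_chain_map[OF fc singular_relcycle_ident[OF p]])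
  also have "chain_map p f (frag_of (restrict id (standard_simplex p))) = frag_of f"
  proof -
    have "simplex_map p f (restrict id (standard_simplex p)) = f"
      using f by (auto simp: simplex_map_def singular_simplex_def extensional_def)
    then show ?thesis by simp
  qed
  finally show ?thesis .
qed

subsection \<open>Faces of the cube and of the simplex\<close>

definition insert_one :: "nat \<Rightarrow> (nat \<Rightarrow> real) \<Rightarrow> nat \<Rightarrow> real" where
  "insert_one m x i = (if i < m then x i else if i = m then 1 else x (i - 1))"

lemma prod_insert_one:
  "(\<Prod>i<k. insert_one m x i) = (\<Prod>i<(if m < k then k - 1 else k). x i)"
proof (induction k)
  case (Suc k)
  show ?case
  proof (cases "m < k")
    case True
    then obtain k' where "k = Suc k'" by (cases k) auto
    then show ?thesis using Suc True by (simp add: insert_one_def)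
  next
    case False
    then show ?thesis using Suc by (auto simp: insert_one_def)
  qed
qed simp

text \<open>The faces t_m = 1 of the cube cover the faces with index at most \<open>n\<close> of the
  simplex, and \<open>theta_last_zero\<close> handles the remaining one, which comes from t_n = 0.
  All other faces t_j = 0 are collapsed to codimension two.\<close>

lemma theta_insert_one:
  assumes "m \<le> n"
  shows "theta (Suc n) (insert_one m x) = simplical_face m (theta n x)"
proof
  fix j
  consider "j < m" | "j = m" | "j > m" by linarith
  then show "theta (Suc n) (insert_one m x) j = simplical_face m (theta n x) j"
  proof cases
    case 1
    then show ?thesis using assms
      by (simp add: theta_def simplical_face_def prod_insert_one) (simp add: insert_one_def)
  next
    case 2
    then show ?thesis using assms by (simp add: theta_def simplical_face_def insert_one_def)
  next
    case 3
    then show ?thesis using assms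
    proof -
      assume m: "m \<le> n"
      consider "j < Suc n" | "j = Suc n" | "j > Suc n" by linarith
      then show ?thesis
      proof cases
        case 1
        then show ?thesis using 3 m by (simp add: theta_def simplical_face_def prod_insert_one) (simp add: insert_one_def)
      next
        case 2
        then show ?thesis using 3 m
          by (simp add: theta_def simplical_face_def prod_insert_one del: prod.lessThan_Suc)
      qed (use 3 m in \<open>simp add: theta_def simplical_face_def; arith\<close>)
    qed
  qed
qed

lemma theta_last_zero:
  assumes "x n = 0"
  shows "theta (Suc n) x = simplical_face (Suc n) (theta n x)"
proof
  fix j
  consider "j < n" | "j = n" | "j = Suc n" | "j > Suc n" by linarith
  then show "theta (Suc n) x j = simplical_face (Suc n) (theta n x) j"
    by cases (auto simp: theta_def simplical_face_def assms)
qed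

section \<open>Homotopy addition\<close>

lemma unit_cube_SucI: "x \<in> unit_cube (Suc n) \<Longrightarrow> x n = 0 \<Longrightarrow> x \<in> unit_cube n"
  unfolding unit_cube_def by (simp add: less_Suc_eq Suc_le_eq) (metis le_neq_implies_less)

lemma unit_cube_drop:
  assumes "x \<in> unit_cube (Suc n)"
  shows "x(n := 0) \<in> unit_cube n"
proof -
  have "(x(n := 0)) i = 0" if "n \<le> i" for i
    using assms that by (cases "i = n") (auto simp: unit_cube_def)
  moreover have "0 \<le> (x(n := 0)) i \<and> (x(n := 0)) i \<le> 1" for i using unit_cubeD[OF assms] by simp
  ultimately show ?thesis unfolding unit_cube_def mem_Collect_eq by blast
qed

lemma unit_cube_coordinate_0: "x \<in> unit_cube n \<Longrightarrow> x n = 0"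
  by (simp add: unit_cube_def)

text \<open>A relative spheroid of dimension n + 1 with boundary \<open>b\<close>, recorded only
  through its homology value \<open>w\<close>. The relation between \<open>b\<close> and
  \<open>w\<close> takes the place of the relative homotopy group with its boundary map and Hurewicz
  homomorphism.\<close>

definition rel_filling ::
    "nat \<Rightarrow> 'a topology \<Rightarrow> 'a set \<Rightarrow> 'a \<Rightarrow> (nat \<Rightarrow> real) chain set \<Rightarrow> ((nat \<Rightarrow> real) \<Rightarrow> 'a) \<Rightarrow> 'a chain set \<Rightarrow> bool" where
  "rel_filling n X A a0 v b w \<longleftrightarrow>
     (\<exists>H. continuous_map (cube (Suc n)) X H \<and> (\<forall>x\<in>unit_cube n. H x = b x) \<and>
        (\<forall>x\<in>unit_cube (Suc n). (\<exists>i<n. x i = 0 \<or> x i = 1) \<or> x n = 1 \<longrightarrow> H x = a0) \<and>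
        hom_induced (int (Suc n)) (cube (Suc n)) (cube_boundary (Suc n)) X A H v = w)"

lemma filling_boundary:
  assumes "\<And>x. x \<in> unit_cube n \<Longrightarrow> H x \<in> A" "a0 \<in> A"
    "\<And>x. x \<in> unit_cube (Suc n) \<Longrightarrow> (\<exists>i<n. x i = 0 \<or> x i = 1) \<or> x n = 1 \<Longrightarrow> H x = a0"
  shows "H ` cube_boundary (Suc n) \<subseteq> A"
proof (intro image_subsetI)
  fix x assume x: "x \<in> cube_boundary (Suc n)"
  then have xc: "x \<in> unit_cube (Suc n)" by (simp add: cube_boundary_eq)
  show "H x \<in> A"
  proof (cases "x n = 0")
    case True
    then have "x \<in> unit_cube n" using xc by (rule unit_cube_SucI[rotated])
    then show ?thesis by (rule assms(1))
  next
    case False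
    obtain i where "i < Suc n" "x i = 0 \<or> x i = 1" using x by (auto simp: cube_boundary_eq)
    then have "(\<exists>i<n. x i = 0 \<or> x i = 1) \<or> x n = 1" using False by (auto simp: less_Suc_eq)
    then show ?thesis using assms(2) assms(3)[OF xc] by simp
  qed
qed

lemma spheroid_subtopologyD:
  assumes "b \<in> spheroids n (subtopology X A) a0"
  shows "b \<in> spheroids n X a0" "x \<in> unit_cube n \<Longrightarrow> b x \<in> A"
  using assms by (auto simp: spheroids_iff continuous_map_in_subtopology cube_eq)

section \<open>Gluing relative fillings\<close>

locale filling_context =
  fixes n :: nat and X :: "'a topology" and A :: "'a set" and a0 :: 'a and v :: "(nat \<Rightarrow> real) chain set"
  assumes n: "2 \<le> n" and a0: "a0 \<in> topspace X" "a0 \<in> A"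
    and v: "v \<in> carrier (relative_homology_group (int (Suc n)) (cube (Suc n)) (cube_boundary (Suc n)))"
begin

abbreviation "S \<equiv> spheroids n (subtopology X A) a0"
abbreviation "cls \<equiv> spheroid_class n (subtopology X A) a0"
abbreviation "PG \<equiv> homotopy_group n (subtopology X A) a0"
abbreviation "HG \<equiv> relative_homology_group (int (Suc n)) X A"
abbreviation "val H \<equiv> hom_induced (int (Suc n)) (cube (Suc n)) (cube_boundary (Suc n)) X A H v"
abbreviation "fill \<equiv> rel_filling n X A a0 v"

lemma n0: "0 < n" using n by simp

lemma base: "a0 \<in> topspace (subtopology X A)" using a0 by simp

lemma fill_mult:
  assumes b: "b \<in> S" "b' \<in> S" and f: "fill b w" "fill b' w'"
  shows "fill (concat_at 0 b b') (w \<otimes>\<^bsub>HG\<^esub> w')"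
proof -
  obtain H where H: "continuous_map (cube (Suc n)) X H" "\<And>x. x\<in>unit_cube n \<Longrightarrow> H x = b x"
    "\<And>x. x\<in>unit_cube (Suc n) \<Longrightarrow> (\<exists>i<n. x i = 0 \<or> x i = 1) \<or> x n = 1 \<Longrightarrow> H x = a0" "val H = w"
    using f(1) unfolding rel_filling_def by blast
  obtain H' where H': "continuous_map (cube (Suc n)) X H'" "\<And>x. x\<in>unit_cube n \<Longrightarrow> H' x = b' x"
    "\<And>x. x\<in>unit_cube (Suc n) \<Longrightarrow> (\<exists>i<n. x i = 0 \<or> x i = 1) \<or> x n = 1 \<Longrightarrow> H' x = a0" "val H' = w'"
    using f(2) unfolding rel_filling_def by blast
  have agree: "H x = H' (x(0 := 0))" if x: "x \<in> unit_cube (Suc n)" "x 0 = 1" for x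
  proof -
    have "x(0 := 0) \<in> unit_cube (Suc n)" using x by (auto simp: unit_cube_def)
    moreover have "\<exists>i<n. x i = 0 \<or> x i = 1" "\<exists>i<n. (x(0 := 0)) i = 0 \<or> (x(0 := 0)) i = (1::real)"
      using x n0 by auto
    ultimately show ?thesis using H(3)[OF x(1)] H'(3)[of "x(0:=0)"] by simp
  qed
  have bd: "H ` cube_boundary (Suc n) \<subseteq> A" "H' ` cube_boundary (Suc n) \<subseteq> A"
    by (rule filling_boundary[OF _ a0(2) H(3)], simp add: H(2) spheroid_subtopologyD(2)[OF b(1)], assumption+)
       (rule filling_boundary[OF _ a0(2) H'(3)], simp add: H'(2) spheroid_subtopologyD(2)[OF b(2)], assumption+)
  have "val (concat_at 0 H H') = w \<otimes>\<^bsub>HG\<^esub> w'"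
    unfolding H(4)[symmetric] H'(4)[symmetric] by (rule hom_induced_concat_at[OF v H(1) H'(1) _ agree bd]) simp_all
  moreover have "continuous_map (cube (Suc n)) X (concat_at 0 H H')"
    by (rule continuous_map_concat_at[OF H(1) H'(1) _ agree]) simp
  moreover have "concat_at 0 H H' x = concat_at 0 b b' x" if "x \<in> unit_cube n" for x
    using concat_at_eval[OF n0 that, where 'a = 'a and 'b = 'a] H(2) H'(2) by (elim disjE bexE) (metis, metis)
  moreover have "concat_at 0 H H' x = a0"
    if x: "x \<in> unit_cube (Suc n)" "(\<exists>i<n. x i = 0 \<or> x i = 1) \<or> x n = 1" for x
  proof (cases "x 0 \<le> 1/2")
    case True
    let ?y = "squeeze 0 (\<lambda>u. 2 * u) x"
    have "?y \<in> unit_cube (Suc n)" using x True unit_cubeD[OF x(1)] by (intro squeeze_in_cube) auto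
    moreover have "(\<exists>i<n. ?y i = 0 \<or> ?y i = 1) \<or> ?y n = 1"
    proof -
      have "?y i = 0 \<or> ?y i = 1" if "x i = 0 \<or> x i = 1" for i
        using that True by (cases "i = 0") (auto simp: squeeze_def)
      moreover have "?y n = x n" using n0 by (simp add: squeeze_def)
      ultimately show ?thesis using x(2) by metis
    qed
    ultimately show ?thesis using True H(3) by (simp add: concat_at_def)
  next
    case False
    let ?y = "squeeze 0 (\<lambda>u. 2 * u - 1) x"
    have "?y \<in> unit_cube (Suc n)" using x False unit_cubeD[OF x(1)] by (intro squeeze_in_cube) auto
    moreover have "(\<exists>i<n. ?y i = 0 \<or> ?y i = 1) \<or> ?y n = 1"
    proof -
      have "?y i = 0 \<or> ?y i = 1" if "x i = 0 \<or> x i = 1" for i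
        using that False by (cases "i = 0") (auto simp: squeeze_def)
      moreover have "?y n = x n" using n0 by (simp add: squeeze_def)
      ultimately show ?thesis using x(2) by metis
    qed
    ultimately show ?thesis using False H'(3) by (simp add: concat_at_def)
  qed
  ultimately show ?thesis unfolding rel_filling_def by blast
qed

lemma fill_inv:
  assumes b: "b \<in> S" and f: "fill b w"
  shows "fill (b \<circ> flip 0) (inv\<^bsub>HG\<^esub> w)"
proof -
  obtain H where H: "continuous_map (cube (Suc n)) X H" "\<And>x. x\<in>unit_cube n \<Longrightarrow> H x = b x"
    "\<And>x. x\<in>unit_cube (Suc n) \<Longrightarrow> (\<exists>i<n. x i = 0 \<or> x i = 1) \<or> x n = 1 \<Longrightarrow> H x = a0" "val H = w"
    using f unfolding rel_filling_def by blast
  have bd: "H ` cube_boundary (Suc n) \<subseteq> A"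

    by (rule filling_boundary[OF _ a0(2) H(3)], simp add: H(2) spheroid_subtopologyD(2)[OF b], assumption+)
  have fl: "flip 0 x \<in> unit_cube m" if "x \<in> unit_cube m" "0 < m" for x m
    using continuous_map_flip[OF that(2)] that(1) by (auto simp: continuous_map_def)
  have "val (H \<circ> flip 0) = inv\<^bsub>HG\<^esub> w" using hom_induced_flip[OF v H(1) _ bd] H(4) by simp
  moreover have "continuous_map (cube (Suc n)) X (H \<circ> flip 0)"
    by (rule continuous_map_compose[OF continuous_map_flip H(1)]) simp
  moreover have "(H \<circ> flip 0) x = (b \<circ> flip 0) x" if "x \<in> unit_cube n" for x
    using H(2)[OF fl[OF that n0]] by simp
  moreover have "(H \<circ> flip 0) x = a0"
    if x: "x \<in> unit_cube (Suc n)" "(\<exists>i<n. x i = 0 \<or> x i = 1) \<or> x n = 1" for x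
  proof -
    have "flip 0 x i = 0 \<or> flip 0 x i = 1" if "x i = 0 \<or> x i = 1" for i
      using that by (cases "i = 0") (auto simp: flip_def squeeze_def)
    moreover have "flip 0 x n = x n" using n0 by (simp add: flip_def squeeze_def)
    ultimately have "(\<exists>i<n. flip 0 x i = 0 \<or> flip 0 x i = 1) \<or> flip 0 x n = 1" using x(2) by metis
    then show ?thesis using H(3)[OF fl[OF x(1)]] by simp
  qed
  ultimately show ?thesis unfolding rel_filling_def by blast
qed

text \<open>A homotopy inside \<open>A\<close>, seen as a map of the cube of dimension n + 1, has
  value one. It is glued below the given filling along the last coordinate.\<close>

lemma fill_homotopic:
  assumes h: "spheroid_homotopic n (subtopology X A) a0 b' b" and f: "fill b w"
  shows "fill b' w"
proof -
  obtain H where H: "continuous_map (cube (Suc n)) X H" "\<And>x. x\<in>unit_cube n \<Longrightarrow> H x = b x"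
    "\<And>x. x\<in>unit_cube (Suc n) \<Longrightarrow> (\<exists>i<n. x i = 0 \<or> x i = 1) \<or> x n = 1 \<Longrightarrow> H x = a0" "val H = w"
    using f unfolding rel_filling_def by blast
  obtain k where k: "continuous_map (prod_topology (top_of_set {0..1::real}) (cube n)) (subtopology X A) k"
    "\<And>x. x\<in>unit_cube n \<Longrightarrow> k (0, x) = b' x \<and> k (1, x) = b x"
     "\<And>t x. t\<in>{0..1} \<Longrightarrow> x\<in>cube_boundary n \<Longrightarrow> k (t, x) = a0"
    using h unfolding spheroid_homotopic_iff by blast
  define K where "K x = k (x n, x(n := 0))" for x
  note drop = unit_cube_drop
  have KA: "continuous_map (cube (Suc n)) (subtopology X A) K"
    unfolding K_def
  proof (rule continuous_map_compose[OF _ k(1), unfolded comp_def])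
    have "continuous_on (unit_cube (Suc n)) (\<lambda>x. (x n, x(n := 0)))"
      by (intro continuous_on_Pair continuous_on_fun_upd continuous_on_id continuous_on_const continuous_on_coordinates)
    then show "continuous_map (cube (Suc n)) (prod_topology (top_of_set {0..1}) (cube n)) (\<lambda>x. (x n, x(n := 0)))"
      using drop unit_cubeD by (auto simp: cube_eq continuous_map_in_subtopology simp flip: subtopology_Times)
  qed
  then have K: "continuous_map (cube (Suc n)) X K" "\<And>x. x \<in> unit_cube (Suc n) \<Longrightarrow> K x \<in> A"
    by (auto simp: continuous_map_in_subtopology)
  have vK: "val K = \<one>\<^bsub>HG\<^esub>" using K by (intro hom_induced_into_subset) auto
  have agree: "K x = H (x(n := 0))" if x: "x \<in> unit_cube (Suc n)" "x n = 1" for x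
    using k(2)[OF drop[OF x(1)]] H(2)[OF drop[OF x(1)]] x by (simp add: K_def)
  have b: "b \<in> S" using spheroid_homotopicD(2)[OF h] .
  have bd: "H ` cube_boundary (Suc n) \<subseteq> A"

    by (rule filling_boundary[OF _ a0(2) H(3)], simp add: H(2) spheroid_subtopologyD(2)[OF b], assumption+)
  have bdK: "K ` cube_boundary (Suc n) \<subseteq> A" using K(2) cube_boundary_subset by blast
  interpret HG: comm_group HG by simp
  have "val (concat_at n K H) = val K \<otimes>\<^bsub>HG\<^esub> val H"
    by (rule hom_induced_concat_at[OF v K(1) H(1) _ agree bdK bd]) simp_all
  also have "\<dots> = w" using HG.l_one[of "val H"] unfolding vK H(4)[symmetric] by (simp only: hom_induced_carrier)
  finally have vv: "val (concat_at n K H) = w" .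
  have side: "K x = a0" if x: "x \<in> unit_cube (Suc n)" "i < n" "x i = 0 \<or> x i = 1" for x i
  proof -
    have "x(n := 0) \<in> cube_boundary n" using drop[OF x(1)] x by (intro boundaryI[of _ _ i]) auto
    then show ?thesis using k(3) unit_cubeD[OF x(1)] by (simp add: K_def)
  qed
  have "continuous_map (cube (Suc n)) X (concat_at n K H)"
    by (rule continuous_map_concat_at[OF K(1) H(1) _ agree]) simp
  moreover have "concat_at n K H x = b' x" if x: "x \<in> unit_cube n" for x
  proof -
    have "x n = 0" using x by (rule unit_cube_coordinate_0)
    then show ?thesis using k(2)[OF x] by (simp add: concat_at_def K_def squeeze_def fun_upd_idem)
  qed
  moreover have "concat_at n K H x = a0"
    if x: "x \<in> unit_cube (Suc n)" "(\<exists>i<n. x i = 0 \<or> x i = 1) \<or> x n = 1" for x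
  proof (cases "x n \<le> 1/2")
    case True
    let ?y = "squeeze n (\<lambda>u. 2 * u) x"
    have "?y \<in> unit_cube (Suc n)" using x True unit_cubeD[OF x(1)] by (intro squeeze_in_cube) auto
    moreover obtain i where "i < n" "x i = 0 \<or> x i = 1" using x(2) True by auto
    moreover from this have "?y i = 0 \<or> ?y i = 1" by (simp add: squeeze_def)
    ultimately show ?thesis using True side by (simp add: concat_at_def)
  next
    case False
    let ?y = "squeeze n (\<lambda>u. 2 * u - 1) x"
    have "?y \<in> unit_cube (Suc n)" using x False unit_cubeD[OF x(1)] by (intro squeeze_in_cube) auto
    moreover have "(\<exists>i<n. ?y i = 0 \<or> ?y i = 1) \<or> ?y n = 1"
      using x(2) by (auto simp: squeeze_def)
    ultimately show ?thesis using False H(3) by (simp add: concat_at_def)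
  qed
  ultimately show ?thesis using vv unfolding rel_filling_def by blast
qed

lemma fill_const:
  assumes "fill (\<lambda>_. a0) w"
  obtains H where "H \<in> spheroids (Suc n) X a0" "val H = w"
proof -
  obtain H where H: "continuous_map (cube (Suc n)) X H" "\<And>x. x\<in>unit_cube n \<Longrightarrow> H x = a0"
    "\<And>x. x\<in>unit_cube (Suc n) \<Longrightarrow> (\<exists>i<n. x i = 0 \<or> x i = 1) \<or> x n = 1 \<Longrightarrow> H x = a0" "val H = w"
    using assms unfolding rel_filling_def by blast
  have "H ` cube_boundary (Suc n) \<subseteq> {a0}" using H by (intro filling_boundary) auto
  then show ?thesis using that[of H] H(1,4) by (auto simp: spheroids_iff)
qed

lemma fill_class:
  assumes "b \<in> S" "b' \<in> S" "cls b = cls b'" "fill b w"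
  shows "fill b' w"
  using spheroid_class_eq_iff[OF assms(1), of b'] assms fill_homotopic by blast

text \<open>The top \<open>p\<close> has to be moved to the bottom. A copy \<open>M\<close> of the
  reverse of \<open>p\<close>, constant in the last coordinate, is glued beside \<open>K\<close> and
  turns the top into \<open>p\<close> followed by its reverse; the contraction \<open>N\<close> of
  that is glued on top. Both additions stay in \<open>A\<close> and have value one.\<close>

lemma fill_from_homotopy:
  assumes K: "continuous_map (cube (Suc n)) X K"
    and q: "q \<in> S" "\<And>x. x \<in> unit_cube n \<Longrightarrow> K x = q x"
    and p: "p \<in> S" "\<And>x. x \<in> unit_cube n \<Longrightarrow> K (x(n := 1)) = p x"
    and sides: "\<And>x i. x \<in> unit_cube (Suc n) \<Longrightarrow> i < n \<Longrightarrow> x i = 0 \<or> x i = 1 \<Longrightarrow> K x = a0"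
  shows "fill (concat_at 0 q (p \<circ> flip 0)) (val K)"
proof -
  let ?p' = "p \<circ> flip 0"
  have p': "?p' \<in> S" by (rule flip_spheroids[OF p(1) n0])
  interpret HG: comm_group HG by simp
  note drop = unit_cube_drop
  have lift: "x(n := 1) \<in> unit_cube (Suc n)" if "x \<in> unit_cube n" for x
    using that by (auto simp: unit_cube_def)
  define M where "M x = (p \<circ> flip 0) (x(n := 0))" for x
  have "continuous_on (unit_cube (Suc n)) (\<lambda>x. x(n := 0))"
    by (intro continuous_on_fun_upd continuous_on_id continuous_on_const)
  then have "continuous_map (cube (Suc n)) (cube n) (\<lambda>x. x(n := 0))" using drop by (auto simp: cube_eq)
  moreover have "continuous_map (cube n) (subtopology X A) (p \<circ> flip 0)" using p' by (simp add: spheroids_iff)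
  ultimately have "continuous_map (cube (Suc n)) (subtopology X A) ((p \<circ> flip 0) \<circ> (\<lambda>x. x(n := 0)))"
    by (rule continuous_map_compose)
  moreover have "M = (p \<circ> flip 0) \<circ> (\<lambda>x. x(n := 0))" by (rule ext) (simp add: M_def)
  ultimately have MA: "continuous_map (cube (Suc n)) (subtopology X A) M" by simp
  then have M: "continuous_map (cube (Suc n)) X M" "\<And>x. x \<in> unit_cube (Suc n) \<Longrightarrow> M x \<in> A"
    by (auto simp: continuous_map_in_subtopology)
  have Mside: "M x = a0" if "x \<in> unit_cube (Suc n)" "i < n" "x i = 0 \<or> x i = 1" for x i
  proof -
    have "x(n := 0) \<in> cube_boundary n" using drop that by (intro boundaryI[of _ _ i]) auto
    then show ?thesis using p' by (simp add: M_def spheroids_iff)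
  qed
  have agree: "K x = M (x(0 := 0))" if x: "x \<in> unit_cube (Suc n)" "x 0 = 1" for x
  proof -
    have "x(0 := 0) \<in> unit_cube (Suc n)" using x by (auto simp: unit_cube_def)
    then show ?thesis using sides[OF x(1) n0] Mside[of "x(0:=0)" 0] x(2) n0 by simp
  qed
  have bdK: "K ` cube_boundary (Suc n) \<subseteq> A"
  proof (intro image_subsetI)
    fix x assume x: "x \<in> cube_boundary (Suc n)"
    then have xc: "x \<in> unit_cube (Suc n)" by (simp add: cube_boundary_eq)
    obtain i where i: "i < Suc n" "x i = 0 \<or> x i = 1" using x by (auto simp: cube_boundary_eq)
    show "K x \<in> A"
    proof (cases "i < n")
      case True
      then show ?thesis using sides[OF xc True i(2)] a0 by simp
    next
      case False
      then have "x n = 0 \<or> x n = 1" using i by (auto simp: less_Suc_eq)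
      then show ?thesis
      proof
        assume "x n = 0"
        then have "x \<in> unit_cube n" using xc by (rule unit_cube_SucI[rotated])
        then show ?thesis using q spheroid_subtopologyD(2)[OF q(1)] by simp
      next
        assume "x n = 1"
        then have "K x = p (x(n := 0))" using p(2)[OF drop[OF xc]] by (simp add: fun_upd_idem)
        then show ?thesis using spheroid_subtopologyD(2)[OF p(1) drop[OF xc]] by simp
      qed
    qed
  qed
  have bdM: "M ` cube_boundary (Suc n) \<subseteq> A" using M(2) cube_boundary_subset by blast
  define L where "L = concat_at 0 K M"
  have Lc: "continuous_map (cube (Suc n)) X L" unfolding L_def
    by (rule continuous_map_concat_at[OF K M(1) _ agree]) simp
  have vM: "val M = \<one>\<^bsub>HG\<^esub>" using M by (intro hom_induced_into_subset) auto
  have "val L = val K \<otimes>\<^bsub>HG\<^esub> val M"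
    unfolding L_def by (rule hom_induced_concat_at[OF v K M(1) _ agree bdK bdM]) simp_all
  also have "\<dots> = val K" unfolding vM by (rule HG.r_one) (rule hom_induced_carrier)
  finally have vL: "val L = val K" .
  have bdL: "L ` cube_boundary (Suc n) \<subseteq> A"
    using concat_at_boundary[of "Suc n" K A M 0] bdK bdM by (auto simp: L_def)
  have Lbot: "L x = concat_at 0 q ?p' x" if x: "x \<in> unit_cube n" for x
  proof -
    have "M y = ?p' y" if "y \<in> unit_cube n" for y
      using unit_cube_coordinate_0[OF that] by (simp add: M_def fun_upd_idem)
    then show ?thesis
      using concat_at_eval[OF n0 x, where 'a = 'a and 'b = 'a] q(2) unfolding L_def by (elim disjE bexE) (metis, metis)
  qed
  have Lside: "L x = a0" if x: "x \<in> unit_cube (Suc n)" "i < n" "x i = 0 \<or> x i = 1" for x i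
  proof (cases "x 0 \<le> 1/2")
    case True
    let ?y = "squeeze 0 (\<lambda>u. 2 * u) x"
    have "?y \<in> unit_cube (Suc n)" using x True unit_cubeD[OF x(1)] by (intro squeeze_in_cube) auto
    moreover have "?y i = 0 \<or> ?y i = 1" using x True by (cases "i = 0") (auto simp: squeeze_def)
    ultimately show ?thesis using True sides x(2) by (simp add: L_def concat_at_def)
  next
    case False
    let ?y = "squeeze 0 (\<lambda>u. 2 * u - 1) x"
    have "?y \<in> unit_cube (Suc n)" using x False unit_cubeD[OF x(1)] by (intro squeeze_in_cube) auto
    moreover have "?y i = 0 \<or> ?y i = 1" using x False by (cases "i = 0") (auto simp: squeeze_def)
    ultimately show ?thesis using False Mside x(2) by (simp add: L_def concat_at_def)
  qed
  have Ltop: "L (x(n := 1)) = concat_at 0 p ?p' x" if x: "x \<in> unit_cube n" for x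
  proof -
    have 1: "L (x(n := 1)) = concat_at 0 (\<lambda>y. K (y(n := 1))) (\<lambda>y. M (y(n := 1))) x"
      using n0 by (simp add: L_def concat_at_def squeeze_def fun_upd_twist)
    have "M (y(n := 1)) = ?p' y" if "y \<in> unit_cube n" for y
      using unit_cube_coordinate_0[OF that] by (simp add: M_def fun_upd_idem)
    then show ?thesis
      unfolding 1 using concat_at_eval[OF n0 x, where 'a = 'a and 'b = 'a] p(2) by (elim disjE bexE) (metis, metis)
  qed
  obtain k where k: "continuous_map (prod_topology (top_of_set {0..1::real}) (cube n)) (subtopology X A) k"
    "\<And>x. x\<in>unit_cube n \<Longrightarrow> k (0, x) = concat_at 0 p ?p' x \<and> k (1, x) = a0"
     "\<And>t x. t\<in>{0..1} \<Longrightarrow> x\<in>cube_boundary n \<Longrightarrow> k (t, x) = a0"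
    using concat_at_flip[OF p(1) n0] unfolding spheroid_homotopic_iff by blast
  define N where "N x = k (x n, x(n := 0))" for x
  have NA: "continuous_map (cube (Suc n)) (subtopology X A) N"
    unfolding N_def
  proof (rule continuous_map_compose[OF _ k(1), unfolded comp_def])
    have "continuous_on (unit_cube (Suc n)) (\<lambda>x. (x n, x(n := 0)))"
      by (intro continuous_on_Pair continuous_on_fun_upd continuous_on_id continuous_on_const continuous_on_coordinates)
    then show "continuous_map (cube (Suc n)) (prod_topology (top_of_set {0..1}) (cube n)) (\<lambda>x. (x n, x(n := 0)))"
      using drop unit_cubeD by (auto simp: cube_eq continuous_map_in_subtopology simp flip: subtopology_Times)
  qed
  then have N: "continuous_map (cube (Suc n)) X N" "\<And>x. x \<in> unit_cube (Suc n) \<Longrightarrow> N x \<in> A"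
    by (auto simp: continuous_map_in_subtopology)
  have vN: "val N = \<one>\<^bsub>HG\<^esub>" using N by (intro hom_induced_into_subset) auto
  have bdN: "N ` cube_boundary (Suc n) \<subseteq> A" using N(2) cube_boundary_subset by blast
  have agree': "L x = N (x(n := 0))" if x: "x \<in> unit_cube (Suc n)" "x n = 1" for x
  proof -
    have "L x = concat_at 0 p ?p' (x(n := 0))" using Ltop[OF drop[OF x(1)]] x(2) by (simp add: fun_upd_idem)
    then show ?thesis using k(2)[OF drop[OF x(1)]] by (simp add: N_def)
  qed
  have Nside: "N x = a0" if x: "x \<in> unit_cube (Suc n)" "i < n" "x i = 0 \<or> x i = 1" for x i
  proof -
    have "x(n := 0) \<in> cube_boundary n" using drop[OF x(1)] x by (intro boundaryI[of _ _ i]) auto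
    then show ?thesis using k(3) unit_cubeD[OF x(1)] by (simp add: N_def)
  qed
  have "val (concat_at n L N) = val L \<otimes>\<^bsub>HG\<^esub> val N"
    by (rule hom_induced_concat_at[OF v Lc N(1) _ agree' bdL bdN]) simp_all
  also have "\<dots> = val K" unfolding vN vL by (rule HG.r_one) (rule hom_induced_carrier)
  finally have "val (concat_at n L N) = val K" .
  moreover have "continuous_map (cube (Suc n)) X (concat_at n L N)"
    by (rule continuous_map_concat_at[OF Lc N(1) _ agree']) simp
  moreover have "concat_at n L N x = concat_at 0 q ?p' x" if x: "x \<in> unit_cube n" for x
  proof -
    have "x n = 0" using x by (rule unit_cube_coordinate_0)
    then have "concat_at n L N x = L x" by (simp add: concat_at_def squeeze_def fun_upd_idem)
    then show ?thesis using Lbot[OF x] by simp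
  qed
  moreover have "concat_at n L N x = a0"
    if x: "x \<in> unit_cube (Suc n)" "(\<exists>i<n. x i = 0 \<or> x i = 1) \<or> x n = 1" for x
  proof (cases "x n \<le> 1/2")
    case True
    let ?y = "squeeze n (\<lambda>u. 2 * u) x"
    have "?y \<in> unit_cube (Suc n)" using x True unit_cubeD[OF x(1)] by (intro squeeze_in_cube) auto
    moreover obtain i where "i < n" "x i = 0 \<or> x i = 1" using x(2) True by auto
    moreover from this have "?y i = 0 \<or> ?y i = 1" by (simp add: squeeze_def)
    ultimately show ?thesis using True Lside by (simp add: concat_at_def)
  next
    case False
    let ?y = "squeeze n (\<lambda>u. 2 * u - 1) x"
    have y: "?y \<in> unit_cube (Suc n)" using x False unit_cubeD[OF x(1)] by (intro squeeze_in_cube) auto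
    have "N ?y = a0"
    proof (cases "x n = 1")
      case True
      then have "N ?y = k (1, ?y(n := 0))" by (simp add: N_def squeeze_def)
      then show ?thesis using k(2)[OF drop[OF y]] by simp
    next
      case False
      then obtain i where "i < n" "x i = 0 \<or> x i = 1" using x(2) by auto
      moreover from this have "?y i = 0 \<or> ?y i = 1" by (simp add: squeeze_def)
      ultimately show ?thesis using Nside[OF y] by blast
    qed
    then show ?thesis using False by (simp add: concat_at_def)
  qed
  ultimately show ?thesis unfolding rel_filling_def by blast
qed

end

text \<open>\<open>foldq n m\<close> stretches the coordinates \<open>m, \<dots>, n - 1\<close> by \<open>c\<close>, truncates them at \<open>1\<close> and moves the
  surplus to the last coordinate \<open>n\<close>: it wraps the bottom of the cube around the walls \<open>x\<^sub>k = 1\<close>. On the second half of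
  coordinate \<open>m\<close> it becomes \<open>collar n m\<close>, a map into the wall \<open>x\<^sub>m = 1\<close>.\<close>

definition foldq :: "nat \<Rightarrow> nat \<Rightarrow> real \<Rightarrow> real \<Rightarrow> (nat \<Rightarrow> real) \<Rightarrow> nat \<Rightarrow> real" where
  "foldq n m c b x i =
     (if i < m then x i else if i < n then min 1 (c * x i)
      else if i = n then min 1 (b + (\<Sum>k\<in>{m..<n}. max 0 (c * x k - 1))) else 0)"

definition collar :: "nat \<Rightarrow> nat \<Rightarrow> real \<Rightarrow> (nat \<Rightarrow> real) \<Rightarrow> nat \<Rightarrow> real" where
  "collar n m c x i =
     (if i < m then x i else if i = m then 1 else if i < n then min 1 (c * x i)
      else if i = n then min 1 (x m + (\<Sum>k\<in>{Suc m..<n}. max 0 (c * x k - 1))) else 0)"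

text \<open>The cyclic permutation of the coordinates m, ..., n - 1 that moves coordinate
  \<open>m\<close> to the end. It appears because on the wall x_m = 1 the coordinate
  \<open>m\<close> of the collar plays the part of the height.\<close>

definition cyc :: "nat \<Rightarrow> nat \<Rightarrow> (nat \<Rightarrow> real) \<Rightarrow> nat \<Rightarrow> real" where
  "cyc n m x i = (if i < m then x i else if Suc i < n then x (Suc i) else if Suc i = n then x m else 0)"

lemma collar_sum_pos:
  assumes "(\<Sum>k\<in>{m..<n}. max 0 (c * x k - 1)) \<noteq> (0::real)"
  obtains k where "m \<le> k" "k < n" "min 1 (c * x k) = 1"
proof -
  obtain k where "k \<in> {m..<n}" "max 0 (c * x k - 1) \<noteq> 0" using sum.not_neutral_contains_not_neutral[OF assms] by blast
  then have "m \<le> k" "k < n" "min 1 (c * x k) = 1" by auto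
  then show ?thesis by (rule that)
qed

lemma collar_sum_nonneg: "0 \<le> (\<Sum>k\<in>{m..<n}. max 0 (c * x k - 1 :: real))"
  by (intro sum_nonneg) auto

lemma cyc_in_cube: "x \<in> unit_cube n \<Longrightarrow> m < n \<Longrightarrow> cyc n m x \<in> unit_cube n"
proof -
  assume x: "x \<in> unit_cube n" and m: "m < n"
  have "0 \<le> cyc n m x i \<and> cyc n m x i \<le> 1" for i using unit_cubeD[OF x] by (simp add: cyc_def)
  moreover have "cyc n m x i = 0" if "n \<le> i" for i using m that by (simp add: cyc_def)
  ultimately show ?thesis unfolding unit_cube_def by blast
qed

lemma cyc_boundary:
  assumes "x \<in> cube_boundary n" "m < n" shows "cyc n m x \<in> cube_boundary n"
proof -
  obtain k where k: "k < n" "x k = 0 \<or> x k = 1" using assms by (auto simp: cube_boundary_eq)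
  consider "k < m" | "k = m" | "m < k" by linarith
  then have "\<exists>i<n. cyc n m x i = 0 \<or> cyc n m x i = 1"
  proof cases
    case 1
    then show ?thesis using k by (intro exI[of _ k]) (auto simp: cyc_def)
  next
    case 2
    then show ?thesis using k by (intro exI[of _ "n - 1"]) (auto simp: cyc_def)
  next
    case 3
    then show ?thesis using k by (intro exI[of _ "k - 1"]) (auto simp: cyc_def)
  qed
  then show ?thesis using cyc_in_cube[of x n m] assms by (auto simp: cube_boundary_eq)
qed

lemma continuous_on_cyc: "continuous_on T (cyc n m)"
proof (rule continuous_on_coordinatewise_then_product)
  show "continuous_on T (\<lambda>x. cyc n m x i)" for i
    unfolding cyc_def by (cases "i < m"; cases "Suc i < n"; cases "Suc i = n") (auto intro!: continuous_intros)
qed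

section \<open>Signs of coordinate permutations\<close>

context filling_context begin

definition signed :: "nat \<Rightarrow> ((nat \<Rightarrow> real) \<Rightarrow> 'a) set \<Rightarrow> ((nat \<Rightarrow> real) \<Rightarrow> 'a) set" where
  "signed k a = (if even k then a else inv\<^bsub>PG\<^esub> a)"

lemma cyc_spheroid:
  assumes "f \<in> S" "m < n" shows "f \<circ> cyc n m \<in> S"
proof -
  have "continuous_map (cube n) (cube n) (cyc n m)"
    using continuous_on_cyc cyc_in_cube assms(2) by (auto simp: cube_eq)
  then have "continuous_map (cube n) (subtopology X A) (f \<circ> cyc n m)"
    using assms(1) by (intro continuous_map_compose) (auto simp: spheroids_iff)
  moreover have "(f \<circ> cyc n m) x = a0" if "x \<in> cube_boundary n" for x
    using cyc_boundary[OF that assms(2)] assms(1) by (simp add: spheroids_iff)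
  ultimately show ?thesis by (simp add: spheroids_iff)
qed

lemma cls_eqI: "spheroid_homotopic n (subtopology X A) a0 f g \<Longrightarrow> cls f = cls g"
  using spheroid_class_eq_iff spheroid_homotopicD(2) by metis

text \<open>The cyclic permutation of n - m coordinates is a product of n - 1 - m transpositions,
  and each of them inverts the class by \<open>spheroid_swap\<close>.\<close>

lemma cls_cyc:
  assumes f: "f \<in> S" and m: "m < n"
  shows "cls (f \<circ> cyc n m) = signed (n - 1 - m) (cls f)"
  using m
proof (induction "n - 1 - m" arbitrary: m)
  case 0
  then have "m = n - 1" by simp
  have "cyc n (n - 1) x = x" if "x \<in> unit_cube n" for x
    using that n0 by (auto simp: cyc_def unit_cube_def fun_eq_iff)
  then have "spheroid_homotopic n (subtopology X A) a0 (f \<circ> cyc n m) f"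
    using \<open>m = n - 1\<close> cyc_spheroid[OF f 0(2)] by (intro spheroid_homotopic_eqI) auto
  from cls_eqI[OF this] show ?case using 0 by (simp add: signed_def comp_def)
next
  case (Suc k)
  interpret comm_group PG by (rule comm_group_homotopy_group[OF n base])
  have m': "Suc m < n" "k = n - 1 - Suc m" using Suc by auto
  have IH: "cls (f \<circ> cyc n (Suc m)) = signed k (cls f)" using Suc.hyps(1)[OF m'(2,1)] m' by simp
  let ?g = "f \<circ> cyc n (Suc m)"
  have g: "?g \<in> S" by (rule cyc_spheroid[OF f m'(1)])
  have "f \<circ> cyc n m = (\<lambda>x. ?g (x(m := x (Suc m), Suc m := x m)))"
  proof (intro ext)
    fix x
    have "cyc n m x = cyc n (Suc m) (x(m := x (Suc m), Suc m := x m))"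
      using m' by (auto simp: cyc_def fun_eq_iff)
    then show "(f \<circ> cyc n m) x = ?g (x(m := x (Suc m), Suc m := x m))" by simp
  qed
  moreover have "spheroid_homotopic n (subtopology X A) a0 (\<lambda>x. ?g (x(m := x (Suc m), Suc m := x m))) (?g \<circ> flip m)"
    using m' by (intro spheroid_swap[OF g]) auto
  moreover have "spheroid_homotopic n (subtopology X A) a0 (?g \<circ> flip m) (?g \<circ> flip 0)"
    using m' by (intro flip_homotopic[OF g _ n base]) auto
  ultimately have "cls (f \<circ> cyc n m) = cls (?g \<circ> flip 0)"
    using cls_eqI by metis
  also have "\<dots> = inv\<^bsub>PG\<^esub> (cls ?g)" by (rule inv_homotopy_group[OF n g base, symmetric])
  also have "\<dots> = signed (Suc k) (cls f)"
    using f by (auto simp: IH signed_def carrier_homotopy_group)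
  finally show ?case using Suc.hyps(2) by simp
qed

end

text \<open>The hypotheses describe \<open>theta\<close> followed by a simplex that is constant on
  its codimension-two skeleton: only the walls x_m = 1 and the bottom x_n = 0 can carry nonconstant
  faces.\<close>

locale cube_faces = filling_context n X A a0 v for n :: nat and X :: "'a topology" and A a0 v +
  fixes h :: "(nat \<Rightarrow> real) \<Rightarrow> 'a"
  assumes hc: "continuous_map (cube (Suc n)) X h"
    and hA: "\<And>x. x \<in> cube_boundary (Suc n) \<Longrightarrow> h x \<in> A"
    and h1: "\<And>x i. x \<in> unit_cube (Suc n) \<Longrightarrow> i < n \<Longrightarrow> x i = 0 \<Longrightarrow> h x = a0"
    and h2: "\<And>x i j. x \<in> unit_cube (Suc n) \<Longrightarrow> i \<le> n \<Longrightarrow> j \<le> n \<Longrightarrow> i \<noteq> j \<Longrightarrow> x i = 1 \<Longrightarrow> x j = 1 \<Longrightarrow> h x = a0"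
    and h3: "\<And>x i. x \<in> unit_cube (Suc n) \<Longrightarrow> i < n \<Longrightarrow> x i = 1 \<Longrightarrow> x n = 0 \<Longrightarrow> h x = a0"
begin

lemma pull_homotopic:
  fixes \<mu> :: "real \<Rightarrow> (nat \<Rightarrow> real) \<Rightarrow> nat \<Rightarrow> real"
  assumes c: "continuous_on ({0..1} \<times> unit_cube n) (\<lambda>z. \<mu> (fst z) (snd z))"
    and b: "\<And>t x. t \<in> {0..1} \<Longrightarrow> x \<in> unit_cube n \<Longrightarrow> \<mu> t x \<in> cube_boundary (Suc n)"
    and z: "\<And>t x. t \<in> {0..1} \<Longrightarrow> x \<in> cube_boundary n \<Longrightarrow> h (\<mu> t x) = a0"
    and ab: "\<And>x. x \<in> unit_cube n \<Longrightarrow> p x = h (\<mu> 0 x)" "\<And>x. x \<in> unit_cube n \<Longrightarrow> q x = h (\<mu> 1 x)"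
  shows "spheroid_homotopic n (subtopology X A) a0 p q"
  unfolding spheroid_homotopic_iff
proof (intro exI[of _ "\<lambda>z. h (\<mu> (fst z) (snd z))"] conjI ballI)
  have b': "\<mu> t x \<in> unit_cube (Suc n)" if "t \<in> {0..1}" "x \<in> unit_cube n" for t x
    using b[OF that] cube_boundary_subset by auto
  have "continuous_map (prod_topology (top_of_set {0..1}) (cube n)) (cube (Suc n)) (\<lambda>z. \<mu> (fst z) (snd z))"
    using c b' unfolding cube_eq by (auto simp: continuous_map_in_subtopology simp flip: subtopology_Times)
  then have "continuous_map (prod_topology (top_of_set {0..1}) (cube n)) X (\<lambda>z. h (\<mu> (fst z) (snd z)))"
    using continuous_map_compose[OF _ hc, of _ "\<lambda>z. \<mu> (fst z) (snd z)"] by (simp add: comp_def)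
  then show "continuous_map (prod_topology (top_of_set {0..1}) (cube n)) (subtopology X A) (\<lambda>z. h (\<mu> (fst z) (snd z)))"
    using hA b by (auto simp: continuous_map_in_subtopology)
qed (use ab z in auto)

lemma pull_spheroid:
  assumes "continuous_on (unit_cube n) \<mu>"
    and "\<And>x. x \<in> unit_cube n \<Longrightarrow> \<mu> x \<in> cube_boundary (Suc n)"
    and "\<And>x. x \<in> cube_boundary n \<Longrightarrow> h (\<mu> x) = a0"
  shows "(\<lambda>x. h (\<mu> x)) \<in> S"
proof -
  have "continuous_on ({0..1::real} \<times> unit_cube n) (\<lambda>z. \<mu> (snd z))"
    by (rule continuous_on_compose2[OF assms(1)]) (auto intro!: continuous_intros)
  then have "spheroid_homotopic n (subtopology X A) a0 (\<lambda>x. h (\<mu> x)) (\<lambda>x. h (\<mu> x))"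
    using assms by (intro pull_homotopic[where \<mu> = "\<lambda>_. \<mu>"]) auto
  then show ?thesis by (rule spheroid_homotopicD)
qed

definition face :: "nat \<Rightarrow> (nat \<Rightarrow> real) \<Rightarrow> 'a" where "face m x = h (insert_one m x)"

lemma insert_one_boundary:
  assumes "x \<in> unit_cube n" "m \<le> n" shows "insert_one m x \<in> cube_boundary (Suc n)"
  using assms unit_cubeD[OF assms(1)]
  by (intro boundaryI[of _ _ m]) (auto simp: unit_cube_def insert_one_def)

lemma face_spheroid: assumes m: "m \<le> n" shows "face m \<in> S"
  unfolding face_def[abs_def]
proof (rule pull_spheroid)
  show "continuous_on (unit_cube n) (insert_one m)"
  proof (rule continuous_on_coordinatewise_then_product)
    show "continuous_on (unit_cube n) (\<lambda>x. insert_one m x i)" for i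
      unfolding insert_one_def by (cases "i < m"; cases "i = m") (auto intro!: continuous_intros)
  qed
  show "insert_one m x \<in> cube_boundary (Suc n)" if "x \<in> unit_cube n" for x by (rule insert_one_boundary[OF that m])
  fix x assume x: "x \<in> cube_boundary n"
  then have xc: "x \<in> unit_cube n" by (simp add: cube_boundary_eq)
  have ic: "insert_one m x \<in> unit_cube (Suc n)" using insert_one_boundary[OF xc m] cube_boundary_subset by auto
  have one: "insert_one m x m = 1" by (simp add: insert_one_def)
  obtain k where k: "k < n" "x k = 0 \<or> x k = 1" using x by (auto simp: cube_boundary_eq)
  define k' where "k' = (if k < m then k else Suc k)"
  have k': "k' \<le> n" "k' \<noteq> m" "insert_one m x k' = x k" using k by (auto simp: k'_def insert_one_def)
  show "h (insert_one m x) = a0"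
  proof (cases "x k = 1")
    case True
    then show ?thesis using h2[OF ic k'(1) m k'(2)] k' one by simp
  next
    case False
    then have z: "insert_one m x k' = 0" using k k' by simp
    show ?thesis
    proof (cases "k' = n")
      case True
      then have "m < n" using m k' by simp
      then show ?thesis using h3[OF ic _ one] z True by simp
    next
      case False
      then show ?thesis using h1[OF ic _ z] k' by simp
    qed
  qed
qed

lemma collar_boundary:
  assumes x: "x \<in> unit_cube n" and m: "m < n" and c: "1 \<le> c"
  shows "collar n m c x \<in> cube_boundary (Suc n)"
proof (rule boundaryI[of _ _ m])
  have "0 \<le> x m + (\<Sum>k\<in>{Suc m..<n}. max 0 (c * x k - 1))"
    using unit_cubeD(1)[OF x] collar_sum_nonneg by (intro add_nonneg_nonneg)
  moreover have "0 \<le> c * x i" for i using c unit_cubeD(1)[OF x, of i] by simp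
  ultimately show "collar n m c x \<in> unit_cube (Suc n)"
    using unit_cubeD[OF x] m by (auto simp: unit_cube_def collar_def)
qed (use m in \<open>auto simp: collar_def\<close>)

lemma continuous_on_collar:
  "continuous_on T (\<lambda>z. collar n m (2 - fst z) (snd z))"
proof (rule continuous_on_coordinatewise_then_product)
  show "continuous_on T (\<lambda>z. collar n m (2 - fst z) (snd z) i)" for i
    unfolding collar_def
    by (cases "i < m"; cases "i = m"; cases "i < n"; cases "i = n") (auto intro!: continuous_intros)
qed

text \<open>As the stretching factor falls from 2 to 1 the surplus disappears and the collar becomes
  the parametrization of the wall by permuted coordinates. The boundary always goes to a point with
  a zero among its first \<open>n\<close> coordinates, to one with two coordinates equal to 1, or to
  the edge of the bottom.\<close>

lemma collar_homotopic:
  assumes m: "m < n"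
  shows "spheroid_homotopic n (subtopology X A) a0 (\<lambda>x. h (collar n m 2 x)) (face m \<circ> cyc n m)"
proof (rule pull_homotopic[where \<mu> = "\<lambda>t. collar n m (2 - t)"])
  show "continuous_on ({0..1} \<times> unit_cube n) (\<lambda>z. collar n m (2 - fst z) (snd z))" by (rule continuous_on_collar)
  show b: "collar n m (2 - t) x \<in> cube_boundary (Suc n)" if "t \<in> {0..1}" "x \<in> unit_cube n" for t x
    using that by (intro collar_boundary m) auto
  fix t :: real and x assume t: "t \<in> {0..1}" and x: "x \<in> cube_boundary n"
  define c where "c = 2 - t"
  have c: "1 \<le> c" using t by (simp add: c_def)
  have xc: "x \<in> unit_cube n" using x by (simp add: cube_boundary_eq)
  have cc: "collar n m c x \<in> unit_cube (Suc n)" using b[OF t xc] cube_boundary_subset by (auto simp: c_def)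
  have one: "collar n m c x m = 1" by (simp add: collar_def)
  obtain k where k: "k < n" "x k = 0 \<or> x k = 1" using x by (auto simp: cube_boundary_eq)
  have "h (collar n m c x) = a0"
  proof (cases "k = m")
    case False
    show ?thesis
    proof (cases "x k = 1")
      case True
      then have "collar n m c x k = 1" using k False c by (auto simp: collar_def)
      then show ?thesis using h2[OF cc _ _ False] one k m by simp
    next
      assume "x k \<noteq> 1"
      then have "collar n m c x k = 0" using k False by (auto simp: collar_def)
      then show ?thesis using h1[OF cc k(1)] by simp
    qed
  next
    case True
    show ?thesis
    proof (cases "x k = 1")
      case True
      then have "collar n m c x n = 1" using \<open>k = m\<close> m collar_sum_nonneg[of c x "Suc m" n] by (auto simp: collar_def)
      then show ?thesis using h2[OF cc, of m n] one m by simp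
    next
      assume "x k \<noteq> 1"
      then have x0: "x m = 0" using k True by simp
      show ?thesis
      proof (cases "(\<Sum>k\<in>{Suc m..<n}. max 0 (c * x k - 1)) = 0")
        case True
        then have "collar n m c x n = 0" using x0 m by (simp add: collar_def)
        then show ?thesis using h3[OF cc m one] by simp
      next
        case False
        then obtain j where "Suc m \<le> j" "j < n" "min 1 (c * x j) = 1" by (rule collar_sum_pos)
        then have "collar n m c x j = 1" "j \<le> n" "j \<noteq> m" by (auto simp: collar_def)
        then show ?thesis using h2[OF cc, of m j] one m by simp
      qed
    qed
  qed
  then show "h (collar n m (2 - t) x) = a0" by (simp add: c_def)
next
  show "h (collar n m 2 x) = h (collar n m (2 - 0) x)" for x by simp
  show "(face m \<circ> cyc n m) x = h (collar n m (2 - 1) x)" if x: "x \<in> unit_cube n" for x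
  proof -
    have "max 0 (1 * x k - 1) = 0" for k using unit_cubeD(2)[OF x, of k] by simp
    moreover have "min 1 (1 * x k) = x k" for k using unit_cubeD(2)[OF x, of k] by simp
    moreover have "x i = 0" if "i \<ge> n" for i using x that by (simp add: unit_cube_def)
    ultimately have "insert_one m (cyc n m x) = collar n m (2 - 1) x"
      using m unit_cubeD(2)[OF x, of m] by (intro ext) (auto simp: insert_one_def cyc_def collar_def)
    then show ?thesis by (simp add: face_def)
  qed
qed

text \<open>The bottom together with the walls x_k = 1 for m \<le> k < n, unrolled into one
  spheroid. For \<open>m = n\<close> it is the bottom alone, for \<open>m = 0\<close> it contains
  all side walls.\<close>

definition cross :: "nat \<Rightarrow> (nat \<Rightarrow> real) \<Rightarrow> 'a" where "cross m x = h (foldq n m 2 0 x)"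

lemma foldq_in_cube:
  assumes "x \<in> unit_cube k" "m \<le> n" "0 \<le> b" "0 \<le> c"
  shows "foldq n m c b x \<in> unit_cube (Suc n)"
proof -
  have "0 \<le> b + (\<Sum>k\<in>{m..<n}. max 0 (c * x k - 1))"
    using assms(3) collar_sum_nonneg by (intro add_nonneg_nonneg)
  moreover have "0 \<le> c * x i" for i using assms unit_cubeD(1)[OF assms(1), of i] by simp
  ultimately show ?thesis
    using unit_cubeD[OF assms(1)] assms(2) by (auto simp: unit_cube_def foldq_def)
qed

lemma cross_spheroid: assumes m: "m \<le> n" shows "cross m \<in> S"
  unfolding cross_def[abs_def]
proof (rule pull_spheroid)
  show "continuous_on (unit_cube n) (foldq n m 2 0)"
  proof (rule continuous_on_coordinatewise_then_product)
    show "continuous_on (unit_cube n) (\<lambda>x. foldq n m 2 0 x i)" for i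
      unfolding foldq_def by (cases "i < m"; cases "i < n"; cases "i = n") (auto intro!: continuous_intros)
  qed
  show b: "foldq n m 2 0 x \<in> cube_boundary (Suc n)" if x: "x \<in> unit_cube n" for x
  proof (cases "(\<Sum>k\<in>{m..<n}. max 0 (2 * x k - 1)) = 0")
    case True
    then show ?thesis using m foldq_in_cube[OF x m, of 0 2] by (intro boundaryI[of _ _ n]) (auto simp: foldq_def)
  next
    case False
    then obtain j where "m \<le> j" "j < n" "min 1 (2 * x j) = 1" by (rule collar_sum_pos)
    then show ?thesis using m foldq_in_cube[OF x m, of 0 2] by (intro boundaryI[of _ _ j]) (auto simp: foldq_def)
  qed
  fix x assume x: "x \<in> cube_boundary n"
  then have xc: "x \<in> unit_cube n" by (simp add: cube_boundary_eq)
  have cc: "foldq n m 2 0 x \<in> unit_cube (Suc n)" using b[OF xc] cube_boundary_subset by auto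
  obtain k where k: "k < n" "x k = 0 \<or> x k = 1" using x by (auto simp: cube_boundary_eq)
  show "h (foldq n m 2 0 x) = a0"
  proof (cases "x k = 1")
    case False
    then have "foldq n m 2 0 x k = 0" using k by (auto simp: foldq_def)
    then show ?thesis using h1[OF cc k(1)] by simp
  next
    case True
    then have one: "foldq n m 2 0 x k = 1" using k by (auto simp: foldq_def)
    show ?thesis
    proof (cases "m \<le> k")
      case mk: True
      have "max 0 (2 * x k - 1) \<le> (\<Sum>k\<in>{m..<n}. max 0 (2 * x k - 1))"
        using mk k by (intro member_le_sum) auto
      then have "foldq n m 2 0 x n = 1" using True m by (auto simp: foldq_def)
      then show ?thesis using h2[OF cc, of k n] one k by simp
    next
      case mk: False
      show ?thesis
      proof (cases "(\<Sum>k\<in>{m..<n}. max 0 (2 * x k - 1)) = 0")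
        case True
        then have "foldq n m 2 0 x n = 0" using m by (simp add: foldq_def)
        then show ?thesis using h3[OF cc k(1) one] by simp
      next
        case False
        then obtain j where "m \<le> j" "j < n" "min 1 (2 * x j) = 1" by (rule collar_sum_pos)
        then have "foldq n m 2 0 x j = 1" "j \<le> n" "j \<noteq> k" using mk by (auto simp: foldq_def)
        then show ?thesis using h2[OF cc, of k j] one k by simp
      qed
    qed
  qed
qed

lemma cross_last: "x \<in> unit_cube n \<Longrightarrow> cross n x = h x"
  unfolding cross_def by (rule arg_cong[of _ _ h]) (auto simp: foldq_def unit_cube_def fun_eq_iff)

text \<open>The cut is at x_m = 1/2. In the first half coordinate \<open>m\<close> is only doubled
  and produces no surplus; in the second half it is stuck at 1 and its surplus climbs the
  wall.\<close>

lemma cross_step: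
  assumes m: "m < n" and x: "x \<in> unit_cube n"
  shows "cross m x = concat_at m (cross (Suc m)) (\<lambda>x. h (collar n m 2 x)) x"
proof -
  have split: "(\<Sum>k\<in>{m..<n}. max 0 (2 * x k - 1)) = max 0 (2 * x m - 1) + (\<Sum>k\<in>{Suc m..<n}. max 0 (2 * x k - 1))"
    using m by (simp add: sum.atLeast_Suc_lessThan)
  have upd: "(\<Sum>k\<in>{Suc m..<n}. max 0 (2 * (x(m := u)) k - 1)) = (\<Sum>k\<in>{Suc m..<n}. max 0 (2 * x k - 1))" for u
    by (intro sum.cong) auto
  show ?thesis
  proof (cases "x m \<le> 1/2")
    case True
    have "foldq n m 2 0 x = foldq n (Suc m) 2 0 (x(m := 2 * x m))"
      using True m unfolding foldq_def upd split by (auto simp: fun_eq_iff)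
    then show ?thesis using True by (simp add: concat_at_def cross_def squeeze_def)
  next
    case False
    have "foldq n m 2 0 x = collar n m 2 (x(m := 2 * x m - 1))"
      using False m unfolding foldq_def collar_def upd split by (auto simp: fun_eq_iff)
    then show ?thesis using False by (simp add: concat_at_def cross_def squeeze_def)
  qed
qed

lemma cls_cross_step:
  assumes m: "m < n"
  shows "cls (cross m) = cls (cross (Suc m)) \<otimes>\<^bsub>PG\<^esub> signed (n - 1 - m) (cls (face m))"
proof -
  let ?Z = "\<lambda>x. h (collar n m 2 x)"
  have Z: "?Z \<in> S" by (rule spheroid_homotopicD(1)[OF collar_homotopic[OF m]])
  have C: "cross (Suc m) \<in> S" using m by (intro cross_spheroid) simp
  have "spheroid_homotopic n (subtopology X A) a0 (cross m) (concat_at m (cross (Suc m)) ?Z)"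
    using cross_step[OF m] m by (intro spheroid_homotopic_eqI cross_spheroid) auto
  also have "spheroid_homotopic n (subtopology X A) a0 \<dots> (concat_at 0 (cross (Suc m)) ?Z)"
    by (rule concat_at_0_eq[OF C Z m])
  finally have "cls (cross m) = cls (concat_at 0 (cross (Suc m)) ?Z)"
    by (rule cls_eqI)
  also have "\<dots> = cls (cross (Suc m)) \<otimes>\<^bsub>PG\<^esub> cls ?Z" by (rule mult_homotopy_group[OF C Z n0, symmetric])
  also have "cls ?Z = cls (face m \<circ> cyc n m)"
    by (rule cls_eqI[OF collar_homotopic[OF m]])
  also have "\<dots> = signed (n - 1 - m) (cls (face m))" using cls_cyc[OF face_spheroid m] m by simp
  finally show ?thesis .
qed

definition folded_top :: "real \<Rightarrow> (nat \<Rightarrow> real) \<Rightarrow> 'a" where "folded_top c x = h (foldq n 0 c 1 x)"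

lemma folded_top_homotopic:
  "spheroid_homotopic n (subtopology X A) a0 (folded_top 2) (face n)"
proof (rule pull_homotopic[where \<mu> = "\<lambda>t. foldq n 0 (2 - t) 1"])
  show "continuous_on ({0..1} \<times> unit_cube n) (\<lambda>z. foldq n 0 (2 - fst z) 1 (snd z))"
  proof (rule continuous_on_coordinatewise_then_product)
    show "continuous_on ({0..1} \<times> unit_cube n) (\<lambda>z. foldq n 0 (2 - fst z) 1 (snd z) i)" for i
      unfolding foldq_def by (cases "i < n"; cases "i = n") (auto intro!: continuous_intros)
  qed
  have top: "foldq n 0 c 1 x n = 1" for c x
    using collar_sum_nonneg[of c x 0 n] by (simp add: foldq_def)
  show b: "foldq n 0 (2 - t) 1 x \<in> cube_boundary (Suc n)" if "t \<in> {0..1}" "x \<in> unit_cube n" for t x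
    using foldq_in_cube[OF that(2), of 0 1 "2 - t"] that top by (intro boundaryI[of _ _ n]) auto
  fix t :: real and x assume t: "t \<in> {0..1}" and x: "x \<in> cube_boundary n"
  have xc: "x \<in> unit_cube n" using x by (simp add: cube_boundary_eq)
  have cc: "foldq n 0 (2 - t) 1 x \<in> unit_cube (Suc n)" using b[OF t xc] cube_boundary_subset by auto
  obtain k where k: "k < n" "x k = 0 \<or> x k = 1" using x by (auto simp: cube_boundary_eq)
  then have "foldq n 0 (2 - t) 1 x k = 0 \<or> foldq n 0 (2 - t) 1 x k = 1" using t by (auto simp: foldq_def)
  then show "h (foldq n 0 (2 - t) 1 x) = a0"
    using h1[OF cc k(1)] h2[OF cc, of k n] top k(1) by auto
next
  show "folded_top 2 x = h (foldq n 0 (2 - 0) 1 x)" for x by (simp add: folded_top_def)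
  show "face n x = h (foldq n 0 (2 - 1) 1 x)" if x: "x \<in> unit_cube n" for x
    unfolding face_def
  proof (rule arg_cong[of _ _ h], rule ext)
    fix i
    have "max 0 (1 * x k - 1) = 0" for k using unit_cubeD(2)[OF x, of k] by simp
    moreover have "min 1 (1 * x k) = x k" for k using unit_cubeD(2)[OF x, of k] by simp
    moreover have "x (i - 1) = 0" if "i > n" using x that by (simp add: unit_cube_def)
    ultimately show "insert_one n x i = foldq n 0 (2 - 1) 1 x i" by (auto simp: insert_one_def foldq_def)
  qed
qed

text \<open>Letting the factor fall from 2 to 1 deforms the folding into the identity. Points of the
  boundary stay there, since the last coordinate can leave 0 only when another coordinate has
  reached 1.\<close>

lemma val_fold: "val (\<lambda>x. h (foldq n 0 2 (x n) x)) = val h"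
proof -
  let ?w = "\<lambda>t x. foldq n 0 (2 - t) (x n) x"
  have c: "continuous_on ({0..1} \<times> unit_cube (Suc n)) (\<lambda>z. ?w (fst z) (snd z))"
  proof (rule continuous_on_coordinatewise_then_product)
    show "continuous_on ({0..1} \<times> unit_cube (Suc n)) (\<lambda>z. ?w (fst z) (snd z) i)" for i
      unfolding foldq_def by (cases "i < n"; cases "i = n") (auto intro!: continuous_intros)
  qed
  have wc: "?w t x \<in> unit_cube (Suc n)" if "t \<in> {0..1}" "x \<in> unit_cube (Suc n)" for t x
    using that unit_cubeD[OF that(2)] by (intro foldq_in_cube) auto
  have wb: "?w t x \<in> cube_boundary (Suc n)" if t: "t \<in> {0..1}" and x: "x \<in> cube_boundary (Suc n)" for t x
  proof -
    have xc: "x \<in> unit_cube (Suc n)" using x by (simp add: cube_boundary_eq)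
    obtain k where k: "k < Suc n" "x k = 0 \<or> x k = 1" using x by (auto simp: cube_boundary_eq)
    consider "k < n" | "x n = 1" | "x n = 0" using k by (auto simp: less_Suc_eq)
    then show ?thesis
    proof cases
      case 1
      then show ?thesis using k t by (intro boundaryI[OF wc[OF t xc], of k]) (auto simp: foldq_def)
    next
      case 2
      then show ?thesis using collar_sum_nonneg[of "2 - t" x 0 n]
        by (intro boundaryI[OF wc[OF t xc], of n]) (auto simp: foldq_def)
    next
      case 3
      show ?thesis
      proof (cases "(\<Sum>k\<in>{0..<n}. max 0 ((2 - t) * x k - 1)) = 0")
        case True
        then show ?thesis using 3 by (intro boundaryI[OF wc[OF t xc], of n]) (auto simp: foldq_def)
      next
        case False
        then obtain j where "j < n" "min 1 ((2 - t) * x j) = 1" by (rule collar_sum_pos)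
        then show ?thesis by (intro boundaryI[OF wc[OF t xc], of j]) (auto simp: foldq_def)
      qed
    qed
  qed
  let ?E = "hom_induced (int (Suc n)) (cube (Suc n)) (cube_boundary (Suc n)) (cube (Suc n)) (cube_boundary (Suc n))"
  have hb: "h \<in> cube_boundary (Suc n) \<rightarrow> A" using hA by auto
  have w0: "continuous_map (cube (Suc n)) (cube (Suc n)) (?w 0)" "?w 0 \<in> cube_boundary (Suc n) \<rightarrow> cube_boundary (Suc n)"
  proof -
    have "continuous_on (unit_cube (Suc n)) (\<lambda>x. ?w (fst (0::real, x)) (snd (0::real, x)))"
      by (rule continuous_on_compose2[OF c]) (auto intro!: continuous_intros)
    then show "continuous_map (cube (Suc n)) (cube (Suc n)) (?w 0)" using wc[of 0] by (auto simp: cube_eq)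
    show "?w 0 \<in> cube_boundary (Suc n) \<rightarrow> cube_boundary (Suc n)" using wb[of 0] by auto
  qed
  have w1: "?w 1 x = x" if x: "x \<in> unit_cube (Suc n)" for x
  proof
    fix i
    have "max 0 (1 * x k - 1) = 0" for k using unit_cubeD(2)[OF x, of k] by simp
    moreover have "min 1 (1 * x k) = x k" for k using unit_cubeD(2)[OF x, of k] by simp
    moreover have "x i = 0" if "i > n" using x that by (simp add: unit_cube_def)
    ultimately show "?w 1 x i = x i" by (auto simp: foldq_def)
  qed
  have "?E (?w 0) = ?E id"
    unfolding cube_eq by (rule hom_induced_homotopic_on[OF c]) (use wc wb w1 in auto)
  then have "?E (?w 0) v = v" using v by (simp add: hom_induced_id)
  then have "val h = val (h \<circ> ?w 0)" using hom_induced_compose'[OF w0 hc hb, of "int (Suc n)" v] by simp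
  then show ?thesis by (simp add: comp_def)
qed

text \<open>After folding the side walls are constant: where x_i = 1 the surplus has raised the last
  coordinate to 1 as well. The folded cube is then a homotopy from \<open>cross 0\<close> to the
  folded top, to which \<open>fill_from_homotopy\<close> applies.\<close>

theorem fill_cube_faces:
  obtains b where "b \<in> S" "fill b (val h)" "cls b = cls (cross 0) \<otimes>\<^bsub>PG\<^esub> inv\<^bsub>PG\<^esub> cls (face n)"
proof -
  let ?K = "\<lambda>x. h (foldq n 0 2 (x n) x)"
  have T: "folded_top 2 \<in> S" by (rule spheroid_homotopicD(1)[OF folded_top_homotopic])
  have C: "cross 0 \<in> S" by (rule cross_spheroid) simp
  let ?b = "concat_at 0 (cross 0) (folded_top 2 \<circ> flip 0)"
  have wc: "foldq n 0 2 (x n) x \<in> unit_cube (Suc n)" if "x \<in> unit_cube (Suc n)" for x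
    using that unit_cubeD[OF that] by (intro foldq_in_cube) auto
  have "fill ?b (val ?K)"
  proof (rule fill_from_homotopy[OF _ C _ T])
    have "continuous_on (unit_cube (Suc n)) (\<lambda>x. foldq n 0 2 (x n) x)"
    proof (rule continuous_on_coordinatewise_then_product)
      show "continuous_on (unit_cube (Suc n)) (\<lambda>x. foldq n 0 2 (x n) x i)" for i
        unfolding foldq_def by (cases "i < n"; cases "i = n") (auto intro!: continuous_intros)
    qed
    then have "continuous_map (cube (Suc n)) (cube (Suc n)) (\<lambda>x. foldq n 0 2 (x n) x)"
      using wc by (auto simp: cube_eq)
    from continuous_map_compose[OF this hc] show "continuous_map (cube (Suc n)) X ?K" by (simp add: comp_def)
    show "?K x = cross 0 x" if "x \<in> unit_cube n" for x using that by (simp add: cross_def unit_cube_def)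
    show "h (foldq n 0 2 ((x(n := 1)) n) (x(n := 1))) = folded_top 2 x" if "x \<in> unit_cube n" for x
      unfolding folded_top_def
    proof (rule arg_cong[of _ _ h], rule ext)
      fix i
      have "(\<Sum>k\<in>{0..<n}. max 0 (2 * (x(n := 1)) k - 1)) = (\<Sum>k\<in>{0..<n}. max 0 (2 * x k - 1))"
        by (intro sum.cong) auto
      then show "foldq n 0 2 ((x(n := 1)) n) (x(n := 1)) i = foldq n 0 2 1 x i" by (simp add: foldq_def)
    qed
    show "?K x = a0" if x: "x \<in> unit_cube (Suc n)" and i: "i < n" "x i = 0 \<or> x i = 1" for x i
      using i(2)
    proof
      assume "x i = 0"
      then have "foldq n 0 2 (x n) x i = 0" using i by (simp add: foldq_def)
      then show ?thesis using h1[OF wc[OF x] i(1)] by simp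
    next
      assume xi: "x i = 1"
      then have 1: "foldq n 0 2 (x n) x i = 1" using i by (simp add: foldq_def)
      have "max 0 (2 * x i - 1) \<le> (\<Sum>k\<in>{0..<n}. max 0 (2 * x k - 1))"
        using i by (intro member_le_sum) auto
      then have "1 \<le> x n + (\<Sum>k\<in>{0..<n}. max 0 (2 * x k - 1))" using xi unit_cubeD(1)[OF x, of n] by simp
      then have "foldq n 0 2 (x n) x n = 1" by (simp add: foldq_def)
      then show ?thesis using h2[OF wc[OF x], of i n] 1 i by simp
    qed
  qed
  moreover have "cls ?b = cls (cross 0) \<otimes>\<^bsub>PG\<^esub> inv\<^bsub>PG\<^esub> cls (face n)"
  proof -
    have "cls ?b = cls (cross 0) \<otimes>\<^bsub>PG\<^esub> cls (folded_top 2 \<circ> flip 0)"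
      by (rule mult_homotopy_group[OF C flip_spheroids[OF T n0] n0, symmetric])
    also have "cls (folded_top 2 \<circ> flip 0) = inv\<^bsub>PG\<^esub> cls (folded_top 2)"
      by (rule inv_homotopy_group[OF n T base, symmetric])
    also have "cls (folded_top 2) = cls (face n)"
      by (rule cls_eqI[OF folded_top_homotopic])
    finally show ?thesis .
  qed
  ultimately show ?thesis
    using that[of ?b] concat_at_spheroids[OF C flip_spheroids[OF T n0] n0] val_fold by simp
qed

end

section \<open>Cycles with collapsed codimension-two skeleton\<close>

lemma sqnorm_shift: "sqnorm n x = (x 0)\<^sup>2 + (\<Sum>i<n. (x (Suc i))\<^sup>2)"
  unfolding sqnorm_def lessThan_Suc_atMost[symmetric] by (rule sum.lessThan_Suc_shift)

text \<open>For \<open>e = 0\<close>, \<open>ehat n k e w s\<close> is the inversion of the point \<open>((k + 1)/2, w/s)\<close> in the unit sphere,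
  which lies on the \<open>k\<close>-th sphere of the earring.\<close>

definition eden :: "nat \<Rightarrow> nat \<Rightarrow> (nat \<Rightarrow> real) \<Rightarrow> real \<Rightarrow> real" where
  "eden n k w s = ((real k + 1) / 2 * s)\<^sup>2 + (\<Sum>i<n. (w i)\<^sup>2)"

definition ehat :: "nat \<Rightarrow> nat \<Rightarrow> real \<Rightarrow> (nat \<Rightarrow> real) \<Rightarrow> real \<Rightarrow> nat \<Rightarrow> real" where
  "ehat n k e w s i =
     (if i = 0 then (real k + 1) / 2 * s\<^sup>2 / (eden n k w s + e)
      else if i \<le> n then s * w (i - 1) / (eden n k w s + e) else 0)"

lemma eden_nonneg: "0 \<le> eden n k w s"
  unfolding eden_def by (intro add_nonneg_nonneg sum_nonneg) auto

lemma eden_pos: "s \<noteq> 0 \<or> (\<exists>i<n. w i \<noteq> 0) \<Longrightarrow> 0 < eden n k w s"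
proof (elim disjE exE conjE)
  assume "s \<noteq> 0"
  then show ?thesis unfolding eden_def by (intro add_pos_nonneg sum_nonneg) auto
next
  fix i assume "i < n" "w i \<noteq> 0"
  then have "0 < (\<Sum>i<n. (w i)\<^sup>2)" by (intro sum_pos2[of _ i]) auto
  then show ?thesis unfolding eden_def by (intro add_nonneg_pos) auto
qed

lemma ehat_0: "ehat n k e w 0 = earring_base"
  by (auto simp: ehat_def earring_base_def)

lemma ehat_in_esphere:
  assumes "0 < eden n k w s"
  shows "ehat n k 0 w s \<in> esphere n k"
proof -
  define D where "D = eden n k w s"
  define c where "c = (real k + 1) / 2"
  have D: "0 < D" "D = c\<^sup>2 * s\<^sup>2 + (\<Sum>i<n. (w i)\<^sup>2)"
    using assms unfolding D_def c_def eden_def power_mult_distrib by simp_all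
  have "sqnorm n (ehat n k 0 w s) = (c * s\<^sup>2 / D)\<^sup>2 + (\<Sum>i<n. (s * w i / D)\<^sup>2)"
    unfolding sqnorm_shift by (simp add: ehat_def c_def D_def Suc_le_eq)
  also have "(\<Sum>i<n. (s * w i / D)\<^sup>2) = s\<^sup>2 / D\<^sup>2 * (\<Sum>i<n. (w i)\<^sup>2)"
    by (simp add: sum_distrib_left power_mult_distrib power_divide)
  also have "(c * s\<^sup>2 / D)\<^sup>2 + s\<^sup>2 / D\<^sup>2 * (\<Sum>i<n. (w i)\<^sup>2) = s\<^sup>2 / D\<^sup>2 * D"
  proof -
    have "(c * s\<^sup>2 / D)\<^sup>2 + s\<^sup>2 / D\<^sup>2 * (\<Sum>i<n. (w i)\<^sup>2) = s\<^sup>2 / D\<^sup>2 * (c\<^sup>2 * s\<^sup>2 + (\<Sum>i<n. (w i)\<^sup>2))"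
      by (simp add: power_mult_distrib power_divide distrib_left mult.commute power2_eq_square)
    then show ?thesis using D(2) by simp
  qed
  also have "\<dots> = s\<^sup>2 / D" using D by (simp add: power2_eq_square)
  finally have "sqnorm n (ehat n k 0 w s) = s\<^sup>2 / D" .
  moreover have "ehat n k 0 w s 0 = c * s\<^sup>2 / D" by (simp add: ehat_def c_def D_def)
  moreover have "\<forall>i>n. ehat n k 0 w s i = 0" by (simp add: ehat_def)
  ultimately show ?thesis by (simp add: esphere_def c_def)
qed

text \<open>For \<open>e = 0\<close> the value depends only on the ratio of \<open>w\<close> to
  \<open>s\<close>. With c = (k + 1)/2, inversion sends \<open>y\<close> to a point with first
  coordinate c and tangential part c y_(i+1) / y_0, and inverting again returns
  \<open>y\<close>.\<close>

lemma ehat_esphere: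
  assumes y: "y \<in> esphere n k" "y \<noteq> earring_base" and l: "0 < l"
  shows "ehat n k 0 (\<lambda>i. l * ((real k + 1) / 2 * y (Suc i))) (l * y 0) = y"
proof
  fix i
  define c where "c = (real k + 1) / 2"
  have c: "0 < c" by (simp add: c_def)
  have y0: "0 < y 0" by (rule esphere_pos[OF y])
  have "eden n k (\<lambda>i. l * (c * y (Suc i))) (l * y 0) = l\<^sup>2 * c\<^sup>2 * sqnorm n y"
    unfolding eden_def sqnorm_shift c_def[symmetric] by (simp add: power_mult_distrib sum_distrib_left algebra_simps)
  also have "\<dots> = l\<^sup>2 * c * (c * sqnorm n y)" by (simp add: power2_eq_square)
  also have "c * sqnorm n y = y 0" using y(1) by (simp add: esphere_def c_def)
  finally have D: "eden n k (\<lambda>i. l * (c * y (Suc i))) (l * y 0) = l\<^sup>2 * c * y 0" .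
  show "ehat n k 0 (\<lambda>i. l * ((real k + 1) / 2 * y (Suc i))) (l * y 0) i = y i"
    unfolding c_def[symmetric] ehat_def D using l c y0 y(1)
    by (cases i) (auto simp: esphere_def power2_eq_square power_mult_distrib)
qed

section \<open>Simplices modulo their boundary as spheres\<close>

definition minc :: "nat \<Rightarrow> (nat \<Rightarrow> real) \<Rightarrow> real" where "minc n x = Min (x ` {..n})"

lemma minc_le: "i \<le> n \<Longrightarrow> minc n x \<le> x i"
  by (simp add: minc_def)

lemma minc_attained: obtains i where "i \<le> n" "x i = minc n x"
proof -
  have "minc n x \<in> x ` {..n}" unfolding minc_def by (rule Min_in) auto
  then show ?thesis using that by auto
qed

lemma minc_eqI: "(\<And>i. i \<le> n \<Longrightarrow> a \<le> x i) \<Longrightarrow> j \<le> n \<Longrightarrow> x j = a \<Longrightarrow> minc n x = a"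
  unfolding minc_def by (rule Min_eqI) auto

lemma continuous_on_minc: "continuous_on S (minc n)"
proof (induction n)
  case 0
  then show ?case unfolding minc_def by (auto intro: continuous_intros)
next
  case (Suc n)
  have "minc (Suc n) x = min (x (Suc n)) (minc n x)" for x
    unfolding minc_def atMost_Suc image_insert by (rule Min_insert) auto
  then show ?case using Suc by (auto intro!: continuous_intros)
qed

text \<open>For \<open>e = 0\<close> this is the quotient map that collapses the boundary of the
  simplex to the base point of the sphere: the least coordinate plays the part of \<open>s\<close>
  in \<open>ehat\<close>, the differences of coordinates that of \<open>w\<close>. The summand
  \<open>e\<close> keeps the denominator positive where the formula is used off the simplex.\<close>

definition cell :: "nat \<Rightarrow> nat \<Rightarrow> real \<Rightarrow> (nat \<Rightarrow> real) \<Rightarrow> nat \<Rightarrow> real" where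
  "cell n k e x = ehat n k e (\<lambda>i. x i - x n) (minc n x)"

lemma cell_den_pos:
  assumes "x i \<noteq> 0" "i \<le> n"
  shows "0 < eden n k (\<lambda>i. x i - x n) (minc n x)"
proof (rule eden_pos, rule ccontr)
  assume *: "\<not> (minc n x \<noteq> 0 \<or> (\<exists>i<n. x i - x n \<noteq> 0))"
  obtain j where j: "j \<le> n" "x j = minc n x" by (rule minc_attained)
  have "x m = x n" if "m \<le> n" for m using * that by (cases "m = n") auto
  then have "x i = x n" "x j = x n" using assms(2) j(1) by blast+
  then show False using * j assms by simp
qed

lemma simplex_nonzero:
  assumes "x \<in> standard_simplex n" obtains i where "i \<le> n" "0 < x i"
proof -
  have "\<exists>i\<le>n. x i \<noteq> 0"
  proof (rule ccontr)
    assume "\<not> ?thesis"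
    then have "(\<Sum>i\<le>n. x i) = 0" by (intro sum.neutral) auto
    then show False using assms by (simp add: standard_simplex_def)
  qed
  then show ?thesis using that simplex_nonneg[OF assms] by (metis order_le_less)
qed

lemma cell_in_esphere: "x \<in> standard_simplex n \<Longrightarrow> cell n k 0 x \<in> esphere n k"
  unfolding cell_def by (metis ehat_in_esphere cell_den_pos simplex_nonzero less_irrefl)

lemma cell_boundary:
  assumes "\<And>i. i \<le> n \<Longrightarrow> 0 \<le> x i" "j \<le> n" "x j = 0"
  shows "cell n k e x = earring_base"
proof -
  have "minc n x = 0" using assms by (rule minc_eqI)
  then show ?thesis by (simp add: cell_def ehat_0)
qed

text \<open>Equal values mean equal ratios of the coordinate differences to the least coordinate. So
  \<open>x\<close> is a positive multiple of \<open>y\<close>, and the factor is 1 because both have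
  coordinate sum 1.\<close>

lemma cell_inj:
  assumes x: "x \<in> standard_simplex n" and y: "y \<in> standard_simplex n"
    and eq: "cell n k 0 x = cell n k 0 y" "cell n k 0 x \<noteq> earring_base"
  shows "x = y"
proof -
  define c where "c = (real k + 1) / 2"
  define s t where "s = minc n x" and "t = minc n y"
  define D D' where "D = eden n k (\<lambda>i. x i - x n) s" and "D' = eden n k (\<lambda>i. y i - y n) t"
  have c: "0 < c" by (simp add: c_def)
  have "cell n k 0 x 0 \<noteq> 0" "cell n k 0 y 0 \<noteq> 0"
    using esphere_eq_base[OF cell_in_esphere[OF x]] eq by metis+
  then have nz: "s \<noteq> 0" "D \<noteq> 0" "t \<noteq> 0" "D' \<noteq> 0"
    by (auto simp: cell_def ehat_def s_def t_def D_def D'_def)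
  have pos: "0 < s" "0 < t"
    using nz(1,3) simplex_nonneg[OF x] simplex_nonneg[OF y] minc_attained unfolding s_def t_def by (metis order_le_less)+
  have e0: "c * s\<^sup>2 / D = c * t\<^sup>2 / D'"
    using fun_cong[OF eq(1), of 0] by (simp add: cell_def ehat_def c_def s_def t_def D_def D'_def)
  have ei: "s * (x i - x n) / D = t * (y i - y n) / D'" if "i < n" for i
    using fun_cong[OF eq(1), of "Suc i"] that by (simp add: cell_def ehat_def s_def t_def D_def D'_def)
  define l where "l = s / t"
  have l: "0 < l" using pos by (simp add: l_def)
  have diff: "x i - x n = l * (y i - y n)" if "i \<le> n" for i
  proof (cases "i = n")
    case False
    then have "s * (x i - x n) / D = t * (y i - y n) / D'" using ei that by simp
    then have "s * (x i - x n) * D' = t * (y i - y n) * D" using nz by (simp add: field_simps)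
    moreover have "D' * s\<^sup>2 = t\<^sup>2 * D" using e0 nz c by (simp add: field_simps)
    ultimately have "t\<^sup>2 * D * (x i - x n) = s * t * (y i - y n) * D"
      by (metis (no_types, opaque_lifting) mult.assoc mult.commute power2_eq_square)
    then have "t * (x i - x n) = s * (y i - y n)" using nz by (simp add: power2_eq_square)
    then show ?thesis using nz by (simp add: l_def field_simps)
  qed simp
  obtain j where j: "j \<le> n" "x j = s" using minc_attained s_def by metis
  have diffj: "x i - s = l * (y i - y j)" if "i \<le> n" for i using diff[OF that] diff[OF j(1)] j(2) by (simp add: algebra_simps)
  have "minc n y = y j"
  proof (rule minc_eqI[OF _ j(1)])
    fix i assume i: "i \<le> n"
    have "0 \<le> l * (y i - y j)" using diffj[OF i] minc_le[OF i, of x] by (simp add: s_def)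
    then show "y j \<le> y i" using l by (simp add: zero_le_mult_iff)
  qed simp
  then have "x i = l * y i" if "i \<le> n" for i using diffj[OF that] nz by (simp add: l_def t_def field_simps)
  moreover from this have "(\<Sum>i\<le>n. x i) = l * (\<Sum>i\<le>n. y i)" by (simp add: sum_distrib_left)
  then have "l = 1" using x y by (simp add: standard_simplex_def)
  ultimately have "x i = y i" if "i \<le> n" for i using that by simp
  then show ?thesis using x y by (auto simp: standard_simplex_def fun_eq_iff) (metis not_le)
qed

lemma cell_surj:
  assumes y: "y \<in> esphere n k" and n: "0 < n"
  obtains x where "x \<in> standard_simplex n" "cell n k 0 x = y"
proof (cases "y = earring_base")
  case True
  define x :: "nat \<Rightarrow> real" where "x = (\<lambda>i. if i = 0 then 1 else 0)"
  have "x \<in> standard_simplex n" by (auto simp: standard_simplex_def x_def)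
  moreover have "cell n k 0 x = y" using n True by (subst cell_boundary[of n x n]) (auto simp: x_def)
  ultimately show ?thesis by (rule that)
next
  case False
  define c where "c = (real k + 1) / 2"
  have y0: "0 < y 0" by (rule esphere_pos[OF y False])
  \<comment> \<open>\<open>y\<close> prescribes the ratios of the coordinate differences to the
    least coordinate. Shifting these ratios so that the least is 1 and dividing by their sum yields
    the point of the simplex.\<close>
  define q where "q i = (if i < n then c * y (Suc i) / y 0 else 0)" for i
  define p where "p i = q i - minc n q + 1" for i
  have p1: "1 \<le> p i" if "i \<le> n" for i using minc_le[OF that, of q] by (simp add: p_def)
  define B where "B = (\<Sum>i\<le>n. p i)"
  have B: "0 < B" unfolding B_def using p1 by (intro sum_pos) (auto intro: less_le_trans[OF zero_less_one])
  have pB: "p i \<le> B" if "i \<le> n" for i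
    unfolding B_def using that p1 by (intro member_le_sum) (auto intro: order_trans[OF zero_le_one])
  define x where "x i = (if i \<le> n then p i / B else 0)" for i
  have x: "x \<in> standard_simplex n"
  proof -
    have "(\<Sum>i\<le>n. x i) = (\<Sum>i\<le>n. p i) / B" unfolding sum_divide_distrib by (simp add: x_def)
    then have "(\<Sum>i\<le>n. x i) = 1" using B by (simp add: B_def)
    moreover have "0 \<le> x i \<and> x i \<le> 1" for i using p1[of i] pB[of i] B by (auto simp: x_def)
    ultimately show ?thesis by (auto simp: standard_simplex_def x_def)
  qed
  obtain j where j: "j \<le> n" "q j = minc n q" by (rule minc_attained)
  have s: "minc n x = 1 / B"
  proof (rule minc_eqI[OF _ j(1)])
    show "1 / B \<le> x i" if "i \<le> n" for i using p1[OF that] B that by (simp add: x_def divide_right_mono)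
  qed (use j in \<open>auto simp: x_def p_def\<close>)
  define l where "l = 1 / (B * y 0)"
  have l: "0 < l" using B y0 by (simp add: l_def)
  have w: "x i - x n = l * (c * y (Suc i))" if "i < n" for i
    using that by (simp add: x_def p_def q_def l_def diff_divide_distrib[symmetric])
  have "cell n k 0 x = ehat n k 0 (\<lambda>i. l * (c * y (Suc i))) (l * y 0)"
  proof
    fix i
    have "eden n k (\<lambda>i. x i - x n) (1 / B) = eden n k (\<lambda>i. l * (c * y (Suc i))) (1 / B)"
      using w by (simp add: eden_def)
    moreover have "l * y 0 = 1 / B" using y0 by (simp add: l_def)
    ultimately show "cell n k 0 x i = ehat n k 0 (\<lambda>i. l * (c * y (Suc i))) (l * y 0) i"
      using w[of "i - 1"] unfolding cell_def s by (auto simp: ehat_def)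
  qed
  also have "\<dots> = y" using ehat_esphere[OF y False l] by (simp add: c_def)
  finally show ?thesis using that x by blast
qed

lemma continuous_on_ehat:
  assumes "continuous_on S e" "\<And>i. i < n \<Longrightarrow> continuous_on S (\<lambda>x. w x i)" "continuous_on S s"
    and "\<And>x. x \<in> S \<Longrightarrow> eden n k (w x) (s x) + e x \<noteq> 0"
  shows "continuous_on S (\<lambda>x. ehat n k (e x) (w x) (s x))"
proof (rule continuous_on_coordinatewise_then_product)
  fix i
  have D: "continuous_on S (\<lambda>x. eden n k (w x) (s x) + e x)"
    unfolding eden_def using assms(1-3) by (auto intro!: continuous_intros)
  show "continuous_on S (\<lambda>x. ehat n k (e x) (w x) (s x) i)"
  proof (cases i)
    case 0
    have "continuous_on S (\<lambda>x. (real k + 1) / 2 * (s x)\<^sup>2 / (eden n k (w x) (s x) + e x))"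
      using D assms(3,4) by (intro continuous_on_divide) (auto intro!: continuous_intros)
    then show ?thesis unfolding ehat_def using 0 by simp
  next
    case (Suc j)
    have "continuous_on S (\<lambda>x. s x * w x j / (eden n k (w x) (s x) + e x))" if "j < n"
      using D assms(3,4) assms(2)[OF that] by (intro continuous_on_divide) (auto intro!: continuous_intros)
    then show ?thesis unfolding ehat_def using Suc by (cases "j < n") auto
  qed
qed

definition drop_coord :: "nat \<Rightarrow> (nat \<Rightarrow> real) \<Rightarrow> nat \<Rightarrow> real" where
  "drop_coord j x i = x (if i < j then i else Suc i)"

lemma drop_coord_simplical_face: "drop_coord j (simplical_face j x) = x"
  by (auto simp: drop_coord_def simplical_face_def)

lemma continuous_on_drop_coord: "continuous_on S (drop_coord j)"
  by (rule continuous_on_coordinatewise_then_product) (auto simp: drop_coord_def intro!: continuous_intros)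

lemma continuous_on_cell:
  assumes e: "continuous_on S e" and d: "continuous_on S d"
    and "\<And>x. x \<in> S \<Longrightarrow> 0 \<le> e x" "\<And>x. x \<in> S \<Longrightarrow> e x = 0 \<Longrightarrow> d x \<in> standard_simplex n"
  shows "continuous_on S (\<lambda>x. cell n k (e x) (d x))"
  unfolding cell_def
proof (rule continuous_on_ehat[OF e])
  have "continuous_on S (\<lambda>x. d x i)" for i
    using continuous_on_compose2[OF continuous_on_coordinates(1) d] by blast
  then show "continuous_on S (\<lambda>x. d x i - d x n)" for i by (intro continuous_intros)
  show "continuous_on S (\<lambda>x. minc n (d x))"
    using continuous_on_compose2[OF continuous_on_minc d] by blast
  fix x assume x: "x \<in> S"
  show "eden n k (\<lambda>i. d x i - d x n) (minc n (d x)) + e x \<noteq> 0"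
  proof (cases "e x = 0")
    case True
    then show ?thesis using cell_den_pos simplex_nonzero assms(4)[OF x True] by (metis add.right_neutral less_irrefl)
  next
    case False
    then show ?thesis using assms(3)[OF x] eden_nonneg[of n k "\<lambda>i. d x i - d x n" "minc n (d x)"] by linarith
  qed
qed

lemma drop_coord_simplex:
  assumes "x \<in> standard_simplex (Suc n)" "x j = 0" "j \<le> Suc n"
  shows "drop_coord j x \<in> standard_simplex n"
proof -
  have "(\<Sum>i\<in>{..Suc n} - {j}. x i) = (\<Sum>i\<le>n. drop_coord j x i)"
    by (rule sum.reindex_bij_witness[of _ "\<lambda>i. if i < j then i else Suc i" "\<lambda>i. if i < j then i else i - 1"])
       (use assms in \<open>auto simp: drop_coord_def\<close>)
  moreover have "(\<Sum>i\<in>{..Suc n} - {j}. x i) = (\<Sum>i\<le>Suc n. x i)"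
    using assms by (intro sum.mono_neutral_left) auto
  ultimately show ?thesis using assms by (auto simp: standard_simplex_def drop_coord_def)
qed

section \<open>Homotopy addition for singular simplices\<close>

locale simplex_filling = filling_context n X A a0 "transferred_class (Suc n)" for n :: nat and X :: "'a topology" and A a0
begin

definition skeletal :: "((nat \<Rightarrow> real) \<Rightarrow> 'a) \<Rightarrow> bool" where
  "skeletal \<sigma> \<longleftrightarrow> singular_simplex (Suc n) X \<sigma> \<and> \<sigma> ` simplex_boundary (Suc n) \<subseteq> A \<and>
     (\<forall>x\<in>standard_simplex (Suc n). \<forall>i\<le>Suc n. \<forall>j\<le>Suc n. i \<noteq> j \<and> x i = 0 \<and> x j = 0 \<longrightarrow> \<sigma> x = a0)"

lemma skeletal_cube_faces:
  assumes "skeletal \<sigma>"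
  shows "cube_faces n X A a0 (transferred_class (Suc n)) (\<sigma> \<circ> theta (Suc n))"
proof
  have s: "continuous_map (top_of_set (standard_simplex (Suc n))) X \<sigma>" "\<sigma> ` simplex_boundary (Suc n) \<subseteq> A"
    and z: "\<And>x i j. x\<in>standard_simplex (Suc n) \<Longrightarrow> i \<le> Suc n \<Longrightarrow> j \<le> Suc n \<Longrightarrow> i \<noteq> j \<Longrightarrow> x i = 0 \<Longrightarrow> x j = 0 \<Longrightarrow> \<sigma> x = a0"
    using assms unfolding skeletal_def singular_simplex_def simplex_top by blast+
  have "continuous_map (cube (Suc n)) (top_of_set (standard_simplex (Suc n))) (theta (Suc n))"
    using theta_in_simplex continuous_on_theta by (auto simp: cube_eq)
  then show "continuous_map (cube (Suc n)) X (\<sigma> \<circ> theta (Suc n))" using s(1) by (rule continuous_map_compose)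
  show "(\<sigma> \<circ> theta (Suc n)) x \<in> A" if "x \<in> cube_boundary (Suc n)" for x
    using s(2) theta_boundary[OF that] by auto
  show "(\<sigma> \<circ> theta (Suc n)) x = a0" if "x \<in> unit_cube (Suc n)" "i < n" "x i = 0" for x i
    using z[OF theta_in_simplex[OF that(1)], of n "Suc n"] theta_eq_0(2)[of x i, OF that(3)] that(2) by simp
  show "(\<sigma> \<circ> theta (Suc n)) x = a0"
    if "x \<in> unit_cube (Suc n)" "i \<le> n" "j \<le> n" "i \<noteq> j" "x i = 1" "x j = 1" for x i j
    using z[OF theta_in_simplex[OF that(1)], of i j] theta_eq_0(1) that by simp
  show "(\<sigma> \<circ> theta (Suc n)) x = a0" if "x \<in> unit_cube (Suc n)" "i < n" "x i = 1" "x n = 0" for x i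
    using z[OF theta_in_simplex[OF that(1)], of i "Suc n"] theta_eq_0(1)[of x i, OF that(3), of "Suc n"]
      theta_eq_0(2)[of x n, OF that(4), of "Suc n" "Suc n"] that by simp
qed

lemma skeletal_face:
  assumes "skeletal \<sigma>" "m \<le> n"
  shows "cube_faces.face (\<sigma> \<circ> theta (Suc n)) m \<in> S"
    "cls (cube_faces.face (\<sigma> \<circ> theta (Suc n)) m) = cls (singular_face (Suc n) m \<sigma> \<circ> theta n)"
    "singular_face (Suc n) m \<sigma> \<circ> theta n \<in> S"
proof -
  interpret cube_faces n X A a0 "transferred_class (Suc n)" "\<sigma> \<circ> theta (Suc n)" by (rule skeletal_cube_faces[OF assms(1)])
  show f: "face m \<in> S" by (rule face_spheroid[OF assms(2)])
  have "face m x = (singular_face (Suc n) m \<sigma> \<circ> theta n) x" if "x \<in> unit_cube n" for x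
    using theta_in_simplex[OF that] assms(2) by (simp add: face_def theta_insert_one singular_face_def)
  then have h: "spheroid_homotopic n (subtopology X A) a0 (face m) (singular_face (Suc n) m \<sigma> \<circ> theta n)"
    by (intro spheroid_homotopic_eqI f)
  show "cls (face m) = cls (singular_face (Suc n) m \<sigma> \<circ> theta n)" by (rule cls_eqI[OF h])
  show "singular_face (Suc n) m \<sigma> \<circ> theta n \<in> S" by (rule spheroid_homotopicD(2)[OF h])
qed

lemma skeletal_last_face:
  assumes "skeletal \<sigma>"
  shows "cls (cube_faces.cross n (\<sigma> \<circ> theta (Suc n)) n) = cls (singular_face (Suc n) (Suc n) \<sigma> \<circ> theta n)"
    "singular_face (Suc n) (Suc n) \<sigma> \<circ> theta n \<in> S"
proof -
  interpret cube_faces n X A a0 "transferred_class (Suc n)" "\<sigma> \<circ> theta (Suc n)" by (rule skeletal_cube_faces[OF assms(1)])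
  have c: "cross n \<in> S" by (rule cross_spheroid) simp
  have "cross n x = (singular_face (Suc n) (Suc n) \<sigma> \<circ> theta n) x" if "x \<in> unit_cube n" for x
    using theta_in_simplex[OF that] theta_last_zero[of x n, OF unit_cube_coordinate_0[OF that]]
    by (simp add: cross_last[OF that] singular_face_def)
  then have h: "spheroid_homotopic n (subtopology X A) a0 (cross n) (singular_face (Suc n) (Suc n) \<sigma> \<circ> theta n)"
    by (intro spheroid_homotopic_eqI c)
  show "cls (cross n) = cls (singular_face (Suc n) (Suc n) \<sigma> \<circ> theta n)" by (rule cls_eqI[OF h])
  show "singular_face (Suc n) (Suc n) \<sigma> \<circ> theta n \<in> S" by (rule spheroid_homotopicD(2)[OF h])
qed

text \<open>The factor brings the boundary of a simplex into the form that the folded cube produces: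
  the bottom, then the walls with alternating signs, and the top with a minus sign.\<close>

lemma alternating_faces:
  fixes \<tau> :: "nat \<Rightarrow> 'b"
  shows "frag_cmul ((-1) ^ Suc n) (\<Sum>k\<le>Suc n. frag_cmul ((-1) ^ k) (frag_of (\<tau> k)))
    = frag_of (\<tau> (Suc n)) + (\<Sum>k<n. frag_cmul ((-1) ^ (n - 1 - k)) (frag_of (\<tau> k))) - frag_of (\<tau> n)"
proof -
  have s: "(-1 :: int) ^ Suc n * (-1) ^ k = (-1) ^ (n - 1 - k)" if "k < n" for k
  proof -
    have "Suc n + k = (n - 1 - k) + 2 * Suc k" using that by simp
    then have "(-1 :: int) ^ (Suc n + k) = (-1) ^ (n - 1 - k) * (-1) ^ (2 * Suc k)" by (metis power_add)
    then show ?thesis by (simp only: power_add power_mult) simp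
  qed
  have "frag_cmul ((-1) ^ Suc n) (\<Sum>k\<le>Suc n. frag_cmul ((-1) ^ k) (frag_of (\<tau> k)))
    = (\<Sum>k\<le>Suc n. frag_cmul ((-1) ^ Suc n * (-1) ^ k) (frag_of (\<tau> k)))" by (simp only: frag_cmul_sum frag_cmul_cmul)
  also have "\<dots> = (\<Sum>k<n. frag_cmul ((-1) ^ Suc n * (-1) ^ k) (frag_of (\<tau> k)))
      + frag_cmul ((-1) ^ Suc n * (-1) ^ n) (frag_of (\<tau> n)) + frag_cmul ((-1) ^ Suc n * (-1) ^ Suc n) (frag_of (\<tau> (Suc n)))"
    by (simp only: sum.atMost_Suc lessThan_Suc_atMost[symmetric] sum.lessThan_Suc)
  also have "(\<Sum>k<n. frag_cmul ((-1) ^ Suc n * (-1) ^ k) (frag_of (\<tau> k))) = (\<Sum>k<n. frag_cmul ((-1) ^ (n - 1 - k)) (frag_of (\<tau> k)))"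
    using s by (intro sum.cong) auto
  also have "(-1 :: int) ^ Suc n * (-1) ^ n = -1" by (simp flip: power_add)
  also have "(-1 :: int) ^ Suc n * (-1) ^ Suc n = 1" by (simp flip: power_add)
  finally show ?thesis by simp
qed

definition face_spheroids :: "((nat \<Rightarrow> real) \<Rightarrow> 'a) set" where "face_spheroids = {\<tau>. \<tau> \<circ> theta n \<in> S}"

text \<open>The homotopy addition theorem.\<close>

lemma fill_skeletal:
  assumes \<sigma>: "skeletal \<sigma>" and h: "h \<in> hom (free_Abelian_group face_spheroids) PG"
    and hf: "\<And>\<tau>. \<tau> \<in> face_spheroids \<Longrightarrow> h (frag_of \<tau>) = cls (\<tau> \<circ> theta n)"
  obtains b where "b \<in> S" "fill b (homologous_rel_set (Suc n) X A (frag_of \<sigma>))"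
    "cls b = h (frag_cmul ((-1) ^ Suc n) (chain_boundary (Suc n) (frag_of \<sigma>)))"
proof -
  interpret cube_faces n X A a0 "transferred_class (Suc n)" "\<sigma> \<circ> theta (Suc n)" by (rule skeletal_cube_faces[OF \<sigma>])
  interpret PG: comm_group PG by (rule comm_group_homotopy_group[OF n base])
  interpret h: group_hom "free_Abelian_group face_spheroids" PG h
    using h by (simp add: group_hom_def group_hom_axioms_def PG.is_group)
  let ?\<tau> = "\<lambda>k. singular_face (Suc n) k \<sigma>"
  have \<tau>: "?\<tau> k \<in> face_spheroids" if "k \<le> Suc n" for k
    using skeletal_face(3)[OF \<sigma>, of k] skeletal_last_face(2)[OF \<sigma>] that by (cases "k = Suc n") (auto simp: face_spheroids_def)
  have sg: "signed i (cls (face k)) = h (frag_cmul ((-1) ^ i) (frag_of (?\<tau> k)))" if k: "k \<le> n" for i k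
  proof -
    have "cls (face k) = h (frag_of (?\<tau> k))" using hf[OF \<tau>, of k] skeletal_face(2)[OF \<sigma> k] k by simp
    moreover have "h (- frag_of (?\<tau> k)) = inv\<^bsub>PG\<^esub> h (frag_of (?\<tau> k))"
      using h.hom_inv[of "frag_of (?\<tau> k)"] \<tau>[of k] k by simp
    ultimately show ?thesis by (simp add: signed_def)
  qed
  have ks: "Poly_Mapping.keys (\<Sum>k<j. frag_cmul ((-1) ^ (n - 1 - k)) (frag_of (?\<tau> k))) \<subseteq> face_spheroids" if "j \<le> n" for j
  proof -
    have "(\<Sum>k<j. frag_cmul ((-1) ^ (n - 1 - k)) (frag_of (?\<tau> k))) \<in> carrier (free_Abelian_group face_spheroids)"
      using \<tau> that by (intro sum_closed_free_Abelian_group) (auto simp: keys_cmul[THEN subsetD])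
    then show ?thesis by simp
  qed
  \<comment> \<open>The walls are peeled off one at a time, each contributing its face with the sign
    of the coordinate permutation.\<close>
  have iter: "cls (cross 0) = cls (cross j) \<otimes>\<^bsub>PG\<^esub> h (\<Sum>k<j. frag_cmul ((-1) ^ (n - 1 - k)) (frag_of (?\<tau> k)))" if "j \<le> n" for j
    using that
  proof (induction j)
    case 0
    have "cls (cross 0) \<in> carrier PG" using cross_spheroid[of 0] by (simp add: carrier_homotopy_group)
    moreover have "h 0 = \<one>\<^bsub>PG\<^esub>" using h.hom_one by simp
    ultimately show ?case by (simp only: lessThan_0 sum.empty PG.r_one)
  next
    case (Suc j)
    let ?s = "\<Sum>k<j. frag_cmul ((-1) ^ (n - 1 - k)) (frag_of (?\<tau> k))"
    let ?t = "frag_cmul ((-1) ^ (n - 1 - j)) (frag_of (?\<tau> j))"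
    have c: "cls (cross (Suc j)) \<in> carrier PG" using cross_spheroid[of "Suc j"] Suc by (simp add: carrier_homotopy_group)
    have st: "?s \<in> carrier (free_Abelian_group face_spheroids)" "?t \<in> carrier (free_Abelian_group face_spheroids)"
      using ks[of j] Suc \<tau>[of j] by (auto simp: keys_cmul[THEN subsetD])
    have "cls (cross 0) = (cls (cross (Suc j)) \<otimes>\<^bsub>PG\<^esub> h ?t) \<otimes>\<^bsub>PG\<^esub> h ?s"
    proof -
      have "cls (cross 0) = cls (cross j) \<otimes>\<^bsub>PG\<^esub> h ?s" by (rule Suc.IH) (use Suc.prems in simp)
      moreover have "j < n" "j \<le> n" using Suc.prems by auto
      then have "cls (cross j) = cls (cross (Suc j)) \<otimes>\<^bsub>PG\<^esub> h ?t" using cls_cross_step[of j] sg[of j "n - 1 - j"] by metis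
      ultimately show ?thesis by metis
    qed
    also have "\<dots> = cls (cross (Suc j)) \<otimes>\<^bsub>PG\<^esub> h (?s + ?t)"
      using c st h.hom_mult[OF st] h.hom_closed[OF st(1)] h.hom_closed[OF st(2)] by (simp add: PG.m_ac)
    finally show ?case by (simp only: sum.lessThan_Suc)
  qed
  obtain b where b: "b \<in> S" "fill b (val (\<sigma> \<circ> theta (Suc n)))" "cls b = cls (cross 0) \<otimes>\<^bsub>PG\<^esub> inv\<^bsub>PG\<^esub> cls (face n)"
    by (rule fill_cube_faces)
  have "val (\<sigma> \<circ> theta (Suc n)) = homologous_rel_set (Suc n) X A (frag_of \<sigma>)"
    using \<sigma> by (intro hom_induced_transferred) (auto simp: skeletal_def)
  moreover have "cls b = h (frag_cmul ((-1) ^ Suc n) (chain_boundary (Suc n) (frag_of \<sigma>)))"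
  proof -
    let ?s = "\<Sum>k<n. frag_cmul ((-1) ^ (n - 1 - k)) (frag_of (?\<tau> k))"
    let ?C = "carrier (free_Abelian_group face_spheroids)"
    have C: "frag_of (?\<tau> (Suc n)) \<in> ?C" "?s \<in> ?C" "- frag_of (?\<tau> n) \<in> ?C" "frag_of (?\<tau> (Suc n)) + ?s \<in> ?C"
    proof -
      show 1: "frag_of (?\<tau> (Suc n)) \<in> ?C" "?s \<in> ?C" using \<tau> ks[of n] by auto
      show "- frag_of (?\<tau> n) \<in> ?C" using \<tau>[of n] by (simp add: keys_minus)
      show "frag_of (?\<tau> (Suc n)) + ?s \<in> ?C" using h.G.m_closed[OF 1] by simp
    qed
    have "cls b = (h (frag_of (?\<tau> (Suc n))) \<otimes>\<^bsub>PG\<^esub> h ?s) \<otimes>\<^bsub>PG\<^esub> h (- frag_of (?\<tau> n))"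
      using b(3) iter[of n] skeletal_last_face(1)[OF \<sigma>] hf[OF \<tau>, of "Suc n"] sg[of n 1] by (simp add: signed_def)
    also have "\<dots> = h ((frag_of (?\<tau> (Suc n)) + ?s) + - frag_of (?\<tau> n))"
      using h.hom_mult[OF C(1,2)] h.hom_mult[OF C(4,3)] by simp
    also have "(frag_of (?\<tau> (Suc n)) + ?s) + - frag_of (?\<tau> n) = frag_cmul ((-1) ^ Suc n) (chain_boundary (Suc n) (frag_of \<sigma>))"
      unfolding chain_boundary_of using alternating_faces[of ?\<tau>] by simp
    finally show ?thesis .
  qed
  ultimately show ?thesis using that[OF b(1)] b(2) by simp
qed

lemma fill_zero: "fill (\<lambda>_. a0) (homologous_rel_set (Suc n) X A 0)"
proof -
  have c: "continuous_map (cube (Suc n)) X (\<lambda>_. a0)" using a0 by simp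
  have "val (\<lambda>_. a0) = \<one>\<^bsub>HG\<^esub>" using a0 by (intro hom_induced_into_subset c) auto
  also have "\<dots> = homologous_rel_set (Suc n) X A 0"
    unfolding one_relative_homology_group by (rule sym) (simp add: homologous_rel_set_eq_relboundary)
  finally show ?thesis using c unfolding rel_filling_def by blast
qed

text \<open>By induction on chains, a chain of skeletal simplices is filled over a spheroid in
  \<open>A\<close> whose class is the image of the signed boundary under the homomorphism
  \<open>h\<close> that evaluates faces. For a cycle this class is trivial, the boundary can be made
  constant, and the filling becomes a spheroid.\<close>

theorem spheroid_of_cycle:
  assumes c: "\<And>\<sigma>. \<sigma> \<in> Poly_Mapping.keys c \<Longrightarrow> skeletal \<sigma>" and cyc: "chain_boundary (Suc n) c = 0"
  obtains H where "H \<in> spheroids (Suc n) X a0" "val H = homologous_rel_set (Suc n) X A c"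
proof -
  interpret PG: comm_group PG by (rule comm_group_homotopy_group[OF n base])
  interpret HG: comm_group HG by simp
  obtain h where h: "h \<in> hom (free_Abelian_group face_spheroids) PG"
    and hf: "\<And>\<tau>. \<tau> \<in> face_spheroids \<Longrightarrow> h (frag_of \<tau>) = cls (\<tau> \<circ> theta n)"
    using PG.free_Abelian_group_universal[of "\<lambda>\<tau>. cls (\<tau> \<circ> theta n)" face_spheroids]
    by (auto simp: face_spheroids_def carrier_homotopy_group)
  interpret h: group_hom "free_Abelian_group face_spheroids" PG h
    using h by (simp add: group_hom_def group_hom_axioms_def PG.is_group)
  let ?C = "carrier (free_Abelian_group face_spheroids)"
  let ?d = "\<lambda>c. frag_cmul ((-1) ^ Suc n) (chain_boundary (Suc n) c)"
  have "singular_relcycle (Suc n) X A c \<and> ?d c \<in> ?C \<and>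
     (\<exists>b\<in>S. fill b (homologous_rel_set (Suc n) X A c) \<and> cls b = h (?d c))"
  proof (rule frag_induction[of c "Collect skeletal"])
    show "Poly_Mapping.keys c \<subseteq> Collect skeletal" using c by auto
    have "(\<lambda>_. a0) \<in> S" by (rule const_spheroids[OF base])
    then show "singular_relcycle (Suc n) X A 0 \<and> ?d 0 \<in> ?C \<and>
       (\<exists>b\<in>S. fill b (homologous_rel_set (Suc n) X A 0) \<and> cls b = h (?d 0))"
      using fill_zero h.hom_one by (auto simp: one_homotopy_group intro!: bexI[of _ "\<lambda>_. a0"])
  next
    fix \<sigma> assume "\<sigma> \<in> Collect skeletal"
    then have \<sigma>: "skeletal \<sigma>" by simp
    obtain b where b: "b \<in> S" "fill b (homologous_rel_set (Suc n) X A (frag_of \<sigma>))" "cls b = h (?d (frag_of \<sigma>))"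
      by (rule fill_skeletal[OF \<sigma> h hf])
    have "singular_relcycle (Suc n) X A (frag_of \<sigma>)"
      using \<sigma> by (intro singular_relcycle_simplex) (auto simp: skeletal_def)
    moreover have "singular_face (Suc n) k \<sigma> \<in> face_spheroids" if "k \<le> Suc n" for k
      using skeletal_face(3)[OF \<sigma>, of k] skeletal_last_face(2)[OF \<sigma>] that by (cases "k = Suc n") (auto simp: face_spheroids_def)
    then have "?d (frag_of \<sigma>) \<in> ?C"
      unfolding chain_boundary_of frag_cmul_sum
      by (simp only: if_False Suc_not_Zero frag_cmul_sum, intro sum_closed_free_Abelian_group) (auto dest!: keys_cmul[THEN subsetD])
    ultimately show "singular_relcycle (Suc n) X A (frag_of \<sigma>) \<and> ?d (frag_of \<sigma>) \<in> ?C \<and>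
       (\<exists>b\<in>S. fill b (homologous_rel_set (Suc n) X A (frag_of \<sigma>)) \<and> cls b = h (?d (frag_of \<sigma>)))" using b by blast
  next
    fix x y
    assume "singular_relcycle (Suc n) X A x \<and> ?d x \<in> ?C \<and> (\<exists>b\<in>S. fill b (homologous_rel_set (Suc n) X A x) \<and> cls b = h (?d x))"
      and "singular_relcycle (Suc n) X A y \<and> ?d y \<in> ?C \<and> (\<exists>b\<in>S. fill b (homologous_rel_set (Suc n) X A y) \<and> cls b = h (?d y))"
    then obtain a b where a: "singular_relcycle (Suc n) X A x" "?d x \<in> ?C" "a \<in> S" "fill a (homologous_rel_set (Suc n) X A x)" "cls a = h (?d x)"
      and b: "singular_relcycle (Suc n) X A y" "?d y \<in> ?C" "b \<in> S" "fill b (homologous_rel_set (Suc n) X A y)" "cls b = h (?d y)" by blast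
    have b': "b \<circ> flip 0 \<in> S" by (rule flip_spheroids[OF b(3) n0])
    have xy: "singular_relcycle (Suc n) X A (x - y)" by (rule singular_relcycle_diff[OF a(1) b(1)])
    have in_HG: "homologous_rel_set (Suc n) X A w \<in> carrier HG" if "singular_relcycle (Suc n) X A w" for w
      using that unfolding carrier_relative_homology_group by blast
    have "homologous_rel_set (Suc n) X A (x - y) \<otimes>\<^bsub>HG\<^esub> homologous_rel_set (Suc n) X A y = homologous_rel_set (Suc n) X A x"
      using mult_homologous_rel_set[OF xy b(1)] by simp
    then have "homologous_rel_set (Suc n) X A (x - y)
        = homologous_rel_set (Suc n) X A x \<otimes>\<^bsub>HG\<^esub> inv\<^bsub>HG\<^esub> homologous_rel_set (Suc n) X A y"
      using in_HG[OF a(1)] in_HG[OF b(1)] in_HG[OF xy] by (metis HG.inv_solve_right)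
    then have "fill (concat_at 0 a (b \<circ> flip 0)) (homologous_rel_set (Suc n) X A (x - y))"
      using fill_mult[OF a(3) b' a(4) fill_inv[OF b(3,4)]] by simp
    moreover have "?d (x - y) = ?d x + - ?d y"
    proof -
      have "frag_cmul k (u - w) = frag_cmul k u + - frag_cmul k w" for k :: int and u w :: "'a chain"
        by (rule poly_mapping_eqI) (simp add: lookup_minus lookup_add right_diff_distrib)
      then show ?thesis by (simp only: chain_boundary_diff)
    qed
    moreover have m: "- ?d y \<in> ?C" using b(2) by (simp only: carrier_free_Abelian_group_iff keys_minus)
    moreover have "?d x + - ?d y \<in> ?C" using h.G.m_closed[OF a(2) m] by simp
    moreover have "cls (concat_at 0 a (b \<circ> flip 0)) = h (?d x + - ?d y)"
    proof -
      have "cls (concat_at 0 a (b \<circ> flip 0)) = cls a \<otimes>\<^bsub>PG\<^esub> inv\<^bsub>PG\<^esub> cls b"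
        by (simp only: mult_homotopy_group[OF a(3) b' n0] inv_homotopy_group[OF n b(3) base])
      also have "inv\<^bsub>PG\<^esub> cls b = h (- ?d y)"
        using h.hom_inv[OF b(2)] b(2,5) by (simp only: carrier_free_Abelian_group_iff inv_free_Abelian_group)
      also have "cls a \<otimes>\<^bsub>PG\<^esub> h (- ?d y) = h (?d x + - ?d y)" using h.hom_mult[OF a(2) m] a(5) by simp
      finally show ?thesis .
    qed
    ultimately show "singular_relcycle (Suc n) X A (x - y) \<and> ?d (x - y) \<in> ?C \<and>
       (\<exists>b\<in>S. fill b (homologous_rel_set (Suc n) X A (x - y)) \<and> cls b = h (?d (x - y)))"
      using xy concat_at_spheroids[OF a(3) b' n0] by (intro conjI bexI[of _ "concat_at 0 a (b \<circ> flip 0)"]) metis+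
  qed
  then obtain b where b: "b \<in> S" "fill b (homologous_rel_set (Suc n) X A c)" "cls b = h 0" by (auto simp: cyc)
  have "cls b = cls (\<lambda>_. a0)" using b(3) h.hom_one by (simp add: one_homotopy_group)
  then have "fill (\<lambda>_. a0) (homologous_rel_set (Suc n) X A c)"
    using fill_class[OF b(1) const_spheroids[OF base] _ b(2)] by simp
  then show ?thesis by (rule fill_const) (rule that)
qed

end

section \<open>Lifting a cycle to the space of tagged points\<close>

lemma inj_hom_induced_triple:
  assumes "T \<subseteq> S" "trivial_group (relative_homology_group p (subtopology X S) T)"
  shows "inj_on (hom_induced p X T X S id) (carrier (relative_homology_group p X T))"
proof -
  let ?i = "hom_induced p (subtopology X S) T X T id"
  interpret i: group_hom "relative_homology_group p (subtopology X S) T" "relative_homology_group p X T" ?i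
    by (simp add: group_hom_def group_hom_axioms_def hom_induced_hom)
  interpret j: group_hom "relative_homology_group p X T" "relative_homology_group p X S" "hom_induced p X T X S id"
    by (simp add: group_hom_def group_hom_axioms_def hom_induced_hom)
  have "?i ` carrier (relative_homology_group p (subtopology X S) T)
    = kernel (relative_homology_group p X T) (relative_homology_group p X S) (hom_induced p X T X S id)"
    using homology_exactness_triple_3[OF assms(1), of p X] by simp
  moreover have "?i ` carrier (relative_homology_group p (subtopology X S) T) = {\<one>\<^bsub>relative_homology_group p X T\<^esub>}"
    using assms(2) i.hom_one by (auto simp: trivial_group_def)
  ultimately show ?thesis unfolding j.inj_iff_trivial_ker by metis
qed

text \<open>A choice of lifts simplex by simplex commutes with the boundary once the faces of a lift
  are the lifts of the faces; cycles then lift to cycles.\<close>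

lemma chain_boundary_lift:
  assumes "\<And>\<sigma> j. \<sigma> \<in> Poly_Mapping.keys c \<Longrightarrow> j \<le> Suc m \<Longrightarrow> singular_face (Suc m) j (L' \<sigma>) = L (singular_face (Suc m) j \<sigma>)"
  shows "chain_boundary (Suc m) (frag_extend (frag_of \<circ> L') c) = frag_extend (frag_of \<circ> L) (chain_boundary (Suc m) c)"
  using subset_refl[of "Poly_Mapping.keys c"]
proof (rule frag_induction[of c "Poly_Mapping.keys c"])
  fix \<sigma> assume \<sigma>: "\<sigma> \<in> Poly_Mapping.keys c"
  have "(\<Sum>k\<le>Suc m. frag_cmul ((-1) ^ k) (frag_of (singular_face (Suc m) k (L' \<sigma>))))
      = (\<Sum>k\<le>Suc m. frag_cmul ((-1) ^ k) (frag_of (L (singular_face (Suc m) k \<sigma>))))"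
    using assms[OF \<sigma>] by (intro sum.cong) auto
  then show "chain_boundary (Suc m) (frag_extend (frag_of \<circ> L') (frag_of \<sigma>)) = frag_extend (frag_of \<circ> L) (chain_boundary (Suc m) (frag_of \<sigma>))"
    by (simp add: chain_boundary_of frag_extend_sum frag_extend_cmul del: sum.atMost_Suc)
qed (auto simp: frag_extend_diff chain_boundary_diff)

lemma chain_map_lift:
  assumes "\<And>\<sigma>. \<sigma> \<in> Poly_Mapping.keys c \<Longrightarrow> simplex_map p f (L \<sigma>) = \<sigma>"
  shows "chain_map p f (frag_extend (frag_of \<circ> L) c) = c"
  using subset_refl[of "Poly_Mapping.keys c"]
  by (rule frag_induction[of c "Poly_Mapping.keys c"]) (auto simp: assms frag_extend_diff chain_map_diff)

text \<open>Every cell of dimension \<open>n\<close> of the cycle is tagged with its own sphere of a finite bouquet, so that in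
  \<open>X \<times> \<real>\<^sup>\<nat>\<close> the union of the lifted faces is that bouquet, whose homology vanishes in degree \<open>n + 1\<close>.\<close>

locale skeletal_cycle =
  fixes n :: nat and X :: "'a topology" and x0 :: 'a and z :: "'a chain"
  assumes n: "2 \<le> n" and x0: "x0 \<in> topspace X"
    and z: "singular_chain (Suc n) X z" and cyc: "chain_boundary (Suc n) z = 0"
    and skel: "\<And>\<sigma> x i j. \<sigma> \<in> Poly_Mapping.keys z \<Longrightarrow> x \<in> standard_simplex (Suc n) \<Longrightarrow> i \<le> Suc n \<Longrightarrow> j \<le> Suc n \<Longrightarrow>
      i \<noteq> j \<Longrightarrow> x i = 0 \<Longrightarrow> x j = 0 \<Longrightarrow> \<sigma> x = x0"
begin

definition faces :: "((nat \<Rightarrow> real) \<Rightarrow> 'a) set" where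
  "faces = (\<Union>\<sigma>\<in>Poly_Mapping.keys z. (\<lambda>j. singular_face (Suc n) j \<sigma>) ` {..Suc n})"

abbreviation "label \<equiv> to_nat_on faces"

definition lift_face :: "((nat \<Rightarrow> real) \<Rightarrow> 'a) \<Rightarrow> (nat \<Rightarrow> real) \<Rightarrow> 'a \<times> (nat \<Rightarrow> real)" where
  "lift_face \<tau> = restrict (\<lambda>x. (\<tau> x, cell n (label \<tau>) 0 x)) (standard_simplex n)"

text \<open>On face \<open>j\<close> every other summand is evaluated at a boundary point of its
  cell and vanishes, the base point being the origin. One sum thus extends the cells of all faces
  over the simplex. The argument \<open>x j\<close> is positive off face \<open>j\<close>, where the
  remaining coordinates no longer have sum 1.\<close>

definition shadow :: "((nat \<Rightarrow> real) \<Rightarrow> 'a) \<Rightarrow> (nat \<Rightarrow> real) \<Rightarrow> nat \<Rightarrow> real" where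
  "shadow \<sigma> x i = (\<Sum>j\<le>Suc n. cell n (label (singular_face (Suc n) j \<sigma>)) (x j) (drop_coord j x) i)"

definition lift_simplex :: "((nat \<Rightarrow> real) \<Rightarrow> 'a) \<Rightarrow> (nat \<Rightarrow> real) \<Rightarrow> 'a \<times> (nat \<Rightarrow> real)" where
  "lift_simplex \<sigma> = restrict (\<lambda>x. (\<sigma> x, shadow \<sigma> x)) (standard_simplex (Suc n))"

definition X' :: "('a \<times> (nat \<Rightarrow> real)) topology" where "X' = prod_topology X euclidean"

definition a0 :: "'a \<times> (nat \<Rightarrow> real)" where "a0 = (x0, earring_base)"

definition A' :: "('a \<times> (nat \<Rightarrow> real)) set" where
  "A' = insert a0 (\<Union>\<tau>\<in>faces. lift_face \<tau> ` standard_simplex n)"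

lemma finite_faces: "finite faces"
  by (simp add: faces_def)

lemma facesI: "\<sigma> \<in> Poly_Mapping.keys z \<Longrightarrow> j \<le> Suc n \<Longrightarrow> singular_face (Suc n) j \<sigma> \<in> faces"
  by (auto simp: faces_def)

lemma simplexD: "\<sigma> \<in> Poly_Mapping.keys z \<Longrightarrow> singular_simplex (Suc n) X \<sigma>"
  using z by (auto simp: singular_chain_def)

lemma faceE:
  assumes "\<tau> \<in> faces"
  shows "singular_simplex n X \<tau>" "\<And>x. x \<in> simplex_boundary n \<Longrightarrow> \<tau> x = x0"
proof -
  obtain \<sigma> j where \<sigma>: "\<sigma> \<in> Poly_Mapping.keys z" "j \<le> Suc n" "\<tau> = singular_face (Suc n) j \<sigma>"
    using assms by (auto simp: faces_def)
  show "singular_simplex n X \<tau>" using singular_simplex_singular_face[OF simplexD[OF \<sigma>(1)], of j] \<sigma> by simp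
  fix x assume x: "x \<in> simplex_boundary n"
  then obtain i where i: "i \<le> n" "x i = 0" and xs: "x \<in> standard_simplex n" by (auto simp: simplex_boundary_def)
  have f: "simplical_face j x \<in> standard_simplex (Suc n)"
    using simplical_face_in_standard_simplex[of "Suc n" j x] \<sigma>(2) xs by simp
  have "\<tau> x = \<sigma> (simplical_face j x)" using xs \<sigma>(3) by (simp add: singular_face_def)
  also have "\<dots> = x0"
    by (rule skel[OF \<sigma>(1) f \<sigma>(2), of "if i < j then i else Suc i"]) (use i in \<open>auto simp: simplical_face_def\<close>)
  finally show "\<tau> x = x0" .
qed

lemma lift_face_boundary: "\<tau> \<in> faces \<Longrightarrow> x \<in> simplex_boundary n \<Longrightarrow> lift_face \<tau> x = a0"
  using faceE(2)[of \<tau> x] cell_boundary[of n x _ "label \<tau>" 0] simplex_nonneg[of x n]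
  by (auto simp: lift_face_def a0_def simplex_boundary_def)

lemma lift_face_simplex:
  assumes "\<tau> \<in> faces" shows "singular_simplex n X' (lift_face \<tau>)"
proof -
  have "continuous_on (standard_simplex n) (\<lambda>x. cell n (label \<tau>) 0 x)"
    by (intro continuous_on_cell continuous_intros continuous_on_id) auto
  then have "continuous_map (top_of_set (standard_simplex n)) X' (\<lambda>x. (\<tau> x, cell n (label \<tau>) 0 x))"
    using faceE(1)[OF assms] by (auto simp: X'_def continuous_map_pairwise singular_simplex_def simplex_top comp_def)
  then show ?thesis unfolding singular_simplex_def simplex_top lift_face_def
    by (auto intro: continuous_map_eq)
qed

lemma singular_face_lift_simplex:
  assumes \<sigma>: "\<sigma> \<in> Poly_Mapping.keys z" and j: "j \<le> Suc n"
  shows "singular_face (Suc n) j (lift_simplex \<sigma>) = lift_face (singular_face (Suc n) j \<sigma>)"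
proof
  fix x
  show "singular_face (Suc n) j (lift_simplex \<sigma>) x = lift_face (singular_face (Suc n) j \<sigma>) x"
  proof (cases "x \<in> standard_simplex n")
    case False
    then show ?thesis by (simp add: singular_face_def lift_face_def)
  next
    case x: True
    let ?y = "simplical_face j x"
    have y: "?y \<in> standard_simplex (Suc n)" using simplical_face_in_standard_simplex[of "Suc n" j x] j x by simp
    have yj: "?y j = 0" by (simp add: simplical_face_def)
    have "shadow \<sigma> ?y i = cell n (label (singular_face (Suc n) j \<sigma>)) 0 x i" for i
    proof -
      have "cell n (label (singular_face (Suc n) m \<sigma>)) (?y m) (drop_coord m ?y) i = 0" if "m \<le> Suc n" "m \<noteq> j" for m
      proof -
        let ?j = "if j < m then j else j - 1"
        have "drop_coord m ?y ?j = 0" "?j \<le> n" using that j yj by (auto simp: drop_coord_def)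
        then have "cell n (label (singular_face (Suc n) m \<sigma>)) (?y m) (drop_coord m ?y) = earring_base"
          using simplex_nonneg[OF y] by (intro cell_boundary[of _ _ ?j]) (auto simp: drop_coord_def)
        then show ?thesis by (simp add: earring_base_def)
      qed
      then have "shadow \<sigma> ?y i = (\<Sum>m\<le>Suc n. if m = j then cell n (label (singular_face (Suc n) j \<sigma>)) (?y j) (drop_coord j ?y) i else 0)"
        unfolding shadow_def by (intro sum.cong) auto
      also have "\<dots> = cell n (label (singular_face (Suc n) j \<sigma>)) (?y j) (drop_coord j ?y) i" using j by simp
      finally show ?thesis by (simp add: yj drop_coord_simplical_face)
    qed
    then have "shadow \<sigma> ?y = cell n (label (singular_face (Suc n) j \<sigma>)) 0 x" by (rule ext)
    then show ?thesis using x y by (simp add: singular_face_def lift_face_def lift_simplex_def)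
  qed
qed

lemma lift_simplex_simplex:
  assumes \<sigma>: "\<sigma> \<in> Poly_Mapping.keys z" shows "singular_simplex (Suc n) X' (lift_simplex \<sigma>)"
proof -
  have c: "continuous_on (standard_simplex (Suc n)) (\<lambda>x. cell n k (x j) (drop_coord j x))" if "j \<le> Suc n" for j k
    using drop_coord_simplex that simplex_nonneg
    by (intro continuous_on_cell continuous_on_coordinates continuous_on_drop_coord) auto
  have "continuous_on (standard_simplex (Suc n)) (shadow \<sigma>)"
  proof (rule continuous_on_coordinatewise_then_product)
    show "continuous_on (standard_simplex (Suc n)) (\<lambda>x. shadow \<sigma> x i)" for i
      unfolding shadow_def
      by (intro continuous_on_sum) (use continuous_on_compose2[OF continuous_on_coordinates(1) c] in blast)
  qed
  then have "continuous_map (top_of_set (standard_simplex (Suc n))) X' (\<lambda>x. (\<sigma> x, shadow \<sigma> x))"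
    using simplexD[OF \<sigma>] by (auto simp: X'_def continuous_map_pairwise singular_simplex_def simplex_top comp_def)
  then show ?thesis unfolding singular_simplex_def simplex_top lift_simplex_def
    by (auto intro: continuous_map_eq)
qed

lemma simplex_boundary_face:
  assumes x: "x \<in> simplex_boundary (Suc n)"
  obtains j y where "j \<le> Suc n" "y \<in> standard_simplex n" "x = simplical_face j y"
proof -
  obtain j where j: "j \<le> Suc n" "x j = 0" and xs: "x \<in> standard_simplex (Suc n)" using x by (auto simp: simplex_boundary_def)
  have "x = simplical_face j (drop_coord j x)" using j by (auto simp: simplical_face_def drop_coord_def fun_eq_iff)
  then show ?thesis using that j drop_coord_simplex[OF xs j(2,1)] by blast
qed

text \<open>\<open>A'\<close> is compact because the cycle has finitely many faces, and the tag maps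
  it continuously and bijectively onto a finite bouquet, which is Hausdorff. Hence it is a
  homeomorphism, and the homology of the bouquet relative to its base point vanishes in degree n +
  1.\<close>

lemma trivial_homology_A':
  "trivial_group (relative_homology_group (int (Suc n)) (subtopology X' A') {a0})"
proof -
  let ?N = "{..<card faces}"
  let ?B = "top_of_set (bouquet n ?N)"
  have lab: "bij_betw label faces ?N" by (rule to_nat_on_finite[OF finite_faces])
  have AX: "A' \<subseteq> topspace X'"
  proof -
    have "lift_face \<tau> x \<in> topspace X'" if "\<tau> \<in> faces" "x \<in> standard_simplex n" for \<tau> x
      using lift_face_simplex[OF that(1)] that(2) by (auto simp: singular_simplex_def simplex_top continuous_map_def)
    moreover have "a0 \<in> topspace X'" using x0 by (simp add: X'_def a0_def)
    ultimately show ?thesis unfolding A'_def by blast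
  qed
  have pt: "p = a0 \<or> (\<exists>\<tau>\<in>faces. \<exists>x\<in>standard_simplex n. p = (\<tau> x, cell n (label \<tau>) 0 x))" if "p \<in> A'" for p
    using that by (auto simp: A'_def lift_face_def)
  \<comment> \<open>The tag is trivial only on the boundary of a cell, and there the face itself has
    the value \<open>x0\<close>.\<close>
  have base0: "p = a0" if "p \<in> A'" "snd p = earring_base" for p
    using pt[OF that(1)]
  proof (elim disjE bexE)
    fix \<tau> x assume \<tau>: "\<tau> \<in> faces" "x \<in> standard_simplex n" "p = (\<tau> x, cell n (label \<tau>) 0 x)"
    obtain i where i: "i \<le> n" "x i = minc n x" by (rule minc_attained)
    have "cell n (label \<tau>) 0 x 0 = 0" using that(2) \<tau>(3) by (simp add: earring_base_def)
    moreover obtain m where "m \<le> n" "0 < x m" using \<tau>(2) by (rule simplex_nonzero)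
    then have "0 < eden n (label \<tau>) (\<lambda>i. x i - x n) (minc n x)" using cell_den_pos by (metis less_irrefl)
    ultimately have "minc n x = 0" by (auto simp: cell_def ehat_def)
    then have "x \<in> simplex_boundary n" using \<tau>(2) i by (auto simp: simplex_boundary_def)
    then have "\<tau> x = x0" using faceE(2)[OF \<tau>(1)] by simp
    then show ?thesis using \<tau>(3) that(2) by (simp add: a0_def)
  qed
  have cont: "continuous_map (subtopology X' A') ?B snd"
  proof -
    have "snd p \<in> bouquet n ?N" if "p \<in> A'" for p
      using pt[OF that] cell_in_esphere lab by (fastforce simp: a0_def bouquet_def bij_betw_def)
    moreover have "continuous_map (subtopology X' A') euclidean snd"
      unfolding X'_def by (intro continuous_map_from_subtopology continuous_map_snd)
    ultimately show ?thesis by (auto simp: continuous_map_in_subtopology)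
  qed
  have hm: "homeomorphic_map (subtopology X' A') ?B snd"
  proof (rule continuous_imp_homeomorphic_map[OF cont])
    have "compactin X' (lift_face \<tau> ` standard_simplex n)" if "\<tau> \<in> faces" for \<tau>
    proof (rule image_compactin)
      show "continuous_map (top_of_set (standard_simplex n)) X' (lift_face \<tau>)"
        using lift_face_simplex[OF that] by (simp add: singular_simplex_def simplex_top)
      show "compactin (top_of_set (standard_simplex n)) (standard_simplex n)"
        using compactin_standard_simplex[of n] simplex_top[of n] by (simp add: compactin_subtopology euclidean_product_topology)
    qed
    then have "compactin X' (\<Union>\<tau>\<in>faces. lift_face \<tau> ` standard_simplex n)"
      using finite_faces by (intro compactin_Union) auto
    moreover have "compactin X' {a0}" using x0 by (simp add: X'_def a0_def)
    ultimately have "compactin X' A'" using compactin_Un[of X' "{a0}"] by (simp add: A'_def)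
    then show "compact_space (subtopology X' A')" by (rule compact_space_subtopology)
    show "Hausdorff_space ?B" by (simp add: Hausdorff_space_subtopology)
    show "snd ` topspace (subtopology X' A') = topspace ?B"
    proof
      show "snd ` topspace (subtopology X' A') \<subseteq> topspace ?B" using cont by (auto simp: continuous_map_def)
      show "topspace ?B \<subseteq> snd ` topspace (subtopology X' A')"
      proof
        fix y assume "y \<in> topspace ?B"
        then consider "y = earring_base" | k where "k < card faces" "y \<in> esphere n k" by (auto simp: bouquet_def)
        then show "y \<in> snd ` topspace (subtopology X' A')"
        proof cases
          case 1
          have "a0 \<in> topspace (subtopology X' A')" using AX by (auto simp: A'_def)
          then show ?thesis using 1 by (force simp: a0_def)
        next
          case 2
          have "k \<in> label ` faces" using 2(1) lab by (simp add: bij_betw_def)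
          then obtain \<tau> where \<tau>: "\<tau> \<in> faces" "label \<tau> = k" by blast
          obtain x where x: "x \<in> standard_simplex n" "cell n k 0 x = y"
            by (rule cell_surj[OF 2(2)]) (use n in auto)
          have "lift_face \<tau> x \<in> topspace (subtopology X' A')" using AX \<tau> x by (auto simp: A'_def)
          moreover have "snd (lift_face \<tau> x) = y" using \<tau> x by (simp add: lift_face_def)
          ultimately show ?thesis by force
        qed
      qed
    qed
    show "inj_on snd (topspace (subtopology X' A'))"
    proof (rule inj_onI)
      fix p q assume "p \<in> topspace (subtopology X' A')" "q \<in> topspace (subtopology X' A')" and eq: "snd p = snd q"
      then have p: "p \<in> A'" and q: "q \<in> A'" by auto
      show "p = q"
      proof (cases "snd p = earring_base")
        case True
        then show ?thesis using base0[OF p] base0[OF q] eq by simp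
      next
        case False
        then obtain \<tau> x where \<tau>: "\<tau> \<in> faces" "x \<in> standard_simplex n" "p = (\<tau> x, cell n (label \<tau>) 0 x)"
          using pt[OF p] by (auto simp: a0_def)
        obtain \<tau>' x' where \<tau>': "\<tau>' \<in> faces" "x' \<in> standard_simplex n" "q = (\<tau>' x', cell n (label \<tau>') 0 x')"
          using pt[OF q] False eq by (auto simp: a0_def)
        have "cell n (label \<tau>) 0 x = cell n (label \<tau>') 0 x'" "cell n (label \<tau>) 0 x \<noteq> earring_base"
          using \<tau>(3) \<tau>'(3) eq False by simp_all
        then have "label \<tau> = label \<tau>'"
          using esphere_disjoint[OF cell_in_esphere[OF \<tau>(2)], of "label \<tau>" "label \<tau>'"] cell_in_esphere[OF \<tau>'(2), of "label \<tau>'"]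
            by metis
        then have t: "\<tau> = \<tau>'" using bij_betw_imp_inj_on[OF lab] \<tau>(1) \<tau>'(1) by (simp only: inj_on_eq_iff)
        have "x = x'" using cell_inj[OF \<tau>(2) \<tau>'(2), of "label \<tau>"] False eq \<tau>(3) \<tau>'(3) t by simp
        then show ?thesis using \<tau>(3) \<tau>'(3) t by simp
      qed
    qed
  qed
  have sub: "{a0} \<subseteq> topspace (subtopology X' A')" using AX by (auto simp: A'_def)
  have im: "snd ` {a0} = {earring_base}" by (simp add: a0_def)
  have triv: "trivial_group (relative_homology_group (int (Suc n)) ?B {earring_base})"
    using trivial_homology_bouquet_finite[of ?N "{}" "int (Suc n)" n] by (simp add: bouquet_def)
  show ?thesis
    using isomorphic_group_triviality[OF is_isoI[OF homeomorphic_map_relative_homology_iso[OF hm sub im, of "int (Suc n)"]]] triv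
    by (simp only: group_relative_homology_group)
qed

text \<open>The lifted cycle and the spheroid built from it agree relative to \<open>A'\<close>,
  hence also relative to \<open>a0\<close>, since the homology of \<open>A'\<close> vanishes in this
  degree. Forgetting the tags carries both to \<open>X\<close>.\<close>

theorem skeletal_cycle_is_spheroid:
  obtains G where "G \<in> spheroids (Suc n) X x0"
    "hom_induced (int (Suc n)) (cube (Suc n)) (cube_boundary (Suc n)) X {x0} G (transferred_class (Suc n))
       = homologous_rel_set (Suc n) X {x0} z"
proof -
  have a0X: "a0 \<in> topspace X'" using x0 by (simp add: X'_def a0_def)
  interpret simplex_filling n X' A' a0
    using n a0X transferred_class_carrier[of "Suc n"] by unfold_locales (auto simp: A'_def)
  define z' where "z' = frag_extend (frag_of \<circ> lift_simplex) z"
  have kz: "Poly_Mapping.keys z' \<subseteq> lift_simplex ` Poly_Mapping.keys z"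
    using keys_frag_extend[of "frag_of \<circ> lift_simplex" z] by (auto simp: z'_def)
  have sk: "skeletal \<sigma>'" if \<sigma>': "\<sigma>' \<in> Poly_Mapping.keys z'" for \<sigma>'
  proof -
    obtain \<sigma> where \<sigma>: "\<sigma> \<in> Poly_Mapping.keys z" "\<sigma>' = lift_simplex \<sigma>" using kz \<sigma>' by blast
    have fc: "lift_simplex \<sigma> (simplical_face j y) = lift_face (singular_face (Suc n) j \<sigma>) y"
      if "j \<le> Suc n" "y \<in> standard_simplex n" for j y
      using fun_cong[OF singular_face_lift_simplex[OF \<sigma>(1) that(1)], of y] that(2) by (simp add: singular_face_def)
    have "lift_simplex \<sigma> x \<in> A'" if x: "x \<in> simplex_boundary (Suc n)" for x
    proof -
      obtain j y where "j \<le> Suc n" "y \<in> standard_simplex n" "x = simplical_face j y" using x by (rule simplex_boundary_face)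
      then show ?thesis using fc facesI[OF \<sigma>(1)] by (auto simp: A'_def)
    qed
    moreover have "lift_simplex \<sigma> x = a0"
      if x: "x \<in> standard_simplex (Suc n)" "i \<le> Suc n" "j \<le> Suc n" "i \<noteq> j" "x i = 0" "x j = 0" for x i j
    proof -
      have "drop_coord j x \<in> standard_simplex n" by (rule drop_coord_simplex[OF x(1,6,3)])
      moreover have "drop_coord j x (if i < j then i else i - 1) = 0" using x by (auto simp: drop_coord_def)
      moreover have "(if i < j then i else i - 1) \<le> n" using x by auto
      ultimately have "drop_coord j x \<in> simplex_boundary n" "drop_coord j x \<in> standard_simplex n" unfolding simplex_boundary_def by blast+
      moreover have "x = simplical_face j (drop_coord j x)" using x by (auto simp: simplical_face_def drop_coord_def fun_eq_iff)
      ultimately show ?thesis using fc[OF x(3)] lift_face_boundary[OF facesI[OF \<sigma>(1) x(3)]] by metis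
    qed
    ultimately show ?thesis using lift_simplex_simplex[OF \<sigma>(1)] unfolding skeletal_def \<sigma>(2) by blast
  qed
  have cyc': "chain_boundary (Suc n) z' = 0"
    unfolding z'_def using chain_boundary_lift[of z n lift_simplex lift_face] singular_face_lift_simplex cyc by simp
  obtain H where H: "H \<in> spheroids (Suc n) X' a0" "val H = homologous_rel_set (Suc n) X' A' z'"
    by (rule spheroid_of_cycle[OF sk cyc'])
  have z'c: "singular_chain (Suc n) X' z'" using kz lift_simplex_simplex by (auto simp: singular_chain_def)
  have rc: "singular_relcycle (Suc n) X' T z'" for T
    using z'c cyc' by (simp add: singular_relcycle)
  have Hc: "continuous_map (cube (Suc n)) X' H" "H \<in> cube_boundary (Suc n) \<rightarrow> {a0}" using H(1) by (auto simp: spheroids_iff)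
  let ?val0 = "hom_induced (int (Suc n)) (cube (Suc n)) (cube_boundary (Suc n)) X' {a0} H (transferred_class (Suc n))"
  let ?j = "hom_induced (int (Suc n)) X' {a0} X' A' id"
  have "?j ?val0 = val H"
    using hom_induced_compose'[OF Hc, of X' id A' "int (Suc n)" "transferred_class (Suc n)"] by (auto simp: A'_def)
  also have "\<dots> = ?j (homologous_rel_set (Suc n) X' {a0} z')"
    using hom_induced_chain_map[OF continuous_map_id, of "{a0}" A' "Suc n" X' z'] rc chain_map_ident[OF z'c] H(2) by (simp add: A'_def)
  finally have j: "?j ?val0 = ?j (homologous_rel_set (Suc n) X' {a0} z')" .
  have "?val0 = homologous_rel_set (Suc n) X' {a0} z'"
  proof (rule inj_onD[OF inj_hom_induced_triple[OF _ trivial_homology_A'] j])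
    show "{a0} \<subseteq> A'" by (simp add: A'_def)
    show "?val0 \<in> carrier (relative_homology_group (int (Suc n)) X' {a0})" by (rule hom_induced_carrier)
    show "homologous_rel_set (Suc n) X' {a0} z' \<in> carrier (relative_homology_group (int (Suc n)) X' {a0})"
      using rc unfolding carrier_relative_homology_group by blast
  qed
  moreover have fst: "continuous_map X' X fst" "fst \<in> {a0} \<rightarrow> {x0}" by (auto simp: X'_def a0_def continuous_map_fst)
  have "simplex_map (Suc n) fst (lift_simplex \<sigma>) = \<sigma>" if "\<sigma> \<in> Poly_Mapping.keys z" for \<sigma>
    using simplexD[OF that] by (auto simp: singular_simplex_def simplex_map_def lift_simplex_def fun_eq_iff restrict_def extensional_def)
  then have "chain_map (Suc n) fst z' = z" unfolding z'_def by (intro chain_map_lift)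
  then have "hom_induced (int (Suc n)) X' {a0} X {x0} fst (homologous_rel_set (Suc n) X' {a0} z') = homologous_rel_set (Suc n) X {x0} z"
    using hom_induced_chain_map[OF fst rc] by simp
  ultimately have "hom_induced (int (Suc n)) (cube (Suc n)) (cube_boundary (Suc n)) X {x0} (fst \<circ> H) (transferred_class (Suc n))
       = homologous_rel_set (Suc n) X {x0} z"
    using hom_induced_compose'[OF Hc fst, of "int (Suc n)" "transferred_class (Suc n)"] by simp
  moreover have "fst \<circ> H \<in> spheroids (Suc n) X x0"

    using continuous_map_compose[OF Hc(1) fst(1)] Hc(2) by (fastforce simp: spheroids_iff a0_def Pi_iff)
  ultimately show ?thesis using that by blast
qed

end

section \<open>Approximation avoiding a point\<close>

text \<open>Multinomial expectation: \<open>multinom m q h x\<close> is the mean of \<open>h\<close> over the vector of counts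
  in \<open>q\<close> independent draws from \<open>{0, \<dots>, m}\<close> with probabilities \<open>x\<close>.\<close>

fun multinom :: "nat \<Rightarrow> nat \<Rightarrow> ((nat \<Rightarrow> real) \<Rightarrow> real) \<Rightarrow> (nat \<Rightarrow> real) \<Rightarrow> real" where
  "multinom m 0 h x = h (\<lambda>_. 0)"
| "multinom m (Suc q) h x = (\<Sum>l\<le>m. x l * multinom m q (\<lambda>u. h (u(l := u l + 1))) x)"

definition counts :: "nat \<Rightarrow> nat \<Rightarrow> (nat \<Rightarrow> real) set" where
  "counts m q = {u. (\<forall>i. 0 \<le> u i) \<and> (\<forall>i>m. u i = 0) \<and> (\<Sum>i\<le>m. u i) = real q}"

lemma counts_Suc:
  assumes "u \<in> counts m q" "l \<le> m" shows "u(l := u l + 1) \<in> counts m (Suc q)"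
proof -
  have "(\<Sum>i\<le>m. (u(l := u l + 1)) i) = (\<Sum>i\<le>m. u i + (if i = l then 1 else 0))"
    by (intro sum.cong) auto
  also have "\<dots> = real q + 1" using assms by (simp add: sum.distrib counts_def)
  finally show ?thesis using assms by (auto simp: counts_def)
qed

lemma multinom_cong: "(\<And>u. u \<in> counts m q \<Longrightarrow> h u = h' u) \<Longrightarrow> multinom m q h x = multinom m q h' x"
proof (induction q arbitrary: h h')
  case 0
  then show ?case by (simp add: counts_def)
next
  case (Suc q)
  have "multinom m q (\<lambda>u. h (u(l := u l + 1))) x = multinom m q (\<lambda>u. h' (u(l := u l + 1))) x" if "l \<le> m" for l
    using Suc.prems counts_Suc that by (intro Suc.IH) blast
  then show ?case by simp
qed

lemma multinom_mono:
  "(\<And>i. 0 \<le> x i) \<Longrightarrow> (\<And>u. u \<in> counts m q \<Longrightarrow> h u \<le> h' u) \<Longrightarrow> multinom m q h x \<le> multinom m q h' x"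
proof (induction q arbitrary: h h')
  case 0
  then show ?case by (simp add: counts_def)
next
  case (Suc q)
  have "multinom m q (\<lambda>u. h (u(l := u l + 1))) x \<le> multinom m q (\<lambda>u. h' (u(l := u l + 1))) x" if "l \<le> m" for l
    using Suc.prems counts_Suc that by (intro Suc.IH) blast+
  then show ?case using Suc.prems(1) by (auto intro!: sum_mono mult_left_mono)
qed

lemma multinom_add: "multinom m q (\<lambda>u. a u + b u) x = multinom m q a x + multinom m q b x"
proof (induction q arbitrary: a b)
  case (Suc q)
  show ?case unfolding multinom.simps Suc distrib_left sum.distrib ..
qed simp

lemma multinom_cmul: "multinom m q (\<lambda>u. c * a u) x = c * multinom m q a x"
proof (induction q arbitrary: a)
  case (Suc q)
  show ?case unfolding multinom.simps Suc sum_distrib_left by (simp only: mult.left_commute)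
qed simp

lemma multinom_sum: "finite I \<Longrightarrow> multinom m q (\<lambda>u. \<Sum>i\<in>I. a i u) x = (\<Sum>i\<in>I. multinom m q (a i) x)"
proof (induction I rule: finite_induct)
  case empty
  then show ?case using multinom_cmul[of m q 0 "\<lambda>_. 0" x] by simp
qed (simp add: multinom_add)

lemma multinom_const: "(\<Sum>i\<le>m. x i) = 1 \<Longrightarrow> multinom m q (\<lambda>_. c) x = c"
proof (induction q)
  case (Suc q)
  then show ?case unfolding multinom.simps by (simp add: sum_distrib_right[symmetric])
qed simp

text \<open>With \<open>b\<close> minus the mean this is the variance of a binomial count. The shift
  is kept general because conditioning on one draw changes it by 1.\<close>

lemma multinom_square:
  assumes "(\<Sum>i\<le>m. x i) = 1" "i \<le> m"
  shows "multinom m q (\<lambda>u. (u i + b)\<^sup>2) x = (real q * x i + b)\<^sup>2 + real q * x i * (1 - x i)"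
proof (induction q arbitrary: b)
  case (Suc q)
  let ?F = "\<lambda>b. (real q * x i + b)\<^sup>2 + real q * x i * (1 - x i)"
  have "multinom m q (\<lambda>u. ((u(l := u l + 1)) i + b)\<^sup>2) x = (if l = i then ?F (b + 1) else ?F b)" for l
  proof (cases "l = i")
    case True
    have "(u(l := u l + 1)) i + b = u i + (b + 1)" for u :: "nat \<Rightarrow> real" using True by simp
    then show ?thesis using Suc[of "b + 1"] True by (simp only: if_True refl)
  next
    case False
    have "(u(l := u l + 1)) i + b = u i + b" for u :: "nat \<Rightarrow> real" using False by simp
    then show ?thesis using Suc[of b] False by (simp only: if_False refl)
  qed
  then have "multinom m (Suc q) (\<lambda>u. (u i + b)\<^sup>2) x = (\<Sum>l\<le>m. x l * ?F b + (if l = i then x i * (?F (b + 1) - ?F b) else 0))"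
    unfolding multinom.simps by (intro sum.cong) (auto simp: algebra_simps)
  also have "\<dots> = (\<Sum>l\<le>m. x l) * ?F b + x i * (?F (b + 1) - ?F b)"
    using assms(2) by (simp add: sum.distrib sum_distrib_right)
  also have "\<dots> = (real (Suc q) * x i + b)\<^sup>2 + real (Suc q) * x i * (1 - x i)"
    unfolding assms(1) by (simp add: power2_eq_square algebra_simps)
  finally show ?case .
qed simp

text \<open>Changing the probabilities of a single draw costs at most \<open>M\<close> times their
  distance in the sum norm; the costs of \<open>q\<close> draws add up.\<close>

lemma multinom_lipschitz:
  assumes x: "\<And>i. 0 \<le> x i" "(\<Sum>i\<le>m. x i) = 1" and y: "\<And>i. 0 \<le> y i" "(\<Sum>i\<le>m. y i) = 1"
    and h: "\<And>u. u \<in> counts m q \<Longrightarrow> \<bar>h u\<bar> \<le> M"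
  shows "\<bar>multinom m q h x - multinom m q h y\<bar> \<le> real q * M * (\<Sum>i\<le>m. \<bar>x i - y i\<bar>)"
  using h
proof (induction q arbitrary: h)
  case (Suc q)
  let ?h = "\<lambda>l u. h (u(l := u l + 1))"
  let ?d = "\<Sum>i\<le>m. \<bar>x i - y i\<bar>"
  have b: "\<bar>?h l u\<bar> \<le> M" if "l \<le> m" "u \<in> counts m q" for l u using Suc.prems counts_Suc that by blast
  have bx: "\<bar>multinom m q (?h l) x\<bar> \<le> M" if "l \<le> m" for l
  proof -
    have "multinom m q (?h l) x \<le> multinom m q (\<lambda>_. M) x" using b[OF that] by (intro multinom_mono x) (auto simp: abs_le_iff)
    moreover have "multinom m q (\<lambda>_. -M) x \<le> multinom m q (?h l) x" using b[OF that] by (intro multinom_mono x) (auto simp: abs_le_iff, smt (verit))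
    ultimately show ?thesis using multinom_const[OF x(2)] by (simp add: abs_le_iff)
  qed
  have ih: "\<bar>multinom m q (?h l) x - multinom m q (?h l) y\<bar> \<le> real q * M * ?d" if "l \<le> m" for l
    using b[OF that] by (rule Suc.IH)
  have split: "multinom m (Suc q) h x - multinom m (Suc q) h y
      = (\<Sum>l\<le>m. (x l - y l) * multinom m q (?h l) x) + (\<Sum>l\<le>m. y l * (multinom m q (?h l) x - multinom m q (?h l) y))"
    unfolding multinom.simps sum.distrib[symmetric] sum_subtractf[symmetric] by (intro sum.cong) (auto simp: algebra_simps)
  have "\<bar>multinom m (Suc q) h x - multinom m (Suc q) h y\<bar> \<le> (\<Sum>l\<le>m. \<bar>x l - y l\<bar> * M) + (\<Sum>l\<le>m. y l * (real q * M * ?d))"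
    unfolding split
  proof (rule order_trans[OF abs_triangle_ineq], rule add_mono)
    show "\<bar>\<Sum>l\<le>m. (x l - y l) * multinom m q (?h l) x\<bar> \<le> (\<Sum>l\<le>m. \<bar>x l - y l\<bar> * M)"
      using bx by (intro order_trans[OF sum_abs] sum_mono) (auto simp: abs_mult intro!: mult_left_mono)
    show "\<bar>\<Sum>l\<le>m. y l * (multinom m q (?h l) x - multinom m q (?h l) y)\<bar> \<le> (\<Sum>l\<le>m. y l * (real q * M * ?d))"
      using ih y(1) by (intro order_trans[OF sum_abs] sum_mono) (auto simp: abs_mult intro!: mult_left_mono)
  qed
  also have "(\<Sum>l\<le>m. \<bar>x l - y l\<bar> * M) + (\<Sum>l\<le>m. y l * (real q * M * ?d)) = ?d * M + real q * M * ?d"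
    unfolding sum_distrib_right[of "\<lambda>l. \<bar>x l - y l\<bar>" "{..m}" M, symmetric]
      sum_distrib_right[of y "{..m}" "real q * M * ?d", symmetric] y(2) by simp
  also have "\<dots> = real (Suc q) * M * ?d" by (simp add: algebra_simps)
  finally show ?case .
qed simp

lemma sum_simplical_face:
  assumes "j \<le> Suc m"
  shows "(\<Sum>l\<le>Suc m. simplical_face j y l * F l) = (\<Sum>l\<le>m. y l * (F (if l < j then l else Suc l) :: real))"
proof -
  have "(\<Sum>l\<le>Suc m. simplical_face j y l * F l) = (\<Sum>l\<in>{..Suc m} - {j}. simplical_face j y l * F l)"
    using assms by (intro sum.mono_neutral_right) (auto simp: simplical_face_def)
  also have "\<dots> = (\<Sum>l\<le>m. y l * F (if l < j then l else Suc l))"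
    by (rule sum.reindex_bij_witness[of _ "\<lambda>i. if i < j then i else Suc i" "\<lambda>i. if i < j then i else i - 1"])
       (use assms in \<open>auto simp: simplical_face_def\<close>)
  finally show ?thesis .
qed

text \<open>An index of probability zero is never drawn, so on a face only the values of
  \<open>h\<close> on that face enter. This is what makes the approximation natural in
  faces.\<close>

lemma multinom_simplical_face:
  assumes j: "j \<le> Suc m"
  shows "multinom (Suc m) q h (simplical_face j y) = multinom m q (\<lambda>u. h (simplical_face j u)) y"
proof (induction q arbitrary: h)
  case 0
  have "simplical_face j (\<lambda>_. 0 :: real) = (\<lambda>_. 0)" by (auto simp: simplical_face_def)
  then show ?case by simp
next
  case (Suc q)
  have upd: "simplical_face j (u(l := u l + 1)) = (simplical_face j u)((if l < j then l else Suc l) := simplical_face j u (if l < j then l else Suc l) + 1)"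
    for l and u :: "nat \<Rightarrow> real" by (auto simp: simplical_face_def fun_eq_iff)
  show ?case
    unfolding multinom.simps sum_simplical_face[OF j] Suc upd ..
qed

section \<open>Bernstein polynomials on the simplex\<close>

definition bernstein :: "nat \<Rightarrow> nat \<Rightarrow> ((nat \<Rightarrow> real) \<Rightarrow> real) \<Rightarrow> (nat \<Rightarrow> real) \<Rightarrow> real" where
  "bernstein m q g = multinom m q (\<lambda>u. g (\<lambda>i. u i / real q))"

lemma counts_simplex:
  assumes "u \<in> counts m q" "0 < q" shows "(\<lambda>i. u i / real q) \<in> standard_simplex m"
proof -
  have "u i \<le> real q" if "i \<le> m" for i
    using assms(1) that member_le_sum[of i "{..m}" u] by (auto simp: counts_def)
  then have "u i \<le> real q" for i using assms(1) by (cases "i \<le> m") (auto simp: counts_def)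
  then show ?thesis using assms by (auto simp: standard_simplex_def counts_def simp flip: sum_divide_distrib)
qed

lemma bernstein_simplical_face:
  assumes "j \<le> Suc m"
  shows "bernstein (Suc m) q g (simplical_face j y) = bernstein m q (\<lambda>u. g (simplical_face j u)) y"
proof -
  have "(\<lambda>i. simplical_face j u i / real q) = simplical_face j (\<lambda>i. u i / real q)" for u
    by (auto simp: simplical_face_def)
  then show ?thesis unfolding bernstein_def multinom_simplical_face[OF assms] by simp
qed

lemma bernstein_cong:
  assumes "\<And>u. u \<in> standard_simplex m \<Longrightarrow> g u = g' u" "0 < q"
  shows "bernstein m q g x = bernstein m q g' x"
  unfolding bernstein_def using assms counts_simplex by (intro multinom_cong) blast

lemma bernstein_lipschitz:
  assumes x: "x \<in> standard_simplex m" and y: "y \<in> standard_simplex m" and q: "0 < q"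
    and h: "\<And>u. u \<in> standard_simplex m \<Longrightarrow> \<bar>g u\<bar> \<le> M"
  shows "\<bar>bernstein m q g x - bernstein m q g y\<bar> \<le> real q * M * (\<Sum>i\<le>m. \<bar>x i - y i\<bar>)"
  unfolding bernstein_def
  using x y simplex_nonneg[OF x] simplex_nonneg[OF y] h counts_simplex[OF _ q] by (intro multinom_lipschitz) (auto simp: standard_simplex_def)

text \<open>The metric on sequences weights later coordinates by powers of 1/2. The first ones, each
  within d/4, contribute less than d/2, and all the others together less than d/2.\<close>

lemma simplex_uniformly_continuous:
  assumes g: "continuous_on (standard_simplex m) g" and \<epsilon>: "0 < \<epsilon>"
  obtains \<rho> where "0 < \<rho>" "\<And>x y. x \<in> standard_simplex m \<Longrightarrow> y \<in> standard_simplex m \<Longrightarrow>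
      (\<And>i. i \<le> m \<Longrightarrow> \<bar>x i - y i\<bar> < \<rho>) \<Longrightarrow> \<bar>g x - g y :: real\<bar> < \<epsilon>"
proof -
  have "compact (standard_simplex m)"
    using compactin_standard_simplex[of m] by (simp add: euclidean_product_topology)
  then have "uniformly_continuous_on (standard_simplex m) g" using g by (rule compact_uniformly_continuous[rotated])
  then obtain d where d: "0 < d" "\<And>x y. x \<in> standard_simplex m \<Longrightarrow> y \<in> standard_simplex m \<Longrightarrow> dist y x < d \<Longrightarrow> dist (g y) (g x) < \<epsilon>"
    using \<epsilon> unfolding uniformly_continuous_on_def by metis
  obtain N where N: "(1/2 :: real) ^ N < d / 2" using real_arch_pow_inv[of "d/2" "1/2"] d by auto
  have "\<bar>g x - g y\<bar> < \<epsilon>" if x: "x \<in> standard_simplex m" and y: "y \<in> standard_simplex m"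
    and lt: "\<And>i. i \<le> m \<Longrightarrow> \<bar>x i - y i\<bar> < d / 4" for x y
  proof -
    have l: "\<bar>x i - y i\<bar> < d / 4" for i
      using lt x y d(1) by (cases "i \<le> m") (auto simp: standard_simplex_def)
    let ?S = "{dist (x (from_nat k)) (y (from_nat k)) | k. k \<le> N}"
    have "Max ?S < d / 4" using l by (subst Max_less_iff) (auto simp: dist_real_def)
    moreover have "dist x y \<le> 2 * Max ?S + (1/2) ^ N" by (rule dist_fun_le_dist_first_terms)
    ultimately have "dist x y < d" using N by linarith
    then show ?thesis using d(2)[OF y x] by (simp add: dist_real_def)
  qed
  then show ?thesis using that[of "d / 4"] d(1) by simp
qed

text \<open>Chebyshev's argument. Where all relative frequencies are within \<rho> of
  \<open>x\<close>, uniform continuity bounds the error by half of \<epsilon>. Elsewhere the error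
  is at most 2 M, hence at most \<open>K\<close> times the squared deviation, whose expectation is
  at most 1/q.\<close>

lemma bernstein_converges:
  assumes g: "continuous_on (standard_simplex m) g" and M: "\<And>x. x \<in> standard_simplex m \<Longrightarrow> \<bar>g x\<bar> \<le> M" and \<epsilon>: "0 < \<epsilon>"
  shows "\<forall>\<^sub>F q in sequentially. \<forall>x\<in>standard_simplex m. \<bar>bernstein m q g x - g x\<bar> \<le> \<epsilon>"
proof -
  obtain \<rho> where \<rho>: "0 < \<rho>" and close: "\<And>x y. x \<in> standard_simplex m \<Longrightarrow> y \<in> standard_simplex m \<Longrightarrow>
      (\<And>i. i \<le> m \<Longrightarrow> \<bar>x i - y i\<bar> < \<rho>) \<Longrightarrow> \<bar>g x - g y\<bar> < \<epsilon> / 2"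
    using simplex_uniformly_continuous[OF g, of "\<epsilon> / 2"] \<epsilon> by auto
  define K where "K = 2 * M / \<rho>\<^sup>2"
  have "(\<lambda>i. if i = 0 then 1 else 0) \<in> standard_simplex m" by (auto simp: standard_simplex_def)
  then have M0: "0 \<le> M" using M by fastforce
  then have K: "0 \<le> K" by (simp add: K_def)
  have main: "\<bar>bernstein m q g x - g x\<bar> \<le> \<epsilon> / 2 + K * (1 / real q)" if x: "x \<in> standard_simplex m" and q: "0 < q" for q x
  proof -
    have x1: "(\<Sum>i\<le>m. x i) = 1" using x by (simp add: standard_simplex_def)
    note x0 = simplex_nonneg[OF x]
    let ?V = "\<lambda>u. \<Sum>i\<le>m. (u i / real q - x i)\<^sup>2"
    have pt: "\<bar>g (\<lambda>i. u i / real q) - g x\<bar> \<le> \<epsilon> / 2 + K * ?V u" if u: "u \<in> counts m q" for u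
    proof -
      let ?w = "\<lambda>i. u i / real q"
      have w: "?w \<in> standard_simplex m" by (rule counts_simplex[OF u q])
      have V0: "0 \<le> ?V u" by (intro sum_nonneg) auto
      show ?thesis
      proof (cases "\<forall>i\<le>m. \<bar>?w i - x i\<bar> < \<rho>")
        case True
        then have "\<bar>g ?w - g x\<bar> < \<epsilon> / 2" by (intro close w x) auto
        then show ?thesis using K V0 mult_nonneg_nonneg[OF K V0] by linarith
      next
        case False
        then obtain i where i: "i \<le> m" "\<rho> \<le> \<bar>?w i - x i\<bar>" by force
        have "\<rho>\<^sup>2 \<le> (?w i - x i)\<^sup>2" using power_mono[OF i(2), of 2] \<rho> by simp
        also have "\<dots> \<le> ?V u" using i(1) by (intro member_le_sum) auto
        finally have "K * \<rho>\<^sup>2 \<le> K * ?V u" using K by (intro mult_left_mono)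
        moreover have "K * \<rho>\<^sup>2 = 2 * M" using \<rho> by (simp add: K_def)
        ultimately show ?thesis using M[OF w] M[OF x] \<epsilon> by linarith
      qed
    qed
    have "multinom m q ?V x = (\<Sum>i\<le>m. multinom m q (\<lambda>u. (u i / real q - x i)\<^sup>2) x)" by (rule multinom_sum) simp
    also have "\<dots> = (\<Sum>i\<le>m. x i * (1 - x i) / real q)"
    proof (intro sum.cong refl)
      fix i assume "i \<in> {..m}"
      then have i: "i \<le> m" by simp
      have "(u i / real q - x i)\<^sup>2 = 1 / (real q)\<^sup>2 * (u i + - (real q * x i))\<^sup>2" for u :: "nat \<Rightarrow> real"
        using q by (simp add: power2_eq_square field_simps)
      then have "multinom m q (\<lambda>u. (u i / real q - x i)\<^sup>2) x = 1 / (real q)\<^sup>2 * multinom m q (\<lambda>u. (u i + - (real q * x i))\<^sup>2) x"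
        by (simp only: multinom_cmul)
      also have "\<dots> = x i * (1 - x i) / real q"
        unfolding multinom_square[OF x1 i] using q by (simp add: power2_eq_square)
      finally show "multinom m q (\<lambda>u. (u i / real q - x i)\<^sup>2) x = x i * (1 - x i) / real q" .
    qed
    also have "\<dots> \<le> (\<Sum>i\<le>m. x i / real q)"
      using x0 q by (intro sum_mono divide_right_mono) (auto simp: mult_left_le)
    also have "\<dots> = 1 / real q" by (simp add: x1 flip: sum_divide_distrib)
    finally have V: "multinom m q ?V x \<le> 1 / real q" .
    have up: "multinom m q (\<lambda>u. a + b * ?V u) x = a + b * multinom m q ?V x" for a b
      unfolding multinom_add multinom_cmul multinom_const[OF x1] ..
    have "bernstein m q g x \<le> multinom m q (\<lambda>u. (g x + \<epsilon> / 2) + K * ?V u) x"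
      unfolding bernstein_def
    proof (rule multinom_mono[OF x0])
      fix u assume "u \<in> counts m q"
      from pt[OF this] show "g (\<lambda>i. u i / real q) \<le> (g x + \<epsilon> / 2) + K * ?V u" by linarith
    qed
    moreover have "multinom m q (\<lambda>u. (g x - \<epsilon> / 2) + (- K) * ?V u) x \<le> bernstein m q g x"
      unfolding bernstein_def
    proof (rule multinom_mono[OF x0])
      fix u assume "u \<in> counts m q"
      from pt[OF this] show "(g x - \<epsilon> / 2) + (- K) * ?V u \<le> g (\<lambda>i. u i / real q)" unfolding mult_minus_left by linarith
    qed
    moreover have "K * multinom m q ?V x \<le> K * (1 / real q)" using V K by (rule mult_left_mono)
    ultimately show ?thesis unfolding up by (simp add: abs_le_iff)
  qed
  have "(\<lambda>q. K * (1 / real q)) \<longlonglongrightarrow> K * 0" by (intro tendsto_intros lim_1_over_n)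
  then have "\<forall>\<^sub>F q in sequentially. K * (1 / real q) < \<epsilon> / 2" using \<epsilon> by (intro order_tendstoD(2)) auto
  with eventually_gt_at_top[of 0] show ?thesis
  proof eventually_elim
    case (elim q)
    show ?case
    proof
      fix x assume "x \<in> standard_simplex m"
      from main[OF this elim(1)] elim(2) show "\<bar>bernstein m q g x - g x\<bar> \<le> \<epsilon>" by linarith
    qed
  qed
qed

lemma continuous_on_multinom: "continuous_on S (multinom m q h)"
proof (induction q arbitrary: h)
  case (Suc q)
  then show ?case by (auto intro!: continuous_intros)
qed simp

text \<open>Pigeonhole: the \<open>M\<^sup>n\<close> candidates of a grid of mesh \<open>\<eta>/M\<close> outnumber the cells of
  an \<open>(n - 1)\<close>-dimensional domain whose images have diameter below the mesh.\<close>

lemma avoid_small_point: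
  fixes f :: "'p \<Rightarrow> nat \<Rightarrow> real" and cl :: "nat \<Rightarrow> 'p \<Rightarrow> 'c"
  assumes n: "0 < n" and \<eta>: "0 < \<eta>" and L: "0 \<le> L"
    and fin: "\<And>G. 0 < G \<Longrightarrow> finite (cl G ` P)" and card: "\<And>G. 0 < G \<Longrightarrow> card (cl G ` P) \<le> C0 * (G + 1) ^ (n - 1)"
    and lip: "\<And>G x y i. 0 < G \<Longrightarrow> x \<in> P \<Longrightarrow> y \<in> P \<Longrightarrow> cl G x = cl G y \<Longrightarrow> i < n \<Longrightarrow> \<bar>f x i - f y i\<bar> \<le> L / real G"
  obtains p \<mu> where "0 < \<mu>" "\<And>i. i < n \<Longrightarrow> \<bar>p i\<bar> \<le> \<eta>" "\<And>x. x \<in> P \<Longrightarrow> \<exists>i<n. \<mu> \<le> \<bar>f x i - p i\<bar>"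
proof -
  \<comment> \<open>\<open>C\<close> makes images of cells smaller than a quarter of the mesh.
    \<open>M\<close> below is chosen so that the number of grid points, the \<open>n\<close>-th
    power of \<open>M\<close>, exceeds the bound for the number of cells at G = C M. The margin
    \<mu> takes another quarter of the mesh.\<close>
  obtain C :: nat where C: "4 * L / \<eta> < real C" using reals_Archimedean2 by blast
  have C1: "0 < C"
  proof (rule ccontr)
    assume "\<not> 0 < C"
    then show False using C L \<eta> by (simp add: divide_less_0_iff)
  qed
  define M where "M = C0 * (C + 1) ^ (n - 1) + 1"
  define G where "G = C * M"
  have M: "0 < M" by (simp add: M_def)
  then have G: "0 < G" using C1 by (simp add: G_def)
  define \<mu> where "\<mu> = \<eta> / (8 * real M)"
  have \<mu>: "0 < \<mu>" using \<eta> M by (simp add: \<mu>_def)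
  define p where "p a i = \<eta> * real (a i) / real M" for a :: "nat \<Rightarrow> nat" and i
  have LG: "L / real G + 2 * \<mu> < \<eta> / real M"
  proof -
    have "4 * L < \<eta> * real C" using C \<eta> by (simp add: field_simps)
    then have "L / real G < \<eta> / (4 * real M)" using M C1 by (simp add: G_def field_simps)
    moreover have "2 * \<mu> = \<eta> / (4 * real M)" "\<eta> / real M = 4 * (\<eta> / (4 * real M))" "0 < \<eta> / (4 * real M)"
      using \<eta> M by (auto simp: \<mu>_def)
    ultimately show ?thesis by linarith
  qed
  let ?A = "{..<n} \<rightarrow>\<^sub>E {..<M}"
  have "\<exists>a\<in>?A. \<forall>x\<in>P. \<exists>i<n. \<mu> \<le> \<bar>f x i - p a i\<bar>"
  proof (rule ccontr)
    assume "\<not> ?thesis"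
    then have "\<forall>a\<in>?A. \<exists>x\<in>P. \<forall>i<n. \<bar>f x i - p a i\<bar> < \<mu>" by (meson not_le)
    then obtain w where w: "\<And>a. a \<in> ?A \<Longrightarrow> w a \<in> P" "\<And>a i. a \<in> ?A \<Longrightarrow> i < n \<Longrightarrow> \<bar>f (w a) i - p a i\<bar> < \<mu>" by metis
    have "inj_on (\<lambda>a. cl G (w a)) ?A"
    proof (rule inj_onI)
      fix a b assume a: "a \<in> ?A" and b: "b \<in> ?A" and eq: "cl G (w a) = cl G (w b)"
      have "a i = b i" if i: "i < n" for i
      proof (rule ccontr)
        assume "a i \<noteq> b i"
        then have "1 \<le> \<bar>real (a i) - real (b i)\<bar>" by linarith
        then have "\<eta> / real M * 1 \<le> \<eta> / real M * \<bar>real (a i) - real (b i)\<bar>" using \<eta> M by (intro mult_left_mono) auto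
        also have "\<dots> = \<bar>p a i - p b i\<bar>"
        proof -
          have "p a i - p b i = \<eta> / real M * (real (a i) - real (b i))" by (simp add: p_def algebra_simps diff_divide_distrib)
          then show ?thesis using \<eta> by (simp add: abs_mult)
        qed
        also have "\<dots> < L / real G + 2 * \<mu>"
          using w(2)[OF a i] w(2)[OF b i] lip[OF G w(1)[OF a] w(1)[OF b] eq i] by linarith
        finally show False using LG by simp
      qed
      then show "a = b" using a b by (intro PiE_ext[of a "{..<n}"]) auto
    qed
    then have "card ?A \<le> card (cl G ` P)" using w(1) fin[OF G] by (intro card_inj_on_le[of "\<lambda>a. cl G (w a)"]) auto
    moreover have "card ?A = M ^ n" by (simp add: card_PiE)
    moreover have "card (cl G ` P) \<le> C0 * (G + 1) ^ (n - 1)" by (rule card[OF G])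
    moreover have "C0 * (G + 1) ^ (n - 1) \<le> C0 * ((C + 1) * M) ^ (n - 1)"
      using M by (intro mult_left_mono power_mono) (auto simp: G_def)
    moreover have "C0 * ((C + 1) * M) ^ (n - 1) = (C0 * (C + 1) ^ (n - 1)) * M ^ (n - 1)" by (simp only: power_mult_distrib mult.assoc)
    moreover have "\<dots> < M * M ^ (n - 1)" using M by (intro mult_strict_right_mono) (auto simp: M_def)
    moreover have "M * M ^ (n - 1) = M ^ n" using n by (simp flip: power_Suc)
    ultimately show False by linarith
  qed
  then obtain a where a: "a \<in> ?A" "\<And>x. x \<in> P \<Longrightarrow> \<exists>i<n. \<mu> \<le> \<bar>f x i - p a i\<bar>" by blast
  have "\<bar>p a i\<bar> \<le> \<eta>" if "i < n" for i
  proof -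
    have "a i < M" using a(1) that by auto
    then show ?thesis using \<eta> M by (simp add: p_def field_simps)
  qed
  then show ?thesis using that[OF \<mu>, of "p a"] a(2) by blast
qed

section \<open>Pushing cycles off the antipodes of the base point\<close>

text \<open>At a zero of \<open>q\<close> the bound squeezes \<open>f\<close> to 0; near any other
  point the condition on \<open>q\<close> holds automatically. The application is to the push at the
  base point, where the defining quotient degenerates.\<close>

lemma continuous_on_dominated:
  fixes f :: "'a::topological_space \<Rightarrow> real"
  assumes q: "continuous_on S q" and f: "continuous_on {x \<in> S. q x \<noteq> 0} f" and le: "\<And>x. x \<in> S \<Longrightarrow> \<bar>f x\<bar> \<le> q x"
  shows "continuous_on S f"
  unfolding continuous_on_def
proof
  fix x assume x: "x \<in> S"
  show "(f \<longlongrightarrow> f x) (at x within S)"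
  proof (cases "q x = 0")
    case True
    have "(q \<longlongrightarrow> 0) (at x within S)" using q x True by (metis continuous_on_def)
    moreover have "\<forall>\<^sub>F y in at x within S. norm (f y) \<le> q y"
      using le by (auto simp: eventually_at_filter)
    ultimately have "(f \<longlongrightarrow> 0) (at x within S)" by (rule Lim_null_comparison[rotated])
    moreover have "f x = 0" using le[OF x] True by simp
    ultimately show ?thesis by simp
  next
    case False
    have "openin (top_of_set S) (S \<inter> q -` (- {0}))" by (rule continuous_openin_preimage_gen[OF q]) auto
    then obtain W where W: "open W" "S \<inter> q -` (- {0}) = S \<inter> W" by (metis openin_open)
    have eq: "{x \<in> S. q x \<noteq> 0} = S \<inter> W" using W(2) by auto
    have "x \<in> W" using W(2) x False by auto
    then have "at x within S = at x within {x \<in> S. q x \<noteq> 0}" unfolding eq using W(1) by (intro at_within_nhd[of x W]) auto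
    then show ?thesis using f x False by (simp add: continuous_on_def)
  qed
qed

text \<open>\<open>displaced\<close> moves the tangential coordinates of \<open>y\<close> towards \<open>l\<close>, and \<open>push\<close> lowers the height at the same
  time; height \<open>0\<close> is the base point. The extra summand in the denominator of \<open>ehat\<close> is positive only where the
  height vanishes and keeps the denominator away from \<open>0\<close>.\<close>

definition displaced :: "nat \<Rightarrow> real \<Rightarrow> (nat \<Rightarrow> real) \<Rightarrow> (nat \<Rightarrow> real) \<Rightarrow> nat \<Rightarrow> real" where
  "displaced k t y l i = (real k + 1) / 2 * (y (Suc i) + t * (l i - y (Suc i)))"

definition push :: "nat \<Rightarrow> nat \<Rightarrow> real \<Rightarrow> real \<Rightarrow> (nat \<Rightarrow> real) \<Rightarrow> (nat \<Rightarrow> real) \<Rightarrow> nat \<Rightarrow> real" where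
  "push n k \<epsilon> t y l =
     ehat n k (max 0 (t / (2 * (real k + 1)) - y 0)) (displaced k t y l)
       (max 0 (y 0 - t / (2 * (real k + 1)) - t * sqrt (\<Sum>i<n. (displaced k t y l i)\<^sup>2) / \<epsilon>))"

text \<open>The tolerance is a quarter of the radius of the sphere, small enough for
  \<open>displaced_lower_bound\<close>.\<close>

definition close_to :: "nat \<Rightarrow> nat \<Rightarrow> (nat \<Rightarrow> real) \<Rightarrow> (nat \<Rightarrow> real) \<Rightarrow> bool" where
  "close_to n k y l \<longleftrightarrow> (\<Sum>i<n. (l i - y (Suc i))\<^sup>2) \<le> (1 / (4 * (real k + 1)))\<^sup>2"

section \<open>Estimates for the push on a single sphere\<close>

lemma esphere_coordinate:
  assumes "p \<in> esphere n k" shows "(p i)\<^sup>2 \<le> 2 / (real k + 1) * p 0" "\<bar>p i\<bar> \<le> 2 / (real k + 1)"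
proof -
  have e: "sqnorm n p = 2 / (real k + 1) * p 0" using assms by (simp add: esphere_def field_simps)
  show *: "(p i)\<^sup>2 \<le> 2 / (real k + 1) * p 0" for i
  proof (cases "i \<le> n")
    case True
    then have "(p i)\<^sup>2 \<le> sqnorm n p" unfolding sqnorm_def by (intro member_le_sum) auto
    then show ?thesis using e by simp
  next
    case False
    then show ?thesis using assms esphere_nonneg[OF assms] by (simp add: esphere_def)
  qed
  have p0: "0 \<le> p 0" by (rule esphere_nonneg[OF assms])
  have "p 0 \<le> 2 / (real k + 1)"
  proof (cases "p 0 = 0")
    case False
    then have "0 < p 0" using p0 by simp
    with *[of 0] show ?thesis unfolding power2_eq_square by (rule mult_right_le_imp_le)
  qed simp
  then have "2 / (real k + 1) * p 0 \<le> 2 / (real k + 1) * (2 / (real k + 1))" by (intro mult_left_mono) auto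
  then have "(p i)\<^sup>2 \<le> (2 / (real k + 1))\<^sup>2" using *[of i] by (simp add: power2_eq_square)
  then show "\<bar>p i\<bar> \<le> 2 / (real k + 1)" by (subst (asm) power2_le_iff_abs_le) auto
qed

text \<open>With r the radius, the tangential part of \<open>y\<close> has square sum 2 r y_0 -
  y_0^2, which is at least r y_0 on the lower half. The displacement has square sum at most (t r /
  4)^2, which is at most r y_0 / 4 because t r \<le> 2 y_0. The inequality a^2 / 2 - b^2 \<le> (a +
  b)^2 combines the two.\<close>

lemma displaced_lower_bound:
  assumes y: "y \<in> esphere n k" and l: "close_to n k y l" and t: "0 \<le> t" "t \<le> 1"
    and lo: "t / (2 * (real k + 1)) \<le> y 0" and hi: "y 0 \<le> 1 / (real k + 1)"
  shows "(real k + 1) / 16 * y 0 \<le> (\<Sum>i<n. (displaced k t y l i)\<^sup>2)"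
proof -
  define r where "r = 1 / (real k + 1)"
  have r: "0 < r" by (simp add: r_def)
  have y0: "0 \<le> y 0" by (rule esphere_nonneg[OF y])
  have "sqnorm n y = 2 * r * y 0" using y by (simp add: esphere_def r_def field_simps)
  then have A: "(\<Sum>i<n. (y (Suc i))\<^sup>2) = 2 * r * y 0 - (y 0)\<^sup>2" unfolding sqnorm_shift by simp
  have "y 0 * y 0 \<le> r * y 0" using hi y0 by (intro mult_right_mono) (auto simp: r_def)
  then have A': "r * y 0 \<le> (\<Sum>i<n. (y (Suc i))\<^sup>2)" unfolding A by (simp add: power2_eq_square)
  have tr: "t * r \<le> 2 * y 0" using lo by (simp add: r_def field_simps)
  have "(\<Sum>i<n. (t * (l i - y (Suc i)))\<^sup>2) = t\<^sup>2 * (\<Sum>i<n. (l i - y (Suc i))\<^sup>2)"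
    by (simp add: power_mult_distrib sum_distrib_left)
  also have "\<dots> \<le> t\<^sup>2 * (r / 4)\<^sup>2"
  proof -
    have e: "1 / (4 * (real k + 1)) = r / 4" by (simp add: r_def field_simps)
    show ?thesis using l unfolding close_to_def e by (rule mult_left_mono) simp
  qed
  also have "\<dots> = (t * r)\<^sup>2 / 16" by (simp add: power2_eq_square)
  also have "\<dots> \<le> (2 * y 0)\<^sup>2 / 16" using tr t r by (intro divide_right_mono power_mono) auto
  also have "\<dots> \<le> r * y 0 / 4" using \<open>y 0 * y 0 \<le> r * y 0\<close> by (simp add: power2_eq_square)
  finally have B: "(\<Sum>i<n. (t * (l i - y (Suc i)))\<^sup>2) \<le> r * y 0 / 4" .
  have "(\<Sum>i<n. (y (Suc i))\<^sup>2) / 2 - (\<Sum>i<n. (t * (l i - y (Suc i)))\<^sup>2) = (\<Sum>i<n. (y (Suc i))\<^sup>2 / 2 - (t * (l i - y (Suc i)))\<^sup>2)"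
    by (simp add: sum_subtractf sum_divide_distrib)
  also have "\<dots> \<le> (\<Sum>i<n. (y (Suc i) + t * (l i - y (Suc i)))\<^sup>2)"
  proof (rule sum_mono)
    have "a\<^sup>2 / 2 - b\<^sup>2 \<le> (a + b)\<^sup>2" for a b :: real
      using zero_le_power2[of "a + 2 * b"] by (simp add: power2_eq_square algebra_simps)
    then show "(y (Suc i))\<^sup>2 / 2 - (t * (l i - y (Suc i)))\<^sup>2 \<le> (y (Suc i) + t * (l i - y (Suc i)))\<^sup>2" for i .
  qed
  finally have S: "r * y 0 / 4 \<le> (\<Sum>i<n. (y (Suc i) + t * (l i - y (Suc i)))\<^sup>2)" using A' B by linarith
  have "(\<Sum>i<n. (displaced k t y l i)\<^sup>2) = (1 / (2 * r))\<^sup>2 * (\<Sum>i<n. (y (Suc i) + t * (l i - y (Suc i)))\<^sup>2)"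
    unfolding displaced_def power_mult_distrib by (simp add: r_def sum_distrib_left)
  moreover have "(1 / (2 * r))\<^sup>2 * (r * y 0 / 4) \<le> (1 / (2 * r))\<^sup>2 * (\<Sum>i<n. (y (Suc i) + t * (l i - y (Suc i)))\<^sup>2)"
    using S by (intro mult_left_mono) auto
  moreover have "(1 / (2 * r))\<^sup>2 * (r * y 0 / 4) = 1 / r * (y 0 / 16)" using r by (simp add: power2_eq_square)
  moreover have "1 / r * (y 0 / 16) = (real k + 1) / 16 * y 0" by (simp add: r_def)
  ultimately show ?thesis by simp
qed

lemma push_pos_height:
  assumes "0 < \<epsilon>" "0 \<le> t" and "max 0 (y 0 - t / (2 * (real k + 1)) - t * sqrt (\<Sum>i<n. (displaced k t y l i)\<^sup>2) / \<epsilon>) \<noteq> 0"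
  shows "t / (2 * (real k + 1)) < y 0" "max 0 (t / (2 * (real k + 1)) - y 0) = 0"
    "max 0 (y 0 - t / (2 * (real k + 1)) - t * sqrt (\<Sum>i<n. (displaced k t y l i)\<^sup>2) / \<epsilon>) \<le> y 0"
proof -
  have "0 \<le> t * sqrt (\<Sum>i<n. (displaced k t y l i)\<^sup>2) / \<epsilon>" "0 \<le> t / (2 * (real k + 1))"
    using assms(1,2) by (auto intro!: divide_nonneg_pos mult_nonneg_nonneg real_sqrt_ge_zero sum_nonneg)
  then show "t / (2 * (real k + 1)) < y 0" "max 0 (t / (2 * (real k + 1)) - y 0) = 0"
    "max 0 (y 0 - t / (2 * (real k + 1)) - t * sqrt (\<Sum>i<n. (displaced k t y l i)\<^sup>2) / \<epsilon>) \<le> y 0"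
    using assms(3) by linarith+
qed

lemma push_in_esphere:
  assumes "0 < \<epsilon>" "0 \<le> t" shows "push n k \<epsilon> t y l \<in> esphere n k"
proof (cases "max 0 (y 0 - t / (2 * (real k + 1)) - t * sqrt (\<Sum>i<n. (displaced k t y l i)\<^sup>2) / \<epsilon>) = 0")
  case True
  then show ?thesis unfolding push_def by (simp only: ehat_0 base_in_esphere)
next
  case False
  then show ?thesis unfolding push_def push_pos_height(2)[OF assms False]
    by (intro ehat_in_esphere eden_pos disjI1) (rule False)
qed

lemma push_0:
  assumes y: "y \<in> esphere n k" shows "push n k \<epsilon> 0 y l = y"
proof (cases "y = earring_base")
  case True
  then show ?thesis by (simp add: push_def earring_base_def ehat_0[unfolded earring_base_def])
next
  case False
  have "displaced k 0 y l = (\<lambda>i. 1 * ((real k + 1) / 2 * y (Suc i)))" by (simp add: displaced_def fun_eq_iff)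
  moreover have "max 0 (- y 0) = 0" "max 0 (y 0) = 1 * y 0" using esphere_nonneg[OF y] by auto
  ultimately show ?thesis using ehat_esphere[OF y False, of 1] by (simp add: push_def)
qed

lemma push_base:
  assumes "0 < \<epsilon>" "0 \<le> t" shows "push n k \<epsilon> t earring_base l = earring_base"
proof -
  have "max 0 (earring_base 0 - t / (2 * (real k + 1)) - t * sqrt (\<Sum>i<n. (displaced k t earring_base l i)\<^sup>2) / \<epsilon>) = 0"
  proof (rule ccontr)
    assume "\<not> ?thesis"
    from push_pos_height(1)[OF assms this] have "t / (2 * (real k + 1)) < 0" by (simp add: earring_base_def)
    moreover have "0 \<le> t / (2 * (real k + 1))" using assms(2) by simp
    ultimately show False by linarith
  qed
  then show ?thesis unfolding push_def by (simp only: ehat_0)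
qed

text \<open>A point of the sphere has height at most 2/(k + 1), and \<open>far\<close> makes the
  amount subtracted from the height at least that large.\<close>

lemma push_1:
  assumes y: "y \<in> esphere n k" and \<epsilon>: "0 < \<epsilon>" and far: "4 * \<epsilon> / (real k + 1)\<^sup>2 \<le> sqrt (\<Sum>i<n. (l i)\<^sup>2)"
  shows "push n k \<epsilon> 1 y l = earring_base"
proof -
  have d: "displaced k 1 y l i = (real k + 1) / 2 * l i" for i by (simp add: displaced_def)
  have "sqrt (\<Sum>i<n. (displaced k 1 y l i)\<^sup>2) = (real k + 1) / 2 * sqrt (\<Sum>i<n. (l i)\<^sup>2)"
    unfolding d power_mult_distrib sum_distrib_left[symmetric] by (simp add: real_sqrt_mult real_sqrt_divide)
  also have "\<dots> \<ge> (real k + 1) / 2 * (4 * \<epsilon> / (real k + 1)\<^sup>2)" using far by (intro mult_left_mono) auto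
  also have "(real k + 1) / 2 * (4 * \<epsilon> / (real k + 1)\<^sup>2) = 2 / (real k + 1) * \<epsilon>" by (simp add: power2_eq_square)
  finally have "2 / (real k + 1) \<le> 1 * sqrt (\<Sum>i<n. (displaced k 1 y l i)\<^sup>2) / \<epsilon>" using \<epsilon> by (simp add: field_simps)
  moreover have "0 \<le> 1 / (2 * (real k + 1))" by simp
  moreover have "y 0 \<le> 2 / (real k + 1)" using esphere_coordinate(2)[OF y, of 0] by simp
  ultimately have "max 0 (y 0 - 1 / (2 * (real k + 1)) - 1 * sqrt (\<Sum>i<n. (displaced k 1 y l i)\<^sup>2) / \<epsilon>) = 0" by linarith
  then show ?thesis unfolding push_def by (simp only: ehat_0)
qed

text \<open>Uniformly in the time and in the approximation, the height of a point grows at most by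
  the factor 8. On the lower half this comes from \<open>displaced_lower_bound\<close>, on the upper
  half from the diameter of the sphere. Height controls all coordinates, so points near the base
  point stay near it.\<close>

lemma push_bound:
  assumes y: "y \<in> esphere n k" and l: "close_to n k y l" and t: "0 \<le> t" "t \<le> 1" and \<epsilon>: "0 < \<epsilon>"
  shows "\<bar>push n k \<epsilon> t y l i\<bar> \<le> 4 * sqrt (y 0)"
proof -
  let ?P = "push n k \<epsilon> t y l"
  define s where "s = max 0 (y 0 - t / (2 * (real k + 1)) - t * sqrt (\<Sum>i<n. (displaced k t y l i)\<^sup>2) / \<epsilon>)"
  define N where "N = (\<Sum>i<n. (displaced k t y l i)\<^sup>2)"
  have P: "?P \<in> esphere n k" by (rule push_in_esphere[OF \<epsilon> t(1)])
  have y0: "0 \<le> y 0" by (rule esphere_nonneg[OF y])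
  have "?P 0 \<le> 8 * y 0"
  proof (cases "s = 0")
    case True
    then have "?P = earring_base" unfolding push_def s_def[symmetric] by (simp only: ehat_0)
    then show ?thesis using y0 by (simp add: earring_base_def)
  next
    case False
    note h = push_pos_height[OF \<epsilon> t(1) False[unfolded s_def]]
    have s: "0 < s" "s \<le> y 0" using False h(3) by (auto simp: s_def)
    show ?thesis
    proof (cases "y 0 \<le> 1 / (real k + 1)")
      case True
      have N: "(real k + 1) / 16 * y 0 \<le> N" unfolding N_def using h(1) by (intro displaced_lower_bound[OF y l t _ True]) simp
      have "0 < (real k + 1) / 16 * y 0" using s by (intro mult_pos_pos) auto
      then have N0: "0 < N" using N by linarith
      have "?P 0 = (real k + 1) / 2 * s\<^sup>2 / (((real k + 1) / 2 * s)\<^sup>2 + N)"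
        unfolding push_def s_def[symmetric] h(2) by (simp add: ehat_def eden_def N_def)
      also have "\<dots> \<le> (real k + 1) / 2 * s\<^sup>2 / N" using N0 by (intro divide_left_mono) (auto intro!: mult_pos_pos add_nonneg_pos)
      also have "\<dots> \<le> 8 * y 0"
      proof -
        have "s\<^sup>2 \<le> (y 0)\<^sup>2" using s by (intro power_mono) auto
        then have "(real k + 1) / 2 * s\<^sup>2 \<le> (real k + 1) / 2 * (y 0 * y 0)" by (simp add: power2_eq_square mult_left_mono)
        also have "\<dots> = 8 * y 0 * ((real k + 1) / 16 * y 0)" by simp
        also have "\<dots> \<le> 8 * y 0 * N" using N y0 by (intro mult_left_mono) auto
        finally show ?thesis using N0 by (simp add: divide_le_eq)
      qed
      finally show ?thesis .
    next
      case False
      then show ?thesis using esphere_coordinate(2)[OF P, of 0] by linarith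
    qed
  qed
  then have "2 / (real k + 1) * ?P 0 \<le> 2 * (8 * y 0)"
    using esphere_nonneg[OF P] y0 by (intro mult_mono) (auto simp: divide_le_eq)
  then have "(?P i)\<^sup>2 \<le> (4 * sqrt (y 0))\<^sup>2"
    using esphere_coordinate(1)[OF P, of i] y0 by (simp add: power_mult_distrib)
  then show ?thesis using y0 by (subst (asm) power2_le_iff_abs_le) auto
qed

text \<open>If both summands vanished, \<open>y\<close> would have height t / (2 (k + 1)) and a
  displaced tangential part equal to zero, against the lower bound for that part.\<close>

lemma push_denominator:
  assumes y: "y \<in> esphere n k" "y 0 \<noteq> 0" and l: "close_to n k y l" and t: "0 \<le> t" "t \<le> 1"
  shows "eden n k (displaced k t y l) (max 0 (y 0 - t / (2 * (real k + 1)) - t * sqrt (\<Sum>i<n. (displaced k t y l i)\<^sup>2) / \<epsilon>))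
      + max 0 (t / (2 * (real k + 1)) - y 0) \<noteq> 0" (is "eden n k ?w ?s + ?e \<noteq> 0")
proof
  assume 0: "eden n k ?w ?s + ?e = 0"
  have y0: "0 < y 0" using esphere_nonneg[OF y(1)] y(2) by simp
  have "0 \<le> eden n k ?w ?s" "0 \<le> ?e" by (auto intro: eden_nonneg)
  then have e: "eden n k ?w ?s = 0" "?e = 0" using 0 by linarith+
  then have "?s = 0" "\<And>i. i < n \<Longrightarrow> ?w i = 0" using eden_pos[of ?s n ?w k] by (metis less_irrefl)+
  moreover from this(2) have N: "(\<Sum>i<n. (?w i)\<^sup>2) = 0" by simp
  ultimately have "y 0 \<le> t / (2 * (real k + 1))" by simp
  then have "y 0 = t / (2 * (real k + 1))" using e(2) by linarith
  moreover have "t / 2 * (1 / (real k + 1)) \<le> 1 * (1 / (real k + 1))" using t by (intro mult_right_mono) auto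
  ultimately have "(real k + 1) / 16 * y 0 \<le> 0" using displaced_lower_bound[OF y(1) l t] N by simp
  then show False using y0 by (simp add: mult_le_0_iff)
qed

text \<open>Off the base point the quotient has a nonzero denominator, and at the base point
  \<open>push_bound\<close> dominates every coordinate.\<close>

lemma continuous_on_push:
  assumes \<epsilon>: "0 < \<epsilon>"
  shows "continuous_on {z. fst z \<in> {0..1} \<and> fst (snd z) \<in> esphere n k \<and> close_to n k (fst (snd z)) (snd (snd z))}
     (\<lambda>z. push n k \<epsilon> (fst z) (fst (snd z)) (snd (snd z)))" (is "continuous_on ?E _")
proof (rule continuous_on_coordinatewise_then_product)
  fix i
  have cy: "continuous_on S (\<lambda>z. fst (snd z) j)" for S :: "(real \<times> (nat \<Rightarrow> real) \<times> (nat \<Rightarrow> real)) set" and j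
    by (rule continuous_on_product_then_coordinatewise[where f = "\<lambda>z. fst (snd z)"])
       (intro continuous_on_fst continuous_on_snd continuous_on_id)
  have cl: "continuous_on S (\<lambda>z. snd (snd z) j)" for S :: "(real \<times> (nat \<Rightarrow> real) \<times> (nat \<Rightarrow> real)) set" and j
    by (rule continuous_on_product_then_coordinatewise[where f = "\<lambda>z. snd (snd z)"])
       (intro continuous_on_snd continuous_on_id)
  show "continuous_on ?E (\<lambda>z. push n k \<epsilon> (fst z) (fst (snd z)) (snd (snd z)) i)"
  proof (rule continuous_on_dominated[where q = "\<lambda>z. 4 * sqrt (fst (snd z) 0)"])
    show "continuous_on ?E (\<lambda>z. 4 * sqrt (fst (snd z) 0))" by (intro continuous_intros cy)
    show "\<bar>push n k \<epsilon> (fst z) (fst (snd z)) (snd (snd z)) i\<bar> \<le> 4 * sqrt (fst (snd z) 0)" if "z \<in> ?E" for z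
      using that by (intro push_bound \<epsilon>) auto
    let ?E' = "{z \<in> ?E. 4 * sqrt (fst (snd z) 0) \<noteq> 0}"
    have "continuous_on ?E' (\<lambda>z. displaced k (fst z) (fst (snd z)) (snd (snd z)) i)" for i
      unfolding displaced_def by (intro continuous_intros cy cl)
    note w = this
    have "continuous_on ?E' (\<lambda>z. push n k \<epsilon> (fst z) (fst (snd z)) (snd (snd z)))"
      unfolding push_def
    proof (rule continuous_on_ehat)
      show "continuous_on ?E' (\<lambda>z. max 0 (fst z / (2 * (real k + 1)) - fst (snd z) 0))"
        by (intro continuous_intros cy) auto
      show "continuous_on ?E' (\<lambda>z. displaced k (fst z) (fst (snd z)) (snd (snd z)) i)" for i by (rule w)
      show "continuous_on ?E' (\<lambda>z. max 0 (fst (snd z) 0 - fst z / (2 * (real k + 1))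
          - fst z * sqrt (\<Sum>i<n. (displaced k (fst z) (fst (snd z)) (snd (snd z)) i)\<^sup>2) / \<epsilon>))"
        using \<epsilon> by (intro continuous_intros cy w) auto
      fix z assume z: "z \<in> ?E'"
      show "eden n k (displaced k (fst z) (fst (snd z)) (snd (snd z))) (max 0 (fst (snd z) 0 - fst z / (2 * (real k + 1))
          - fst z * sqrt (\<Sum>i<n. (displaced k (fst z) (fst (snd z)) (snd (snd z)) i)\<^sup>2) / \<epsilon>))
          + max 0 (fst z / (2 * (real k + 1)) - fst (snd z) 0) \<noteq> 0"
        using z by (intro push_denominator) auto
    qed
    then show "continuous_on ?E' (\<lambda>z. push n k \<epsilon> (fst z) (fst (snd z)) (snd (snd z)) i)"
      by (rule continuous_on_product_then_coordinatewise)
  qed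
qed

text \<open>Points of the earring with approximations \<open>l k\<close> of the tangential coordinates of their projections to
  the spheres. A choice of approximations that is natural in faces lifts cycles to this space, where the
  perturbation is an honest homotopy.\<close>

definition data_space :: "nat \<Rightarrow> ((nat \<Rightarrow> real) \<times> (nat \<Rightarrow> nat \<Rightarrow> real)) set" where
  "data_space n = {(y, l). y \<in> bouquet n UNIV \<and> (\<forall>k. close_to n k (bouquet_retract n {k} y) (l k))}"

definition push_all :: "nat \<Rightarrow> (nat \<Rightarrow> real) \<Rightarrow> real \<Rightarrow> (nat \<Rightarrow> real) \<times> (nat \<Rightarrow> nat \<Rightarrow> real) \<Rightarrow> nat \<Rightarrow> real" where
  "push_all n \<epsilon> t d = (if fst d = earring_base then earring_base
     else let k = (THE k. fst d \<in> esphere n k) in push n k (\<epsilon> k) t (fst d) (snd d k))"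

lemma push_all_esphere:
  assumes "y \<in> esphere n k" "0 < \<epsilon> k" "0 \<le> t"
  shows "push_all n \<epsilon> t (y, l) = push n k (\<epsilon> k) t y (l k)"
proof (cases "y = earring_base")
  case True
  then show ?thesis using push_base[OF assms(2,3)] by (simp add: push_all_def)
next
  case False
  then have "(THE k. y \<in> esphere n k) = k" using esphere_disjoint assms(1) by (intro the_equality) blast+
  then show ?thesis using False by (simp add: push_all_def)
qed

lemma bouquet_cases:
  assumes "y \<in> bouquet n UNIV" obtains k where "y \<in> esphere n k"
  using assms base_in_esphere unfolding bouquet_def by blast

lemma bouquet_retract_esphere:
  assumes "y \<in> esphere n j"
  shows "bouquet_retract n {k} y = (if k = j then y else earring_base)"
  using assms esphere_disjoint[OF assms] by (auto simp: bouquet_retract_def bouquet_def)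

lemma push_all_in_bouquet:
  assumes "\<And>k. 0 < \<epsilon> k" "0 \<le> t" "y \<in> bouquet n UNIV"
  shows "push_all n \<epsilon> t (y, l) \<in> bouquet n UNIV"
proof -
  obtain k where k: "y \<in> esphere n k" by (rule bouquet_cases[OF assms(3)])
  have "push n k (\<epsilon> k) t y (l k) \<in> esphere n k" by (rule push_in_esphere[OF assms(1,2)])
  then show ?thesis unfolding push_all_esphere[OF k assms(1,2)] by (auto simp: bouquet_def)
qed

text \<open>The spheres shrink, so the maps that move only the first \<open>N\<close> spheres converge uniformly.\<close>

lemma continuous_on_push_all:
  assumes \<epsilon>: "\<And>k. 0 < \<epsilon> k"
  shows "continuous_on ({0..1} \<times> data_space n) (\<lambda>z. push_all n \<epsilon> (fst z) (snd z))"
proof (rule continuous_on_coordinatewise_then_product)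
  fix i
  let ?Z = "{0..1::real} \<times> data_space n"
  let ?term = "\<lambda>k z. push n k (\<epsilon> k) (fst z) (bouquet_retract n {k} (fst (snd z))) (snd (snd z) k) i"
  have "continuous_on ?Z (?term k)" for k
  proof -
    have c: "continuous_on ?Z (\<lambda>z. (fst z, bouquet_retract n {k} (fst (snd z)), snd (snd z) k))"
    proof (intro continuous_on_Pair)
      show "continuous_on ?Z (\<lambda>z. bouquet_retract n {k} (fst (snd z)))"
        by (rule continuous_on_compose2[OF continuous_on_bouquet_retract[of n UNIV]])
           (auto intro!: continuous_on_fst continuous_on_snd continuous_on_id simp: data_space_def)
      show "continuous_on ?Z (\<lambda>z. snd (snd z) k)"
        by (rule continuous_on_product_then_coordinatewise[where f = "\<lambda>z. snd (snd z)"])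
           (intro continuous_on_snd continuous_on_id)
    qed (intro continuous_on_fst continuous_on_id)
    have sub: "(\<lambda>z. (fst z, bouquet_retract n {k} (fst (snd z)), snd (snd z) k)) ` ?Z
       \<subseteq> {z. fst z \<in> {0..1} \<and> fst (snd z) \<in> esphere n k \<and> close_to n k (fst (snd z)) (snd (snd z))}"
      using base_in_esphere by (auto simp: data_space_def bouquet_retract_def bouquet_def)
    have "continuous_on ?Z (\<lambda>z. push n k (\<epsilon> k) (fst z) (bouquet_retract n {k} (fst (snd z))) (snd (snd z) k))"
      using continuous_on_compose2[OF continuous_on_push[OF \<epsilon>] c sub] by (simp only: fst_conv snd_conv)
    then show ?thesis by (rule continuous_on_product_then_coordinatewise)
  qed
  then have "\<forall>\<^sub>F N in sequentially. continuous_on ?Z (\<lambda>z. \<Sum>k<N. ?term k z)"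
    by (intro always_eventually allI continuous_on_sum)
  moreover have "uniform_limit ?Z (\<lambda>N z. \<Sum>k<N. ?term k z) (\<lambda>z. push_all n \<epsilon> (fst z) (snd z) i) sequentially"
  proof (rule uniform_limitI)
    fix e :: real assume "0 < e"
    \<comment> \<open>From index \<open>N0\<close> on the coordinates of points of the spheres are
      smaller than \<open>e\<close>, so leaving those spheres out of the sum is harmless.\<close>
    obtain N0 :: nat where N0: "2 / e < real N0" using reals_Archimedean2 by blast
    have "dist (\<Sum>k<N. ?term k z) (push_all n \<epsilon> (fst z) (snd z) i) < e" if N: "N0 \<le> N" and z: "z \<in> ?Z" for N z
    proof -
      obtain t y l where z': "z = (t, y, l)" "0 \<le> t" "y \<in> bouquet n UNIV" using z by (cases z) (auto simp: data_space_def)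
      obtain j where j: "y \<in> esphere n j" by (rule bouquet_cases[OF z'(3)])
      let ?p = "push n j (\<epsilon> j) t y (l j) i"
      have "?term k z = (if k = j then ?p else 0)" for k
        using push_base[OF \<epsilon> z'(2)] by (simp add: z'(1) bouquet_retract_esphere[OF j] earring_base_def)
      then have s: "(\<Sum>k<N. ?term k z) = (if j < N then ?p else 0)" by simp
      have v: "push_all n \<epsilon> (fst z) (snd z) i = ?p" by (simp add: z'(1) push_all_esphere[OF j \<epsilon> z'(2)])
      show ?thesis
      proof (cases "j < N")
        case True
        then show ?thesis using s v \<open>0 < e\<close> by simp
      next
        case False
        have "\<bar>?p\<bar> \<le> 2 / (real j + 1)" by (rule esphere_coordinate(2)[OF push_in_esphere[OF \<epsilon> z'(2)]])
        also have "\<dots> < e"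
        proof -
          have "2 / e < real j + 1" using N0 N False by linarith
          then show ?thesis using \<open>0 < e\<close> by (simp add: field_simps)
        qed
        finally show ?thesis using s v False by (simp add: dist_real_def)
      qed
    qed
    then show "\<forall>\<^sub>F N in sequentially. \<forall>z\<in>?Z. dist (\<Sum>k<N. ?term k z) (push_all n \<epsilon> (fst z) (snd z) i) < e"
      unfolding eventually_sequentially by blast
  qed
  ultimately show "continuous_on ?Z (\<lambda>z. push_all n \<epsilon> (fst z) (snd z) i)"
    by (rule uniform_limit_theorem) simp
qed

section \<open>Approximations whose codimension-two image misses a point\<close>

definition codim2 :: "nat \<Rightarrow> (nat \<Rightarrow> real) set" where
  "codim2 m = {x \<in> standard_simplex m. \<exists>i j. i \<le> m \<and> j \<le> m \<and> i \<noteq> j \<and> x i = 0 \<and> x j = 0}"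

lemma simplex_l1_distance:
  assumes "x \<in> standard_simplex m" "y \<in> standard_simplex m" "e \<le> m"
  shows "(\<Sum>l\<le>m. \<bar>x l - y l\<bar>) \<le> 2 * (\<Sum>l\<in>{..m} - {e}. \<bar>x l - y l\<bar>)"
proof -
  have "(\<Sum>l\<le>m. x l - y l) = 0" using assms by (simp add: standard_simplex_def sum_subtractf)
  then have "x e - y e = - (\<Sum>l\<in>{..m} - {e}. x l - y l)"
    using sum.remove[of "{..m}" e "\<lambda>l. x l - y l"] assms(3) by simp
  then have "\<bar>x e - y e\<bar> \<le> (\<Sum>l\<in>{..m} - {e}. \<bar>x l - y l\<bar>)" using sum_abs[of "\<lambda>l. x l - y l" "{..m} - {e}"] by simp
  then show ?thesis using sum.remove[of "{..m}" e "\<lambda>l. \<bar>x l - y l\<bar>"] assms(3) by simp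
qed

text \<open>A point of the simplex of dimension n + 1 has n + 2 coordinates. Two of them vanish and
  one is determined by the sum, so a cell is given by rounding the other n - 1 down to multiples of
  1/G. Recovering the eliminated coordinate at most doubles the distance.\<close>

lemma codim2_cells:
  assumes n: "0 < n" and K: "finite K"
  obtains cl :: "nat \<Rightarrow> 'k \<times> (nat \<Rightarrow> real) \<Rightarrow> ('k \<times> nat \<times> nat \<times> nat) \<times> (nat \<Rightarrow> nat)" and C0
  where "\<And>G. finite (cl G ` (K \<times> codim2 (Suc n)))"
    "\<And>G. card (cl G ` (K \<times> codim2 (Suc n))) \<le> C0 * (G + 1) ^ (n - 1)"
    "\<And>G \<sigma> x \<sigma>' x'. 0 < G \<Longrightarrow> x \<in> codim2 (Suc n) \<Longrightarrow> x' \<in> codim2 (Suc n) \<Longrightarrow> cl G (\<sigma>, x) = cl G (\<sigma>', x')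
       \<Longrightarrow> \<sigma> = \<sigma>' \<and> (\<Sum>l\<le>Suc n. \<bar>x l - x' l\<bar>) \<le> 2 * real n / real G"
proof -
  let ?m = "Suc n"
  \<comment> \<open>\<open>i\<close> and \<open>j\<close> mark two vanishing coordinates,
    \<open>e\<close> the one recovered from the sum. The triple belongs to the name of the cell, so
    points of one cell are rounded in the same coordinates.\<close>
  define I where "I = {(i, j, e). i \<le> ?m \<and> j \<le> ?m \<and> e \<le> ?m \<and> i \<noteq> j \<and> i \<noteq> e \<and> j \<noteq> e}"
  have "\<exists>i j e. (i, j, e) \<in> I \<and> x i = 0 \<and> x j = 0" if "x \<in> codim2 ?m" for x
  proof -
    obtain i j where ij: "i \<le> ?m" "j \<le> ?m" "i \<noteq> j" "x i = 0" "x j = 0" using \<open>x \<in> codim2 ?m\<close> by (auto simp: codim2_def)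
    have "card {i, j} < card {..?m}" using n ij(3) by simp
    then obtain e where "e \<in> {..?m}" "e \<notin> {i, j}" by (metis card_mono finite.emptyI finite.insertI not_le subsetI)
    then have "(i, j, e) \<in> I" using ij by (auto simp: I_def)
    then show ?thesis using ij by blast
  qed
  then obtain a b c where abc: "\<And>x. x \<in> codim2 ?m \<Longrightarrow> (a x, b x, c x) \<in> I"
    "\<And>x. x \<in> codim2 ?m \<Longrightarrow> x (a x) = 0" "\<And>x. x \<in> codim2 ?m \<Longrightarrow> x (b x) = 0" by metis
  define R where "R = (\<lambda>(i, j, e). {..?m} - {i, j, e})"
  define cl :: "nat \<Rightarrow> 'k \<times> (nat \<Rightarrow> real) \<Rightarrow> ('k \<times> nat \<times> nat \<times> nat) \<times> (nat \<Rightarrow> nat)" where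
    "cl G = (\<lambda>(\<sigma>, x). ((\<sigma>, a x, b x, c x), restrict (\<lambda>l. nat \<lfloor>real G * x l\<rfloor>) (R (a x, b x, c x))))" for G
  have finI: "finite I"
    by (rule finite_subset[of _ "{..?m} \<times> {..?m} \<times> {..?m}"]) (auto simp: I_def)
  have cardR: "finite (R t)" "card (R t) = n - 1" if "t \<in> I" for t
    using that by (auto simp: I_def R_def card_Diff_subset)
  let ?T = "\<lambda>G. SIGMA s : K \<times> I. R (snd s) \<rightarrow>\<^sub>E {..G::nat}"
  have sub: "cl G ` (K \<times> codim2 ?m) \<subseteq> ?T G" for G
  proof
    fix s assume "s \<in> cl G ` (K \<times> codim2 ?m)"
    then obtain \<sigma> x where s: "\<sigma> \<in> K" "x \<in> codim2 ?m" "s = cl G (\<sigma>, x)" by auto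
    have "nat \<lfloor>real G * x l\<rfloor> \<le> G" for l
    proof -
      have "x l \<le> 1" using s(2) by (cases "l \<le> ?m") (auto simp: codim2_def standard_simplex_def)
      then have "real G * x l \<le> real G" by (simp add: mult_left_le)
      then have "\<lfloor>real G * x l\<rfloor> \<le> int G" by linarith
      then show ?thesis by simp
    qed
    then show "s \<in> ?T G" using s abc(1)[OF s(2)] by (auto simp: cl_def)
  qed
  have finT: "finite (?T G)" for G
    using K finI cardR by (intro finite_SigmaI finite_cartesian_product finite_PiE) auto
  have cardT: "card (?T G) = card (K \<times> I) * (G + 1) ^ (n - 1)" for G
  proof -
    have "card (?T G) = (\<Sum>s\<in>K \<times> I. card (R (snd s) \<rightarrow>\<^sub>E {..G}))"
      using K finI cardR by (intro card_SigmaI) (auto intro!: finite_PiE)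
    also have "\<dots> = (\<Sum>s\<in>K \<times> I. (G + 1) ^ (n - 1))"
      using cardR by (intro sum.cong) (auto simp: card_PiE)
    finally show ?thesis by simp
  qed
  show ?thesis
  proof (rule that[of cl "card (K \<times> I)"])
    show "finite (cl G ` (K \<times> codim2 ?m))" for G by (rule finite_subset[OF sub finT])
    show "card (cl G ` (K \<times> codim2 ?m)) \<le> card (K \<times> I) * (G + 1) ^ (n - 1)" for G
      using card_mono[OF finT sub] by (simp only: cardT)
    fix G \<sigma> x \<sigma>' x'
    assume G: "0 < G" and x: "x \<in> codim2 ?m" and x': "x' \<in> codim2 ?m" and eq: "cl G (\<sigma>, x) = cl G (\<sigma>', x')"
    have t: "\<sigma> = \<sigma>'" "a x = a x'" "b x = b x'" "c x = c x'" using eq by (auto simp: cl_def)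
    have xs: "x \<in> standard_simplex ?m" "x' \<in> standard_simplex ?m" using x x' by (auto simp: codim2_def)
    let ?R = "R (a x, b x, c x)"
    have near: "\<bar>x l - x' l\<bar> \<le> 1 / real G" if l: "l \<in> ?R" for l
    proof -
      have "restrict (\<lambda>l. nat \<lfloor>real G * x l\<rfloor>) ?R l = restrict (\<lambda>l. nat \<lfloor>real G * x' l\<rfloor>) ?R l"
        using eq t by (simp add: cl_def)
      then have "nat \<lfloor>real G * x l\<rfloor> = nat \<lfloor>real G * x' l\<rfloor>" using l by simp
      moreover have "0 \<le> real G * x l" "0 \<le> real G * x' l" using simplex_nonneg[OF xs(1)] simplex_nonneg[OF xs(2)] by auto
      ultimately have "\<lfloor>real G * x l\<rfloor> = \<lfloor>real G * x' l\<rfloor>" by (simp add: nat_eq_iff)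
      then have "\<bar>real G * x l - real G * x' l\<bar> \<le> 1" by linarith
      then have "real G * \<bar>x l - x' l\<bar> \<le> 1" by (simp add: abs_mult flip: right_diff_distrib)
      then show ?thesis using G by (simp add: field_simps)
    qed
    have I: "(a x, b x, c x) \<in> I" by (rule abc(1)[OF x])
    have "(\<Sum>l\<in>{..?m} - {c x}. \<bar>x l - x' l\<bar>) = (\<Sum>l\<in>?R. \<bar>x l - x' l\<bar>)"
      using abc(2,3)[OF x] abc(2,3)[OF x'] t by (intro sum.mono_neutral_right) (auto simp: R_def)
    also have "\<dots> \<le> real (card ?R) * (1 / real G)" using near by (intro sum_bounded_above) auto
    also have "\<dots> \<le> real n * (1 / real G)" using cardR(2)[OF I] by (intro mult_right_mono) auto
    finally have "(\<Sum>l\<in>{..?m} - {c x}. \<bar>x l - x' l\<bar>) \<le> real n / real G" by simp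
    moreover have "c x \<le> ?m" using I by (auto simp: I_def)
    ultimately show "\<sigma> = \<sigma>' \<and> (\<Sum>l\<le>?m. \<bar>x l - x' l\<bar>) \<le> 2 * real n / real G"
      using t(1) simplex_l1_distance[OF xs, of "c x"] by simp
  qed
qed

text \<open>Bernstein polynomials are Lipschitz, so the image of the codimension-two skeleton, of
  dimension n - 1, cannot fill a neighbourhood of the origin in dimension \<open>n\<close>; a small
  translation by \<open>p\<close> moves it off the origin. Degree and translation are common to all
  simplices of \<open>K\<close>, as naturality in faces requires.\<close>

lemma approximation_avoiding_point:
  assumes n: "0 < n" and K: "finite K" and \<eta>: "0 < \<eta>"
    and c: "\<And>\<sigma> i. \<sigma> \<in> K \<Longrightarrow> i < n \<Longrightarrow> continuous_on (standard_simplex (Suc n)) (g \<sigma> i)"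
    and bd: "\<And>\<sigma> i x. \<sigma> \<in> K \<Longrightarrow> i < n \<Longrightarrow> x \<in> standard_simplex (Suc n) \<Longrightarrow> \<bar>g \<sigma> i x\<bar> \<le> 2"
  shows "\<exists>q p \<mu>. 0 < q \<and> 0 < \<mu> \<and>
     (\<forall>\<sigma>\<in>K. \<forall>i<n. \<forall>x\<in>standard_simplex (Suc n). \<bar>bernstein (Suc n) q (g \<sigma> i) x - p i - g \<sigma> i x\<bar> \<le> \<eta>) \<and>
     (\<forall>\<sigma>\<in>K. \<forall>x\<in>codim2 (Suc n). \<exists>i<n. \<mu> \<le> \<bar>bernstein (Suc n) q (g \<sigma> i) x - p i\<bar>)"
proof -
  let ?m = "Suc n"
  have "\<forall>\<^sub>F q in sequentially. \<forall>s\<in>K \<times> {..<n}. \<forall>x\<in>standard_simplex ?m. \<bar>bernstein ?m q (g (fst s) (snd s)) x - g (fst s) (snd s) x\<bar> \<le> \<eta> / 2"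
    using K \<eta> by (intro eventually_ball_finite finite_cartesian_product ballI bernstein_converges[where M = 2]) (auto intro: c bd)
  then obtain q0 where "\<forall>q\<ge>q0. \<forall>s\<in>K \<times> {..<n}. \<forall>x\<in>standard_simplex ?m. \<bar>bernstein ?m q (g (fst s) (snd s)) x - g (fst s) (snd s) x\<bar> \<le> \<eta> / 2"
    unfolding eventually_sequentially by blast
  then have q: "\<bar>bernstein ?m (Suc q0) (g \<sigma> i) x - g \<sigma> i x\<bar> \<le> \<eta> / 2" if "\<sigma> \<in> K" "i < n" "x \<in> standard_simplex ?m" for \<sigma> i x
    using that by (metis SigmaI fst_conv snd_conv lessThan_iff le_SucI order_refl)
  obtain cl :: "nat \<Rightarrow> 'a \<times> (nat \<Rightarrow> real) \<Rightarrow> ('a \<times> nat \<times> nat \<times> nat) \<times> (nat \<Rightarrow> nat)" and C0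
    where cl: "\<And>G. finite (cl G ` (K \<times> codim2 ?m))" "\<And>G. card (cl G ` (K \<times> codim2 ?m)) \<le> C0 * (G + 1) ^ (n - 1)"
    "\<And>G \<sigma> x \<sigma>' x'. 0 < G \<Longrightarrow> x \<in> codim2 ?m \<Longrightarrow> x' \<in> codim2 ?m \<Longrightarrow> cl G (\<sigma>, x) = cl G (\<sigma>', x')
       \<Longrightarrow> \<sigma> = \<sigma>' \<and> (\<Sum>l\<le>?m. \<bar>x l - x' l\<bar>) \<le> 2 * real n / real G"
    using codim2_cells[OF n K] by blast
  define f where "f s i = bernstein ?m (Suc q0) (g (fst s) i) (snd s)" for s :: "'a \<times> (nat \<Rightarrow> real)" and i
  have lip: "\<bar>f s i - f s' i\<bar> \<le> (real (Suc q0) * 2 * (2 * real n)) / real G"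
    if "0 < G" "s \<in> K \<times> codim2 ?m" "s' \<in> K \<times> codim2 ?m" "cl G s = cl G s'" "i < n" for G s s' i
  proof -
    obtain \<sigma> x \<sigma>' x' where s: "s = (\<sigma>, x)" "s' = (\<sigma>', x')" by (metis surj_pair)
    have e: "\<sigma> = \<sigma>'" "(\<Sum>l\<le>?m. \<bar>x l - x' l\<bar>) \<le> 2 * real n / real G" using cl(3)[OF that(1), of x x' \<sigma> \<sigma>'] that s by auto
    have "\<bar>f s i - f s' i\<bar> \<le> real (Suc q0) * 2 * (\<Sum>l\<le>?m. \<bar>x l - x' l\<bar>)"
      unfolding f_def s fst_conv snd_conv e(1)[symmetric] using that s bd by (intro bernstein_lipschitz) (auto simp: codim2_def)
    also have "\<dots> \<le> real (Suc q0) * 2 * (2 * real n / real G)" using e(2) by (intro mult_left_mono) auto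
    finally show ?thesis by (simp only: times_divide_eq_right)
  qed
  have \<eta>2: "0 < \<eta> / 2" and L: "0 \<le> real (Suc q0) * 2 * (2 * real n)" using \<eta> by auto
  have "\<exists>p \<mu>. 0 < \<mu> \<and> (\<forall>i<n. \<bar>p i\<bar> \<le> \<eta> / 2) \<and> (\<forall>s\<in>K \<times> codim2 ?m. \<exists>i<n. \<mu> \<le> \<bar>f s i - p i\<bar>)"
  proof (rule avoid_small_point[of n "\<eta> / 2" "real (Suc q0) * 2 * (2 * real n)" cl "K \<times> codim2 ?m" C0 f, OF n \<eta>2 L cl(1,2) lip])
    fix p \<mu> assume "0 < \<mu>" "\<And>i. i < n \<Longrightarrow> \<bar>p i\<bar> \<le> \<eta> / 2" "\<And>s. s \<in> K \<times> codim2 ?m \<Longrightarrow> \<exists>i<n. \<mu> \<le> \<bar>f s i - p i\<bar>"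
    then show ?thesis by (intro exI[of _ p] exI[of _ \<mu>]) blast
  qed
  then obtain p \<mu> where p': "0 < \<mu> \<and> (\<forall>i<n. \<bar>p i\<bar> \<le> \<eta> / 2) \<and> (\<forall>s\<in>K \<times> codim2 ?m. \<exists>i<n. \<mu> \<le> \<bar>f s i - p i\<bar>)"
    by (elim exE)
  then have p: "0 < \<mu>" "\<And>i. i < n \<Longrightarrow> \<bar>p i\<bar> \<le> \<eta> / 2" "\<And>s. s \<in> K \<times> codim2 ?m \<Longrightarrow> \<exists>i<n. \<mu> \<le> \<bar>f s i - p i\<bar>"
    by auto
  have "\<bar>bernstein ?m (Suc q0) (g \<sigma> i) x - p i - g \<sigma> i x\<bar> \<le> \<eta>" if "\<sigma> \<in> K" "i < n" "x \<in> standard_simplex ?m" for \<sigma> i x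
    using q[OF that] p(2)[OF that(2)] by linarith
  moreover have "\<exists>i<n. \<mu> \<le> \<bar>bernstein ?m (Suc q0) (g \<sigma> i) x - p i\<bar>" if "\<sigma> \<in> K" "x \<in> codim2 ?m" for \<sigma> x
    using p(3)[of "(\<sigma>, x)"] that by (simp add: f_def)
  ultimately show ?thesis using p(1) by (intro exI[of _ "Suc q0"] exI[of _ p] exI[of _ \<mu>]) blast
qed

text \<open>A cycle is pushed off the antipodes of the base point along its codimension-two skeleton.\<close>

theorem skeletal_representative:
  fixes n :: nat
  defines "X \<equiv> top_of_set (bouquet n UNIV)"
  assumes n: "2 \<le> n" and z: "singular_relcycle (Suc n) X {} z"
  obtains z1 where "skeletal_cycle n X earring_base z1"
    "homologous_rel_set (Suc n) X {earring_base} z1 = homologous_rel_set (Suc n) X {earring_base} z"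
proof -
  let ?m = "Suc n" and ?K = "Poly_Mapping.keys z" and ?D = "top_of_set (data_space n)"
  have n0: "0 < n" using n by simp
  have zc: "singular_chain ?m X z" "chain_boundary ?m z = 0" using z by (auto simp: singular_cycle)
  have \<sigma>c: "continuous_on (standard_simplex ?m) \<sigma>" "\<And>x. x \<in> standard_simplex ?m \<Longrightarrow> \<sigma> x \<in> bouquet n UNIV"
    "\<sigma> \<in> extensional (standard_simplex ?m)" if "\<sigma> \<in> ?K" for \<sigma>
  proof -
    have "singular_simplex ?m X \<sigma>" using zc(1) that by (auto simp: singular_chain_def)
    then show "continuous_on (standard_simplex ?m) \<sigma>" "\<And>x. x \<in> standard_simplex ?m \<Longrightarrow> \<sigma> x \<in> bouquet n UNIV"
      "\<sigma> \<in> extensional (standard_simplex ?m)"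
      by (auto simp: singular_simplex_def simplex_top X_def continuous_map_in_subtopology)
  qed
  \<comment> \<open>The tangential coordinates of the simplex after projection to the sphere with
    index \<open>k\<close>. On that sphere they vanish together only at the base point and at its
    antipode.\<close>
  define g where "g k \<sigma> i x = bouquet_retract n {k} (\<sigma> x) (Suc i)" for k \<sigma> i and x :: "nat \<Rightarrow> real"
  have gc: "continuous_on (standard_simplex ?m) (g k \<sigma> i)" if "\<sigma> \<in> ?K" for k \<sigma> i
  proof -
    have "continuous_on (standard_simplex ?m) (\<lambda>x. bouquet_retract n {k} (\<sigma> x))"
      using \<sigma>c[OF that] by (intro continuous_on_compose2[OF continuous_on_bouquet_retract[of n UNIV]]) auto
    then show ?thesis unfolding g_def by (rule continuous_on_product_then_coordinatewise)
  qed
  have gb: "\<bar>g k \<sigma> i x\<bar> \<le> 2" for k \<sigma> i x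
  proof -
    have "bouquet_retract n {k} (\<sigma> x) \<in> esphere n k" using base_in_esphere by (auto simp: bouquet_retract_def bouquet_def)
    then have "\<bar>g k \<sigma> i x\<bar> \<le> 2 / (real k + 1)" unfolding g_def by (rule esphere_coordinate)
    also have "\<dots> \<le> 2" by (simp add: divide_le_eq)
    finally show ?thesis .
  qed
  \<comment> \<open>A quarter of the radius, divided by \<open>n\<close> so that all
    \<open>n\<close> coordinates together stay within \<open>close_to\<close>.\<close>
  define \<eta> where "\<eta> k = 1 / (4 * (real k + 1)) / real n" for k
  have "\<exists>q p \<mu>. 0 < q \<and> 0 < \<mu> \<and>
     (\<forall>\<sigma>\<in>?K. \<forall>i<n. \<forall>x\<in>standard_simplex ?m. \<bar>bernstein ?m q (g k \<sigma> i) x - p i - g k \<sigma> i x\<bar> \<le> \<eta> k) \<and>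
     (\<forall>\<sigma>\<in>?K. \<forall>x\<in>codim2 ?m. \<exists>i<n. \<mu> \<le> \<bar>bernstein ?m q (g k \<sigma> i) x - p i\<bar>)" for k
    using n0 gc gb by (intro approximation_avoiding_point) (auto simp: \<eta>_def)
  then obtain q p \<mu> where q: "\<And>k. 0 < q k" and \<mu>: "\<And>k. 0 < \<mu> k"
    and near: "\<And>k \<sigma> i x. \<sigma> \<in> ?K \<Longrightarrow> i < n \<Longrightarrow> x \<in> standard_simplex ?m \<Longrightarrow> \<bar>bernstein ?m (q k) (g k \<sigma> i) x - p k i - g k \<sigma> i x\<bar> \<le> \<eta> k"
    and far: "\<And>k \<sigma> x. \<sigma> \<in> ?K \<Longrightarrow> x \<in> codim2 ?m \<Longrightarrow> \<exists>i<n. \<mu> k \<le> \<bar>bernstein ?m (q k) (g k \<sigma> i) x - p k i\<bar>"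
    by metis
  \<comment> \<open>With this value the threshold of \<open>push_1\<close> is exactly
    \<open>\<mu> k\<close>.\<close>
  define \<epsilon> where "\<epsilon> k = \<mu> k * (real k + 1)\<^sup>2 / 4" for k
  have \<epsilon>: "0 < \<epsilon> k" for k using \<mu> by (simp add: \<epsilon>_def)
  \<comment> \<open>The dimension \<open>m\<close> is a parameter because the same formula serves
    the simplices of the cycle and their faces; naturality of the Bernstein polynomials makes the
    lift \<open>L\<close> commute with faces.\<close>
  define dat where "dat m \<sigma> x k i = bernstein m (q k) (g k \<sigma> i) x - p k i" for m \<sigma> x k i
  define L where "L m \<sigma> = restrict (\<lambda>x. (\<sigma> x, dat m \<sigma> x)) (standard_simplex m)" for m \<sigma>
  have faces: "singular_face ?m j (L ?m \<sigma>) = L n (singular_face ?m j \<sigma>)" if j: "j \<le> ?m" for j \<sigma>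
  proof
    fix y
    show "singular_face ?m j (L ?m \<sigma>) y = L n (singular_face ?m j \<sigma>) y"
    proof (cases "y \<in> standard_simplex n")
      case True
      have "bernstein ?m (q k) (g k \<sigma> i) (simplical_face j y) = bernstein n (q k) (g k (singular_face ?m j \<sigma>) i) y" for k i
        unfolding bernstein_simplical_face[OF j] by (rule bernstein_cong[OF _ q]) (simp add: g_def singular_face_def)
      then have "dat ?m \<sigma> (simplical_face j y) = dat n (singular_face ?m j \<sigma>) y" by (simp add: dat_def fun_eq_iff)
      then show ?thesis using True simplical_face_in_standard_simplex[of ?m j y] j by (simp add: singular_face_def L_def)
    qed (simp add: singular_face_def L_def)
  qed
  have Ls: "singular_simplex ?m ?D (L ?m \<sigma>)" if \<sigma>: "\<sigma> \<in> ?K" for \<sigma>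
  proof -
    have "continuous_on (standard_simplex ?m) (\<lambda>x. dat ?m \<sigma> x)"
    proof (rule continuous_on_coordinatewise_then_product, rule continuous_on_coordinatewise_then_product)
      show "continuous_on (standard_simplex ?m) (\<lambda>x. dat ?m \<sigma> x k i)" for k i
        unfolding dat_def bernstein_def by (intro continuous_on_diff continuous_on_multinom continuous_on_const)
    qed
    then have c: "continuous_on (standard_simplex ?m) (\<lambda>x. (\<sigma> x, dat ?m \<sigma> x))" using \<sigma>c(1)[OF \<sigma>] by (intro continuous_on_Pair)
    have "(\<sigma> x, dat ?m \<sigma> x) \<in> data_space n" if x: "x \<in> standard_simplex ?m" for x
    proof -
      have "close_to n k (bouquet_retract n {k} (\<sigma> x)) (dat ?m \<sigma> x k)" for k
      proof -
        have "(dat ?m \<sigma> x k i - bouquet_retract n {k} (\<sigma> x) (Suc i))\<^sup>2 \<le> (\<eta> k)\<^sup>2" if "i < n" for i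
          using near[OF \<sigma> that x, of k] by (subst power2_le_iff_abs_le) (auto simp: dat_def g_def \<eta>_def)
        then have "(\<Sum>i<n. (dat ?m \<sigma> x k i - bouquet_retract n {k} (\<sigma> x) (Suc i))\<^sup>2) \<le> real (card {..<n}) * (\<eta> k)\<^sup>2"
          by (intro sum_bounded_above) auto
        also have "\<dots> \<le> real n * real n * (\<eta> k)\<^sup>2" using n0 by (intro mult_right_mono) auto
        also have "\<dots> = (1 / (4 * (real k + 1)))\<^sup>2" using n0 by (simp add: \<eta>_def power_divide power2_eq_square)
        finally show ?thesis by (simp only: close_to_def)
      qed
      then show ?thesis using \<sigma>c(2)[OF \<sigma> x] by (simp add: data_space_def)
    qed
    then show ?thesis using c unfolding singular_simplex_def simplex_top L_def
      by (auto simp: continuous_map_in_subtopology intro: continuous_on_eq)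
  qed
  define zh where "zh = frag_extend (frag_of \<circ> L ?m) z"
  have kzh: "Poly_Mapping.keys zh \<subseteq> L ?m ` ?K"
    using keys_frag_extend[of "frag_of \<circ> L ?m" z] by (auto simp: zh_def)
  have zhc: "singular_chain ?m ?D zh" using kzh Ls by (auto simp: singular_chain_def)
  have zhb: "chain_boundary ?m zh = 0" unfolding zh_def using chain_boundary_lift[of z n "L ?m" "L n"] faces zc(2) by simp
  have zhr: "singular_relcycle ?m ?D {} zh" using zhc zhb by (simp add: singular_cycle)
  have "continuous_on ({1} \<times> data_space n) (\<lambda>z. push_all n \<epsilon> (fst z) (snd z))"
    by (rule continuous_on_subset[OF continuous_on_push_all[OF \<epsilon>]]) auto
  then have "continuous_on (data_space n) (\<lambda>d. push_all n \<epsilon> (fst (1::real, d)) (snd (1::real, d)))"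
    by (rule continuous_on_compose2) (auto intro!: continuous_on_Pair continuous_on_const continuous_on_id)
  then have pc: "continuous_map ?D X (push_all n \<epsilon> 1)"
    using push_all_in_bouquet[of \<epsilon> 1, OF \<epsilon>] by (auto simp: X_def continuous_map_in_subtopology data_space_def)
  have fc: "continuous_map ?D X fst"
    by (auto simp: X_def continuous_map_in_subtopology data_space_def intro!: continuous_on_fst continuous_on_id)
  define z1 where "z1 = chain_map ?m (push_all n \<epsilon> 1) zh"
  have "simplex_map ?m fst (L ?m \<sigma>) = \<sigma>" if "\<sigma> \<in> ?K" for \<sigma>
    using \<sigma>c(3)[OF that] by (auto simp: simplex_map_def L_def fun_eq_iff restrict_def extensional_def)
  then have "chain_map ?m fst zh = z" unfolding zh_def by (intro chain_map_lift)
  then have "homologous_rel_set ?m X {earring_base} z = hom_induced (int ?m) ?D {} X {earring_base} fst (homologous_rel_set ?m ?D {} zh)"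
    using hom_induced_chain_map[OF fc _ zhr, of "{earring_base}"] by simp
  also have "hom_induced (int ?m) ?D {} X {earring_base} fst = hom_induced (int ?m) ?D {} X {earring_base} (push_all n \<epsilon> 1)"
    unfolding X_def
  proof (rule hom_induced_homotopic_on[OF continuous_on_push_all[OF \<epsilon>]])
    show "push_all n \<epsilon> t x \<in> bouquet n UNIV" if "t \<in> {0..1}" "x \<in> data_space n" for t x
      using that push_all_in_bouquet[of \<epsilon> t "fst x" n "snd x"] \<epsilon> by (auto simp: data_space_def)
    show "fst x = push_all n \<epsilon> 0 x" if x_in: "x \<in> data_space n" for x
    proof -
      obtain y l where x: "x = (y, l)" "y \<in> bouquet n UNIV" using x_in by (auto simp: data_space_def)
      obtain k where k: "y \<in> esphere n k" by (rule bouquet_cases[OF x(2)])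
      show ?thesis using push_0[OF k] push_all_esphere[OF k \<epsilon>, of 0] by (simp add: x(1))
    qed
  qed auto
  also have "hom_induced (int ?m) ?D {} X {earring_base} (push_all n \<epsilon> 1) (homologous_rel_set ?m ?D {} zh) = homologous_rel_set ?m X {earring_base} z1"
    unfolding z1_def by (rule hom_induced_chain_map[OF pc _ zhr]) simp
  finally have hom: "homologous_rel_set ?m X {earring_base} z1 = homologous_rel_set ?m X {earring_base} z" by simp
  have "skeletal_cycle n X earring_base z1"
  proof
    show "2 \<le> n" by (rule n)
    show "earring_base \<in> topspace X" by (simp add: X_def)
    show "singular_chain ?m X z1" unfolding z1_def by (rule singular_chain_chain_map[OF zhc pc])
    show "chain_boundary ?m z1 = 0" unfolding z1_def chain_boundary_chain_map[OF zhc] zhb by simp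
    fix \<tau> x i j
    assume \<tau>: "\<tau> \<in> Poly_Mapping.keys z1" and x: "x \<in> standard_simplex ?m" and "i \<le> ?m" "j \<le> ?m" "i \<noteq> j" "x i = 0" "x j = 0"
    then have x2: "x \<in> codim2 ?m" by (auto simp: codim2_def)
    have "Poly_Mapping.keys z1 \<subseteq> simplex_map ?m (push_all n \<epsilon> 1) ` Poly_Mapping.keys zh"
      using keys_frag_extend[of "frag_of \<circ> simplex_map ?m (push_all n \<epsilon> 1)" zh] by (auto simp: z1_def chain_map_def)
    then obtain \<sigma> where \<sigma>: "\<sigma> \<in> ?K" "\<tau> = simplex_map ?m (push_all n \<epsilon> 1) (L ?m \<sigma>)" using \<tau> kzh by blast
    have "\<tau> x = push_all n \<epsilon> 1 (\<sigma> x, dat ?m \<sigma> x)" using x by (simp add: \<sigma>(2) simplex_map_def L_def)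
    also obtain k where k: "\<sigma> x \<in> esphere n k" by (rule bouquet_cases[OF \<sigma>c(2)[OF \<sigma>(1) x]])
    have "push_all n \<epsilon> 1 (\<sigma> x, dat ?m \<sigma> x) = push n k (\<epsilon> k) 1 (\<sigma> x) (dat ?m \<sigma> x k)"
      by (rule push_all_esphere[OF k \<epsilon>]) simp
    also have "\<dots> = earring_base"
    proof (rule push_1[OF k \<epsilon>])
      obtain i where i: "i < n" "\<mu> k \<le> \<bar>dat ?m \<sigma> x k i\<bar>" using far[OF \<sigma>(1) x2, of k] by (auto simp: dat_def)
      have "4 * \<epsilon> k / (real k + 1)\<^sup>2 = \<mu> k" by (simp add: \<epsilon>_def)
      also have "\<dots> \<le> sqrt ((dat ?m \<sigma> x k i)\<^sup>2)" using i(2) by simp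
      also have "\<dots> \<le> sqrt (\<Sum>i<n. (dat ?m \<sigma> x k i)\<^sup>2)"
        using i(1) by (intro real_sqrt_le_mono member_le_sum) auto
      finally show "4 * \<epsilon> k / (real k + 1)\<^sup>2 \<le> sqrt (\<Sum>i<n. (dat ?m \<sigma> x k i)\<^sup>2)" .
    qed
    finally show "\<tau> x = earring_base" .
  qed
  then show ?thesis using that hom by blast
qed

section \<open>Homology in degree n + 1 and the conclusion\<close>

theorem homology_spheroid_values:
  assumes n: "2 \<le> n" and c: "c \<in> carrier (homology_group (int (Suc n)) (hawaiian_earring n))"
  obtains G where "G \<in> spheroids (Suc n) (hawaiian_earring n) earring_base"
    "hom_induced (int (Suc n)) (hawaiian_earring n) {} (hawaiian_earring n) {earring_base} id c
      = hom_induced (int (Suc n)) (cube (Suc n)) (cube_boundary (Suc n)) (hawaiian_earring n) {earring_base} G (transferred_class (Suc n))"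
proof -
  let ?X = "top_of_set (bouquet n UNIV)"
  obtain z where z: "singular_relcycle (Suc n) ?X {} z" "c = homologous_rel_set (Suc n) ?X {} z"
    using c unfolding hawaiian_earring_eq carrier_relative_homology_group by blast
  obtain z1 where z1: "skeletal_cycle n ?X earring_base z1"
    "homologous_rel_set (Suc n) ?X {earring_base} z1 = homologous_rel_set (Suc n) ?X {earring_base} z"
    by (rule skeletal_representative[OF n z(1)])
  obtain G where G: "G \<in> spheroids (Suc n) ?X earring_base"
    "hom_induced (int (Suc n)) (cube (Suc n)) (cube_boundary (Suc n)) ?X {earring_base} G (transferred_class (Suc n))
       = homologous_rel_set (Suc n) ?X {earring_base} z1"
    by (rule skeletal_cycle.skeletal_cycle_is_spheroid[OF z1(1)])
  have "hom_induced (int (Suc n)) ?X {} ?X {earring_base} id c = homologous_rel_set (Suc n) ?X {earring_base} z"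
    unfolding z(2) using hom_induced_chain_map[OF continuous_map_id _ z(1), of "{earring_base}"] z(1)
    by (simp add: chain_map_ident[of _ ?X] singular_cycle)
  then show ?thesis using that G z1(2) unfolding hawaiian_earring_eq by simp
qed

text \<open>The values of spheroids on \<open>transferred_class\<close> exhaust the homology group
  by \<open>homology_spheroid_values\<close>, and the values on any fixed class form a cotorsion
  group.\<close>

theorem cotorsion_homology:
  assumes n: "1 < n"
  shows "cotorsion_group TYPE('e) TYPE('q) (homology_group (int (n + 1)) (hawaiian_earring n))"
proof -
  let ?X = "hawaiian_earring n"
  define H where "H = homology_group (int (Suc n)) ?X"
  define j where "j = hom_induced (int (Suc n)) ?X {} ?X {earring_base} id"
  define V where "V = spheroid_value (Suc n) ?X earring_base (transferred_class (Suc n)) ` spheroids (Suc n) ?X earring_base"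
  have b: "earring_base \<in> topspace ?X" by (simp add: hawaiian_earring_eq)
  have iso: "bij_betw j (carrier H) (carrier (relative_homology_group (int (Suc n)) ?X {earring_base}))"
    using iso_homology_relative_point[OF b, of "int (Suc n)"] by (simp add: iso_def H_def j_def)
  have V: "V = j ` carrier H"
  proof
    show "V \<subseteq> j ` carrier H"
      unfolding bij_betw_imp_surj_on[OF iso] V_def spheroid_value_def by (auto intro: hom_induced_carrier)
    show "j ` carrier H \<subseteq> V"
    proof
      fix w assume "w \<in> j ` carrier H"
      then obtain c where c: "c \<in> carrier (homology_group (int (Suc n)) ?X)" "w = j c" by (auto simp: H_def)
      obtain G where "G \<in> spheroids (Suc n) ?X earring_base" "j c = spheroid_value (Suc n) ?X earring_base (transferred_class (Suc n)) G"
        unfolding j_def spheroid_value_def by (rule homology_spheroid_values[OF _ c(1)]) (use n in auto)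
      then show "w \<in> V" using c(2) by (auto simp: V_def)
    qed
  qed
  have "inv_into (carrier H) j ` V = carrier H"
    unfolding V using bij_betw_imp_inj_on[OF iso] by (force simp: image_image)
  then have "H\<lparr>carrier := inv_into (carrier H) j ` V\<rparr> = H" by simp
  moreover have "cotorsion_group TYPE('e) TYPE('q) (H\<lparr>carrier := inv_into (carrier H) j ` V\<rparr>)"
    unfolding H_def j_def V_def using n by (intro cotorsion_spheroid_values) auto
  ultimately show ?thesis by (simp add: H_def)
qed

theorem theorem3:
  "(\<forall>l n :: nat. 1 < n \<and> n < l \<longrightarrow>
      cotorsion_group TYPE('e) TYPE('q)
        ((homology_group (int l) (hawaiian_earring n))
          \<lparr>carrier := hurewicz l (hawaiian_earring n) earring_base `
             carrier (homotopy_group l (hawaiian_earring n) earring_base)\<rparr>)) \<and>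
   (\<forall>n :: nat. 1 < n \<longrightarrow>
      cotorsion_group TYPE('e) TYPE('q)
        (homology_group (int (n + 1)) (hawaiian_earring n)))"
  using hurewicz_image_cotorsion cotorsion_homology by blast

end
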